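(* Let $A$ be an Artin algebra and $n\ge 2$ an integer. (i) If $\operatorname{inj.dim} A_A<\infty$, then $\mathbf{CM}(T_n(A))=\mathcal S_n(\mathbf{CM}(A))$. (ii) If $A$ is a Gorenstein algebra, then $T_n(A)\text{-}\mathcal Gproj=\mathcal S_n(A\text{-}\mathcal Gproj)$.
   Context: For an Artin algebra $B$, $B\text{-mod}$ is the category of finitely generated left $B$-modules. $\mathbf{CM}(B)={}^\perp({}_BB)=\{X\in B\text{-mod}\mid\operatorname{Ext}^i_B(X,B)=0\ \forall i\ge 1\}$. A module $G\in B\text{-mod}$ is Gorenstein-projective if there is an exact sequence $\cdots\to P^{-1}\to P^0\xrightarrow{d^0}P^1\to\cdots$ of projective modules in $B\text{-mod}$ which stays exact under $\operatorname{Hom}_B(-,B)$ and with $G\cong\operatorname{Ker} d^0$; $B\text{-}\mathcal Gproj$ is the full subcategory of $B\text{-mod}$ of Gorenstein-projective modules. $B$ is a Gorenstein algebra if $\operatorname{inj.dim}{}_BB<\infty$ and $\operatorname{inj.dim}B_B<\infty$. $T_n(A)$ is the algebra of upper triangular $n\times n$ matrices over $A$. $\operatorname{Mor}_n(A)$ is the category whose objects $X_{(\phi_i)}$ are sequences $X_n\xrightarrow{\phi_{n-1}}X_{n-1}\to\cdots\xrightarrow{\phi_1}X_1$ of $A$-maps in $A\text{-mod}$, and whose morphisms are $n$-tuples of $A$-maps commuting with the structure maps. It is identified with $T_n(A)\text{-mod}$: $X_{(\phi_i)}$ corresponds to $\bigoplus_i X_i$, where $(a_{ij})$ sends $(x_i)_i$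 to the column with $i$-th entry $a_{ii}x_i+\sum_{j>i}a_{ij}\phi_i\cdots\phi_{j-1}(x_j)$. For a full subcategory $\mathcal X$ of $A\text{-mod}$, $\mathcal S_n(\mathcal X)$ is the full subcategory of $\operatorname{Mor}_n(A)$ of objects $X_{(\phi_i)}$ with all $X_i\in\mathcal X$, all $\phi_i$ monomorphisms, and all $\operatorname{Coker}\phi_i\in\mathcal X$ ($1\le i\le n-1$). *)

theory Defs
  imports "HOL-Library.Extended_Nat" "HOL-Algebra.Module" "HOL-Algebra.Elementary_Groups" "HOL-Algebra.RingHom"
begin

section \<open>Modules over a not necessarily commutative ring\<close>

text \<open>
  The library locale \<open>module\<close> requires a commutative ring of scalars.  We keep its record type,
  whose fields \<open>mult\<close> and \<open>one\<close> are irrelevant for modules, and its locale \<open>submodule\<close>,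
  which makes no assumption on the scalars.
\<close>

locale left_module = R?: ring R + M?: abelian_group M
  for R :: "('b, 'k) ring_scheme" (structure) and M :: "('b, 'm) module" (structure) +
  assumes smult_closed:
      "\<lbrakk> a \<in> carrier R; x \<in> carrier M \<rbrakk> \<Longrightarrow> a \<odot>\<^bsub>M\<^esub> x \<in> carrier M"
    and smult_l_distr:
      "\<lbrakk> a \<in> carrier R; b \<in> carrier R; x \<in> carrier M \<rbrakk> \<Longrightarrow>
        (a \<oplus> b) \<odot>\<^bsub>M\<^esub> x = a \<odot>\<^bsub>M\<^esub> x \<oplus>\<^bsub>M\<^esub> b \<odot>\<^bsub>M\<^esub> x"
    and smult_r_distr:
      "\<lbrakk> a \<in> carrier R; x \<in> carrier M; y \<in> carrier M \<rbrakk> \<Longrightarrow>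
        a \<odot>\<^bsub>M\<^esub> (x \<oplus>\<^bsub>M\<^esub> y) = a \<odot>\<^bsub>M\<^esub> x \<oplus>\<^bsub>M\<^esub> a \<odot>\<^bsub>M\<^esub> y"
    and smult_assoc1:
      "\<lbrakk> a \<in> carrier R; b \<in> carrier R; x \<in> carrier M \<rbrakk> \<Longrightarrow>
        (a \<otimes> b) \<odot>\<^bsub>M\<^esub> x = a \<odot>\<^bsub>M\<^esub> (b \<odot>\<^bsub>M\<^esub> x)"
    and smult_one:
      "x \<in> carrier M \<Longrightarrow> \<one> \<odot>\<^bsub>M\<^esub> x = x"

definition fin_gen :: "('b, 'k) ring_scheme \<Rightarrow> ('b, 'm) module \<Rightarrow> bool" where
  "fin_gen B M \<longleftrightarrow>
     (\<exists>S. finite S \<and> S \<subseteq> carrier M \<and> (\<forall>N. submodule N B M \<and> S \<subseteq> N \<longrightarrow> N = carrier M))"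

definition fg_mod :: "('b, 'k) ring_scheme \<Rightarrow> ('b, 'm) module set" where
  "fg_mod B = {M. left_module B M \<and> fin_gen B M}"

definition module_hom ::
  "('b, 'k) ring_scheme \<Rightarrow> ('b, 'm) module \<Rightarrow> ('b, 'n) module \<Rightarrow> ('m \<Rightarrow> 'n) set" where
  "module_hom B M N =
     {f \<in> carrier M \<rightarrow> carrier N.
        (\<forall>x\<in>carrier M. \<forall>y\<in>carrier M. f (x \<oplus>\<^bsub>M\<^esub> y) = f x \<oplus>\<^bsub>N\<^esub> f y) \<and>
        (\<forall>b\<in>carrier B. \<forall>x\<in>carrier M. f (b \<odot>\<^bsub>M\<^esub> x) = b \<odot>\<^bsub>N\<^esub> f x)}"

definition module_iso ::
  "('b, 'k) ring_scheme \<Rightarrow> ('b, 'm) module \<Rightarrow> ('b, 'n) module \<Rightarrow> bool" where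
  "module_iso B M N \<longleftrightarrow> (\<exists>f\<in>module_hom B M N. bij_betw f (carrier M) (carrier N))"

definition regular_module :: "('b, 'k) ring_scheme \<Rightarrow> ('b, 'b) module" where
  "regular_module B =
     \<lparr>carrier = carrier B, mult = mult B, one = one B,
      zero = zero B, add = add B,
      smult = mult B\<rparr>"

text \<open>Right \<open>B\<close>-modules are left modules over the opposite ring.\<close>

definition op_ring :: "('b, 'k) ring_scheme \<Rightarrow> 'b ring" where
  "op_ring B =
     \<lparr>carrier = carrier B, mult = (\<lambda>x y. y \<otimes>\<^bsub>B\<^esub> x), one = one B,
      zero = zero B, add = add B\<rparr>"


section \<open>Artin algebras\<close>

definition artinian_cring :: "('r, 'k) ring_scheme \<Rightarrow> bool" where
  "artinian_cring R \<longleftrightarrow> cring R \<and>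
     (\<forall>I :: nat \<Rightarrow> 'r set. (\<forall>k. ideal (I k) R \<and> I (Suc k) \<subseteq> I k) \<longrightarrow> (\<exists>m. \<forall>k\<ge>m. I k = I m))"

text \<open>
  The library locale \<open>algebra\<close> is about commutative algebras.  Here \<open>A\<close> carries its own
  multiplication and, through \<open>smult\<close>, the scalar action of \<open>R\<close>.
\<close>

definition artin_algebra :: "('r, 'k) ring_scheme \<Rightarrow> ('r, 'a) module \<Rightarrow> bool" where
  "artin_algebra R A \<longleftrightarrow>
     artinian_cring R \<and> ring A \<and> module R A \<and>
     (\<forall>r\<in>carrier R. \<forall>x\<in>carrier A. \<forall>y\<in>carrier A.
        r \<odot>\<^bsub>A\<^esub> (x \<otimes>\<^bsub>A\<^esub> y) = (r \<odot>\<^bsub>A\<^esub> x) \<otimes>\<^bsub>A\<^esub> y \<and>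
        r \<odot>\<^bsub>A\<^esub> (x \<otimes>\<^bsub>A\<^esub> y) = x \<otimes>\<^bsub>A\<^esub> (r \<odot>\<^bsub>A\<^esub> y)) \<and>
     fin_gen R A"


section \<open>Projective and injective modules, injective dimension\<close>

text \<open>
  Auxiliary modules that are quantified over inside a definition (test modules, terms of
  resolutions) have carriers in the type \<open>nat \<Rightarrow> 'b\<close>.  Since \<open>B\<^sup>m\<close> embeds in this type as a set,
  and a quotient of \<open>B\<^sup>m\<close> can be carried by a set of coset representatives, every finitely
  generated \<open>B\<close>-module has an isomorphic copy there; so these quantifiers range over all of
  \<open>B-mod\<close> up to isomorphism.
\<close>

type_synonym 'b umodule = "('b, nat \<Rightarrow> 'b) module"

definition fg_projective :: "('b, 'k) ring_scheme \<Rightarrow> ('b, 'm) module \<Rightarrow> bool" where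
  "fg_projective B P \<longleftrightarrow> P \<in> fg_mod B \<and>
     (\<forall>(M :: 'b umodule) \<in> fg_mod B. \<forall>(N :: 'b umodule) \<in> fg_mod B.
        \<forall>g\<in>module_hom B M N. \<forall>f\<in>module_hom B P N.
          g ` carrier M = carrier N \<longrightarrow> (\<exists>h\<in>module_hom B P M. \<forall>x\<in>carrier P. g (h x) = f x))"

definition fg_injective :: "('b, 'k) ring_scheme \<Rightarrow> ('b, 'm) module \<Rightarrow> bool" where
  "fg_injective B I \<longleftrightarrow> I \<in> fg_mod B \<and>
     (\<forall>(M :: 'b umodule) \<in> fg_mod B. \<forall>(N :: 'b umodule) \<in> fg_mod B.
        \<forall>g\<in>module_hom B M N. \<forall>f\<in>module_hom B M I.
          inj_on g (carrier M) \<longrightarrow> (\<exists>h\<in>module_hom B N I. \<forall>x\<in>carrier M. h (g x) = f x))"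

text \<open>
  Exact sequences \<open>0 \<rightarrow> M \<rightarrow> I 0 \<rightarrow> I 1 \<rightarrow> \<dots>\<close> of injective objects of \<open>B-mod\<close> with \<open>I k = 0\<close> for \<open>k > l\<close>.
  Over an Artin algebra injective hulls of finitely generated modules are finitely generated, so
  working inside \<open>B-mod\<close> yields the usual injective dimension.
\<close>

definition injective_resolution_upto ::
  "('b, 'k) ring_scheme \<Rightarrow> ('b, 'm) module \<Rightarrow> nat \<Rightarrow> (nat \<Rightarrow> 'b umodule) \<Rightarrow>
     (nat \<Rightarrow> (nat \<Rightarrow> 'b) \<Rightarrow> (nat \<Rightarrow> 'b)) \<Rightarrow> ('m \<Rightarrow> (nat \<Rightarrow> 'b)) \<Rightarrow> bool" where
  "injective_resolution_upto B M l I d e \<longleftrightarrow>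
     (\<forall>k. fg_injective B (I k)) \<and>
     (\<forall>k. d k \<in> module_hom B (I k) (I (Suc k))) \<and>
     e \<in> module_hom B M (I 0) \<and>
     inj_on e (carrier M) \<and>
     e ` carrier M = a_kernel (I 0) (I 1) (d 0) \<and>
     (\<forall>k. d k ` carrier (I k) = a_kernel (I (Suc k)) (I (Suc (Suc k))) (d (Suc k))) \<and>
     (\<forall>k>l. carrier (I k) = {\<zero>\<^bsub>I k\<^esub>})"

definition inj_dim :: "('b, 'k) ring_scheme \<Rightarrow> ('b, 'm) module \<Rightarrow> enat" where
  "inj_dim B M = (INF l\<in>{l. \<exists>I d e. injective_resolution_upto B M l I d e}. enat l)"

definition left_inj_dim :: "('b, 'k) ring_scheme \<Rightarrow> enat" where
  "left_inj_dim B = inj_dim B (regular_module B)"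

definition right_inj_dim :: "('b, 'k) ring_scheme \<Rightarrow> enat" where
  "right_inj_dim B = inj_dim (op_ring B) (regular_module (op_ring B))"

text \<open>The standing hypothesis that \<open>B\<close> is an Artin algebra is stated separately.\<close>

definition gorenstein :: "('b, 'k) ring_scheme \<Rightarrow> bool" where
  "gorenstein B \<longleftrightarrow> left_inj_dim B < \<infinity> \<and> right_inj_dim B < \<infinity>"


section \<open>Hom groups and Ext groups\<close>

text \<open>Elements of the Hom group are extensional, so that each homomorphism is represented once.\<close>

definition hom_group ::
  "('b, 'k) ring_scheme \<Rightarrow> ('b, 'm) module \<Rightarrow> ('b, 'n) module \<Rightarrow> ('m \<Rightarrow> 'n) monoid" where
  "hom_group B M N =
     \<lparr>carrier = module_hom B M N \<inter> extensional (carrier M),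
      mult = (\<lambda>f g. \<lambda>x\<in>carrier M. f x \<oplus>\<^bsub>N\<^esub> g x),
      one = (\<lambda>x\<in>carrier M. \<zero>\<^bsub>N\<^esub>)\<rparr>"

text \<open>The map \<open>Hom(u, N) : Hom(M, N) \<rightarrow> Hom(L, N)\<close> induced by \<open>u : L \<rightarrow> M\<close>.\<close>

definition hom_pre :: "('b, 'l) module \<Rightarrow> ('l \<Rightarrow> 'm) \<Rightarrow> ('m \<Rightarrow> 'n) \<Rightarrow> ('l \<Rightarrow> 'n)" where
  "hom_pre L u f = (\<lambda>x\<in>carrier L. f (u x))"

definition projective_resolution ::
  "('b, 'k) ring_scheme \<Rightarrow> ('b, 'm) module \<Rightarrow> (nat \<Rightarrow> 'b umodule) \<Rightarrow>
     (nat \<Rightarrow> (nat \<Rightarrow> 'b) \<Rightarrow> (nat \<Rightarrow> 'b)) \<Rightarrow> ((nat \<Rightarrow> 'b) \<Rightarrow> 'm) \<Rightarrow> bool" where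
  "projective_resolution B X P d e \<longleftrightarrow>
     (\<forall>k. fg_projective B (P k)) \<and>
     (\<forall>k. d k \<in> module_hom B (P (Suc k)) (P k)) \<and>
     e \<in> module_hom B (P 0) X \<and>
     e ` carrier (P 0) = carrier X \<and>
     d 0 ` carrier (P 1) = a_kernel (P 0) X e \<and>
     (\<forall>k. d (Suc k) ` carrier (P (Suc (Suc k))) = a_kernel (P (Suc k)) (P k) (d k))"

text \<open>
  A fixed choice of resolution.  One exists for \<open>X\<close> in \<open>B-mod\<close> when \<open>B\<close> is left noetherian,
  in particular when \<open>B\<close> is an Artin algebra; \<open>ext_group\<close> below is only used in that situation.
\<close>

definition chosen_resolution ::
  "('b, 'k) ring_scheme \<Rightarrow> ('b, 'm) module \<Rightarrow>
     (nat \<Rightarrow> 'b umodule) \<times> (nat \<Rightarrow> (nat \<Rightarrow> 'b) \<Rightarrow> (nat \<Rightarrow> 'b))" where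
  "chosen_resolution B X = (SOME (P, d). \<exists>e. projective_resolution B X P d e)"

definition ext_group ::
  "('b, 'k) ring_scheme \<Rightarrow> nat \<Rightarrow> ('b, 'm) module \<Rightarrow> ('b, 'n) module \<Rightarrow>
     ((nat \<Rightarrow> 'b) \<Rightarrow> 'n) set monoid" where
  "ext_group B i X Y =
     (let (P, d) = chosen_resolution B X;
          C = (\<lambda>k. hom_group B (P k) Y);
          Z = kernel (C i) (C (Suc i)) (hom_pre (P (Suc i)) (d i));
          D = (case i of 0 \<Rightarrow> {\<one>\<^bsub>C 0\<^esub>} | Suc k \<Rightarrow> hom_pre (P (Suc k)) (d k) ` carrier (C k))
      in (C i)\<lparr>carrier := Z\<rparr> Mod D)"


section \<open>The subcategories of \<open>B-mod\<close>\<close>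

text \<open>Full subcategories are given by their classes of objects.\<close>

definition CM :: "('b, 'k) ring_scheme \<Rightarrow> ('b, 'm) module set" where
  "CM B = {X \<in> fg_mod B. \<forall>i\<ge>1. trivial_group (ext_group B i X (regular_module B))}"

definition complete_projective_resolution ::
  "('b, 'k) ring_scheme \<Rightarrow> (int \<Rightarrow> 'b umodule) \<Rightarrow> (int \<Rightarrow> (nat \<Rightarrow> 'b) \<Rightarrow> (nat \<Rightarrow> 'b)) \<Rightarrow> bool" where
  "complete_projective_resolution B P d \<longleftrightarrow>
     (\<forall>k. fg_projective B (P k)) \<and>
     (\<forall>k. d k \<in> module_hom B (P k) (P (k + 1))) \<and>
     (\<forall>k. d k ` carrier (P k) = a_kernel (P (k + 1)) (P (k + 2)) (d (k + 1))) \<and>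
     (\<forall>k. hom_pre (P (k + 1)) (d (k + 1)) ` carrier (hom_group B (P (k + 2)) (regular_module B)) =
          kernel (hom_group B (P (k + 1)) (regular_module B))
                 (hom_group B (P k) (regular_module B)) (hom_pre (P k) (d k)))"

definition Gproj :: "('b, 'k) ring_scheme \<Rightarrow> ('b, 'm) module set" where
  "Gproj B = {G \<in> fg_mod B. \<exists>P d. complete_projective_resolution B P d \<and>
     module_iso B G ((P 0)\<lparr>carrier := a_kernel (P 0) (P 1) (d 0)\<rparr>)}"


section \<open>Triangular matrix algebras and the monomorphism category\<close>

text \<open>Matrices are indexed by \<open>{1..n}\<close> and padded by zero outside.\<close>

definition tri_ring :: "nat \<Rightarrow> ('a, 'k) ring_scheme \<Rightarrow> (nat \<Rightarrow> nat \<Rightarrow> 'a) ring" where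
  "tri_ring n A =
     \<lparr>carrier = {a. \<forall>i j. a i j \<in> carrier A \<and> (\<not> (1 \<le> i \<and> i \<le> j \<and> j \<le> n) \<longrightarrow> a i j = \<zero>\<^bsub>A\<^esub>)},
      mult = (\<lambda>a b i j. \<Oplus>\<^bsub>A\<^esub>k\<in>{1..n}. a i k \<otimes>\<^bsub>A\<^esub> b k j),
      one = (\<lambda>i j. if i = j \<and> 1 \<le> i \<and> i \<le> n then \<one>\<^bsub>A\<^esub> else \<zero>\<^bsub>A\<^esub>),
      zero = (\<lambda>i j. \<zero>\<^bsub>A\<^esub>),
      add = (\<lambda>a b i j. a i j \<oplus>\<^bsub>A\<^esub> b i j)\<rparr>"

text \<open>
  Objects of \<open>Mor\<^sub>n(A)\<close> are pairs \<open>(X, \<phi>)\<close> with \<open>\<phi> i : X (i + 1) \<rightarrow> X i\<close>; only the values \<open>X i\<close> for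
  \<open>1 \<le> i \<le> n\<close> and \<open>\<phi> i\<close> for \<open>1 \<le> i < n\<close> matter.
\<close>

type_synonym ('a, 'm) mor_obj = "(nat \<Rightarrow> ('a, 'm) module) \<times> (nat \<Rightarrow> 'm \<Rightarrow> 'm)"

definition Mor :: "nat \<Rightarrow> ('a, 'k) ring_scheme \<Rightarrow> ('a, 'm) mor_obj set" where
  "Mor n A = {(X, \<phi>). (\<forall>i\<in>{1..n}. X i \<in> fg_mod A) \<and>
                       (\<forall>i\<in>{1..<n}. \<phi> i \<in> module_hom A (X (i + 1)) (X i))}"

text \<open>The composite \<open>\<phi> i \<circ> \<phi> (i + 1) \<circ> \<dots> \<circ> \<phi> (j - 1)\<close>.\<close>

definition path_map :: "(nat \<Rightarrow> 'm \<Rightarrow> 'm) \<Rightarrow> nat \<Rightarrow> nat \<Rightarrow> 'm \<Rightarrow> 'm" where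
  "path_map \<phi> i j = foldr (\<circ>) (map \<phi> [i..<j]) id"

text \<open>
  The identification of \<open>Mor\<^sub>n(A)\<close> with the category of finitely generated \<open>T\<^sub>n(A)\<close>-modules:
  the direct sum of the \<open>X i\<close> with the action of upper triangular matrices through the \<open>\<phi> i\<close>.
\<close>

fun tri_module ::
  "nat \<Rightarrow> ('a, 'm) mor_obj \<Rightarrow> (nat \<Rightarrow> nat \<Rightarrow> 'a, nat \<Rightarrow> 'm) module" where
  "tri_module n (X, \<phi>) =
     \<lparr>carrier = (\<Pi>\<^sub>E i\<in>{1..n}. carrier (X i)),
      mult = undefined,
      one = undefined,
      zero = (\<lambda>i\<in>{1..n}. \<zero>\<^bsub>X i\<^esub>),
      add = (\<lambda>x y. \<lambda>i\<in>{1..n}. x i \<oplus>\<^bsub>X i\<^esub> y i),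
      smult = (\<lambda>a x. \<lambda>i\<in>{1..n}.
        (a i i \<odot>\<^bsub>X i\<^esub> x i) \<oplus>\<^bsub>X i\<^esub>
        (\<Oplus>\<^bsub>X i\<^esub>j\<in>{i<..n}. a i j \<odot>\<^bsub>X i\<^esub> path_map \<phi> i j (x j)))\<rparr>"

text \<open>
  The cokernel of \<open>f : X \<rightarrow> Y\<close>, that is \<open>Y\<close> modulo the image of \<open>f\<close>.  Each coset is represented by
  one chosen element of it, so that the cokernel has the same type as \<open>Y\<close> and can be tested for
  membership in the same class of modules.
\<close>

definition coset_rep :: "('a, 'm) module \<Rightarrow> 'm set \<Rightarrow> 'm \<Rightarrow> 'm" where
  "coset_rep Y H y = (SOME z. z \<in> H +>\<^bsub>Y\<^esub> y)"

definition coker ::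
  "('a, 'l) module \<Rightarrow> ('a, 'm) module \<Rightarrow> ('l \<Rightarrow> 'm) \<Rightarrow> ('a, 'm) module" where
  "coker X Y f =
     (let rep = coset_rep Y (f ` carrier X) in
       \<lparr>carrier = rep ` carrier Y,
        mult = undefined,
        one = undefined,
        zero = rep \<zero>\<^bsub>Y\<^esub>,
        add = (\<lambda>x y. rep (x \<oplus>\<^bsub>Y\<^esub> y)),
        smult = (\<lambda>a x. rep (a \<odot>\<^bsub>Y\<^esub> x))\<rparr>)"

definition mono_cat ::
  "nat \<Rightarrow> ('a, 'k) ring_scheme \<Rightarrow> ('a, 'm) module set \<Rightarrow> ('a, 'm) mor_obj set" where
  "mono_cat n A \<X> = {(X, \<phi>) \<in> Mor n A.
     (\<forall>i\<in>{1..n}. X i \<in> \<X>) \<and>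
     (\<forall>i\<in>{1..<n}. inj_on (\<phi> i) (carrier (X (i + 1)))) \<and>
     (\<forall>i\<in>{1..<n}. coker (X (i + 1)) (X i) (\<phi> i) \<in> \<X>)}"

text \<open>
  A class of \<open>T\<^sub>n(A)\<close>-modules regarded as a full subcategory of \<open>Mor\<^sub>n(A)\<close> under the identification.
\<close>

definition in_Mor ::
  "nat \<Rightarrow> ('a, 'k) ring_scheme \<Rightarrow> (nat \<Rightarrow> nat \<Rightarrow> 'a, nat \<Rightarrow> 'm) module set \<Rightarrow>
     ('a, 'm) mor_obj set" where
  "in_Mor n A \<Y> = {Z \<in> Mor n A. tri_module n Z \<in> \<Y>}"

end

theory Submission
  imports Defs
begin

text \<open>
  Write \<open>T\<close> for \<open>T\<^sub>n(A)\<close> and \<open>M\<close> for the \<open>T\<close>-module of an object \<open>(X, \<phi>)\<close>.  A free resolution of \<open>M\<close> is a sequence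
  of matrices over \<open>T\<close>, hence of block triangular matrices over \<open>A\<close>.  Its \<open>i\<close>-th rows form a free
  resolution of \<open>X i\<close>, supported on the blocks \<open>\<ge> i\<close>; if \<open>\<phi> i\<close> is injective, then the block \<open>i\<close> alone
  resolves its cokernel.  The \<open>q\<close>-th columns of the dual over \<open>T\<close> are the dual over \<open>A\<close> of the blocks
  \<open>\<le> q\<close>.  So for injective \<open>\<phi> i\<close> the exact sequences of block triangular complexes show that \<open>M\<close> lies in
  \<open>CM T\<close> if and only if all \<open>X i\<close> and all cokernels lie in \<open>CM A\<close>.

  If \<open>A\<close> has finite injective dimension as a right module, then dualising preserves exactness in
  positive degrees of sequences of finitely generated free right \<open>A\<close>-modules, and this property passes
  from \<open>A\<close> to \<open>T\<close>.  A noetherian ring with this property satisfies \<open>CM = Gproj\<close>: extend the dual of a free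
  resolution to the left by a resolution of its kernel and dualise back.  In particular a module in
  \<open>CM T\<close> embeds into a free \<open>T\<close>-module, and therefore its structure maps are injective.
\<close>

section \<open>Modules and free modules\<close>

text \<open>The obstacle is that an object of \<open>CM T\<close> need not have injective structure
  maps for any evident reason, and without injectivity the single blocks do not resolve the
  cokernels. The detour through \<open>Gproj\<close> repairs this: in a free \<open>T\<close>-module
  the structure maps are the inclusions of row vectors supported on \<open>{i + 1..n}\<close> into
  those supported on \<open>{i..n}\<close>, and submodules inherit their injectivity. Exactness is
  always meant in positive degrees, because degree 0 of a resolution carries the module itself. For
  columns this restriction is stable: the chase for a quotient block uses the subcomplex one degree
  higher. For rows it uses the subcomplex one degree lower, so that degree 0 is reached, and exactly
  there injectivity of \<open>\<phi> i\<close> takes over. No functors between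
  \<open>T\<close>-modules and \<open>A\<close>-modules are needed. All complexes are families of
  matrices, and their rows, columns and blocks differ in the index sets only, so every long exact
  sequence is an elementary chase with block triangular matrices.\<close>

lemma finsum_additive_map:
  assumes "abelian_monoid G" "abelian_monoid H" "h \<in> carrier G \<rightarrow> carrier H"
    and "h \<zero>\<^bsub>G\<^esub> = \<zero>\<^bsub>H\<^esub>"
    and "\<And>x y. x \<in> carrier G \<Longrightarrow> y \<in> carrier G \<Longrightarrow> h (x \<oplus>\<^bsub>G\<^esub> y) = h x \<oplus>\<^bsub>H\<^esub> h y"
    and "f \<in> A \<rightarrow> carrier G"
  shows "h (finsum G f A) = finsum H (\<lambda>a. h (f a)) A"
proof -
  interpret G: abelian_monoid G by fact
  interpret H: abelian_monoid H by fact
  \<comment> \<open>Over an infinite index set both sums are zero by convention, which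
    \<open>h\<close> respects.\<close>
  show ?thesis
  proof (cases "finite A")
    case True
    then show ?thesis using assms(6)
    proof (induction A)
      case empty
      then show ?case using assms(4) by simp
    next
      case (insert a A)
      have 1: "f \<in> A \<rightarrow> carrier G" "f a \<in> carrier G" using insert.prems by auto
      have 2: "(\<lambda>a. h (f a)) \<in> A \<rightarrow> carrier H" "h (f a) \<in> carrier H"
        using 1 assms(3) by auto
      show ?case
        using insert 1 2 by (simp add: assms(5))
    qed
  qed (simp add: assms(4) G.finsum_infinite H.finsum_infinite)
qed

text \<open>\<open>finsum\<close> reads only the carrier, addition and zero of its record. Sums in
  \<open>op_ring B\<close> and in \<open>regular_module B\<close> are thereby rewritten to sums in
  \<open>B\<close>.\<close>

lemma finsum_same_struct:
  assumes "carrier G = carrier H" "add G = add H" "zero G = zero H"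
  shows "finsum G f A = finsum H f A"
  using assms by (simp add: finsum_def finprod_def)

context abelian_monoid begin

lemma finsum_swap:
  assumes "finite I" "finite J" "\<And>s t. s \<in> I \<Longrightarrow> t \<in> J \<Longrightarrow> f s t \<in> carrier G"
  shows "(\<Oplus>s\<in>I. \<Oplus>t\<in>J. f s t) = (\<Oplus>t\<in>J. \<Oplus>s\<in>I. f s t)"
  using assms(1,3)
proof (induction I)
  case empty
  then show ?case by simp
next
  case (insert a I)
  have "(\<Oplus>t\<in>J. \<Oplus>s\<in>insert a I. f s t) = (\<Oplus>t\<in>J. f a t \<oplus> (\<Oplus>s\<in>I. f s t))"
    using insert by (intro finsum_cong') (auto intro!: finsum_closed finsum_insert)
  also have "\<dots> = (\<Oplus>t\<in>J. f a t) \<oplus> (\<Oplus>t\<in>J. \<Oplus>s\<in>I. f s t)"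
    using insert.prems by (intro finsum_addf) (auto intro!: finsum_closed)
  finally show ?case
    using insert by (subst finsum_insert) (auto intro!: finsum_closed)
qed

lemma finsum_restrict_support:
  assumes "finite J" "U \<subseteq> J" "\<And>s. s \<in> J \<Longrightarrow> s \<notin> U \<Longrightarrow> f s = \<zero>" "\<And>s. s \<in> U \<Longrightarrow> f s \<in> carrier G"
  shows "(\<Oplus>s\<in>J. f s) = (\<Oplus>s\<in>U. f s)"
proof -
  have "f s \<in> carrier G" if "s \<in> J" for s using that assms(3,4) by (cases "s \<in> U") auto
  then show ?thesis by (intro add.finprod_mono_neutral_cong_right) (use assms in auto)
qed

lemma finsum_delta:
  assumes "finite I" "f s \<in> carrier G"
  shows "(\<Oplus>t\<in>I. if t = s then f t else \<zero>) = (if s \<in> I then f s else \<zero>)"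
proof (cases "s \<in> I")
  case True
  have "(\<Oplus>t\<in>I. if t = s then f t else \<zero>) = (\<Oplus>t\<in>{s}. f t)"
    by (rule trans[OF finsum_restrict_support[of I "{s}"]]) (use assms True in \<open>auto intro!: finsum_cong'\<close>)
  then show ?thesis using True assms by (simp add: finsum_insert)
next
  case False
  have "(\<Oplus>t\<in>I. if t = s then f t else \<zero>) = (\<Oplus>t\<in>I. \<zero>)" using False by (intro finsum_cong') auto
  then show ?thesis using False by (simp add: finsum_zero)
qed

end

context abelian_group begin

lemma minus_self: "x \<in> carrier G \<Longrightarrow> x \<ominus> x = \<zero>"
  by (simp add: minus_eq r_neg)

lemma add_minus_cancel: "x \<in> carrier G \<Longrightarrow> y \<in> carrier G \<Longrightarrow> y \<oplus> (x \<ominus> y) = x"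
  by (simp add: minus_eq a_lcomm r_neg)

lemma minus_add_cancel: "x \<in> carrier G \<Longrightarrow> y \<in> carrier G \<Longrightarrow> (x \<ominus> y) \<oplus> y = x"
  by (simp add: minus_eq a_assoc l_neg)

lemma minus_eq_zero_iff: "x \<in> carrier G \<Longrightarrow> y \<in> carrier G \<Longrightarrow> x \<ominus> y = \<zero> \<longleftrightarrow> x = y"
  using minus_add_cancel[of x y] minus_self[of x] by (metis l_zero)

lemma eq_add_iff_minus_eq:
  assumes "x \<in> carrier G" "y \<in> carrier G" "z \<in> carrier G"
  shows "x = y \<oplus> z \<longleftrightarrow> x \<ominus> y = z"
proof
  assume "x = y \<oplus> z"
  then show "x \<ominus> y = z" using assms by (metis a_comm add.m_assoc minus_eq r_neg r_zero add.inv_closed)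
next
  assume "x \<ominus> y = z"
  then show "x = y \<oplus> z" using assms add_minus_cancel by metis
qed

end

section \<open>Submodules and homomorphisms of left modules\<close>

context left_module begin

lemma smult_r_null: "a \<in> carrier R \<Longrightarrow> a \<odot>\<^bsub>M\<^esub> \<zero>\<^bsub>M\<^esub> = \<zero>\<^bsub>M\<^esub>"
  by (metis M.add.r_cancel_one' M.l_zero M.zero_closed smult_closed smult_r_distr)

lemma smult_l_null: "x \<in> carrier M \<Longrightarrow> \<zero> \<odot>\<^bsub>M\<^esub> x = \<zero>\<^bsub>M\<^esub>"
  by (metis M.add.r_cancel_one' R.l_zero R.zero_closed smult_closed smult_l_distr)

lemma smult_l_minus: "a \<in> carrier R \<Longrightarrow> x \<in> carrier M \<Longrightarrow> (\<ominus> a) \<odot>\<^bsub>M\<^esub> x = \<ominus>\<^bsub>M\<^esub> (a \<odot>\<^bsub>M\<^esub> x)"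
  by (metis M.minus_equality R.add.inv_closed R.l_neg smult_closed smult_l_distr smult_l_null)

lemma smult_r_minus: "a \<in> carrier R \<Longrightarrow> x \<in> carrier M \<Longrightarrow> a \<odot>\<^bsub>M\<^esub> (\<ominus>\<^bsub>M\<^esub> x) = \<ominus>\<^bsub>M\<^esub> (a \<odot>\<^bsub>M\<^esub> x)"
  by (metis M.minus_equality M.add.inv_closed M.l_neg smult_closed smult_r_distr smult_r_null)

lemma smult_finsum:
  assumes "a \<in> carrier R" "f \<in> S \<rightarrow> carrier M"
  shows "a \<odot>\<^bsub>M\<^esub> (\<Oplus>\<^bsub>M\<^esub>s\<in>S. f s) = (\<Oplus>\<^bsub>M\<^esub>s\<in>S. a \<odot>\<^bsub>M\<^esub> f s)"
  by (rule finsum_additive_map)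
    (use assms in \<open>auto simp: smult_closed smult_r_distr smult_r_null M.abelian_monoid_axioms\<close>)

lemma finsum_smult:
  assumes "x \<in> carrier M" "f \<in> S \<rightarrow> carrier R"
  shows "(\<Oplus>\<^bsub>R\<^esub>s\<in>S. f s) \<odot>\<^bsub>M\<^esub> x = (\<Oplus>\<^bsub>M\<^esub>s\<in>S. f s \<odot>\<^bsub>M\<^esub> x)"
  by (rule finsum_additive_map[where h="\<lambda>a. a \<odot>\<^bsub>M\<^esub> x"])
    (use assms in \<open>auto simp: smult_closed smult_l_distr smult_l_null M.abelian_monoid_axioms
      R.abelian_monoid_axioms\<close>)

lemma submoduleI:
  assumes "H \<subseteq> carrier M" "\<zero>\<^bsub>M\<^esub> \<in> H"
    and "\<And>x y. x \<in> H \<Longrightarrow> y \<in> H \<Longrightarrow> x \<oplus>\<^bsub>M\<^esub> y \<in> H"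
    and "\<And>a x. a \<in> carrier R \<Longrightarrow> x \<in> H \<Longrightarrow> a \<odot>\<^bsub>M\<^esub> x \<in> H"
  shows "submodule H R M"
proof -
  have "\<ominus>\<^bsub>M\<^esub> x \<in> H" if "x \<in> H" for x
  proof -
    have x: "x \<in> carrier M" using that assms(1) by auto
    \<comment> \<open>Closure under inverses comes from the scalar \<ominus> \<one>.\<close>
    have "(\<ominus> \<one>) \<odot>\<^bsub>M\<^esub> x = \<ominus>\<^bsub>M\<^esub> x" using x by (simp add: smult_l_minus smult_one)
    then show ?thesis using assms(4)[of "\<ominus> \<one>" x] that by simp
  qed
  then have "subgroup H (add_monoid M)"
    using assms by (intro M.add.subgroupI) (auto simp: a_inv_def)
  then show ?thesis using assms(4) by (simp add: submodule_def submodule_axioms_def)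
qed

lemma submodule_carrier: "submodule (carrier M) R M"
  by (rule submoduleI) (auto simp: smult_closed)

end

lemma submoduleD:
  assumes "submodule H R M"
  shows "H \<subseteq> carrier M" "\<zero>\<^bsub>M\<^esub> \<in> H"
    and "\<And>x y. x \<in> H \<Longrightarrow> y \<in> H \<Longrightarrow> x \<oplus>\<^bsub>M\<^esub> y \<in> H"
    and "\<And>a x. a \<in> carrier R \<Longrightarrow> x \<in> H \<Longrightarrow> a \<odot>\<^bsub>M\<^esub> x \<in> H"
    and "\<And>x. x \<in> H \<Longrightarrow> \<ominus>\<^bsub>M\<^esub> x \<in> H"
proof -
  interpret submodule H R M by fact
  show "H \<subseteq> carrier M" "\<zero>\<^bsub>M\<^esub> \<in> H" using subset one_closed by auto
  show "\<And>x y. x \<in> H \<Longrightarrow> y \<in> H \<Longrightarrow> x \<oplus>\<^bsub>M\<^esub> y \<in> H" using m_closed by auto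
  show "\<And>a x. a \<in> carrier R \<Longrightarrow> x \<in> H \<Longrightarrow> a \<odot>\<^bsub>M\<^esub> x \<in> H" by auto
  show "\<And>x. x \<in> H \<Longrightarrow> \<ominus>\<^bsub>M\<^esub> x \<in> H" using m_inv_closed by (auto simp: a_inv_def)
qed

lemma left_moduleI:
  assumes "ring R"
    and "\<And>x y. x \<in> carrier M \<Longrightarrow> y \<in> carrier M \<Longrightarrow> x \<oplus>\<^bsub>M\<^esub> y \<in> carrier M"
    and "\<zero>\<^bsub>M\<^esub> \<in> carrier M"
    and "\<And>x y z. x \<in> carrier M \<Longrightarrow> y \<in> carrier M \<Longrightarrow> z \<in> carrier M \<Longrightarrow>
           (x \<oplus>\<^bsub>M\<^esub> y) \<oplus>\<^bsub>M\<^esub> z = x \<oplus>\<^bsub>M\<^esub> (y \<oplus>\<^bsub>M\<^esub> z)"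
    and "\<And>x y. x \<in> carrier M \<Longrightarrow> y \<in> carrier M \<Longrightarrow> x \<oplus>\<^bsub>M\<^esub> y = y \<oplus>\<^bsub>M\<^esub> x"
    and "\<And>x. x \<in> carrier M \<Longrightarrow> \<zero>\<^bsub>M\<^esub> \<oplus>\<^bsub>M\<^esub> x = x"
    and "\<And>x. x \<in> carrier M \<Longrightarrow> \<exists>y\<in>carrier M. y \<oplus>\<^bsub>M\<^esub> x = \<zero>\<^bsub>M\<^esub>"
    and "\<And>a x. a \<in> carrier R \<Longrightarrow> x \<in> carrier M \<Longrightarrow> a \<odot>\<^bsub>M\<^esub> x \<in> carrier M"
    and "\<And>a b x. a \<in> carrier R \<Longrightarrow> b \<in> carrier R \<Longrightarrow> x \<in> carrier M \<Longrightarrow>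
        (a \<oplus>\<^bsub>R\<^esub> b) \<odot>\<^bsub>M\<^esub> x = a \<odot>\<^bsub>M\<^esub> x \<oplus>\<^bsub>M\<^esub> b \<odot>\<^bsub>M\<^esub> x"
    and "\<And>a x y. a \<in> carrier R \<Longrightarrow> x \<in> carrier M \<Longrightarrow> y \<in> carrier M \<Longrightarrow>
        a \<odot>\<^bsub>M\<^esub> (x \<oplus>\<^bsub>M\<^esub> y) = a \<odot>\<^bsub>M\<^esub> x \<oplus>\<^bsub>M\<^esub> a \<odot>\<^bsub>M\<^esub> y"
    and "\<And>a b x. a \<in> carrier R \<Longrightarrow> b \<in> carrier R \<Longrightarrow> x \<in> carrier M \<Longrightarrow>
        (a \<otimes>\<^bsub>R\<^esub> b) \<odot>\<^bsub>M\<^esub> x = a \<odot>\<^bsub>M\<^esub> (b \<odot>\<^bsub>M\<^esub> x)"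
    and "\<And>x. x \<in> carrier M \<Longrightarrow> \<one>\<^bsub>R\<^esub> \<odot>\<^bsub>M\<^esub> x = x"
  shows "left_module R M"
  unfolding left_module_def left_module_axioms_def
  using assms by (intro conjI abelian_groupI) auto

lemma left_module_sub:
  assumes "left_module R M" "submodule H R M"
  shows "left_module R (M\<lparr>carrier := H\<rparr>)"
proof -
  interpret left_module R M by fact
  note sd = submoduleD[OF assms(2)]
  have c: "x \<in> H \<Longrightarrow> x \<in> carrier M" for x using sd(1) by auto
  show ?thesis
  proof (rule left_moduleI)
    fix x assume "x \<in> carrier (M\<lparr>carrier := H\<rparr>)"
    then show "\<exists>y\<in>carrier (M\<lparr>carrier := H\<rparr>). y \<oplus>\<^bsub>M\<lparr>carrier := H\<rparr>\<^esub> x = \<zero>\<^bsub>M\<lparr>carrier := H\<rparr>\<^esub>"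
      using sd(5)[of x] M.l_neg[of x] c[of x] by auto
  qed (use sd c in \<open>auto simp: R.ring_axioms M.a_ac smult_l_distr smult_r_distr smult_assoc1 smult_one\<close>)
qed

locale module_homs = M: left_module R M + N: left_module R N
  for R :: "('b, 'k) ring_scheme" and M :: "('b, 'm) module" and N :: "('b, 'n) module" +
  fixes h assumes h: "h \<in> module_hom R M N"
begin

lemma closed: "x \<in> carrier M \<Longrightarrow> h x \<in> carrier N"
  and hom_add: "x \<in> carrier M \<Longrightarrow> y \<in> carrier M \<Longrightarrow> h (x \<oplus>\<^bsub>M\<^esub> y) = h x \<oplus>\<^bsub>N\<^esub> h y"
  and hom_smult: "a \<in> carrier R \<Longrightarrow> x \<in> carrier M \<Longrightarrow> h (a \<odot>\<^bsub>M\<^esub> x) = a \<odot>\<^bsub>N\<^esub> h x"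
  using h by (auto simp: module_hom_def)

lemma hom_zero: "h \<zero>\<^bsub>M\<^esub> = \<zero>\<^bsub>N\<^esub>"
  by (metis M.R.zero_closed M.smult_l_null N.smult_l_null M.M.zero_closed closed hom_smult)

lemma hom_inv: "x \<in> carrier M \<Longrightarrow> h (\<ominus>\<^bsub>M\<^esub> x) = \<ominus>\<^bsub>N\<^esub> h x"
  by (metis M.M.add.inv_closed M.M.l_neg N.M.minus_equality closed hom_add hom_zero)

lemma hom_minus: "x \<in> carrier M \<Longrightarrow> y \<in> carrier M \<Longrightarrow> h (x \<ominus>\<^bsub>M\<^esub> y) = h x \<ominus>\<^bsub>N\<^esub> h y"
  by (simp add: M.M.minus_eq N.M.minus_eq hom_add hom_inv)

lemma hom_finsum: "f \<in> S \<rightarrow> carrier M \<Longrightarrow> h (\<Oplus>\<^bsub>M\<^esub>s\<in>S. f s) = (\<Oplus>\<^bsub>N\<^esub>s\<in>S. h (f s))"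
  by (rule finsum_additive_map)
    (auto simp: closed hom_add hom_zero M.M.abelian_monoid_axioms N.M.abelian_monoid_axioms)

lemma kernel_submodule: "submodule {x \<in> carrier M. h x = \<zero>\<^bsub>N\<^esub>} R M"
  by (rule M.submoduleI) (auto simp: hom_zero hom_add hom_smult N.smult_r_null M.smult_closed)

lemma image_submodule:
  assumes "submodule H R M" shows "submodule (h ` H) R N"
proof -
  note sd = submoduleD[OF assms]
  show ?thesis
  proof (rule N.submoduleI)
    show "h ` H \<subseteq> carrier N" using sd(1) closed by auto
    show "\<zero>\<^bsub>N\<^esub> \<in> h ` H" using sd(2) hom_zero by (metis imageI)
    fix x y assume "x \<in> h ` H" "y \<in> h ` H"
    then obtain x' y' where "x' \<in> H" "y' \<in> H" "x = h x'" "y = h y'" by auto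
    then show "x \<oplus>\<^bsub>N\<^esub> y \<in> h ` H" using sd hom_add[of x' y'] by (metis imageI subsetD)
  next
    fix a x assume "a \<in> carrier R" "x \<in> h ` H"
    then obtain x' where "x' \<in> H" "x = h x'" by auto
    then show "a \<odot>\<^bsub>N\<^esub> x \<in> h ` H"
      using sd hom_smult[of a x'] \<open>a \<in> carrier R\<close> by (metis imageI subsetD)
  qed
qed

lemma vimage_submodule:
  assumes "submodule H R N" shows "submodule {x \<in> carrier M. h x \<in> H} R M"
  using submoduleD[OF assms]
  by (intro M.submoduleI) (auto simp: hom_zero hom_add hom_smult M.smult_closed)

end

lemma module_homsI: "left_module R M \<Longrightarrow> left_module R N \<Longrightarrow> h \<in> module_hom R M N \<Longrightarrow> module_homs R M N h"
  by (simp add: module_homs_def module_homs_axioms_def)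

lemma module_homI:
  assumes "\<And>x. x \<in> carrier M \<Longrightarrow> f x \<in> carrier N"
    and "\<And>x y. x \<in> carrier M \<Longrightarrow> y \<in> carrier M \<Longrightarrow> f (x \<oplus>\<^bsub>M\<^esub> y) = f x \<oplus>\<^bsub>N\<^esub> f y"
    and "\<And>b x. b \<in> carrier R \<Longrightarrow> x \<in> carrier M \<Longrightarrow> f (b \<odot>\<^bsub>M\<^esub> x) = b \<odot>\<^bsub>N\<^esub> f x"
  shows "f \<in> module_hom R M N"
  using assms by (auto simp: module_hom_def)

lemma module_homD:
  assumes "f \<in> module_hom R M N"
  shows "x \<in> carrier M \<Longrightarrow> f x \<in> carrier N"
    and "x \<in> carrier M \<Longrightarrow> y \<in> carrier M \<Longrightarrow> f (x \<oplus>\<^bsub>M\<^esub> y) = f x \<oplus>\<^bsub>N\<^esub> f y"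
    and "b \<in> carrier R \<Longrightarrow> x \<in> carrier M \<Longrightarrow> f (b \<odot>\<^bsub>M\<^esub> x) = b \<odot>\<^bsub>N\<^esub> f x"
  using assms by (auto simp: module_hom_def)

lemma module_hom_comp:
  "f \<in> module_hom R L M \<Longrightarrow> g \<in> module_hom R M N \<Longrightarrow> (\<lambda>x. g (f x)) \<in> module_hom R L N"
  by (auto simp: module_hom_def Pi_iff)

lemma module_hom_cong:
  "f \<in> module_hom R M N \<Longrightarrow> left_module R M \<Longrightarrow> (\<And>x. x \<in> carrier M \<Longrightarrow> g x = f x) \<Longrightarrow> g \<in> module_hom R M N"
proof -
  assume a: "f \<in> module_hom R M N" "left_module R M" "\<And>x. x \<in> carrier M \<Longrightarrow> g x = f x"
  interpret left_module R M by fact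
  show ?thesis using a by (auto simp: module_hom_def smult_closed)
qed

lemma module_hom_minus:
  assumes "left_module R M" "left_module R N" "f \<in> module_hom R M N" "g \<in> module_hom R M N"
  shows "(\<lambda>x. f x \<ominus>\<^bsub>N\<^esub> g x) \<in> module_hom R M N"
proof -
  interpret f: module_homs R M N f using assms by (intro module_homsI)
  interpret g: module_homs R M N g using assms by (intro module_homsI)
  show ?thesis
    by (rule module_homI)
      (auto simp: f.closed g.closed f.hom_add g.hom_add f.hom_smult g.hom_smult f.N.M.minus_eq
         f.N.M.minus_add f.N.M.a_ac f.N.smult_r_distr f.N.smult_r_minus f.N.smult_closed)
qed

lemma module_hom_plus:
  assumes "left_module R M" "left_module R N" "f \<in> module_hom R M N" "g \<in> module_hom R M N"
  shows "(\<lambda>x. f x \<oplus>\<^bsub>N\<^esub> g x) \<in> module_hom R M N"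
proof -
  interpret f: module_homs R M N f using assms by (intro module_homsI)
  interpret g: module_homs R M N g using assms by (intro module_homsI)
  show ?thesis
    by (rule module_homI)
      (auto simp: f.closed g.closed f.hom_add g.hom_add f.hom_smult g.hom_smult
         f.N.M.a_ac f.N.smult_r_distr f.N.smult_closed)
qed

section \<open>The opposite ring and the regular module\<close>

lemma op_ring_simps [simp]:
  "carrier (op_ring B) = carrier B" "\<zero>\<^bsub>op_ring B\<^esub> = \<zero>\<^bsub>B\<^esub>" "\<one>\<^bsub>op_ring B\<^esub> = \<one>\<^bsub>B\<^esub>"
  "x \<oplus>\<^bsub>op_ring B\<^esub> y = x \<oplus>\<^bsub>B\<^esub> y" "x \<otimes>\<^bsub>op_ring B\<^esub> y = y \<otimes>\<^bsub>B\<^esub> x"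
  by (simp_all add: op_ring_def)

lemma finsum_op_ring [simp]: "finsum (op_ring B) f S = finsum B f S"
  by (rule finsum_same_struct) (simp_all add: op_ring_def)

lemma ring_op_ring: assumes "ring B" shows "ring (op_ring B)"
proof -
  interpret ring B by fact
  show ?thesis
    by (rule ringI; (rule abelian_groupI monoidI)?)
      (auto simp: a_ac m_assoc l_distr r_distr intro: l_neg)
qed

lemma regular_module_simps [simp]:
  "carrier (regular_module B) = carrier B" "\<zero>\<^bsub>regular_module B\<^esub> = \<zero>\<^bsub>B\<^esub>"
  "x \<oplus>\<^bsub>regular_module B\<^esub> y = x \<oplus>\<^bsub>B\<^esub> y" "a \<odot>\<^bsub>regular_module B\<^esub> y = a \<otimes>\<^bsub>B\<^esub> y"
  by (simp_all add: regular_module_def)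

lemma finsum_regular [simp]: "finsum (regular_module B) f S = finsum B f S"
  by (rule finsum_same_struct) (simp_all add: regular_module_def)

lemma left_module_regular: assumes "ring B" shows "left_module B (regular_module B)"
proof -
  interpret ring B by fact
  show ?thesis
    by (rule left_moduleI) (auto simp: ring_axioms a_ac m_assoc l_distr r_distr intro: l_neg)
qed

section \<open>Free modules of row vectors, and matrices\<close>

definition vecs :: "('b, 'k) ring_scheme \<Rightarrow> 'i set \<Rightarrow> ('i \<Rightarrow> 'b) set" where
  "vecs B I = {x. (\<forall>s\<in>I. x s \<in> carrier B) \<and> (\<forall>s. s \<notin> I \<longrightarrow> x s = \<zero>\<^bsub>B\<^esub>)}"

definition free :: "('b, 'k) ring_scheme \<Rightarrow> 'i set \<Rightarrow> ('b, 'i \<Rightarrow> 'b) module" where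
  "free B I =
     \<lparr>carrier = vecs B I, mult = undefined, one = undefined, zero = (\<lambda>_. \<zero>\<^bsub>B\<^esub>),
      add = (\<lambda>x y s. x s \<oplus>\<^bsub>B\<^esub> y s), smult = (\<lambda>a x s. a \<otimes>\<^bsub>B\<^esub> x s)\<rparr>"

lemma free_simps [simp]:
  "carrier (free B I) = vecs B I" "\<zero>\<^bsub>free B I\<^esub> = (\<lambda>_. \<zero>\<^bsub>B\<^esub>)"
  "x \<oplus>\<^bsub>free B I\<^esub> y = (\<lambda>s. x s \<oplus>\<^bsub>B\<^esub> y s)" "a \<odot>\<^bsub>free B I\<^esub> x = (\<lambda>s. a \<otimes>\<^bsub>B\<^esub> x s)"
  by (simp_all add: free_def)

definition unit_vec :: "('b, 'k) ring_scheme \<Rightarrow> 'i \<Rightarrow> 'i \<Rightarrow> 'b" where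
  "unit_vec B s = (\<lambda>t. if t = s then \<one>\<^bsub>B\<^esub> else \<zero>\<^bsub>B\<^esub>)"

definition lin :: "('b, 'm) module \<Rightarrow> 'i set \<Rightarrow> ('i \<Rightarrow> 'm) \<Rightarrow> ('i \<Rightarrow> 'b) \<Rightarrow> 'm" where
  "lin M I g x = (\<Oplus>\<^bsub>M\<^esub>s\<in>I. x s \<odot>\<^bsub>M\<^esub> g s)"

text \<open>
  The index sets are arguments, so that a block of a matrix \<open>D\<close> is given by \<open>D\<close> itself with smaller
  index sets.
\<close>

definition vmul ::
  "('b, 'k) ring_scheme \<Rightarrow> 'i set \<Rightarrow> 'j set \<Rightarrow> ('i \<Rightarrow> 'j \<Rightarrow> 'b) \<Rightarrow> ('i \<Rightarrow> 'b) \<Rightarrow> 'j \<Rightarrow> 'b" where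
  "vmul B I J D x = (\<lambda>t. if t \<in> J then (\<Oplus>\<^bsub>B\<^esub>s\<in>I. x s \<otimes>\<^bsub>B\<^esub> D s t) else \<zero>\<^bsub>B\<^esub>)"

context ring begin

lemma vecsD: "x \<in> vecs R I \<Longrightarrow> x s \<in> carrier R"
  by (cases "s \<in> I") (auto simp: vecs_def)

lemma vecs_out: "x \<in> vecs R I \<Longrightarrow> s \<notin> I \<Longrightarrow> x s = \<zero>"
  by (auto simp: vecs_def)

text \<open>Padding by zero makes the enlargement of an index set a literal inclusion, so that a
  block of a free module is a subset of it.\<close>

lemma vecs_mono: "x \<in> vecs R I \<Longrightarrow> I \<subseteq> J \<Longrightarrow> x \<in> vecs R J"
  using vecsD[of x I] by (auto simp: vecs_def)

lemma left_module_free: "left_module R (free R I)"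
proof (rule left_moduleI)
  fix x assume x: "x \<in> carrier (free R I)"
  show "\<exists>y\<in>carrier (free R I). y \<oplus>\<^bsub>free R I\<^esub> x = \<zero>\<^bsub>free R I\<^esub>"
  proof
    show "(\<lambda>s. \<ominus> x s) \<in> carrier (free R I)" using x by (auto simp: vecs_def)
    show "(\<lambda>s. \<ominus> x s) \<oplus>\<^bsub>free R I\<^esub> x = \<zero>\<^bsub>free R I\<^esub>" using x vecsD[of x I] by (auto simp: l_neg)
  qed
next
  fix x y z assume "x \<in> carrier (free R I)" "y \<in> carrier (free R I)" "z \<in> carrier (free R I)"
  then show "x \<oplus>\<^bsub>free R I\<^esub> y \<oplus>\<^bsub>free R I\<^esub> z = x \<oplus>\<^bsub>free R I\<^esub> (y \<oplus>\<^bsub>free R I\<^esub> z)"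
    using vecsD[of x I] vecsD[of y I] vecsD[of z I] by (auto simp: a_assoc)
next
  fix x y assume "x \<in> carrier (free R I)" "y \<in> carrier (free R I)"
  then show "x \<oplus>\<^bsub>free R I\<^esub> y = y \<oplus>\<^bsub>free R I\<^esub> x"
    using vecsD[of x I] vecsD[of y I] by (auto simp: a_comm)
next
  fix a x y assume "a \<in> carrier R" "x \<in> carrier (free R I)" "y \<in> carrier (free R I)"
  then show "a \<odot>\<^bsub>free R I\<^esub> (x \<oplus>\<^bsub>free R I\<^esub> y) = a \<odot>\<^bsub>free R I\<^esub> x \<oplus>\<^bsub>free R I\<^esub> a \<odot>\<^bsub>free R I\<^esub> y"
    using vecsD[of x I] vecsD[of y I] by (auto simp: r_distr)
next
  fix a b x assume "a \<in> carrier R" "b \<in> carrier R" "x \<in> carrier (free R I)"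
  then show "(a \<oplus> b) \<odot>\<^bsub>free R I\<^esub> x = a \<odot>\<^bsub>free R I\<^esub> x \<oplus>\<^bsub>free R I\<^esub> b \<odot>\<^bsub>free R I\<^esub> x"
    "(a \<otimes> b) \<odot>\<^bsub>free R I\<^esub> x = a \<odot>\<^bsub>free R I\<^esub> (b \<odot>\<^bsub>free R I\<^esub> x)"
    using vecsD[of x I] by (auto simp: l_distr m_assoc)
next
  fix x assume "x \<in> carrier (free R I)"
  then show "\<zero>\<^bsub>free R I\<^esub> \<oplus>\<^bsub>free R I\<^esub> x = x" "\<one> \<odot>\<^bsub>free R I\<^esub> x = x"
    using vecsD[of x I] by auto
qed (auto simp: vecs_def ring_axioms)

lemma unit_vec_closed: "s \<in> I \<Longrightarrow> unit_vec R s \<in> vecs R I"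
  by (auto simp: vecs_def unit_vec_def)

lemma finsum_free:
  assumes "f \<in> S \<rightarrow> vecs R I"
  shows "finsum (free R I) f S = (\<lambda>t. \<Oplus>s\<in>S. f s t)"
proof
  fix t
  interpret F: left_module R "free R I" by (rule left_module_free)
  show "finsum (free R I) f S t = (\<Oplus>s\<in>S. f s t)"
    by (rule finsum_additive_map[where h="\<lambda>x. x t"])
      (use assms in \<open>auto simp: F.M.abelian_monoid_axioms abelian_monoid_axioms vecsD\<close>)
qed

lemma vec_expand:
  assumes "finite I" "x \<in> vecs R I"
  shows "(\<Oplus>\<^bsub>free R I\<^esub>s\<in>I. x s \<odot>\<^bsub>free R I\<^esub> unit_vec R s) = x"
proof -
  interpret F: left_module R "free R I" by (rule left_module_free)
  have cl: "(\<lambda>s. x s \<odot>\<^bsub>free R I\<^esub> unit_vec R s) \<in> I \<rightarrow> vecs R I"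
    using vecsD[OF assms(2)] F.smult_closed[OF _ unit_vec_closed[of _ I, folded free_simps(1)]]
    by (simp del: free_simps(2-) add: Pi_iff)
  show ?thesis
    unfolding finsum_free[OF cl]
  proof
    fix t
    show "(\<Oplus>s\<in>I. (x s \<odot>\<^bsub>free R I\<^esub> unit_vec R s) t) = x t"
    proof (cases "t \<in> I")
      case True
      have "(\<Oplus>s\<in>I. (x s \<odot>\<^bsub>free R I\<^esub> unit_vec R s) t) = (\<Oplus>s\<in>I. if t = s then x s else \<zero>)"
        using assms(2) by (intro finsum_cong') (auto simp: unit_vec_def vecsD)
      also have "\<dots> = x t" using True assms vecsD by (intro finsum_singleton) auto
      finally show ?thesis .
    next
      case False
      have "(\<Oplus>s\<in>I. (x s \<odot>\<^bsub>free R I\<^esub> unit_vec R s) t) = (\<Oplus>s\<in>I. \<zero>)"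
        using assms(2) False by (intro finsum_cong') (auto simp: unit_vec_def vecsD)
      then show ?thesis using False assms vecs_out by (metis finsum_zero)
    qed
  qed
qed

lemma vmul_closed:
  assumes "x \<in> vecs R I" "\<And>s t. D s t \<in> carrier R"
  shows "vmul R I J D x \<in> vecs R J"
  using assms vecsD[of x I] by (auto simp: vmul_def vecs_def intro!: finsum_closed)

end

context left_module begin

lemma lin_hom:
  assumes "g \<in> I \<rightarrow> carrier M"
  shows "lin M I g \<in> module_hom R (free R I) M"
proof (rule module_homI)
  fix x assume "x \<in> carrier (free R I)"
  then show "lin M I g x \<in> carrier M"
    using assms R.vecsD[of x I] unfolding lin_def by (auto intro!: M.finsum_closed smult_closed)
next
  fix x y assume "x \<in> carrier (free R I)" "y \<in> carrier (free R I)"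
  then have c: "x s \<in> carrier R" "y s \<in> carrier R" for s using R.vecsD by auto
  show "lin M I g (x \<oplus>\<^bsub>free R I\<^esub> y) = lin M I g x \<oplus>\<^bsub>M\<^esub> lin M I g y"
    unfolding lin_def using assms c
    by (subst M.finsum_addf[symmetric]) (auto intro!: M.finsum_cong' smult_closed smult_l_distr)
next
  fix a x assume "a \<in> carrier R" "x \<in> carrier (free R I)"
  moreover from this have c: "x s \<in> carrier R" for s using R.vecsD by auto
  ultimately show "lin M I g (a \<odot>\<^bsub>free R I\<^esub> x) = a \<odot>\<^bsub>M\<^esub> lin M I g x"
    unfolding lin_def using assms
    by (subst smult_finsum) (auto intro!: M.finsum_cong' smult_closed smult_assoc1)
qed

lemma lin_unit_vec:
  assumes "finite I" "g \<in> I \<rightarrow> carrier M" "s \<in> I"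
  shows "lin M I g (unit_vec R s) = g s"
proof -
  have "lin M I g (unit_vec R s) = (\<Oplus>\<^bsub>M\<^esub>t\<in>I. if s = t then g t else \<zero>\<^bsub>M\<^esub>)"
    unfolding lin_def using assms
    by (intro M.finsum_cong') (auto simp: unit_vec_def smult_one smult_l_null Pi_iff)
  also have "\<dots> = g s" using assms by (intro M.finsum_singleton) auto
  finally show ?thesis .
qed

lemma hom_free_eq_lin:
  assumes "finite I" "f \<in> module_hom R (free R I) M" "x \<in> vecs R I"
  shows "f x = lin M I (\<lambda>s. f (unit_vec R s)) x"
proof -
  interpret f: module_homs R "free R I" M f
    using assms(2) by (intro module_homsI R.left_module_free left_module_axioms)
  have cl: "(\<lambda>s. x s \<odot>\<^bsub>free R I\<^esub> unit_vec R s) \<in> I \<rightarrow> carrier (free R I)"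
    using R.vecsD[OF assms(3)] f.M.smult_closed[OF _ R.unit_vec_closed[of _ I, folded free_simps(1)]]
    by (simp del: free_simps(2-) add: Pi_iff)
  have "f x = f (\<Oplus>\<^bsub>free R I\<^esub>s\<in>I. x s \<odot>\<^bsub>free R I\<^esub> unit_vec R s)"
    using R.vec_expand[OF assms(1,3)] by simp
  also have "\<dots> = (\<Oplus>\<^bsub>M\<^esub>s\<in>I. f (x s \<odot>\<^bsub>free R I\<^esub> unit_vec R s))"
    by (rule f.hom_finsum[OF cl])
  also have "\<dots> = (\<Oplus>\<^bsub>M\<^esub>s\<in>I. x s \<odot>\<^bsub>M\<^esub> f (unit_vec R s))"
  proof (rule M.finsum_cong')
    fix s assume "s \<in> I"
    then show "f (x s \<odot>\<^bsub>free R I\<^esub> unit_vec R s) = x s \<odot>\<^bsub>M\<^esub> f (unit_vec R s)"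
      using assms(3) R.unit_vec_closed R.vecsD by (intro f.hom_smult) auto
  next
    show "(\<lambda>s. x s \<odot>\<^bsub>M\<^esub> f (unit_vec R s)) \<in> I \<rightarrow> carrier M"
      using R.vecsD[OF assms(3)] f.closed R.unit_vec_closed[of _ I] by (auto intro!: smult_closed)
  qed simp
  finally show ?thesis by (simp add: lin_def)
qed

end

lemma (in ring) vmul_eq_lin:
  assumes "x \<in> vecs R I" "\<And>s t. D s t \<in> carrier R"
  shows "vmul R I J D x = lin (free R J) I (\<lambda>s t. if t \<in> J then D s t else \<zero>) x"
proof -
  interpret F: left_module R "free R J" by (rule left_module_free)
  have "(\<lambda>s. x s \<odot>\<^bsub>free R J\<^esub> (\<lambda>t. if t \<in> J then D s t else \<zero>)) \<in> I \<rightarrow> vecs R J"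
    using assms vecsD[of x I] by (auto simp: vecs_def)
  from finsum_free[OF this] show ?thesis
    using vecsD[OF assms(1)] assms(2) by (auto simp: lin_def vmul_def fun_eq_iff finsum_zero)
qed

lemma (in ring) vmul_hom:
  assumes "\<And>s t. D s t \<in> carrier R"
  shows "vmul R I J D \<in> module_hom R (free R I) (free R J)"
proof -
  interpret F: left_module R "free R J" by (rule left_module_free)
  show ?thesis
    by (rule module_hom_cong[OF F.lin_hom left_module_free])
     (use assms in \<open>auto simp: vmul_eq_lin vecs_def\<close>)
qed

text \<open>The rows of \<open>D\<close> are the images of the unit vectors: with scalars acting
  from the left, maps of free modules multiply row vectors by a matrix from the right. Filling
  \<open>D\<close> up with zeros puts all its entries into the ring, so later closure conditions
  carry no index ranges.\<close>

lemma (in ring) hom_free_eq_vmul: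
  assumes "finite I" "f \<in> module_hom R (free R I) (free R J)"
  obtains D where "\<And>s t. D s t \<in> carrier R" "\<And>x. x \<in> vecs R I \<Longrightarrow> f x = vmul R I J D x"
proof
  interpret F: left_module R "free R J" by (rule left_module_free)
  define D where "D = (\<lambda>s t. if s \<in> I then f (unit_vec R s) t else \<zero>)"
  have v: "s \<in> I \<Longrightarrow> f (unit_vec R s) \<in> vecs R J" for s
    using module_homD(1)[OF assms(2), of "unit_vec R s"] unit_vec_closed[of s I] by simp
  show D: "D s t \<in> carrier R" for s t using vecsD[OF v] by (auto simp: D_def)
  fix x assume x: "x \<in> vecs R I"
  have "f x = lin (free R J) I (\<lambda>s. f (unit_vec R s)) x" by (rule F.hom_free_eq_lin[OF assms x])
  also have "\<dots> = lin (free R J) I (\<lambda>s t. if t \<in> J then D s t else \<zero>) x"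
    unfolding lin_def
    by (rule F.M.finsum_cong') (use v x vecs_out vecsD in \<open>auto simp: D_def fun_eq_iff vecs_def\<close>)
  finally show "f x = vmul R I J D x" using vmul_eq_lin[of x I D J, OF x D] by simp
qed

section \<open>Noetherian rings\<close>

text \<open>Finite generation is expressed inside the ambient module, so that images, preimages and
  intersections can be treated without giving \<open>H\<close> a module structure of its
  own.\<close>

definition fg_sub :: "('b, 'k) ring_scheme \<Rightarrow> ('b, 'm) module \<Rightarrow> 'm set \<Rightarrow> bool" where
  "fg_sub B M H \<longleftrightarrow>
     (\<exists>S. finite S \<and> S \<subseteq> H \<and> (\<forall>N. submodule N B M \<and> S \<subseteq> N \<longrightarrow> H \<subseteq> N))"

definition left_noetherian :: "('b, 'k) ring_scheme \<Rightarrow> bool" where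
  "left_noetherian B \<longleftrightarrow>
     ring B \<and> (\<forall>H. submodule H B (regular_module B) \<longrightarrow> fg_sub B (regular_module B) H)"

lemma fg_subE:
  assumes "fg_sub B M H"
  obtains S where "finite S" "S \<subseteq> H" "\<And>N. submodule N B M \<Longrightarrow> S \<subseteq> N \<Longrightarrow> H \<subseteq> N"
  using assms unfolding fg_sub_def by metis

lemma fin_gen_iff_fg_sub: "fin_gen B M \<longleftrightarrow> fg_sub B M (carrier M)"
proof -
  have "submodule N B M \<Longrightarrow> N = carrier M \<longleftrightarrow> carrier M \<subseteq> N" for N
    using submoduleD(1) by (metis subset_antisym subset_refl)
  then show ?thesis unfolding fin_gen_def fg_sub_def by (metis (no_types))
qed

lemma (in left_module) submodule_inter:
  "submodule H R M \<Longrightarrow> submodule K R M \<Longrightarrow> submodule (H \<inter> K) R M"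
  using submoduleD[of H R M] submoduleD[of K R M] by (intro submoduleI) auto

lemma (in left_module) submodule_of_sub_iff:
  assumes "submodule H R M"
  shows "submodule K R (M\<lparr>carrier := H\<rparr>) \<longleftrightarrow> submodule K R M \<and> K \<subseteq> H"
proof -
  interpret H: left_module R "M\<lparr>carrier := H\<rparr>"
    by (rule left_module_sub[OF left_module_axioms assms])
  show ?thesis
  proof
    assume "submodule K R (M\<lparr>carrier := H\<rparr>)"
    from submoduleD[OF this] submoduleD[OF assms] show "submodule K R M \<and> K \<subseteq> H"
      by (intro conjI submoduleI) auto
  next
    assume "submodule K R M \<and> K \<subseteq> H"
    with submoduleD[of K R M] submoduleD[OF assms] show "submodule K R (M\<lparr>carrier := H\<rparr>)"
      by (intro H.submoduleI) auto
  qed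
qed

lemma (in left_module) fin_gen_sub_iff:
  assumes "submodule H R M"
  shows "fin_gen R (M\<lparr>carrier := H\<rparr>) \<longleftrightarrow> fg_sub R M H"
proof
  assume "fg_sub R M H"
  then obtain S where S: "finite S" "S \<subseteq> H" "\<And>N. submodule N R M \<Longrightarrow> S \<subseteq> N \<Longrightarrow> H \<subseteq> N"
    by (rule fg_subE) blast
  then show "fin_gen R (M\<lparr>carrier := H\<rparr>)"
    unfolding fin_gen_def submodule_of_sub_iff[OF assms] by (intro exI[of _ S]) auto
next
  assume "fin_gen R (M\<lparr>carrier := H\<rparr>)"
  then obtain S where S: "finite S" "S \<subseteq> H"
    "\<And>N. submodule N R M \<Longrightarrow> N \<subseteq> H \<Longrightarrow> S \<subseteq> N \<Longrightarrow> N = H"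
    unfolding fin_gen_def submodule_of_sub_iff[OF assms] by auto
  show "fg_sub R M H" unfolding fg_sub_def
  proof (intro exI[of _ S] conjI allI impI S(1,2))
    fix N assume N: "submodule N R M \<and> S \<subseteq> N"
    then have "N \<inter> H = H" using S(2) assms by (intro S(3) submodule_inter) auto
    then show "H \<subseteq> N" by auto
  qed
qed

context module_homs begin

lemma fg_sub_image:
  assumes "fg_sub R M H" "H \<subseteq> carrier M"
  shows "fg_sub R N (h ` H)"
proof -
  obtain S where S: "finite S" "S \<subseteq> H" "\<And>K. submodule K R M \<Longrightarrow> S \<subseteq> K \<Longrightarrow> H \<subseteq> K"
    by (rule fg_subE[OF assms(1)]) blast
  show ?thesis unfolding fg_sub_def
  proof (intro exI[of _ "h ` S"] conjI allI impI)
    fix K assume K: "submodule K R N \<and> h ` S \<subseteq> K"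
    then have "H \<subseteq> {x \<in> carrier M. h x \<in> K}"
      using S(2) assms(2) by (intro S(3) vimage_submodule) auto
    then show "h ` H \<subseteq> K" by auto
  qed (use S in auto)
qed

text \<open>Preimages of generators of the image, together with generators of the kernel, suffice:
  an element of \<open>H\<close> agrees with some combination of the former up to an element of the
  kernel. This serves both the induction over free modules and the minimality argument for artinian
  rings.\<close>

lemma fg_sub_extension:
  assumes H: "submodule H R M" and im: "fg_sub R N (h ` H)"
    and ker: "fg_sub R M {x \<in> H. h x = \<zero>\<^bsub>N\<^esub>}"
  shows "fg_sub R M H"
proof -
  obtain S where S: "finite S" "S \<subseteq> h ` H" "\<And>K. submodule K R N \<Longrightarrow> S \<subseteq> K \<Longrightarrow> h ` H \<subseteq> K"
    by (rule fg_subE[OF im]) blast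
  obtain S' where S': "finite S'" "S' \<subseteq> {x \<in> H. h x = \<zero>\<^bsub>N\<^esub>}"
    "\<And>K. submodule K R M \<Longrightarrow> S' \<subseteq> K \<Longrightarrow> {x \<in> H. h x = \<zero>\<^bsub>N\<^esub>} \<subseteq> K"
    by (rule fg_subE[OF ker]) blast
  obtain U where U: "finite U" "U \<subseteq> H" "h ` U = S"
    using S(1,2) finite_subset_image by metis
  show ?thesis unfolding fg_sub_def
  proof (intro exI[of _ "U \<union> S'"] conjI allI impI subsetI)
    fix K x assume K: "submodule K R M \<and> U \<union> S' \<subseteq> K" and x: "x \<in> H"
    have KH: "submodule (K \<inter> H) R M" using K H by (intro M.submodule_inter) auto
    have "S \<subseteq> h ` (K \<inter> H)" using K U by auto
    then have "h ` H \<subseteq> h ` (K \<inter> H)" by (intro S(3) image_submodule KH)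
    then have "h x \<in> h ` (K \<inter> H)" using x by (metis imageI subsetD)
    then obtain y where y: "y \<in> K" "y \<in> H" "h x = h y"
      by (elim imageE IntE) (rule that)
    have c: "x \<in> carrier M" "y \<in> carrier M" using x y submoduleD(1)[OF H] by auto
    have "x \<ominus>\<^bsub>M\<^esub> y \<in> H" using x y submoduleD[OF H] by (simp add: M.M.minus_eq)
    moreover have "h (x \<ominus>\<^bsub>M\<^esub> y) = \<zero>\<^bsub>N\<^esub>"
      using c y by (simp add: hom_minus closed N.M.minus_self)
    ultimately have "x \<ominus>\<^bsub>M\<^esub> y \<in> K" using S'(3)[of K] K by auto
    then have "y \<oplus>\<^bsub>M\<^esub> (x \<ominus>\<^bsub>M\<^esub> y) \<in> K" using y submoduleD(3)[of K R M] K by auto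
    then show "x \<in> K" using c by (simp add: M.M.add_minus_cancel)
  qed (use U S' in auto)
qed

end

lemma (in left_module) lin_in_submodule:
  assumes "submodule H R M" "g \<in> I \<rightarrow> H" "x \<in> vecs R I"
  shows "lin M I g x \<in> H"
proof (cases "finite I")
  case True
  have c: "x s \<in> carrier R" for s by (rule R.vecsD[OF assms(3)])
  note sd = submoduleD[OF assms(1)]
  have "F \<subseteq> I \<Longrightarrow> (\<Oplus>\<^bsub>M\<^esub>s\<in>F. x s \<odot>\<^bsub>M\<^esub> g s) \<in> H" if "finite F" for F
    using that
  proof (induction F)
    case empty then show ?case using sd by simp
  next
    case (insert s F)
    have "(\<lambda>s. x s \<odot>\<^bsub>M\<^esub> g s) \<in> insert s F \<rightarrow> H"
      using insert.prems assms(2) by (intro funcsetI sd(4) c) auto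
    then show ?case using insert sd by (subst M.finsum_insert) auto
  qed
  then show ?thesis using True by (simp add: lin_def)
next
  case False
  then show ?thesis using submoduleD(2)[OF assms(1)] by (simp add: lin_def M.finsum_infinite)
qed

lemma (in left_module) lin_image_submodule:
  assumes "g \<in> I \<rightarrow> carrier M"
  shows "submodule (lin M I g ` vecs R I) R M"
proof -
  interpret l: module_homs R "free R I" M "lin M I g"
    by (intro module_homsI R.left_module_free left_module_axioms lin_hom assms)
  show ?thesis using l.image_submodule[OF l.M.submodule_carrier] by simp
qed

text \<open>Enumerating generators by \<open>{..<n}\<close> yields a finite free module mapping onto
  \<open>H\<close>; the free covers and the matrices describing kernels below come from it.\<close>

lemma (in left_module) fg_sub_generators:
  assumes H: "submodule H R M" and fg: "fg_sub R M H"
  obtains n :: nat and g where "g \<in> {..<n} \<rightarrow> H" "lin M {..<n} g ` vecs R {..<n} = H"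
proof -
  obtain S where S: "finite S" "S \<subseteq> H" "\<And>K. submodule K R M \<Longrightarrow> S \<subseteq> K \<Longrightarrow> H \<subseteq> K"
    by (rule fg_subE[OF fg]) blast
  obtain g :: "nat \<Rightarrow> _" and n where g: "S = g ` {i. i < n}"
    using finite_imp_nat_seg_image_inj_on[OF S(1)] by blast
  then have gH: "g \<in> {..<n} \<rightarrow> H" using S by auto
  then have gM: "g \<in> {..<n} \<rightarrow> carrier M" using submoduleD(1)[OF H] by auto
  have "S \<subseteq> lin M {..<n} g ` vecs R {..<n}"
  proof
    fix y assume "y \<in> S"
    then obtain i where i: "i < n" "y = g i" using g by auto
    then have "y = lin M {..<n} g (unit_vec R i)" using gM by (simp add: lin_unit_vec)
    then show "y \<in> lin M {..<n} g ` vecs R {..<n}" using i R.unit_vec_closed[of i "{..<n}"] by auto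
  qed
  then have "H \<subseteq> lin M {..<n} g ` vecs R {..<n}"
    by (intro S(3) lin_image_submodule gM)
  moreover have "lin M {..<n} g ` vecs R {..<n} \<subseteq> H"
    using lin_in_submodule[OF H gH] by auto
  ultimately show ?thesis using that gH by blast
qed

lemma (in left_module) fg_sub_linI:
  assumes "finite I" "g \<in> I \<rightarrow> carrier M"
  shows "fg_sub R M (lin M I g ` vecs R I)"
  unfolding fg_sub_def
proof (intro exI[of _ "g ` I"] conjI allI impI subsetI)
  fix y assume "y \<in> g ` I"
  then obtain i where i: "i \<in> I" "y = g i" by auto
  then show "y \<in> lin M I g ` vecs R I"
    using lin_unit_vec[OF assms i(1)] R.unit_vec_closed[OF i(1)] by (metis imageI)
next
  fix K y assume K: "submodule K R M \<and> g ` I \<subseteq> K" and y: "y \<in> lin M I g ` vecs R I"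
  show "y \<in> K" using y lin_in_submodule[of K g I] K by auto
qed (use assms in auto)

lemma (in ring) free_fg_mod:
  assumes "finite I" shows "free R I \<in> fg_mod R"
proof -
  interpret F: left_module R "free R I" by (rule left_module_free)
  have "lin (free R I) I (unit_vec R) ` vecs R I = vecs R I"
    using vec_expand[OF assms] by (simp add: lin_def del: free_simps(2-))
  moreover have "fg_sub R (free R I) (lin (free R I) I (unit_vec R) ` vecs R I)"
    using assms unit_vec_closed by (intro F.fg_sub_linI) auto
  ultimately show ?thesis
    by (simp add: fg_mod_def left_module_free fin_gen_iff_fg_sub)
qed

lemma (in module_homs) fg_mod_image:
  assumes "fin_gen R M" "h ` carrier M = carrier N" shows "fin_gen R N"
  using fg_sub_image[of "carrier M"] assms by (simp add: fin_gen_iff_fg_sub)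

text \<open>Induction along the projection to the last coordinate: the image of \<open>H\<close> is
  a left ideal, and the kernel lies in the free module of rank one less.\<close>

lemma fg_sub_free_noetherian:
  fixes n :: nat
  assumes "left_noetherian B" "submodule H B (free B {..<n})"
  shows "fg_sub B (free B {..<n}) H"
  using assms(2)
proof (induction n arbitrary: H)
  interpret ring B using assms(1) by (simp add: left_noetherian_def)
  {
    case 0
    interpret F: left_module B "free B {..<0::nat}" by (rule left_module_free)
    from submoduleD(1,2)[OF 0] have "H = {\<lambda>_. \<zero>\<^bsub>B\<^esub>}" by (auto simp: vecs_def)
    then show ?case unfolding fg_sub_def using submoduleD(2)[of _ B "free B {..<0::nat}"]
      by (intro exI[of _ "{}"]) auto
  next
    case (Suc n)
    interpret F: left_module B "free B {..<Suc n}" by (rule left_module_free)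
    interpret F': left_module B "free B {..<n}" by (rule left_module_free)
    interpret h: module_homs B "free B {..<Suc n}" "regular_module B" "\<lambda>x. x n"
      by (intro module_homsI left_module_free left_module_regular ring_axioms module_homI)
        (auto simp: vecsD)
    have sub: "vecs B {..<n} \<subseteq> vecs B {..<Suc n}" by (rule subsetI, erule vecs_mono) auto
    have vn: "x \<in> vecs B {..<n}" if "x \<in> vecs B {..<Suc n}" "x n = \<zero>\<^bsub>B\<^esub>" for x
      using that by (auto simp: vecs_def less_Suc_eq)
    have vn': "x n = \<zero>\<^bsub>B\<^esub>" if "x \<in> vecs B {..<n}" for x
      using that by (auto simp: vecs_def)
    \<comment> \<open>The smaller free module is a subset of the larger one, and intersecting with
      it moves submodules, and hence generation, from one to the other.\<close>
    have tr: "submodule (N \<inter> vecs B {..<n}) B (free B {..<n})" if "submodule N B (free B {..<Suc n})" for N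
      using submoduleD[OF that] F'.smult_closed F'.M.a_closed F'.M.zero_closed by (intro F'.submoduleI) auto
    let ?K = "{x \<in> H. x n = \<zero>\<^bsub>regular_module B\<^esub>}"
    have "x n = \<zero>\<^bsub>B\<^esub> \<longleftrightarrow> x \<in> vecs B {..<n}" if "x \<in> H" for x
      using that submoduleD(1)[OF Suc.prems] vn[of x] vn'[of x] by (metis free_simps(1) subsetD)
    then have K: "?K = H \<inter> vecs B {..<n}" by auto
    have "fg_sub B (free B {..<n}) ?K" unfolding K by (rule Suc.IH[OF tr[OF Suc.prems]])
    then have "fg_sub B (free B {..<Suc n}) ?K"
      unfolding fg_sub_def
    proof (elim exE conjE, intro exI conjI allI impI)
      fix S N assume S: "S \<subseteq> ?K"
        "\<forall>N. submodule N B (free B {..<n}) \<and> S \<subseteq> N \<longrightarrow> ?K \<subseteq> N"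
        and N: "submodule N B (free B {..<Suc n}) \<and> S \<subseteq> N"
      then have "?K \<subseteq> N \<inter> vecs B {..<n}" using tr[of N] K by blast
      then show "?K \<subseteq> N" by auto
    qed
    moreover have "fg_sub B (regular_module B) ((\<lambda>x. x n) ` H)"
      using assms(1) h.image_submodule[OF Suc.prems] by (auto simp: left_noetherian_def)
    ultimately show ?case by (rule h.fg_sub_extension[OF Suc.prems, rotated])
  }
qed

text \<open>\<open>H\<close> is the image of its preimage in a free cover of
  \<open>M\<close>.\<close>

lemma fg_sub_noetherian:
  assumes "left_noetherian B" "left_module B M" "fin_gen B M" "submodule H B M"
  shows "fg_sub B M H"
proof -
  interpret left_module B M by fact
  obtain n :: nat and g where g: "g \<in> {..<n} \<rightarrow> carrier M" "lin M {..<n} g ` vecs B {..<n} = carrier M"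
    using fg_sub_generators[OF submodule_carrier] assms(3) fin_gen_iff_fg_sub by metis
  interpret l: module_homs B "free B {..<n}" M "lin M {..<n} g"
    by (intro module_homsI R.left_module_free left_module_axioms lin_hom g)
  let ?K = "{x \<in> carrier (free B {..<n}). lin M {..<n} g x \<in> H}"
  have "fg_sub B M (lin M {..<n} g ` ?K)"
    by (rule l.fg_sub_image[OF fg_sub_free_noetherian[OF assms(1) l.vimage_submodule[OF assms(4)]]]) auto
  moreover have "lin M {..<n} g ` ?K = H"
    using submoduleD(1)[OF assms(4)] g(2) by auto
  ultimately show ?thesis by simp
qed

text \<open>Since \<open>C\<close> acts through multiplications of \<open>B\<close>, left ideals of
  \<open>B\<close> are \<open>C\<close>-submodules, and generators over \<open>C\<close> also
  generate over \<open>B\<close>. The lemma is used for a ring and for its opposite.\<close>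

lemma left_noetherian_finite_extension:
  assumes "left_noetherian C" "ring B" "left_module C M" "fin_gen C M"
    and "carrier M = carrier B" "zero M = zero B" "add M = add B"
    and sm: "\<And>c x. c \<in> carrier C \<Longrightarrow> x \<in> carrier B \<Longrightarrow> \<exists>b\<in>carrier B. c \<odot>\<^bsub>M\<^esub> x = b \<otimes>\<^bsub>B\<^esub> x"
  shows "left_noetherian B"
  unfolding left_noetherian_def
proof (intro conjI assms(2) allI impI)
  interpret M: left_module C M by fact
  have tr: "submodule H C M" if "submodule H B (regular_module B)" for H
  proof (rule M.submoduleI)
    note sd = submoduleD[OF that]
    fix a x assume ax: "a \<in> carrier C" "x \<in> H"
    then obtain b where "b \<in> carrier B" "a \<odot>\<^bsub>M\<^esub> x = b \<otimes>\<^bsub>B\<^esub> x"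
      using sm[of a x] sd(1) by auto
    then show "a \<odot>\<^bsub>M\<^esub> x \<in> H" using sd(4)[of b x] ax by simp
  qed (use submoduleD[OF that] assms(5-7) in auto)
  fix H assume H: "submodule H B (regular_module B)"
  have "fg_sub C M H" by (rule fg_sub_noetherian[OF assms(1,3,4) tr[OF H]])
  then show "fg_sub B (regular_module B) H"
    unfolding fg_sub_def using tr by (meson dual_order.trans)
qed

section \<open>Artinian commutative rings and Artin algebras are noetherian\<close>

lemma (in cring) submodule_regular_ideal:
  assumes "submodule H R (regular_module R)" shows "ideal H R"
proof -
  note sd = submoduleD[OF assms]
  have "\<ominus> x \<in> H" if "x \<in> H" for x
    using sd(4)[of "\<ominus> \<one>" x] that sd(1) by (auto simp: l_minus)
  then have "subgroup H (add_monoid R)"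
    using sd by (intro add.subgroupI) (auto simp: a_inv_def)
  then show ?thesis
    using sd m_comm by (intro idealI ring_axioms) (auto, metis subsetD)
qed

lemma artinian_cring_stable:
  fixes I :: "nat \<Rightarrow> 'r set"
  assumes "artinian_cring R" "\<And>k. ideal (I k) R" "\<And>k. I (Suc k) \<subseteq> I k"
  obtains m where "I (Suc m) = I m"
proof -
  have "\<exists>m. \<forall>k\<ge>m. I k = I m"
    by (rule conjunct2[OF assms(1)[unfolded artinian_cring_def], THEN spec, of I, THEN mp])
      (use assms(2,3) in simp)
  then obtain m where "\<forall>k\<ge>m. I k = I m" ..
  then have "I (Suc m) = I m" by (elim allE impE) (rule le_SucI[OF order_refl])
  then show ?thesis by (rule that)
qed

text \<open>Without a minimal member, dependent choice would produce a strictly descending sequence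
  of ideals.\<close>

lemma artinian_cring_minimal:
  assumes "artinian_cring R" "\<And>I. I \<in> F \<Longrightarrow> ideal I R" "I0 \<in> F"
  obtains I where "I \<in> F" "\<And>J. J \<in> F \<Longrightarrow> J \<subseteq> I \<Longrightarrow> J = I"
proof (rule ccontr)
  assume "\<not> thesis"
  with that have step: "\<exists>J. J \<in> F \<and> J \<subset> I" if "I \<in> F" for I using \<open>I \<in> F\<close> by (metis psubsetI)
  have "\<exists>f. \<forall>n::nat. f n \<in> F \<and> f (Suc n) \<subset> f n"
    by (rule dependent_nat_choice) (use assms(3) step in auto)
  then obtain f where f: "\<And>n::nat. f n \<in> F" "\<And>n. f (Suc n) \<subset> f n" by blast
  obtain m where "f (Suc m) = f m"
    by (rule artinian_cring_stable[OF assms(1), of f])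
      (use assms(2)[OF f(1)] f(2) in \<open>simp_all add: psubset_imp_subset\<close>)
  then show False using f(2)[of m] by auto
qed

text \<open>
  A minimal non-finitely generated ideal \<open>I\<close> satisfies \<open>r I = 0\<close> or \<open>r I = I\<close> for every \<open>r\<close>; in the
  second case \<open>r\<close> is invertible on \<open>I\<close>.  So \<open>I\<close> behaves like a vector space, and a subideal maximal
  without a given \<open>x \<noteq> 0\<close> is a complement of \<open>R x\<close>.
\<close>

lemma (in cring) artinian_noetherian:
  assumes art: "artinian_cring R"
  shows "left_noetherian R"
proof (rule ccontr)
  let ?M = "regular_module R"
  interpret M: left_module R ?M by (rule left_module_regular[OF ring_axioms])
  assume "\<not> left_noetherian R"
  then obtain I0 where I0: "submodule I0 R ?M" "\<not> fg_sub R ?M I0"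
    using ring_axioms by (auto simp: left_noetherian_def)
  obtain I where "I \<in> {I. submodule I R ?M \<and> \<not> fg_sub R ?M I}"
    and min: "\<And>J. J \<in> {I. submodule I R ?M \<and> \<not> fg_sub R ?M I} \<Longrightarrow> J \<subseteq> I \<Longrightarrow> J = I"
    by (rule artinian_cring_minimal[OF art, of "{I. submodule I R ?M \<and> \<not> fg_sub R ?M I}" I0])
      (use I0 submodule_regular_ideal in auto)
  then have I: "submodule I R ?M" "\<not> fg_sub R ?M I" by auto
  note sd = submoduleD[OF I(1), simplified]
  have fgJ: "fg_sub R ?M J" if "submodule J R ?M" "J \<subseteq> I" "J \<noteq> I" for J
    using min that by blast
  have hom: "module_homs R ?M ?M (\<lambda>x. r \<otimes> x)" if "r \<in> carrier R" for r
    using that by (intro module_homsI M.left_module_axioms module_homI) (auto simp: r_distr m_lcomm)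
  \<comment> \<open>If neither alternative held, the image and the kernel of \<open>r\<close> on
    \<open>I\<close> would both be proper in \<open>I\<close>, hence finitely generated by
    minimality, and then so would be \<open>I\<close>.\<close>
  have alt: "(\<lambda>x. r \<otimes> x) ` I = I \<or> (\<forall>x\<in>I. r \<otimes> x = \<zero>)" if r: "r \<in> carrier R" for r
  proof (rule ccontr)
    assume neg: "\<not> ?thesis"
    interpret h: module_homs R ?M ?M "\<lambda>x. r \<otimes> x" by (rule hom[OF r])
    have "fg_sub R ?M ((\<lambda>x. r \<otimes> x) ` I)"
      using neg r sd(4) by (intro fgJ h.image_submodule I(1)) auto
    moreover have "fg_sub R ?M {x \<in> I. r \<otimes> x = \<zero>\<^bsub>?M\<^esub>}"
    proof (intro fgJ)
      have "submodule (I \<inter> {x \<in> carrier ?M. r \<otimes> x = \<zero>\<^bsub>?M\<^esub>}) R ?M"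
        by (intro M.submodule_inter I(1) h.kernel_submodule)
      moreover have "I \<inter> {x \<in> carrier ?M. r \<otimes> x = \<zero>\<^bsub>?M\<^esub>} = {x \<in> I. r \<otimes> x = \<zero>\<^bsub>?M\<^esub>}"
        using sd(1) by auto
      ultimately show "submodule {x \<in> I. r \<otimes> x = \<zero>\<^bsub>?M\<^esub>} R ?M" by simp
    qed (use neg in auto)
    ultimately show False using h.fg_sub_extension[OF I(1)] I(2) by blast
  qed
  have inv: "\<exists>s\<in>carrier R. \<forall>z\<in>I. z = s \<otimes> (r \<otimes> z)" if r: "r \<in> carrier R" "(\<lambda>x. r \<otimes> x) ` I = I" for r
  proof -
    \<comment> \<open>The principal ideals generated by the powers of \<open>r\<close> stabilise, so
      the m-th power equals the next power times some \<open>s\<close>. Every element of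
      \<open>I\<close> is divisible by the m-th power within \<open>I\<close>, hence
      \<open>s\<close> inverts \<open>r\<close> on \<open>I\<close>.\<close>
    let ?P = "\<lambda>k. (\<lambda>x. (r [^] (k::nat)) \<otimes> x) ` carrier R"
    have P: "ideal (?P k) R" "?P (Suc k) \<subseteq> ?P k" for k
    proof -
      interpret h: module_homs R ?M ?M "\<lambda>x. (r [^] k) \<otimes> x" by (rule hom) (use r in auto)
      show "ideal (?P k) R"
        using submodule_regular_ideal[OF h.image_submodule[OF M.submodule_carrier]] by simp
      show "?P (Suc k) \<subseteq> ?P k" using r by (auto simp: m_assoc)
    qed
    obtain m where "?P (Suc m) = ?P m"
      by (rule artinian_cring_stable[OF art, of ?P, OF P])
    moreover have "r [^] m \<in> ?P m" using r by (intro image_eqI[of _ _ \<one>]) auto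
    ultimately obtain s where s: "s \<in> carrier R" "r [^] m = r [^] (Suc m) \<otimes> s" by auto
    have pw: "\<exists>w\<in>I. z = r [^] k \<otimes> w" if "z \<in> I" for z and k :: nat
      using that
    proof (induction k arbitrary: z)
      case 0 then show ?case using sd(1) by (intro bexI[of _ z]) auto
    next
      case (Suc k)
      then obtain w where w: "w \<in> I" "z = r [^] k \<otimes> w" by blast
      then obtain w' where "w' \<in> I" "w = r \<otimes> w'" using r(2) by blast
      then show ?case using w r sd(1) by (intro bexI[of _ w']) (auto simp: m_assoc)
    qed
    show ?thesis
    proof (intro bexI[of _ s] ballI)
      fix z assume "z \<in> I"
      then obtain w where w: "w \<in> I" "z = r [^] m \<otimes> w" using pw[of z m] by blast
      then have wc: "w \<in> carrier R" using sd(1) by auto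
      have "z = (r [^] (Suc m) \<otimes> s) \<otimes> w" using w(2) by (rule subst[OF s(2), where P="\<lambda>u. z = u \<otimes> w"])
      also have "\<dots> = s \<otimes> (r \<otimes> (r [^] m \<otimes> w))" using wc s(1) r(1) by (simp add: m_ac)
      finally show "z = s \<otimes> (r \<otimes> z)" using w by simp
    qed (use s in auto)
  qed
  have fg0: "fg_sub R ?M {\<zero>}"
    unfolding fg_sub_def using submoduleD(2)[of _ R ?M] by (intro exI[of _ "{}"]) auto
  with I(2) have "I \<noteq> {\<zero>}" by auto
  with sd(2) obtain x where x: "x \<in> I" "x \<noteq> \<zero>" by auto
  have xc: "x \<in> carrier R" using x sd(1) by auto
  let ?F = "{K. submodule K R ?M \<and> K \<subseteq> I \<and> x \<notin> K}"
  have "\<exists>K\<in>?F. \<forall>L\<in>?F. K \<subseteq> L \<longrightarrow> L = K"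
  proof (rule subset_Zorn_nonempty)
    have "submodule {\<zero>} R ?M" by (rule M.submoduleI) auto
    then show "?F \<noteq> {}" using x sd(2) by auto
  next
    fix Ch assume Ch: "Ch \<noteq> {}" "subset.chain ?F Ch"
    then have m: "\<And>K. K \<in> Ch \<Longrightarrow> submodule K R ?M \<and> K \<subseteq> I \<and> x \<notin> K"
      by (auto simp: subset.chain_def)
    have "submodule (\<Union>Ch) R ?M"
    proof (rule M.submoduleI)
      show "\<Union>Ch \<subseteq> carrier ?M" using m submoduleD(1) by blast
      show "\<zero>\<^bsub>?M\<^esub> \<in> \<Union>Ch" using Ch(1) m submoduleD(2) by blast
      fix u v assume "u \<in> \<Union>Ch" "v \<in> \<Union>Ch"
      then obtain K L where KL: "K \<in> Ch" "u \<in> K" "L \<in> Ch" "v \<in> L" by auto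
      then have "K \<subseteq> L \<or> L \<subseteq> K" using Ch(2) unfolding subset.chain_def by blast
      then show "u \<oplus>\<^bsub>?M\<^esub> v \<in> \<Union>Ch"
      proof
        assume "K \<subseteq> L"
        then have "u \<oplus>\<^bsub>?M\<^esub> v \<in> L" using KL m[of L] submoduleD(3)[of L R ?M u v] by blast
        then show ?thesis using KL by blast
      next
        assume "L \<subseteq> K"
        then have "u \<oplus>\<^bsub>?M\<^esub> v \<in> K" using KL m[of K] submoduleD(3)[of K R ?M u v] by blast
        then show ?thesis using KL by blast
      qed
    next
      fix a u assume "a \<in> carrier R" "u \<in> \<Union>Ch"
      then obtain K where "K \<in> Ch" "u \<in> K" by blast
      then show "a \<odot>\<^bsub>?M\<^esub> u \<in> \<Union>Ch"
        using m[of K] submoduleD(4)[of K R ?M a u] \<open>a \<in> carrier R\<close> by blast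
    qed
    then show "\<Union>Ch \<in> ?F" using m by auto
  qed
  then obtain K where K: "submodule K R ?M" "K \<subseteq> I" "x \<notin> K"
    and max: "\<And>L. submodule L R ?M \<Longrightarrow> L \<subseteq> I \<Longrightarrow> x \<notin> L \<Longrightarrow> K \<subseteq> L \<Longrightarrow> L = K" by auto
  note kd = submoduleD[OF K(1), simplified]
  \<comment> \<open>\<open>K\<close> misses \<open>x\<close>, so it is proper in \<open>I\<close>
    and finitely generated. Its generators together with \<open>x\<close> are shown to generate
    \<open>I\<close>, against the choice of \<open>I\<close>.\<close>
  have "fg_sub R ?M K" using K x by (intro fgJ) auto
  then obtain S where S: "finite S" "S \<subseteq> K" "\<And>N. submodule N R ?M \<Longrightarrow> S \<subseteq> N \<Longrightarrow> K \<subseteq> N"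
    by (rule fg_subE) blast
  have "fg_sub R ?M I" unfolding fg_sub_def
  proof (intro exI[of _ "insert x S"] conjI allI impI subsetI)
    fix N y assume N: "submodule N R ?M \<and> insert x S \<subseteq> N" and y: "y \<in> I"
    note nd = submoduleD[OF conjunct1[OF N], simplified]
    have KN: "K \<subseteq> N" using S(3) N by auto
    show "y \<in> N"
    proof (cases "y \<in> K")
      case False
      have yc: "y \<in> carrier R" using y sd(1) by auto
      \<comment> \<open>The sum of \<open>K\<close> and the multiples of \<open>y\<close> is
        strictly larger than \<open>K\<close>, so it contains \<open>x\<close>. The coefficient of
        \<open>y\<close> in \<open>x\<close> does not annihilate \<open>I\<close>, hence is
        invertible there, and \<open>y\<close> is recovered from \<open>x\<close> and an element of
        \<open>K\<close>.\<close>
      let ?L = "{k \<oplus> r \<otimes> y | k r. k \<in> K \<and> r \<in> carrier R}"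
      have Lin: "k \<oplus> r \<otimes> y \<in> ?L" if "k \<in> K" "r \<in> carrier R" for k r using that by blast
      have "submodule ?L R ?M"
      proof (rule M.submoduleI)
        show "?L \<subseteq> carrier ?M" using kd(1) yc by auto
        have "\<zero> \<oplus> \<zero> \<otimes> y = \<zero>" using yc by simp
        then show "\<zero>\<^bsub>?M\<^esub> \<in> ?L" using Lin[OF kd(2) zero_closed] by (metis (no_types, lifting) regular_module_simps(2))
        fix u v assume "u \<in> ?L" "v \<in> ?L"
        then obtain k r k' r' where u: "u = k \<oplus> r \<otimes> y" "v = k' \<oplus> r' \<otimes> y" "k \<in> K" "k' \<in> K"
          "r \<in> carrier R" "r' \<in> carrier R" by blast
        then have "u \<oplus> v = (k \<oplus> k') \<oplus> (r \<oplus> r') \<otimes> y"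
          using kd(1) yc by (auto simp: l_distr a_ac subset_iff)
        moreover have "(k \<oplus> k') \<oplus> (r \<oplus> r') \<otimes> y \<in> ?L" using u kd(3) by (intro Lin) auto
        ultimately show "u \<oplus>\<^bsub>?M\<^esub> v \<in> ?L" by (simp only: regular_module_simps)
      next
        fix a u assume a: "a \<in> carrier R" "u \<in> ?L"
        then obtain k r where u: "u = k \<oplus> r \<otimes> y" "k \<in> K" "r \<in> carrier R" by blast
        then have "a \<otimes> u = (a \<otimes> k) \<oplus> (a \<otimes> r) \<otimes> y"
          using kd(1) yc a by (auto simp: r_distr m_assoc subset_iff)
        moreover have "(a \<otimes> k) \<oplus> (a \<otimes> r) \<otimes> y \<in> ?L" using u a kd(4) by (intro Lin) auto
        ultimately show "a \<odot>\<^bsub>?M\<^esub> u \<in> ?L" by (simp only: regular_module_simps)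
      qed
      moreover have "?L \<subseteq> I" using K(2) y sd by blast
      moreover have "K \<subseteq> ?L"
      proof
        fix k assume "k \<in> K"
        moreover from this have "k \<oplus> \<zero> \<otimes> y = k" using kd(1) yc by auto
        ultimately show "k \<in> ?L" using Lin[of k \<zero>] by (metis (no_types, lifting) zero_closed)
      qed
      moreover have "y \<in> ?L"
      proof -
        have "\<zero> \<oplus> \<one> \<otimes> y = y" using yc by simp
        then show ?thesis using Lin[OF kd(2) one_closed] by (metis (no_types, lifting))
      qed
      ultimately have "x \<in> ?L" using max[of ?L] False by blast
      then obtain k r where kr: "x = k \<oplus> r \<otimes> y" "k \<in> K" "r \<in> carrier R" by blast
      have kc: "k \<in> carrier R" using kr kd(1) by auto
      have "r \<otimes> y \<noteq> \<zero>" using kr K(3) kc by auto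
      then have "\<not> (\<forall>z\<in>I. r \<otimes> z = \<zero>)" using y by blast
      then obtain s where s: "s \<in> carrier R" "\<And>z. z \<in> I \<Longrightarrow> z = s \<otimes> (r \<otimes> z)"
        using alt[OF kr(3)] inv[OF kr(3)] by blast
      have "r \<otimes> y = x \<ominus> k" using kr kc yc by (simp add: minus_eq a_ac r_neg1 r_neg2)
      moreover have "\<ominus> k \<in> N" "x \<in> N"
        using KN kr kc nd(4)[of "\<ominus> \<one>" k] N by (auto simp: l_minus)
      ultimately have "r \<otimes> y \<in> N" using nd(3) by (simp add: minus_eq)
      then show ?thesis using s(2)[OF y] nd(4)[OF s(1)] by metis
    qed (use KN in auto)
  qed (use S K x in auto)
  with I(2) show False by blast
qed

text \<open>A scalar acts as multiplication by its multiple of the identity of \<open>A\<close>,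
  from the left as well as from the right. So both one-sided chain conditions come from finite
  generation over the noetherian ring \<open>R\<close>.\<close>

lemma artin_algebra_left_noetherian:
  assumes "artin_algebra R A"
  shows "left_noetherian A" "left_noetherian (op_ring A)"
proof -
  interpret A: ring A using assms by (simp add: artin_algebra_def)
  interpret M: module R A using assms by (simp add: artin_algebra_def)
  have N: "left_noetherian R" using assms by (intro M.R.artinian_noetherian) (simp add: artin_algebra_def)
  have lm: "left_module R A"
    by (rule left_moduleI)
      (auto simp: M.smult_l_distr M.smult_r_distr M.smult_assoc1 M.R.ring_axioms A.a_ac intro: A.l_neg)
  have fg: "fin_gen R A" using assms by (simp add: artin_algebra_def)
  have comp: "r \<odot>\<^bsub>A\<^esub> (x \<otimes>\<^bsub>A\<^esub> y) = (r \<odot>\<^bsub>A\<^esub> x) \<otimes>\<^bsub>A\<^esub> y"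
    "r \<odot>\<^bsub>A\<^esub> (x \<otimes>\<^bsub>A\<^esub> y) = x \<otimes>\<^bsub>A\<^esub> (r \<odot>\<^bsub>A\<^esub> y)"
    if "r \<in> carrier R" "x \<in> carrier A" "y \<in> carrier A" for r x y
  proof -
    have "\<forall>r\<in>carrier R. \<forall>x\<in>carrier A. \<forall>y\<in>carrier A.
        r \<odot>\<^bsub>A\<^esub> (x \<otimes>\<^bsub>A\<^esub> y) = (r \<odot>\<^bsub>A\<^esub> x) \<otimes>\<^bsub>A\<^esub> y \<and>
        r \<odot>\<^bsub>A\<^esub> (x \<otimes>\<^bsub>A\<^esub> y) = x \<otimes>\<^bsub>A\<^esub> (r \<odot>\<^bsub>A\<^esub> y)"
      using assms unfolding artin_algebra_def by (elim conjE)
    from this[rule_format, OF that] show "r \<odot>\<^bsub>A\<^esub> (x \<otimes>\<^bsub>A\<^esub> y) = (r \<odot>\<^bsub>A\<^esub> x) \<otimes>\<^bsub>A\<^esub> y"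
      "r \<odot>\<^bsub>A\<^esub> (x \<otimes>\<^bsub>A\<^esub> y) = x \<otimes>\<^bsub>A\<^esub> (r \<odot>\<^bsub>A\<^esub> y)" by (rule conjunct1, rule conjunct2)
  qed
  show "left_noetherian A"
  proof (rule left_noetherian_finite_extension[OF N A.ring_axioms lm fg])
    fix c x assume "c \<in> carrier R" "x \<in> carrier A"
    then show "\<exists>b\<in>carrier A. c \<odot>\<^bsub>A\<^esub> x = b \<otimes>\<^bsub>A\<^esub> x"
      using comp(1)[of c "\<one>\<^bsub>A\<^esub>" x] by (intro bexI[of _ "c \<odot>\<^bsub>A\<^esub> \<one>\<^bsub>A\<^esub>"]) auto
  qed simp_all
  show "left_noetherian (op_ring A)"
  proof (rule left_noetherian_finite_extension[OF N ring_op_ring[OF A.ring_axioms] lm fg])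
    fix c x assume "c \<in> carrier R" "x \<in> carrier (op_ring A)"
    then show "\<exists>b\<in>carrier (op_ring A). c \<odot>\<^bsub>A\<^esub> x = b \<otimes>\<^bsub>op_ring A\<^esub> x"
      using comp(2)[of c x "\<one>\<^bsub>A\<^esub>"] by (intro bexI[of _ "c \<odot>\<^bsub>A\<^esub> \<one>\<^bsub>A\<^esub>"]) auto
  qed (simp_all add: op_ring_def)
qed

section \<open>Projective modules and comparison of resolutions\<close>

text \<open>A summand of a finite free module can be lifted against modules of every type, whereas
  \<open>fg_projective\<close> quantifies over test modules with carriers in
  \<open>nat \<Rightarrow> 'b\<close>.\<close>

definition summand :: "('b, 'k) ring_scheme \<Rightarrow> ('b, 'm) module \<Rightarrow> bool" where
  "summand B P \<longleftrightarrow> left_module B P \<and>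
     (\<exists>n::nat. \<exists>\<iota>\<in>module_hom B P (free B {..<n}). \<exists>\<pi>\<in>module_hom B (free B {..<n}) P.
        \<forall>x\<in>carrier P. \<pi> (\<iota> x) = x)"

lemma (in left_module) hom_free_ext:
  assumes "finite I" "f \<in> module_hom R (free R I) M" "g \<in> module_hom R (free R I) M"
    and "\<And>s. s \<in> I \<Longrightarrow> f (unit_vec R s) = g (unit_vec R s)" "x \<in> vecs R I"
  shows "f x = g x"
proof -
  have "lin M I (\<lambda>s. f (unit_vec R s)) x = lin M I (\<lambda>s. g (unit_vec R s)) x"
    unfolding lin_def
  proof (rule M.finsum_cong')
    show "(\<lambda>s. x s \<odot>\<^bsub>M\<^esub> g (unit_vec R s)) \<in> I \<rightarrow> carrier M"
      using R.vecsD[OF assms(5)] module_homD(1)[OF assms(3)] R.unit_vec_closed[of _ I]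
      by (intro funcsetI smult_closed) simp_all
  qed (use assms(4) in auto)
  then show ?thesis
    using hom_free_eq_lin[OF assms(1,2,5)] hom_free_eq_lin[OF assms(1,3,5)] by simp
qed

lemma free_lift:
  assumes "finite I" "left_module B M" "left_module B N"
    and f: "f \<in> module_hom B (free B I) N" and g: "g \<in> module_hom B M N"
    and im: "\<And>s. s \<in> I \<Longrightarrow> f (unit_vec B s) \<in> g ` carrier M"
  obtains h where "h \<in> module_hom B (free B I) M" "\<And>x. x \<in> vecs B I \<Longrightarrow> g (h x) = f x"
proof -
  interpret M: left_module B M by fact
  interpret N: left_module B N by fact
  define m where "m = (\<lambda>s. inv_into (carrier M) g (f (unit_vec B s)))"
  have m: "\<And>s. s \<in> I \<Longrightarrow> m s \<in> carrier M" "\<And>s. s \<in> I \<Longrightarrow> g (m s) = f (unit_vec B s)"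
    using im by (simp_all add: m_def inv_into_into f_inv_into_f)
  then have h: "lin M I m \<in> module_hom B (free B I) M" by (intro M.lin_hom) auto
  show ?thesis
  proof (rule that[OF h])
    fix x assume x: "x \<in> vecs B I"
    have mI: "m \<in> I \<rightarrow> carrier M" using m(1) by auto
    show "g (lin M I m x) = f x"
    proof (rule N.hom_free_ext[OF assms(1) module_hom_comp[OF h g] f _ x])
      fix s assume "s \<in> I"
      then show "g (lin M I m (unit_vec B s)) = f (unit_vec B s)"
        using M.lin_unit_vec[OF assms(1) mI] m(2) by simp
    qed
  qed
qed

text \<open>Asking for a containment of images allows exactness to be fed in directly: a map into
  the kernel of a differential is lifted along the preceding differential.\<close>

lemma summand_lift:
  assumes P: "summand B P" and MN: "left_module B M" "left_module B N"
    and f: "f \<in> module_hom B P N" and g: "g \<in> module_hom B M N"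
    and im: "\<And>x. x \<in> carrier P \<Longrightarrow> f x \<in> g ` carrier M"
  obtains h where "h \<in> module_hom B P M" "\<And>x. x \<in> carrier P \<Longrightarrow> g (h x) = f x"
proof -
  obtain n :: nat and i p where ip: "i \<in> module_hom B P (free B {..<n})"
    "p \<in> module_hom B (free B {..<n}) P" "\<And>x. x \<in> carrier P \<Longrightarrow> p (i x) = x"
    using P unfolding summand_def by blast
  interpret M: left_module B M by fact
  obtain h where h: "h \<in> module_hom B (free B {..<n}) M"
    "\<And>x. x \<in> vecs B {..<n} \<Longrightarrow> g (h x) = f (p x)"
    by (rule free_lift[OF _ MN module_hom_comp[OF ip(2) f] g, of thesis])
      (use im module_homD(1)[OF ip(2)] M.R.unit_vec_closed[of _ "{..<n}"] in auto)
  show ?thesis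
    using that[OF module_hom_comp[OF ip(1) h(1)]] h(2) ip(3) module_homD(1)[OF ip(1)] by simp
qed

text \<open>\<open>I\<close> is renumbered by \<open>{..<card I}\<close>: \<open>summand\<close>
  speaks of natural indices, but the complexes obtained by unfolding triangular matrices are indexed
  by pairs.\<close>

lemma (in ring) summand_free:
  assumes "finite I" shows "summand R (free R I)"
proof -
  obtain b where b: "bij_betw b {..<card I} I"
    using ex_bij_betw_nat_finite[OF assms] by (auto simp: lessThan_atLeast0)
  let ?c = "inv_into {..<card I} b"
  have c: "s \<in> I \<Longrightarrow> ?c s < card I" "s \<in> I \<Longrightarrow> b (?c s) = s" for s
    using bij_betw_inv_into[OF b] b by (auto simp: bij_betw_def f_inv_into_f)
  let ?i = "\<lambda>x k. if k < card I then x (b k) else \<zero>"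
  let ?p = "\<lambda>y s. if s \<in> I then y (?c s) else \<zero>"
  have "?i \<in> module_hom R (free R I) (free R {..<card I})"
    by (rule module_homI) (use bij_betwE[OF b] in \<open>auto simp: vecs_def fun_eq_iff\<close>)
  moreover have "?p \<in> module_hom R (free R {..<card I}) (free R I)"
    using c by (intro module_homI) (auto simp: vecs_def fun_eq_iff)
  moreover have "\<forall>x\<in>carrier (free R I). ?p (?i x) = x"
    using c by (auto simp: vecs_def fun_eq_iff)
  ultimately show ?thesis unfolding summand_def by (intro conjI exI bexI left_module_free)
qed

lemma fg_mod_surj:
  assumes "M \<in> fg_mod B"
  obtains n :: nat and p where "p \<in> module_hom B (free B {..<n}) M" "p ` vecs B {..<n} = carrier M"
proof -
  interpret left_module B M using assms by (simp add: fg_mod_def)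
  have "fg_sub B M (carrier M)" using assms by (simp add: fg_mod_def fin_gen_iff_fg_sub)
  then obtain n :: nat and g where g: "g \<in> {..<n} \<rightarrow> carrier M" "lin M {..<n} g ` vecs B {..<n} = carrier M"
    by (rule fg_sub_generators[OF submodule_carrier]) blast
  then show ?thesis using that lin_hom by blast
qed

text \<open>Lift the identity of \<open>P\<close> along a free cover. The definition applies to this
  lifting problem because both \<open>P\<close> and the free module live in the type of the test
  modules.\<close>

lemma fg_projective_summand:
  fixes P :: "'b umodule"
  assumes "fg_projective B P" shows "summand B P"
proof -
  have P: "P \<in> fg_mod B" using assms by (simp add: fg_projective_def)
  then interpret left_module B P by (simp add: fg_mod_def)
  obtain n :: nat and p where p: "p \<in> module_hom B (free B {..<n}) P" "p ` vecs B {..<n} = carrier P"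
    by (rule fg_mod_surj[OF P]) blast
  have id: "(\<lambda>x. x) \<in> module_hom B P P" by (rule module_homI) auto
  obtain i where "i \<in> module_hom B P (free B {..<n})" "\<forall>x\<in>carrier P. p (i x) = x"
    using conjunct2[OF assms[unfolded fg_projective_def], rule_format,
        OF R.free_fg_mod[of "{..<n}"] P p(1) id] p(2) by auto
  then show ?thesis using p(1) left_module_axioms unfolding summand_def by blast
qed

lemma (in ring) free_fg_projective:
  fixes I :: "nat set"
  assumes "finite I" shows "fg_projective R (free R I)"
  unfolding fg_projective_def
proof (intro conjI ballI impI free_fg_mod[OF assms])
  fix M N :: "'a umodule" and g f
  assume a: "M \<in> fg_mod R" "N \<in> fg_mod R" "g \<in> module_hom R M N" "f \<in> module_hom R (free R I) N"
    "g ` carrier M = carrier N"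
  obtain h where "h \<in> module_hom R (free R I) M" "\<And>x. x \<in> carrier (free R I) \<Longrightarrow> g (h x) = f x"
    by (rule summand_lift[OF summand_free[OF assms], where f=f and g=g and M=M and N=N])
      (use a module_homD(1)[OF a(4)] in \<open>auto simp: fg_mod_def\<close>)
  then show "\<exists>h\<in>module_hom R (free R I) M. \<forall>x\<in>carrier (free R I). g (h x) = f x" by blast
qed

lemma module_hom_inv_into:
  assumes "left_module B M" "f \<in> module_hom B M N" "bij_betw f (carrier M) (carrier N)"
  shows "inv_into (carrier M) f \<in> module_hom B N M"
proof -
  interpret left_module B M by fact
  let ?g = "inv_into (carrier M) f"
  have g: "\<And>y. y \<in> carrier N \<Longrightarrow> ?g y \<in> carrier M" "\<And>y. y \<in> carrier N \<Longrightarrow> f (?g y) = y"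
    "\<And>x. x \<in> carrier M \<Longrightarrow> ?g (f x) = x"
    using assms(3) by (auto simp: bij_betw_def f_inv_into_f inv_into_into)
  show ?thesis
  proof (rule module_homI)
    fix x y assume xy: "x \<in> carrier N" "y \<in> carrier N"
    have "f (?g x \<oplus>\<^bsub>M\<^esub> ?g y) = x \<oplus>\<^bsub>N\<^esub> y"
      using xy g module_homD(2)[OF assms(2), of "?g x" "?g y"] by simp
    then show "?g (x \<oplus>\<^bsub>N\<^esub> y) = ?g x \<oplus>\<^bsub>M\<^esub> ?g y" using g(3)[of "?g x \<oplus>\<^bsub>M\<^esub> ?g y"] g(1) xy by simp
  next
    fix b x assume bx: "b \<in> carrier B" "x \<in> carrier N"
    have "f (b \<odot>\<^bsub>M\<^esub> ?g x) = b \<odot>\<^bsub>N\<^esub> x"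
      using bx g module_homD(3)[OF assms(2), of b "?g x"] by simp
    then show "?g (b \<odot>\<^bsub>N\<^esub> x) = b \<odot>\<^bsub>M\<^esub> ?g x"
      using g(3)[of "b \<odot>\<^bsub>M\<^esub> ?g x"] g(1) bx smult_closed by simp
  qed (rule g)
qed

text \<open>The carrier consists of chosen preimages in a free cover \<open>p\<close>, and the
  operations are transported along the section \<open>\<sigma>\<close>.\<close>

lemma fg_mod_umodule_copy:
  assumes "M \<in> fg_mod B"
  obtains U :: "'b umodule" and f where "U \<in> fg_mod B" "f \<in> module_hom B M U"
    "bij_betw f (carrier M) (carrier U)"
proof -
  interpret left_module B M using assms by (simp add: fg_mod_def)
  obtain n :: nat and p where p: "p \<in> module_hom B (free B {..<n}) M" "p ` vecs B {..<n} = carrier M"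
    by (rule fg_mod_surj[OF assms]) blast
  define \<sigma> where "\<sigma> = inv_into (vecs B {..<n}) p"
  have s: "p (\<sigma> x) = x" if "x \<in> carrier M" for x using that p(2) by (simp add: \<sigma>_def f_inv_into_f)
  define U :: "'b umodule" where
    "U = \<lparr>carrier = \<sigma> ` carrier M, mult = undefined, one = undefined, zero = \<sigma> \<zero>\<^bsub>M\<^esub>,
      add = (\<lambda>u v. \<sigma> (p u \<oplus>\<^bsub>M\<^esub> p v)), smult = (\<lambda>a u. \<sigma> (a \<odot>\<^bsub>M\<^esub> p u))\<rparr>"
  have U: "carrier U = \<sigma> ` carrier M" "\<zero>\<^bsub>U\<^esub> = \<sigma> \<zero>\<^bsub>M\<^esub>"
    "\<And>u v. u \<oplus>\<^bsub>U\<^esub> v = \<sigma> (p u \<oplus>\<^bsub>M\<^esub> p v)" "\<And>a u. a \<odot>\<^bsub>U\<^esub> u = \<sigma> (a \<odot>\<^bsub>M\<^esub> p u)"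
    by (simp_all add: U_def)
  have lU: "left_module B U"
  proof (rule left_moduleI)
    fix u assume "u \<in> carrier U"
    then obtain x where "x \<in> carrier M" "u = \<sigma> x" by (auto simp: U)
    then show "\<exists>v\<in>carrier U. v \<oplus>\<^bsub>U\<^esub> u = \<zero>\<^bsub>U\<^esub>"
      by (intro bexI[of _ "\<sigma> (\<ominus>\<^bsub>M\<^esub> x)"]) (auto simp: U s M.l_neg)
  qed (auto simp: U s R.ring_axioms M.a_ac smult_closed smult_l_distr smult_r_distr smult_assoc1 smult_one)
  have sh: "\<sigma> \<in> module_hom B M U" by (rule module_homI) (auto simp: U s)
  have "fin_gen B U"
    using module_homs.fg_mod_image[OF module_homsI[OF left_module_axioms lU sh]] assms
    by (simp add: U fg_mod_def)
  moreover have "bij_betw \<sigma> (carrier M) (carrier U)"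
    unfolding bij_betw_def U by (auto intro: inj_on_inverseI[of _ p] s)
  ultimately show ?thesis using that lU sh by (auto simp: fg_mod_def)
qed

text \<open>Injectivity is defined by test modules of one fixed type; \<open>M\<close> and
  \<open>N\<close> are replaced by isomorphic copies in that type.\<close>

lemma fg_injective_extend:
  assumes "fg_injective B I" "M \<in> fg_mod B" "N \<in> fg_mod B"
    and g: "g \<in> module_hom B M N" "inj_on g (carrier M)" and f: "f \<in> module_hom B M I"
  obtains h where "h \<in> module_hom B N I" "\<And>x. x \<in> carrier M \<Longrightarrow> h (g x) = f x"
proof -
  interpret M: left_module B M using assms(2) by (simp add: fg_mod_def)
  interpret N: left_module B N using assms(3) by (simp add: fg_mod_def)
  obtain U :: "'a umodule" and a where a: "U \<in> fg_mod B" "a \<in> module_hom B M U"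
    "bij_betw a (carrier M) (carrier U)" by (rule fg_mod_umodule_copy[OF assms(2)]) blast
  obtain V :: "'a umodule" and b where b: "V \<in> fg_mod B" "b \<in> module_hom B N V"
    "bij_betw b (carrier N) (carrier V)" by (rule fg_mod_umodule_copy[OF assms(3)]) blast
  let ?a' = "inv_into (carrier M) a"
  have a': "?a' \<in> module_hom B U M" "bij_betw ?a' (carrier U) (carrier M)"
    using module_hom_inv_into[OF M.left_module_axioms a(2,3)] bij_betw_inv_into[OF a(3)] by auto
  have aa: "x \<in> carrier M \<Longrightarrow> ?a' (a x) = x" for x using a(3) by (simp add: bij_betw_def)
  have "(\<lambda>u. b (g (?a' u))) \<in> module_hom B U V"
    by (rule module_hom_comp[OF module_hom_comp[OF a'(1) g(1)] b(2)])
  moreover have "(\<lambda>u. f (?a' u)) \<in> module_hom B U I" by (rule module_hom_comp[OF a'(1) f])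
  moreover have "inj_on (\<lambda>u. b (g (?a' u))) (carrier U)"
  proof -
    have "inj_on (b \<circ> (g \<circ> ?a')) (carrier U)"
      using a'(2) g(2) b(3) module_homD(1)[OF g(1)]
      by (intro comp_inj_on) (auto simp: bij_betw_def intro: inj_on_subset)
    then show ?thesis by (simp add: o_def)
  qed
  ultimately obtain h where h: "h \<in> module_hom B V I" "\<And>u. u \<in> carrier U \<Longrightarrow> h (b (g (?a' u))) = f (?a' u)"
    using conjunct2[OF assms(1)[unfolded fg_injective_def], rule_format, OF a(1) b(1)] by blast
  show ?thesis
  proof (rule that[OF module_hom_comp[OF b(2) h(1)]])
    fix x assume "x \<in> carrier M"
    then show "h (b (g x)) = f x" using h(2)[of "a x"] aa module_homD(1)[OF a(2)] by simp
  qed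
qed

section \<open>Projective resolutions and their comparison\<close>

definition proj_res ::
  "('b, 'k) ring_scheme \<Rightarrow> ('b, 'm) module \<Rightarrow> (nat \<Rightarrow> ('b, 'p) module) \<Rightarrow>
     (nat \<Rightarrow> 'p \<Rightarrow> 'p) \<Rightarrow> ('p \<Rightarrow> 'm) \<Rightarrow> bool" where
  "proj_res B X P d e \<longleftrightarrow> left_module B X \<and>
     (\<forall>k. summand B (P k)) \<and>
     (\<forall>k. d k \<in> module_hom B (P (Suc k)) (P k)) \<and>
     e \<in> module_hom B (P 0) X \<and>
     e ` carrier (P 0) = carrier X \<and>
     (\<forall>x\<in>carrier (P 0). e x = \<zero>\<^bsub>X\<^esub> \<longleftrightarrow> x \<in> d 0 ` carrier (P 1)) \<and>
     (\<forall>k. \<forall>x\<in>carrier (P (Suc k)). d k x = \<zero>\<^bsub>P k\<^esub> \<longleftrightarrow> x \<in> d (Suc k) ` carrier (P (Suc (Suc k))))"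

lemma projective_resolution_proj_res:
  assumes "projective_resolution B X P d e" "left_module B X" shows "proj_res B X P d e"
proof -
  from assms(1)[unfolded projective_resolution_def a_kernel_def']
  have P: "\<forall>k. fg_projective B (P k)" and d: "\<forall>k. d k \<in> module_hom B (P (Suc k)) (P k)"
    and e: "e \<in> module_hom B (P 0) X" "e ` carrier (P 0) = carrier X"
    and ex0: "d 0 ` carrier (P 1) = {x \<in> carrier (P 0). e x = \<zero>\<^bsub>X\<^esub>}"
    and ex: "\<forall>k. d (Suc k) ` carrier (P (Suc (Suc k))) = {x \<in> carrier (P (Suc k)). d k x = \<zero>\<^bsub>P k\<^esub>}"
    by - (elim conjE, assumption)+
  show ?thesis unfolding proj_res_def
    using fg_projective_summand[OF P[rule_format]] assms(2) d e
    by (intro conjI allI ballI) (simp_all only: ex0 ex mem_Collect_eq simp_thms)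
qed

text \<open>This is the vanishing of the cohomology of Hom(\<open>P\<close>, \<open>Y\<close>) in
  degree \<open>Suc k\<close>, written without quotient groups; for a resolution it is the vanishing
  of Ext in that degree.\<close>

definition hom_exact ::
  "('b, 'k) ring_scheme \<Rightarrow> (nat \<Rightarrow> ('b, 'p) module) \<Rightarrow> (nat \<Rightarrow> 'p \<Rightarrow> 'p) \<Rightarrow> ('b, 'n) module \<Rightarrow> nat \<Rightarrow> bool" where
  "hom_exact B P d Y k \<longleftrightarrow>
     (\<forall>f\<in>module_hom B (P (Suc k)) Y. (\<forall>x\<in>carrier (P (Suc (Suc k))). f (d (Suc k) x) = \<zero>\<^bsub>Y\<^esub>) \<longrightarrow>
        (\<exists>g\<in>module_hom B (P k) Y. \<forall>x\<in>carrier (P (Suc k)). f x = g (d k x)))"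

text \<open>
  The chain maps \<open>u : P \<rightarrow> P'\<close>, \<open>v : P' \<rightarrow> P\<close> and the homotopy \<open>s\<close> from the identity to \<open>v u\<close> are built
  in one recursion, whose invariant only involves the current degree.
\<close>

lemma hom_exact_mono:
  fixes P :: "nat \<Rightarrow> ('b, 'p) module" and P' :: "nat \<Rightarrow> ('b, 'q) module"
  assumes P: "proj_res B X P d e" and P': "proj_res B X P' d' e'"
    and Y: "left_module B Y" and ex: "hom_exact B P' d' Y k"
  shows "hom_exact B P d Y k"
proof -
  note p = P[unfolded proj_res_def] and p' = P'[unfolded proj_res_def]
  have X: "left_module B X" and sP: "\<And>k. summand B (P k)" and dh: "\<And>k. d k \<in> module_hom B (P (Suc k)) (P k)"
    and eh: "e \<in> module_hom B (P 0) X" and esurj: "e ` carrier (P 0) = carrier X"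
    and e0: "\<And>x. x \<in> carrier (P 0) \<Longrightarrow> e x = \<zero>\<^bsub>X\<^esub> \<longleftrightarrow> x \<in> d 0 ` carrier (P (Suc 0))"
    and d0: "\<And>k x. x \<in> carrier (P (Suc k)) \<Longrightarrow> d k x = \<zero>\<^bsub>P k\<^esub> \<longleftrightarrow> x \<in> d (Suc k) ` carrier (P (Suc (Suc k)))"
    using p by simp_all
  have sP': "\<And>k. summand B (P' k)" and dh': "\<And>k. d' k \<in> module_hom B (P' (Suc k)) (P' k)"
    and eh': "e' \<in> module_hom B (P' 0) X" and esurj': "e' ` carrier (P' 0) = carrier X"
    and e0': "\<And>x. x \<in> carrier (P' 0) \<Longrightarrow> e' x = \<zero>\<^bsub>X\<^esub> \<longleftrightarrow> x \<in> d' 0 ` carrier (P' (Suc 0))"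
    and d0': "\<And>k x. x \<in> carrier (P' (Suc k)) \<Longrightarrow> d' k x = \<zero>\<^bsub>P' k\<^esub> \<longleftrightarrow> x \<in> d' (Suc k) ` carrier (P' (Suc (Suc k)))"
    using p' by simp_all
  have lP: "left_module B (P k)" and lP': "left_module B (P' k)" for k
    using sP sP' by (auto simp: summand_def)
  note c = module_homD(1)[OF dh] module_homD(1)[OF dh'] module_homD(1)[OF eh] module_homD(1)[OF eh']
  have dd: "d k (d (Suc k) x) = \<zero>\<^bsub>P k\<^esub>" if "x \<in> carrier (P (Suc (Suc k)))" for k x
    using d0[of "d (Suc k) x" k] c that by blast
  have dd': "d' k (d' (Suc k) x) = \<zero>\<^bsub>P' k\<^esub>" if "x \<in> carrier (P' (Suc (Suc k)))" for k x
    using d0'[of "d' (Suc k) x" k] c that by blast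
  have ed: "e (d 0 x) = \<zero>\<^bsub>X\<^esub>" if "x \<in> carrier (P (Suc 0))" for x
    using e0[of "d 0 x"] c that by blast
  have ed': "e' (d' 0 x) = \<zero>\<^bsub>X\<^esub>" if "x \<in> carrier (P' (Suc 0))" for x
    using e0'[of "d' 0 x"] c that by blast
  have idh: "(\<lambda>x. x) \<in> module_hom B (P k) (P k)" for k by (rule module_homI) auto
  \<comment> \<open>The last clause is the homotopy relation restricted to boundaries, where the
    contribution of the lower homotopy drops out. In this form it mentions degree \<open>k\<close>
    only, and it makes sense at the start, where there is no lower homotopy.\<close>
  define Inv where "Inv = (\<lambda>k (u, v, s).
     u \<in> module_hom B (P k) (P' k) \<and> v \<in> module_hom B (P' k) (P k) \<and> s \<in> module_hom B (P k) (P (Suc k)) \<and>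
     (\<forall>x\<in>carrier (P (Suc k)). u (d k x) \<in> d' k ` carrier (P' (Suc k))) \<and>
     (\<forall>x\<in>carrier (P' (Suc k)). v (d' k x) \<in> d k ` carrier (P (Suc k))) \<and>
     (\<forall>x\<in>carrier (P (Suc k)). v (u (d k x)) \<ominus>\<^bsub>P k\<^esub> d k x = d k (s (d k x))))"
  define St where "St = (\<lambda>k (u, v, s) (u', v', s').
     (\<forall>x\<in>carrier (P (Suc k)). d' k (u' x) = u (d k x)) \<and>
     (\<forall>x\<in>carrier (P' (Suc k)). d k (v' x) = v (d' k x)) \<and>
     (\<forall>x\<in>carrier (P (Suc k)). v' (u' x) \<ominus>\<^bsub>P (Suc k)\<^esub> x = d (Suc k) (s' x) \<oplus>\<^bsub>P (Suc k)\<^esub> s (d k x)))"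
  have "\<exists>w. \<forall>k. Inv k (w k) \<and> St k (w k) (w (Suc k))"
  proof (rule dependent_nat_choice)
    interpret P0: left_module B "P 0" by (rule lP)
    interpret E: module_homs B "P 0" X e by (intro module_homsI lP X eh)
    obtain u where u: "u \<in> module_hom B (P 0) (P' 0)" "\<And>x. x \<in> carrier (P 0) \<Longrightarrow> e' (u x) = e x"
      by (rule summand_lift[OF sP lP' X eh eh']) (use c esurj' in auto)
    obtain v where v: "v \<in> module_hom B (P' 0) (P 0)" "\<And>x. x \<in> carrier (P' 0) \<Longrightarrow> e (v x) = e' x"
      by (rule summand_lift[OF sP' lP X eh' eh]) (use c esurj in auto)
    note uc = module_homD(1)[OF u(1)] and vc = module_homD(1)[OF v(1)]
    have fh: "(\<lambda>x. v (u x) \<ominus>\<^bsub>P 0\<^esub> x) \<in> module_hom B (P 0) (P 0)"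
      by (intro module_hom_minus lP idh module_hom_comp[OF u(1) v(1)])
    obtain s where s: "s \<in> module_hom B (P 0) (P (Suc 0))"
      "\<And>x. x \<in> carrier (P 0) \<Longrightarrow> d 0 (s x) = v (u x) \<ominus>\<^bsub>P 0\<^esub> x"
    proof (rule summand_lift[OF sP lP lP fh dh])
      fix x assume x: "x \<in> carrier (P 0)"
      have "e (v (u x) \<ominus>\<^bsub>P 0\<^esub> x) = \<zero>\<^bsub>X\<^esub>"
        using x uc vc u v by (simp add: E.hom_minus E.N.M.minus_self E.closed)
      then show "v (u x) \<ominus>\<^bsub>P 0\<^esub> x \<in> d 0 ` carrier (P (Suc 0))"
        using e0 x uc vc P0.M.minus_closed by blast
    qed blast
    have "Inv 0 (u, v, s)"
      unfolding Inv_def prod.case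
    proof (intro conjI ballI)
      fix x assume x: "x \<in> carrier (P (Suc 0))"
      then have dx: "d 0 x \<in> carrier (P 0)" by (rule c)
      show "u (d 0 x) \<in> d' 0 ` carrier (P' (Suc 0))"
        using e0'[OF uc[OF dx]] u(2)[OF dx] ed[OF x] by simp
      show "v (u (d 0 x)) \<ominus>\<^bsub>P 0\<^esub> d 0 x = d 0 (s (d 0 x))" using s(2)[OF dx] by simp
    next
      fix x assume x: "x \<in> carrier (P' (Suc 0))"
      then have dx: "d' 0 x \<in> carrier (P' 0)" by (rule c)
      show "v (d' 0 x) \<in> d 0 ` carrier (P (Suc 0))"
        using e0[OF vc[OF dx]] v(2)[OF dx] ed'[OF x] by simp
    qed (use u v s in auto)
    then show "\<exists>w. Inv 0 w" by blast
  next
    fix w k assume "Inv k w"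
    then obtain u v s where w: "w = (u, v, s)" and I: "Inv k (u, v, s)" by (cases w) auto
    have u: "u \<in> module_hom B (P k) (P' k)" and v: "v \<in> module_hom B (P' k) (P k)"
      and s: "s \<in> module_hom B (P k) (P (Suc k))"
      and Ia: "\<And>x. x \<in> carrier (P (Suc k)) \<Longrightarrow> u (d k x) \<in> d' k ` carrier (P' (Suc k))"
      and Ib: "\<And>x. x \<in> carrier (P' (Suc k)) \<Longrightarrow> v (d' k x) \<in> d k ` carrier (P (Suc k))"
      and Ic: "\<And>x. x \<in> carrier (P (Suc k)) \<Longrightarrow> v (u (d k x)) \<ominus>\<^bsub>P k\<^esub> d k x = d k (s (d k x))"
      using I by (simp_all add: Inv_def)
    note uc = module_homD(1)[OF u] and vc = module_homD(1)[OF v] and sc = module_homD(1)[OF s]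
    interpret Pk: left_module B "P k" by (rule lP)
    interpret PS: left_module B "P (Suc k)" by (rule lP)
    interpret PSS: left_module B "P (Suc (Suc k))" by (rule lP)
    interpret D: module_homs B "P (Suc k)" "P k" "d k" by (intro module_homsI lP dh)
    interpret U: module_homs B "P k" "P' k" u by (intro module_homsI lP lP' u)
    interpret V: module_homs B "P' k" "P k" v by (intro module_homsI lP lP' v)
    interpret S: module_homs B "P k" "P (Suc k)" s by (intro module_homsI lP s)
    obtain u' where u': "u' \<in> module_hom B (P (Suc k)) (P' (Suc k))"
      "\<And>x. x \<in> carrier (P (Suc k)) \<Longrightarrow> d' k (u' x) = u (d k x)"
      by (rule summand_lift[OF sP lP' lP' module_hom_comp[OF dh u] dh'])
        (use Ia in auto)
    obtain v' where v': "v' \<in> module_hom B (P' (Suc k)) (P (Suc k))"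
      "\<And>x. x \<in> carrier (P' (Suc k)) \<Longrightarrow> d k (v' x) = v (d' k x)"
      by (rule summand_lift[OF sP' lP lP module_hom_comp[OF dh' v] dh])
        (use Ib in auto)
    note uc' = module_homD(1)[OF u'(1)] and vc' = module_homD(1)[OF v'(1)]
    \<comment> \<open>This is the part of the homotopy relation that must become a boundary. By the
      last clause of \<open>Inv\<close> it consists of cycles, so it lifts along
      \<open>d (Suc k)\<close>.\<close>
    let ?f = "\<lambda>x. (v' (u' x) \<ominus>\<^bsub>P (Suc k)\<^esub> x) \<ominus>\<^bsub>P (Suc k)\<^esub> s (d k x)"
    have fh: "?f \<in> module_hom B (P (Suc k)) (P (Suc k))"
      by (intro module_hom_minus lP idh module_hom_comp[OF u'(1) v'(1)] module_hom_comp[OF dh s])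
    have fc: "x \<in> carrier (P (Suc k)) \<Longrightarrow> ?f x \<in> carrier (P (Suc k))" for x
      by (rule module_homD(1)[OF fh])
    obtain s' where s': "s' \<in> module_hom B (P (Suc k)) (P (Suc (Suc k)))"
      "\<And>x. x \<in> carrier (P (Suc k)) \<Longrightarrow> d (Suc k) (s' x) = ?f x"
    proof (rule summand_lift[OF sP lP lP fh dh])
      fix x assume x: "x \<in> carrier (P (Suc k))"
      have cx: "u' x \<in> carrier (P' (Suc k))" "v' (u' x) \<in> carrier (P (Suc k))" "d k x \<in> carrier (P k)"
        "s (d k x) \<in> carrier (P (Suc k))"
        using x uc' vc' c sc by auto
      have "d k (?f x) = (v (u (d k x)) \<ominus>\<^bsub>P k\<^esub> d k x) \<ominus>\<^bsub>P k\<^esub> d k (s (d k x))"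
        using x cx u'(2) v'(2) by (simp add: D.hom_minus)
      also have "\<dots> = \<zero>\<^bsub>P k\<^esub>" using x cx by (simp add: Ic Pk.M.minus_self D.closed)
      finally show "?f x \<in> d (Suc k) ` carrier (P (Suc (Suc k)))"
        using d0 fc x by blast
    qed blast
    have "Inv (Suc k) (u', v', s')" unfolding Inv_def prod.case
    proof (intro conjI ballI)
      fix x assume x: "x \<in> carrier (P (Suc (Suc k)))"
      then have dx: "d (Suc k) x \<in> carrier (P (Suc k))" using c by auto
      have "d' k (u' (d (Suc k) x)) = \<zero>\<^bsub>P' k\<^esub>" using u'(2)[OF dx] dd[OF x] U.hom_zero by simp
      then show "u' (d (Suc k) x) \<in> d' (Suc k) ` carrier (P' (Suc (Suc k)))"
        using d0' uc' dx by blast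
      have sc': "s' (d (Suc k) x) \<in> carrier (P (Suc (Suc k)))" using module_homD(1)[OF s'(1)] dx by auto
      have "d (Suc k) (s' (d (Suc k) x)) = (v' (u' (d (Suc k) x)) \<ominus>\<^bsub>P (Suc k)\<^esub> d (Suc k) x) \<ominus>\<^bsub>P (Suc k)\<^esub> \<zero>\<^bsub>P (Suc k)\<^esub>"
        using s'(2)[OF dx] dd[OF x] S.hom_zero by simp
      then show "v' (u' (d (Suc k) x)) \<ominus>\<^bsub>P (Suc k)\<^esub> d (Suc k) x = d (Suc k) (s' (d (Suc k) x))"
        using dx uc' vc' by (simp add: PS.M.minus_eq)
    next
      fix x assume x: "x \<in> carrier (P' (Suc (Suc k)))"
      then have dx: "d' (Suc k) x \<in> carrier (P' (Suc k))" using c by auto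
      have "d k (v' (d' (Suc k) x)) = \<zero>\<^bsub>P k\<^esub>" using v'(2)[OF dx] dd'[OF x] V.hom_zero by simp
      then show "v' (d' (Suc k) x) \<in> d (Suc k) ` carrier (P (Suc (Suc k)))"
        using d0 vc' dx by blast
    qed (use u' v' s' in auto)
    moreover have "St k (u, v, s) (u', v', s')" unfolding St_def prod.case
    proof (intro conjI ballI)
      fix x assume x: "x \<in> carrier (P (Suc k))"
      have cx: "v' (u' x) \<in> carrier (P (Suc k))" "s (d k x) \<in> carrier (P (Suc k))"
        using x uc' vc' c sc by auto
      show "v' (u' x) \<ominus>\<^bsub>P (Suc k)\<^esub> x = d (Suc k) (s' x) \<oplus>\<^bsub>P (Suc k)\<^esub> s (d k x)"
        using s'(2)[OF x] x cx by (simp add: PS.M.minus_add_cancel)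
    qed (use u' v' in auto)
    ultimately show "\<exists>w'. Inv (Suc k) w' \<and> St k w w'" unfolding w by blast
  qed
  then obtain w where w: "\<And>k. Inv k (w k)" "\<And>k. St k (w k) (w (Suc k))" by blast
  define u where "u = (\<lambda>k. fst (w k))"
  define v where "v = (\<lambda>k. fst (snd (w k)))"
  define s where "s = (\<lambda>k. snd (snd (w k)))"
  have wk: "w k = (u k, v k, s k)" for k by (simp add: u_def v_def s_def)
  have uh: "u k \<in> module_hom B (P k) (P' k)" and vh: "v k \<in> module_hom B (P' k) (P k)"
    and sh: "s k \<in> module_hom B (P k) (P (Suc k))" for k
    using w(1)[of k] by (simp_all add: Inv_def wk)
  have ud: "\<And>x. x \<in> carrier (P (Suc k)) \<Longrightarrow> d' k (u (Suc k) x) = u k (d k x)"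
    and vd: "\<And>x. x \<in> carrier (P' (Suc k)) \<Longrightarrow> d k (v (Suc k) x) = v k (d' k x)"
    and hd: "\<And>x. x \<in> carrier (P (Suc k)) \<Longrightarrow>
      v (Suc k) (u (Suc k) x) \<ominus>\<^bsub>P (Suc k)\<^esub> x = d (Suc k) (s (Suc k) x) \<oplus>\<^bsub>P (Suc k)\<^esub> s k (d k x)" for k
    using w(2)[of k] by (simp_all add: St_def wk)
  interpret Y: left_module B Y by (rule Y)
  show ?thesis unfolding hom_exact_def
  proof (intro ballI impI)
    fix f assume f: "f \<in> module_hom B (P (Suc k)) Y"
      and f0: "\<forall>x\<in>carrier (P (Suc (Suc k))). f (d (Suc k) x) = \<zero>\<^bsub>Y\<^esub>"
    interpret F: module_homs B "P (Suc k)" Y f by (intro module_homsI lP Y f)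
    \<comment> \<open>Composing with \<open>v\<close> turns the cocycle \<open>f\<close> into a
      cocycle on the resolution for which exactness is known.\<close>
    have "\<forall>x\<in>carrier (P' (Suc (Suc k))). f (v (Suc k) (d' (Suc k) x)) = \<zero>\<^bsub>Y\<^esub>"
      using f0 vd[of _ "Suc k"] module_homD(1)[OF vh] by (metis (no_types))
    then obtain g where g: "g \<in> module_hom B (P' k) Y"
      "\<And>x. x \<in> carrier (P' (Suc k)) \<Longrightarrow> f (v (Suc k) x) = g (d' k x)"
      using ex module_hom_comp[OF vh f] unfolding hom_exact_def by metis
    show "\<exists>g\<in>module_hom B (P k) Y. \<forall>x\<in>carrier (P (Suc k)). f x = g (d k x)"
    proof (intro bexI ballI)
      \<comment> \<open>Apply \<open>f\<close> to the homotopy relation: the boundary term is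
        killed, so f v u - f = f s d. As f v u = g d' u = g u d, the map through which
        \<open>f\<close> factors is g u - f s.\<close>
      show "(\<lambda>x. g (u k x) \<ominus>\<^bsub>Y\<^esub> f (s k x)) \<in> module_hom B (P k) Y"
        by (intro module_hom_minus lP Y module_hom_comp[OF uh g(1)] module_hom_comp[OF sh f])
      fix x assume x: "x \<in> carrier (P (Suc k))"
      have cx: "u (Suc k) x \<in> carrier (P' (Suc k))" "v (Suc k) (u (Suc k) x) \<in> carrier (P (Suc k))"
        "s (Suc k) x \<in> carrier (P (Suc (Suc k)))" "d k x \<in> carrier (P k)" "s k (d k x) \<in> carrier (P (Suc k))"
        "d (Suc k) (s (Suc k) x) \<in> carrier (P (Suc k))"
        using x module_homD(1)[OF uh] module_homD(1)[OF vh] module_homD(1)[OF sh] c by auto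
      have "f (v (Suc k) (u (Suc k) x)) \<ominus>\<^bsub>Y\<^esub> f x = f (d (Suc k) (s (Suc k) x) \<oplus>\<^bsub>P (Suc k)\<^esub> s k (d k x))"
        using cx x hd[OF x] by (simp flip: F.hom_minus)
      also have "\<dots> = f (s k (d k x))" using cx f0 by (simp add: F.hom_add F.closed)
      finally have "f (v (Suc k) (u (Suc k) x)) = f x \<oplus>\<^bsub>Y\<^esub> f (s k (d k x))"
        using cx x by (subst Y.M.eq_add_iff_minus_eq) (auto simp: F.closed)
      moreover have "f (v (Suc k) (u (Suc k) x)) = g (u k (d k x))" using g(2)[OF cx(1)] ud[OF x] by simp
      ultimately show "f x = g (u k (d k x)) \<ominus>\<^bsub>Y\<^esub> f (s k (d k x))"
        using cx x by (simp add: Y.M.minus_eq Y.M.a_assoc Y.M.r_neg F.closed)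
    qed
  qed
qed

lemma hom_exact_cong:
  assumes "proj_res B X P d e" "proj_res B X P' d' e'" "left_module B Y"
  shows "hom_exact B P d Y k \<longleftrightarrow> hom_exact B P' d' Y k"
  using hom_exact_mono[OF assms(1,2,3)] hom_exact_mono[OF assms(2,1,3)] by blast

section \<open>Complexes of matrices and vanishing of Ext\<close>

text \<open>One equivalence at the middle term encodes both the vanishing of the composite and
  exactness.\<close>

definition exact3 ::
  "('b, 'k) ring_scheme \<Rightarrow> 'i set \<Rightarrow> 'j set \<Rightarrow> 'l set \<Rightarrow> ('i \<Rightarrow> 'j \<Rightarrow> 'b) \<Rightarrow> ('j \<Rightarrow> 'l \<Rightarrow> 'b) \<Rightarrow> bool" where
  "exact3 B I J K D E \<longleftrightarrow>
     (\<forall>y\<in>vecs B J. vmul B J K E y = (\<lambda>_. \<zero>\<^bsub>B\<^esub>) \<longleftrightarrow> y \<in> vmul B I J D ` vecs B I)"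

definition mat_transpose :: "('i \<Rightarrow> 'j \<Rightarrow> 'b) \<Rightarrow> 'j \<Rightarrow> 'i \<Rightarrow> 'b" where
  "mat_transpose D = (\<lambda>t s. D s t)"

lemma mat_transpose_transpose [simp]: "mat_transpose (mat_transpose D) = D"
  by (simp add: mat_transpose_def)

definition row_exact where
  "row_exact B J D k \<longleftrightarrow> exact3 B (J (Suc (Suc k))) (J (Suc k)) (J k) (D (Suc k)) (D k)"

text \<open>Column vectors over \<open>B\<close> are row vectors over the opposite ring.\<close>

definition col_exact where
  "col_exact B J D k \<longleftrightarrow>
     exact3 (op_ring B) (J k) (J (Suc k)) (J (Suc (Suc k))) (mat_transpose (D k)) (mat_transpose (D (Suc k)))"

lemma vecs_op_ring [simp]: "vecs (op_ring B) I = vecs B I"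
  by (simp add: vecs_def)

definition mat_res ::
  "('b, 'k) ring_scheme \<Rightarrow> ('b, 'm) module \<Rightarrow> (nat \<Rightarrow> 'i set) \<Rightarrow> (nat \<Rightarrow> 'i \<Rightarrow> 'i \<Rightarrow> 'b) \<Rightarrow>
     (('i \<Rightarrow> 'b) \<Rightarrow> 'm) \<Rightarrow> bool" where
  "mat_res B X J D e \<longleftrightarrow>
     (\<forall>k. finite (J k)) \<and> (\<forall>k s t. D k s t \<in> carrier B) \<and>
     e \<in> module_hom B (free B (J 0)) X \<and> e ` vecs B (J 0) = carrier X \<and>
     (\<forall>x\<in>vecs B (J 0). e x = \<zero>\<^bsub>X\<^esub> \<longleftrightarrow> x \<in> vmul B (J 1) (J 0) (D 0) ` vecs B (J 1)) \<and>
     (\<forall>k. row_exact B J D k)"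

lemma mat_res_proj_res:
  assumes "mat_res B X J D e" "ring B" "left_module B X"
  shows "proj_res B X (\<lambda>k. free B (J k)) (\<lambda>k. vmul B (J (Suc k)) (J k) (D k)) e"
proof -
  interpret ring B by fact
  have "vmul B (J (Suc k)) (J k) (D k) \<in> module_hom B (free B (J (Suc k))) (free B (J k))" for k
    using assms(1) by (intro vmul_hom) (simp add: mat_res_def)
  moreover have "summand B (free B (J k))" for k
    using assms(1) by (intro summand_free) (simp add: mat_res_def)
  ultimately show ?thesis
    using assms(1,3) unfolding proj_res_def mat_res_def row_exact_def exact3_def free_simps
    by (intro conjI allI) (elim conjE; (assumption | simp))+
qed

text \<open>Over a noetherian ring each syzygy of a finite free module is finitely generated, hence
  again the image of a matrix. Iteration gives free resolutions.\<close>

lemma kernel_matrix: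
  fixes n :: nat
  assumes "left_noetherian B" "left_module B N" "h \<in> module_hom B (free B {..<n}) N"
  obtains n' :: nat and D where "\<And>s t. D s t \<in> carrier B"
    "\<And>x. x \<in> vecs B {..<n} \<Longrightarrow> h x = \<zero>\<^bsub>N\<^esub> \<longleftrightarrow> x \<in> vmul B {..<n'} {..<n} D ` vecs B {..<n'}"
proof -
  interpret N: left_module B N by fact
  interpret F: left_module B "free B {..<n}" by (rule N.R.left_module_free)
  interpret h: module_homs B "free B {..<n}" N h by (intro module_homsI F.left_module_axioms assms)
  let ?H = "{x \<in> carrier (free B {..<n}). h x = \<zero>\<^bsub>N\<^esub>}"
  obtain n' :: nat and g where g: "g \<in> {..<n'} \<rightarrow> ?H" "lin (free B {..<n}) {..<n'} g ` vecs B {..<n'} = ?H"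
    by (rule F.fg_sub_generators[OF h.kernel_submodule fg_sub_free_noetherian[OF assms(1) h.kernel_submodule]])
  then have gc: "g \<in> {..<n'} \<rightarrow> carrier (free B {..<n})" by auto
  obtain D where D: "\<And>s t. D s t \<in> carrier B"
    "\<And>x. x \<in> vecs B {..<n'} \<Longrightarrow> lin (free B {..<n}) {..<n'} g x = vmul B {..<n'} {..<n} D x"
    by (rule N.R.hom_free_eq_vmul[OF _ F.lin_hom[OF gc]]) auto
  show ?thesis
  proof (rule that[OF D(1)])
    fix x assume x: "x \<in> vecs B {..<n}"
    have "vmul B {..<n'} {..<n} D ` vecs B {..<n'} = ?H" using D(2) g(2) by (metis (no_types, lifting) image_cong)
    then show "h x = \<zero>\<^bsub>N\<^esub> \<longleftrightarrow> x \<in> vmul B {..<n'} {..<n} D ` vecs B {..<n'}" using x by simp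
  qed
qed

lemma mat_res_exists:
  assumes "left_noetherian B" "X \<in> fg_mod B"
  obtains m :: "nat \<Rightarrow> nat" and D e where "mat_res B X (\<lambda>k. {..<m k}) D e"
proof -
  interpret ring B using assms(1) by (simp add: left_noetherian_def)
  have X: "left_module B X" using assms(2) by (simp add: fg_mod_def)
  obtain n :: nat and e where e: "e \<in> module_hom B (free B {..<n}) X" "e ` vecs B {..<n} = carrier X"
    by (rule fg_mod_surj[OF assms(2)])
  obtain n1 :: nat and D1 where D1: "\<And>s t. D1 s t \<in> carrier B"
    "\<And>x. x \<in> vecs B {..<n} \<Longrightarrow> e x = \<zero>\<^bsub>X\<^esub> \<longleftrightarrow> x \<in> vmul B {..<n1} {..<n} D1 ` vecs B {..<n1}"
    by (rule kernel_matrix[OF assms(1) X e(1)]) blast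
  \<comment> \<open>A state \<open>(a, b, D)\<close> stands for a matrix from rank \<open>b\<close>
    to rank \<open>a\<close>; the matrix in the next state has target rank \<open>b\<close>.\<close>
  define P where "P = (\<lambda>(k::nat) (a::nat, b::nat, D). (k = 0 \<longrightarrow> a = n \<and> b = n1 \<and> D = D1) \<and>
     (\<forall>s t. D s t \<in> carrier B))"
  define Q where "Q = (\<lambda>(k::nat) (a::nat, b::nat, D) (a'::nat, b'::nat, D').
     a' = b \<and> exact3 B {..<b'} {..<b} {..<a} D' D)"
  have "\<exists>w. \<forall>k. P k (w k) \<and> Q k (w k) (w (Suc k))"
  proof (rule dependent_nat_choice)
    show "\<exists>w. P 0 w" using D1 by (intro exI[of _ "(n, n1, D1)"]) (simp add: P_def)
  next
    fix w k assume "P k w"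
    then obtain a b D where w: "w = (a, b, D)" "\<And>s t. D s t \<in> carrier B" by (cases w) (auto simp: P_def)
    obtain b' :: nat and D' where D': "\<And>s t. D' s t \<in> carrier B"
      "\<And>x. x \<in> vecs B {..<b} \<Longrightarrow> vmul B {..<b} {..<a} D x = \<zero>\<^bsub>free B {..<a}\<^esub> \<longleftrightarrow>
         x \<in> vmul B {..<b'} {..<b} D' ` vecs B {..<b'}"
      by (rule kernel_matrix[OF assms(1) left_module_free vmul_hom[of D "{..<b}" "{..<a}", OF w(2)]]) blast
    then have "P (Suc k) (b, b', D') \<and> Q k w (b, b', D')"
      by (simp add: P_def Q_def w exact3_def)
    then show "\<exists>w'. P (Suc k) w' \<and> Q k w w'" by blast
  qed
  then obtain w where w: "\<And>k. P k (w k)" "\<And>k. Q k (w k) (w (Suc k))" by blast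
  define m where "m = (\<lambda>k. fst (w k))"
  define D where "D = (\<lambda>k. snd (snd (w k)))"
  have wk: "w k = (m k, m (Suc k), D k)" for k
    using w(2)[of k] by (cases "w k"; cases "w (Suc k)") (auto simp: m_def D_def Q_def)
  have "mat_res B X (\<lambda>k. {..<m k}) D e"
    unfolding mat_res_def row_exact_def
    using w(1)[of 0] w(1) w(2) D1 e by (simp add: wk P_def Q_def)
  then show ?thesis by (rule that)
qed

section \<open>Duals of free modules as columns\<close>

definition dot :: "('b, 'k) ring_scheme \<Rightarrow> 'i set \<Rightarrow> ('i \<Rightarrow> 'b) \<Rightarrow> ('i \<Rightarrow> 'b) \<Rightarrow> 'b" where
  "dot B I x y = (\<Oplus>\<^bsub>B\<^esub>s\<in>I. x s \<otimes>\<^bsub>B\<^esub> y s)"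

context ring begin

lemma dot_hom:
  assumes "y \<in> vecs R I" shows "(\<lambda>x. dot R I x y) \<in> module_hom R (free R I) (regular_module R)"
proof -
  interpret M: left_module R "regular_module R" by (rule left_module_regular[OF ring_axioms])
  have "lin (regular_module R) I y \<in> module_hom R (free R I) (regular_module R)"
    using assms by (intro M.lin_hom) (auto simp: vecs_def)
  moreover have "(\<lambda>x. dot R I x y) = lin (regular_module R) I y" by (simp add: fun_eq_iff lin_def dot_def)
  ultimately show ?thesis by simp
qed

lemma hom_eq_dot:
  assumes "finite I" "f \<in> module_hom R (free R I) (regular_module R)"
  obtains y where "y \<in> vecs R I" "\<And>x. x \<in> vecs R I \<Longrightarrow> f x = dot R I x y"
proof
  interpret M: left_module R "regular_module R" by (rule left_module_regular[OF ring_axioms])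
  let ?y = "\<lambda>s. if s \<in> I then f (unit_vec R s) else \<zero>"
  have f: "s \<in> I \<Longrightarrow> f (unit_vec R s) \<in> carrier R" for s
    using module_homD(1)[OF assms(2), of "unit_vec R s"] unit_vec_closed[of s I] by simp
  then show "?y \<in> vecs R I" by (auto simp: vecs_def)
  fix x assume x: "x \<in> vecs R I"
  show "f x = dot R I x ?y"
    unfolding M.hom_free_eq_lin[OF assms x] lin_def dot_def finsum_regular
    using f vecsD[OF x] by (intro finsum_cong') auto
qed

lemma dot_unit_vec:
  assumes "finite I" "y \<in> vecs R I" "s \<in> I" shows "dot R I (unit_vec R s) y = y s"
proof -
  interpret M: left_module R "regular_module R" by (rule left_module_regular[OF ring_axioms])
  have "lin (regular_module R) I y (unit_vec R s) = y s"
    using assms by (intro M.lin_unit_vec) (auto simp: vecs_def)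
  then show ?thesis by (simp add: lin_def dot_def)
qed

lemma dot_ext:
  assumes "finite I" "y \<in> vecs R I" "z \<in> vecs R I" "\<And>x. x \<in> vecs R I \<Longrightarrow> dot R I x y = dot R I x z"
  shows "y = z"
proof
  fix s show "y s = z s"
    using dot_unit_vec[OF assms(1,2), of s] dot_unit_vec[OF assms(1,3), of s] assms(4)[of "unit_vec R s"]
      unit_vec_closed[of s I] vecs_out[OF assms(2)] vecs_out[OF assms(3)] by metis
qed

lemma dot_zero: "x \<in> vecs R I \<Longrightarrow> dot R I x (\<lambda>_. \<zero>) = \<zero>"
  using vecsD[of x I] by (simp add: dot_def finsum_zero)

lemma zero_dot: "x \<in> vecs R I \<Longrightarrow> dot R I (\<lambda>_. \<zero>) x = \<zero>"
  using vecsD[of x I] by (simp add: dot_def finsum_zero)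

lemma vmul_op_closed:
  assumes "y \<in> vecs R J" "\<And>s t. D s t \<in> carrier R"
  shows "vmul (op_ring R) J I (mat_transpose D) y \<in> vecs R I"
  using ring.vmul_closed[OF ring_op_ring[OF ring_axioms], of y J "mat_transpose D" I] assms
  by (simp add: mat_transpose_def)

lemma zero_vecs: "(\<lambda>_. \<zero>) \<in> vecs R I"
  by (simp add: vecs_def)

text \<open>Associativity of the product of a row, a matrix and a column. It exhibits the map on
  columns as the dual of the map on rows, with columns treated as rows over the opposite
  ring.\<close>

lemma dot_vmul:
  assumes "finite I" "finite J" "x \<in> vecs R I" "y \<in> vecs R J" "\<And>s t. D s t \<in> carrier R"
  shows "dot R J (vmul R I J D x) y = dot R I x (vmul (op_ring R) J I (mat_transpose D) y)"
proof -
  note c = vecsD[OF assms(3)] vecsD[OF assms(4)] assms(5)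
  have "dot R J (vmul R I J D x) y = (\<Oplus>t\<in>J. (\<Oplus>s\<in>I. x s \<otimes> D s t) \<otimes> y t)"
    unfolding dot_def vmul_def using c by (intro finsum_cong') (auto intro!: finsum_closed)
  also have "\<dots> = (\<Oplus>t\<in>J. \<Oplus>s\<in>I. x s \<otimes> D s t \<otimes> y t)"
    using c assms(1) by (intro finsum_cong') (auto intro!: finsum_closed finsum_ldistr)
  also have "\<dots> = (\<Oplus>s\<in>I. \<Oplus>t\<in>J. x s \<otimes> D s t \<otimes> y t)"
    using c assms by (intro finsum_swap) auto
  also have "\<dots> = (\<Oplus>s\<in>I. x s \<otimes> (\<Oplus>t\<in>J. D s t \<otimes> y t))"
  proof (rule finsum_cong')
    fix s assume "s \<in> I"
    have "x s \<otimes> (\<Oplus>t\<in>J. D s t \<otimes> y t) = (\<Oplus>t\<in>J. x s \<otimes> (D s t \<otimes> y t))"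
      using c assms(2) by (intro finsum_rdistr) auto
    also have "\<dots> = (\<Oplus>t\<in>J. x s \<otimes> D s t \<otimes> y t)"
      using c by (intro finsum_cong') (auto simp: m_assoc)
    finally show "(\<Oplus>t\<in>J. x s \<otimes> D s t \<otimes> y t) = x s \<otimes> (\<Oplus>t\<in>J. D s t \<otimes> y t)" ..
  qed (use c in \<open>auto intro!: finsum_closed\<close>)
  also have "\<dots> = dot R I x (vmul (op_ring R) J I (mat_transpose D) y)"
    unfolding dot_def vmul_def mat_transpose_def using c by (intro finsum_cong') (auto intro!: finsum_closed)
  finally show ?thesis .
qed

text \<open>Paired with a row, the composite of the transposes becomes the composite of
  \<open>D\<close> and \<open>E\<close> applied to that row; pairings separate columns.\<close>

lemma op_comp_zero:
  assumes fin: "finite I" "finite J" "finite K" and D: "\<And>s t. D s t \<in> carrier R" and E: "\<And>s t. E s t \<in> carrier R"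
    and z: "\<And>x. x \<in> vecs R I \<Longrightarrow> vmul R J K E (vmul R I J D x) = (\<lambda>_. \<zero>)" and y: "y \<in> vecs R K"
  shows "vmul (op_ring R) J I (mat_transpose D) (vmul (op_ring R) K J (mat_transpose E) y) = (\<lambda>_. \<zero>)"
proof (rule dot_ext[OF fin(1) _ zero_vecs])
  have Ey: "vmul (op_ring R) K J (mat_transpose E) y \<in> vecs R J" by (rule vmul_op_closed[OF y E])
  show "vmul (op_ring R) J I (mat_transpose D) (vmul (op_ring R) K J (mat_transpose E) y) \<in> vecs R I"
    by (rule vmul_op_closed[OF Ey D])
  fix x assume x: "x \<in> vecs R I"
  have "dot R I x (vmul (op_ring R) J I (mat_transpose D) (vmul (op_ring R) K J (mat_transpose E) y)) =
      dot R K (vmul R J K E (vmul R I J D x)) y"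
    using dot_vmul[OF fin(1,2) x Ey D] dot_vmul[OF fin(2,3) vmul_closed[OF x D] y E] by simp
  then show "dot R I x (vmul (op_ring R) J I (mat_transpose D) (vmul (op_ring R) K J (mat_transpose E) y)) =
      dot R I x (\<lambda>_. \<zero>)"
    using z[OF x] zero_dot[OF y] dot_zero[OF x] by simp
qed

text \<open>Linear forms on a free module are columns. A form vanishing on boundaries is a column
  killed by the next transpose, and a form factoring through \<open>D k\<close> is a column in the
  image of its transpose.\<close>

lemma hom_exact_iff_col_exact:
  assumes fin: "\<And>k. finite (J k)" and D: "\<And>k s t. D k s t \<in> carrier R"
    and z: "\<And>x. x \<in> vecs R (J (Suc (Suc k))) \<Longrightarrow>
      vmul R (J (Suc k)) (J k) (D k) (vmul R (J (Suc (Suc k))) (J (Suc k)) (D (Suc k)) x) = (\<lambda>_. \<zero>)"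
  shows "hom_exact R (\<lambda>k. free R (J k)) (\<lambda>k. vmul R (J (Suc k)) (J k) (D k)) (regular_module R) k \<longleftrightarrow>
         col_exact R J D k"
proof
  let ?d = "\<lambda>k. vmul R (J (Suc k)) (J k) (D k)"
  let ?c = "\<lambda>k. vmul (op_ring R) (J k) (J (Suc k)) (mat_transpose (D k))"
  have adj: "dot R (J k) (?d k x) y = dot R (J (Suc k)) x (?c k y)"
    if "x \<in> vecs R (J (Suc k))" "y \<in> vecs R (J k)" for k x y
    by (rule dot_vmul[OF fin fin that D])
  {
    assume he: "hom_exact R (\<lambda>k. free R (J k)) ?d (regular_module R) k"
    show "col_exact R J D k" unfolding col_exact_def exact3_def
    proof (intro ballI iffI)
      fix y assume "y \<in> vecs (op_ring R) (J (Suc k))"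
        and y0: "?c (Suc k) y = (\<lambda>_. \<zero>\<^bsub>op_ring R\<^esub>)"
      then have y: "y \<in> vecs R (J (Suc k))" by simp
      have "\<forall>x\<in>vecs R (J (Suc (Suc k))). dot R (J (Suc k)) (?d (Suc k) x) y = \<zero>"
        using y y0 by (simp add: adj dot_zero)
      then obtain g where g: "g \<in> module_hom R (free R (J k)) (regular_module R)"
        "\<And>x. x \<in> vecs R (J (Suc k)) \<Longrightarrow> dot R (J (Suc k)) x y = g (?d k x)"
        using he dot_hom[OF y] unfolding hom_exact_def by fastforce
      obtain w where w: "w \<in> vecs R (J k)" "\<And>x. x \<in> vecs R (J k) \<Longrightarrow> g x = dot R (J k) x w"
        by (rule hom_eq_dot[OF fin g(1)]) blast
      have "y = ?c k w"
      proof (rule dot_ext[OF fin y vmul_op_closed[OF w(1) D]])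
        fix x assume x: "x \<in> vecs R (J (Suc k))"
        show "dot R (J (Suc k)) x y = dot R (J (Suc k)) x (?c k w)"
          using g(2)[OF x] w(2)[OF vmul_closed[OF x D]] adj[OF x w(1)] by simp
      qed
      then show "y \<in> ?c k ` vecs (op_ring R) (J k)" using w(1) by simp
    next
      fix y assume "y \<in> ?c k ` vecs (op_ring R) (J k)"
      then obtain w where "w \<in> vecs R (J k)" "y = ?c k w" by auto
      then show "?c (Suc k) y = (\<lambda>_. \<zero>\<^bsub>op_ring R\<^esub>)"
        using op_comp_zero[OF fin fin fin D D z] by simp
    qed
  }
  {
    assume ce: "col_exact R J D k"
    show "hom_exact R (\<lambda>k. free R (J k)) ?d (regular_module R) k" unfolding hom_exact_def
    proof (intro ballI impI)
      fix f assume f: "f \<in> module_hom R (free R (J (Suc k))) (regular_module R)"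
        and f0: "\<forall>x\<in>carrier (free R (J (Suc (Suc k)))). f (?d (Suc k) x) = \<zero>\<^bsub>regular_module R\<^esub>"
      obtain y where y: "y \<in> vecs R (J (Suc k))" "\<And>x. x \<in> vecs R (J (Suc k)) \<Longrightarrow> f x = dot R (J (Suc k)) x y"
        by (rule hom_eq_dot[OF fin f]) blast
      have "?c (Suc k) y = (\<lambda>_. \<zero>)"
      proof (rule dot_ext[OF fin vmul_op_closed[OF y(1) D] zero_vecs])
        fix x assume x: "x \<in> vecs R (J (Suc (Suc k)))"
        show "dot R (J (Suc (Suc k))) x (?c (Suc k) y) = dot R (J (Suc (Suc k))) x (\<lambda>_. \<zero>)"
        proof -
          have "f (?d (Suc k) x) = \<zero>" using f0 x by simp
          then show ?thesis
            using adj[OF x y(1)] y(2)[OF vmul_closed[of x _ "D (Suc k)", OF x D]] dot_zero[OF x] by metis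
        qed
      qed
      then obtain w where w: "w \<in> vecs R (J k)" "y = ?c k w"
        using ce y(1) unfolding col_exact_def exact3_def by auto
      show "\<exists>g\<in>module_hom R (free R (J k)) (regular_module R). \<forall>x\<in>carrier (free R (J (Suc k))). f x = g (?d k x)"
      proof (intro bexI ballI)
        show "(\<lambda>x. dot R (J k) x w) \<in> module_hom R (free R (J k)) (regular_module R)" by (rule dot_hom[OF w(1)])
        fix x assume "x \<in> carrier (free R (J (Suc k)))"
        then have x: "x \<in> vecs R (J (Suc k))" by simp
        show "f x = dot R (J k) (?d k x) w" using y(2)[OF x] adj[OF x w(1)] w(2) by simp
      qed
    qed
  }
qed

end

section \<open>Ext groups as cocycles modulo coboundaries\<close>

lemma trivial_FactGroup_iff:
  assumes "comm_group G" "subgroup D G" "subgroup Z G" "D \<subseteq> Z"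
  shows "trivial_group ((G\<lparr>carrier := Z\<rparr>) Mod D) \<longleftrightarrow> Z \<subseteq> D"
proof -
  interpret G: comm_group G by fact
  let ?Z = "G\<lparr>carrier := Z\<rparr>"
  interpret Z: group ?Z by (rule G.subgroup_imp_group[OF assms(3)])
  interpret Z: comm_group ?Z
    by (rule Z.group_comm_groupI) (use subgroup.subset[OF assms(3)] in \<open>auto intro: G.m_comm\<close>)
  have D: "subgroup D ?Z" by (rule G.subgroup_incl[OF assms(2-4)])
  interpret N: normal D ?Z by (rule Z.subgroup_imp_normal[OF D])
  have triv: "trivial_group (?Z Mod D) \<longleftrightarrow> (\<forall>z\<in>Z. D #>\<^bsub>?Z\<^esub> z = D)"
    using N.factorgroup_is_group subgroup.one_closed[OF assms(3)]
    by (auto simp: trivial_group_def FactGroup_def RCOSETS_def)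
  show ?thesis
    unfolding triv using Z.coset_join1[OF _ _ D] Z.coset_join2[OF _ D] by auto
qed

lemma hom_group_simps [simp]:
  "carrier (hom_group B M N) = module_hom B M N \<inter> extensional (carrier M)"
  "f \<otimes>\<^bsub>hom_group B M N\<^esub> g = (\<lambda>x\<in>carrier M. f x \<oplus>\<^bsub>N\<^esub> g x)"
  "\<one>\<^bsub>hom_group B M N\<^esub> = (\<lambda>x\<in>carrier M. \<zero>\<^bsub>N\<^esub>)"
  by (simp_all add: hom_group_def)

lemma module_hom_restrict:
  assumes "left_module B M" "f \<in> module_hom B M N"
  shows "restrict f (carrier M) \<in> module_hom B M N"
  using assms by (intro module_hom_cong[OF assms(2,1)]) simp

lemma module_hom_zero:
  assumes "left_module B N" shows "(\<lambda>x. \<zero>\<^bsub>N\<^esub>) \<in> module_hom B M N"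
proof -
  interpret left_module B N by fact
  show ?thesis by (rule module_homI) (auto simp: smult_r_null)
qed

lemma comm_group_hom_group:
  assumes "left_module B M" "left_module B N"
  shows "comm_group (hom_group B M N)"
proof (rule comm_groupI)
  interpret M: left_module B M by fact
  interpret N: left_module B N by fact
  show "\<one>\<^bsub>hom_group B M N\<^esub> \<in> carrier (hom_group B M N)"
    using module_hom_restrict[OF assms(1) module_hom_zero[OF assms(2)]] by simp
  fix f assume f: "f \<in> carrier (hom_group B M N)"
  then have fh: "f \<in> module_hom B M N" by simp
  note fc = module_homD(1)[OF fh]
  show "\<one>\<^bsub>hom_group B M N\<^esub> \<otimes>\<^bsub>hom_group B M N\<^esub> f = f"
    using f fc by (auto simp: fun_eq_iff extensional_def restrict_def)
  show "\<exists>g\<in>carrier (hom_group B M N). g \<otimes>\<^bsub>hom_group B M N\<^esub> f = \<one>\<^bsub>hom_group B M N\<^esub>"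
  proof
    show "restrict (\<lambda>x. \<zero>\<^bsub>N\<^esub> \<ominus>\<^bsub>N\<^esub> f x) (carrier M) \<in> carrier (hom_group B M N)"
      using module_hom_restrict[OF assms(1) module_hom_minus[OF assms module_hom_zero[OF assms(2)] fh]] by simp
    show "restrict (\<lambda>x. \<zero>\<^bsub>N\<^esub> \<ominus>\<^bsub>N\<^esub> f x) (carrier M) \<otimes>\<^bsub>hom_group B M N\<^esub> f = \<one>\<^bsub>hom_group B M N\<^esub>"
      using fc by (auto simp: fun_eq_iff restrict_def N.M.minus_add_cancel)
  qed
  fix g assume g: "g \<in> carrier (hom_group B M N)"
  then have gh: "g \<in> module_hom B M N" by simp
  note gc = module_homD(1)[OF gh]
  show "f \<otimes>\<^bsub>hom_group B M N\<^esub> g \<in> carrier (hom_group B M N)"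
    using module_hom_restrict[OF assms(1) module_hom_plus[OF assms fh gh]] by simp
  show "f \<otimes>\<^bsub>hom_group B M N\<^esub> g = g \<otimes>\<^bsub>hom_group B M N\<^esub> f"
    using fc gc by (auto simp: fun_eq_iff restrict_def N.M.a_comm)
  fix h assume "h \<in> carrier (hom_group B M N)"
  then have "\<And>x. x \<in> carrier M \<Longrightarrow> h x \<in> carrier N" using module_homD(1)[of h B M N] by simp
  then show "f \<otimes>\<^bsub>hom_group B M N\<^esub> g \<otimes>\<^bsub>hom_group B M N\<^esub> h =
      f \<otimes>\<^bsub>hom_group B M N\<^esub> (g \<otimes>\<^bsub>hom_group B M N\<^esub> h)"
    using fc gc by (auto simp: fun_eq_iff restrict_def N.M.a_assoc)
qed

lemma hom_pre_group_hom:
  assumes "left_module B L" "left_module B M" "left_module B N" "u \<in> module_hom B L M"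
  shows "group_hom (hom_group B M N) (hom_group B L N) (hom_pre L u)"
proof -
  note uc = module_homD(1)[OF assms(4)]
  have "hom_pre L u \<in> hom (hom_group B M N) (hom_group B L N)"
    unfolding hom_def
  proof (intro CollectI conjI ballI funcsetI)
    fix f assume "f \<in> carrier (hom_group B M N)"
    then show "hom_pre L u f \<in> carrier (hom_group B L N)"
      using module_hom_restrict[OF assms(1) module_hom_comp[OF assms(4), of f N]]
      by (simp add: hom_pre_def)
  qed (use uc in \<open>auto simp: hom_pre_def fun_eq_iff restrict_def\<close>)
  then show ?thesis
    using comm_group_hom_group[OF assms(2,3)] comm_group_hom_group[OF assms(1,3)]
    by (simp add: group_hom_def group_hom_axioms_def comm_group.axioms)
qed

text \<open>Members of \<open>hom_group\<close> are extensional, whereas the arguments elsewhere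
  work with arbitrary functions; restriction to the carrier translates between the two. The
  translation serves Ext groups and the duality clause of complete resolutions alike.\<close>

lemma hom_pre_kernel_image:
  assumes L: "left_module B L" and M: "left_module B M" and N: "left_module B N" and Y: "left_module B Y"
    and u: "u \<in> module_hom B L M" and v: "v \<in> module_hom B M N"
    and vu: "\<And>x. x \<in> carrier L \<Longrightarrow> v (u x) = \<zero>\<^bsub>N\<^esub>"
  shows "hom_pre M v ` carrier (hom_group B N Y) \<subseteq>
      kernel (hom_group B M Y) (hom_group B L Y) (hom_pre L u)" (is "?D \<subseteq> ?Z")
    and "kernel (hom_group B M Y) (hom_group B L Y) (hom_pre L u) \<subseteq>
      hom_pre M v ` carrier (hom_group B N Y) \<longleftrightarrow>
      (\<forall>f\<in>module_hom B M Y. (\<forall>x\<in>carrier L. f (u x) = \<zero>\<^bsub>Y\<^esub>) \<longrightarrow>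
        (\<exists>g\<in>module_hom B N Y. \<forall>x\<in>carrier M. f x = g (v x)))" (is "_ \<longleftrightarrow> ?ext")
proof -
  interpret a: group_hom "hom_group B N Y" "hom_group B M Y" "hom_pre M v"
    by (rule hom_pre_group_hom[OF M N Y v])
  note uc = module_homD(1)[OF u] and vc = module_homD(1)[OF v]
  have Z: "f \<in> ?Z \<longleftrightarrow> f \<in> carrier (hom_group B M Y) \<and> (\<forall>x\<in>carrier L. f (u x) = \<zero>\<^bsub>Y\<^esub>)" for f
    by (auto simp: kernel_def hom_pre_def fun_eq_iff restrict_def)
  have D: "f \<in> ?D \<longleftrightarrow> f \<in> extensional (carrier M) \<and>
      (\<exists>g\<in>module_hom B N Y. \<forall>x\<in>carrier M. f x = g (v x))" for f
  proof
    assume "f \<in> ?D"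
    then show "f \<in> extensional (carrier M) \<and> (\<exists>g\<in>module_hom B N Y. \<forall>x\<in>carrier M. f x = g (v x))"
      by (auto simp: hom_pre_def)
  next
    assume "f \<in> extensional (carrier M) \<and> (\<exists>g\<in>module_hom B N Y. \<forall>x\<in>carrier M. f x = g (v x))"
    then obtain g where g: "f \<in> extensional (carrier M)" "g \<in> module_hom B N Y"
      "\<And>x. x \<in> carrier M \<Longrightarrow> f x = g (v x)" by blast
    show "f \<in> ?D"
    proof
      show "restrict g (carrier N) \<in> carrier (hom_group B N Y)"
        using module_hom_restrict[OF N g(2)] by simp
      show "f = hom_pre M v (restrict g (carrier N))"
        using g(1,3) vc by (auto simp: hom_pre_def fun_eq_iff extensional_def restrict_def)
    qed
  qed
  show "?D \<subseteq> ?Z"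
  proof
    fix f assume f: "f \<in> ?D"
    then have "f \<in> carrier (hom_group B M Y)" using a.img_is_subgroup subgroup.subset by blast
    moreover obtain g where g: "g \<in> module_hom B N Y" "\<And>x. x \<in> carrier M \<Longrightarrow> f x = g (v x)"
      using f unfolding D by blast
    interpret g: module_homs B N Y g by (intro module_homsI N Y g)
    have "\<forall>x\<in>carrier L. f (u x) = \<zero>\<^bsub>Y\<^esub>" using g vu uc g.hom_zero by simp
    ultimately show "f \<in> ?Z" unfolding Z by blast
  qed
  show "?Z \<subseteq> ?D \<longleftrightarrow> ?ext"
  proof
    assume s: "?Z \<subseteq> ?D"
    show ?ext
    proof (intro ballI impI)
      fix f assume f: "f \<in> module_hom B M Y" "\<forall>x\<in>carrier L. f (u x) = \<zero>\<^bsub>Y\<^esub>"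
      then have "restrict f (carrier M) \<in> ?Z"
        unfolding Z using module_hom_restrict[OF M f(1)] uc by simp
      then have "restrict f (carrier M) \<in> ?D" using s by blast
      then show "\<exists>g\<in>module_hom B N Y. \<forall>x\<in>carrier M. f x = g (v x)"
        unfolding D by simp
    qed
  next
    assume h: ?ext
    show "?Z \<subseteq> ?D"
    proof
      fix f assume "f \<in> ?Z"
      then show "f \<in> ?D" using h unfolding Z D by simp
    qed
  qed
qed

text \<open>In degrees \<open>Suc k\<close> the coboundaries are the image of the preceding Hom
  group, so triviality of the quotient is the inclusion of cocycles in that image.\<close>

lemma ext_group_trivial_iff:
  assumes ch: "chosen_resolution B X = (P, d)" and res: "proj_res B X P d e"
    and Y: "left_module B Y"
  shows "trivial_group (ext_group B (Suc k) X Y) \<longleftrightarrow> hom_exact B P d Y k"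
proof -
  have lP: "left_module B (P k)" for k using res by (auto simp: proj_res_def summand_def)
  have dh: "d k \<in> module_hom B (P (Suc k)) (P k)" for k using res by (auto simp: proj_res_def)
  have dd: "d k (d (Suc k) x) = \<zero>\<^bsub>P k\<^esub>" if "x \<in> carrier (P (Suc (Suc k)))" for x
    using res module_homD(1)[OF dh that] that unfolding proj_res_def by blast
  let ?C = "\<lambda>k. hom_group B (P k) Y"
  let ?Z = "kernel (?C (Suc k)) (?C (Suc (Suc k))) (hom_pre (P (Suc (Suc k))) (d (Suc k)))"
  let ?D = "hom_pre (P (Suc k)) (d k) ` carrier (?C k)"
  interpret a: group_hom "?C k" "?C (Suc k)" "hom_pre (P (Suc k)) (d k)"
    by (rule hom_pre_group_hom[OF lP lP Y dh])
  interpret b: group_hom "?C (Suc k)" "?C (Suc (Suc k))" "hom_pre (P (Suc (Suc k))) (d (Suc k))"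
    by (rule hom_pre_group_hom[OF lP lP Y dh])
  note ki = hom_pre_kernel_image[of B "P (Suc (Suc k))" "P (Suc k)" "P k" Y "d (Suc k)" "d k", OF lP lP lP Y dh dh dd]
  have "trivial_group (ext_group B (Suc k) X Y) \<longleftrightarrow> trivial_group ((?C (Suc k)\<lparr>carrier := ?Z\<rparr>) Mod ?D)"
    by (simp add: ext_group_def ch Let_def del: hom_group_simps)
  also have "\<dots> \<longleftrightarrow> ?Z \<subseteq> ?D"
    by (rule trivial_FactGroup_iff[OF comm_group_hom_group[OF lP Y] a.img_is_subgroup b.subgroup_kernel ki(1)])
  also have "\<dots> \<longleftrightarrow> hom_exact B P d Y k" unfolding hom_exact_def by (rule ki(2))
  finally show ?thesis .
qed

text \<open>\<open>ext_group\<close> refers to a resolution picked by choice. One exists because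
  \<open>B\<close> is noetherian, and comparison of resolutions trades it for whichever resolution
  is at hand, in whatever type.\<close>

theorem CM_iff_hom_exact:
  assumes noeth: "left_noetherian B" and X: "X \<in> fg_mod B" and p: "proj_res B X Q \<delta> e"
  shows "X \<in> CM B \<longleftrightarrow> (\<forall>k. hom_exact B Q \<delta> (regular_module B) k)"
proof -
  interpret ring B using noeth by (simp add: left_noetherian_def)
  have lX: "left_module B X" using X by (simp add: fg_mod_def)
  note Y = left_module_regular[OF ring_axioms]
  obtain m :: "nat \<Rightarrow> nat" and D' e' where r': "mat_res B X (\<lambda>k. {..<m k}) D' e'"
    by (rule mat_res_exists[OF noeth X])
  have p': "proj_res B X (\<lambda>k. free B {..<m k}) (\<lambda>k. vmul B {..<m (Suc k)} {..<m k} (D' k)) e'"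
    by (rule mat_res_proj_res[OF r' ring_axioms lX])
  have "projective_resolution B X (\<lambda>k. free B {..<m k}) (\<lambda>k. vmul B {..<m (Suc k)} {..<m k} (D' k)) e'"
    unfolding projective_resolution_def a_kernel_def'
  proof (intro conjI allI)
    show "fg_projective B (free B {..<m k})" for k by (rule free_fg_projective) simp
    have D': "\<And>k s t. D' k s t \<in> carrier B" using r' by (simp add: mat_res_def)
    have vc: "vmul B {..<m (Suc k)} {..<m k} (D' k) x \<in> vecs B {..<m k}" if "x \<in> vecs B {..<m (Suc k)}" for k x
      by (rule vmul_closed[OF that D'])
    show "vmul B {..<m (Suc 0)} {..<m 0} (D' 0) ` carrier (free B {..<m 1}) =
        {x \<in> carrier (free B {..<m 0}). e' x = \<zero>\<^bsub>X\<^esub>}"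
      using r' vc unfolding mat_res_def by auto
    show "vmul B {..<m (Suc (Suc k))} {..<m (Suc k)} (D' (Suc k)) ` carrier (free B {..<m (Suc (Suc k))}) =
      {x \<in> carrier (free B {..<m (Suc k)}). vmul B {..<m (Suc k)} {..<m k} (D' k) x = \<zero>\<^bsub>free B {..<m k}\<^esub>}" for k
      using r' vc unfolding mat_res_def row_exact_def exact3_def by auto
  qed (use p' in \<open>simp_all add: proj_res_def\<close>)
  then have "\<exists>P d. \<exists>e. projective_resolution B X P d e" by blast
  then have ex: "\<exists>Pd. (case Pd of (P, d) \<Rightarrow> \<exists>e. projective_resolution B X P d e)" by auto
  obtain P d where ch: "chosen_resolution B X = (P, d)" by (cases "chosen_resolution B X")
  obtain e'' where "projective_resolution B X P d e''"
    using someI_ex[OF ex] ch by (auto simp: chosen_resolution_def)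
  then have p'': "proj_res B X P d e''" by (rule projective_resolution_proj_res[OF _ lX])
  have ce: "trivial_group (ext_group B (Suc k) X (regular_module B)) \<longleftrightarrow>
      hom_exact B Q \<delta> (regular_module B) k" for k
    using ext_group_trivial_iff[OF ch p'' Y] hom_exact_cong[OF p'' p Y] by blast
  have "(\<forall>i\<ge>1. trivial_group (ext_group B i X (regular_module B))) \<longleftrightarrow>
      (\<forall>k. trivial_group (ext_group B (Suc k) X (regular_module B)))"
    by (metis One_nat_def Suc_le_D Suc_le_mono le0)
  then show ?thesis using X ce by (simp add: CM_def)
qed

theorem CM_iff_col_exact:
  assumes noeth: "left_noetherian B" and X: "X \<in> fg_mod B" and res: "mat_res B X J D e"
  shows "X \<in> CM B \<longleftrightarrow> (\<forall>k. col_exact B J D k)"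
proof -
  interpret ring B using noeth by (simp add: left_noetherian_def)
  have lX: "left_module B X" using X by (simp add: fg_mod_def)
  have p: "proj_res B X (\<lambda>k. free B (J k)) (\<lambda>k. vmul B (J (Suc k)) (J k) (D k)) e"
    by (rule mat_res_proj_res[OF res ring_axioms lX])
  have D: "\<And>k s t. D k s t \<in> carrier B" and fin: "\<And>k. finite (J k)"
    and ex: "\<And>k. row_exact B J D k"
    using res by (simp_all add: mat_res_def)
  have z: "vmul B (J (Suc k)) (J k) (D k) (vmul B (J (Suc (Suc k))) (J (Suc k)) (D (Suc k)) x) = (\<lambda>_. \<zero>\<^bsub>B\<^esub>)"
    if "x \<in> vecs B (J (Suc (Suc k)))" for x k
    using ex[of k] vmul_closed[of x _ "D (Suc k)", OF that D] that unfolding row_exact_def exact3_def by blast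
  have "hom_exact B (\<lambda>k. free B (J k)) (\<lambda>k. vmul B (J (Suc k)) (J k) (D k)) (regular_module B) k \<longleftrightarrow>
      col_exact B J D k" for k
    by (rule hom_exact_iff_col_exact) (use fin D z in auto)
  then show ?thesis using CM_iff_hom_exact[OF noeth X p] by simp
qed

section \<open>Finite injective dimension and duality\<close>

text \<open>Well defined because two preimages differ by an element on which \<open>h\<close>
  vanishes.\<close>

lemma factor_through_image:
  assumes L: "left_module B L" and N: "left_module B N" and Y: "left_module B Y"
    and u: "u \<in> module_hom B L N" and h: "h \<in> module_hom B L Y"
    and ker: "\<And>x. x \<in> carrier L \<Longrightarrow> u x = \<zero>\<^bsub>N\<^esub> \<Longrightarrow> h x = \<zero>\<^bsub>Y\<^esub>"
  obtains f where "f \<in> module_hom B (N\<lparr>carrier := u ` carrier L\<rparr>) Y"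
    "\<And>x. x \<in> carrier L \<Longrightarrow> f (u x) = h x"
proof -
  interpret u: module_homs B L N u by (intro module_homsI L N u)
  interpret h: module_homs B L Y h by (intro module_homsI L Y h)
  define f where "f = (\<lambda>y. h (inv_into (carrier L) u y))"
  have fu: "f (u x) = h x" if x: "x \<in> carrier L" for x
  proof -
    let ?z = "inv_into (carrier L) u (u x)"
    have z: "?z \<in> carrier L" "u ?z = u x" using x by (auto intro: inv_into_into f_inv_into_f)
    have "u (?z \<ominus>\<^bsub>L\<^esub> x) = \<zero>\<^bsub>N\<^esub>" using z x by (simp add: u.hom_minus u.N.M.minus_self u.closed)
    then have "h (?z \<ominus>\<^bsub>L\<^esub> x) = \<zero>\<^bsub>Y\<^esub>" using z x by (intro ker) auto
    then show ?thesis
      using z x by (simp add: f_def h.hom_minus h.N.M.minus_eq_zero_iff h.closed)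
  qed
  show ?thesis
  proof (rule that[OF _ fu])
    show "f \<in> module_hom B (N\<lparr>carrier := u ` carrier L\<rparr>) Y"
    proof (rule module_homI)
      fix y assume "y \<in> carrier (N\<lparr>carrier := u ` carrier L\<rparr>)"
      then obtain x where x: "x \<in> carrier L" "y = u x" by auto
      then show "f y \<in> carrier Y" using fu h.closed by simp
      {
        fix b assume "b \<in> carrier B"
        then show "f (b \<odot>\<^bsub>N\<lparr>carrier := u ` carrier L\<rparr>\<^esub> y) = b \<odot>\<^bsub>Y\<^esub> f y"
          using fu[of "b \<odot>\<^bsub>L\<^esub> x"] fu[of x] x by (simp add: u.hom_smult h.hom_smult u.M.smult_closed)
      }
      fix y' assume "y' \<in> carrier (N\<lparr>carrier := u ` carrier L\<rparr>)"
      then obtain x' where x': "x' \<in> carrier L" "y' = u x'" by auto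
      show "f (y \<oplus>\<^bsub>N\<lparr>carrier := u ` carrier L\<rparr>\<^esub> y') = f y \<oplus>\<^bsub>Y\<^esub> f y'"
        using fu[of "x \<oplus>\<^bsub>L\<^esub> x'"] fu[of x] fu[of x'] x x' by (simp add: u.hom_add h.hom_add)
    qed
  qed
qed

text \<open>
  Dimension shifting along the injective resolution: writing \<open>Z p\<close> for the kernels of an acyclic
  sequence \<open>N\<close> of projectives, every map from \<open>Z p\<close> to the \<open>j\<close>-th cosyzygy of \<open>M\<close> extends to \<open>N p\<close>,
  by descending induction on \<open>j\<close>.
\<close>

lemma inj_res_dual_exact:
  fixes N :: "nat \<Rightarrow> ('b, 'p) module"
  assumes noeth: "left_noetherian B" and M: "left_module B M"
    and res: "injective_resolution_upto B M l I d e"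
    and N: "\<And>p. N p \<in> fg_mod B" "\<And>p. summand B (N p)"
    and \<delta>: "\<And>p. \<delta> p \<in> module_hom B (N p) (N (Suc p))"
    and ex: "\<And>p y. y \<in> carrier (N (Suc p)) \<Longrightarrow>
      \<delta> (Suc p) y = \<zero>\<^bsub>N (Suc (Suc p))\<^esub> \<longleftrightarrow> y \<in> \<delta> p ` carrier (N p)"
    and f: "f \<in> module_hom B (N (Suc k)) M" and f0: "\<And>y. y \<in> carrier (N k) \<Longrightarrow> f (\<delta> k y) = \<zero>\<^bsub>M\<^esub>"
  obtains g where "g \<in> module_hom B (N (Suc (Suc k))) M"
    "\<And>y. y \<in> carrier (N (Suc k)) \<Longrightarrow> f y = g (\<delta> (Suc k) y)"
proof -
  from res[unfolded injective_resolution_upto_def a_kernel_def']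
  have I: "\<forall>k. fg_injective B (I k)" and d: "\<forall>k. d k \<in> module_hom B (I k) (I (Suc k))"
    and e: "e \<in> module_hom B M (I 0)" and einj: "inj_on e (carrier M)"
    and e0: "e ` carrier M = {x \<in> carrier (I 0). d 0 x = \<zero>\<^bsub>I 1\<^esub>}"
    and d0: "\<forall>k. d k ` carrier (I k) = {x \<in> carrier (I (Suc k)). d (Suc k) x = \<zero>\<^bsub>I (Suc (Suc k))\<^esub>}"
    and Il: "\<forall>k>l. carrier (I k) = {\<zero>\<^bsub>I k\<^esub>}"
    by - (elim conjE, assumption)+
  note d = d[rule_format]
  have lI: "left_module B (I k)" for k using I by (simp add: fg_injective_def fg_mod_def)
  have lN: "left_module B (N p)" for p using N(1)[of p] by (simp add: fg_mod_def)
  let ?Z = "\<lambda>p. {x \<in> carrier (N p). \<delta> p x = \<zero>\<^bsub>N (Suc p)\<^esub>}"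
  let ?NZ = "\<lambda>p. (N p)\<lparr>carrier := ?Z p\<rparr>"
  have Zim: "?Z (Suc p) = \<delta> p ` carrier (N p)" for p
    using ex[of _ p] module_homD(1)[OF \<delta>[of p]] by blast
  have NZ: "?NZ p \<in> fg_mod B" for p
  proof -
    interpret D: module_homs B "N p" "N (Suc p)" "\<delta> p" by (intro module_homsI lN \<delta>)
    show ?thesis
      using left_module_sub[OF lN D.kernel_submodule] D.M.fin_gen_sub_iff[OF D.kernel_submodule]
        fg_sub_noetherian[OF noeth lN _ D.kernel_submodule] N(1)[of p]
      by (simp add: fg_mod_def)
  qed
  \<comment> \<open>The induction runs on \<open>i\<close>, the distance of \<open>j\<close> from
    \<open>Suc l\<close>, where the injective resolution has become zero and the zero map is the
    extension.\<close>
  have claim: "\<exists>h\<in>module_hom B (N p) (I j). (\<forall>x\<in>carrier (N p). d j (h x) = \<zero>\<^bsub>I (Suc j)\<^esub>) \<and>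
      (\<forall>x\<in>?Z p. h x = f x)"
    if "j + i = Suc l" "f \<in> module_hom B (?NZ p) (I j)" "\<forall>x\<in>?Z p. d j (f x) = \<zero>\<^bsub>I (Suc j)\<^esub>" for i j p f
    using that
  proof (induction i arbitrary: j p f)
    case 0
    then have Ij: "carrier (I j) = {\<zero>\<^bsub>I j\<^esub>}" using Il by simp
    interpret D: module_homs B "I j" "I (Suc j)" "d j" by (intro module_homsI lI d)
    show ?case
    proof (intro bexI[OF _ module_hom_zero[OF lI]] conjI ballI)
      fix x assume "x \<in> ?Z p"
      then show "\<zero>\<^bsub>I j\<^esub> = f x" using module_homD(1)[OF 0(2), of x] Ij by simp
    qed (rule D.hom_zero)
  next
    case (Suc i)
    interpret D: module_homs B "I j" "I (Suc j)" "d j" by (intro module_homsI lI d)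
    interpret \<Delta>: module_homs B "N p" "N (Suc p)" "\<delta> p" by (intro module_homsI lN \<delta>)
    have incl: "(\<lambda>x. x) \<in> module_hom B (?NZ p) (N p)" by (rule module_homI) auto
    \<comment> \<open>Injectivity extends \<open>f\<close> to \<open>N p\<close>, but the values
      need not be killed by \<open>d j\<close>. The defect vanishes on the kernel
      \<open>?Z p\<close>, so it factors through \<open>\<delta> p\<close> and becomes a map from
      the next kernel to the next cosyzygy, to which the induction hypothesis applies.\<close>
    obtain g where g: "g \<in> module_hom B (N p) (I j)" "\<And>x. x \<in> carrier (?NZ p) \<Longrightarrow> g x = f x"
      by (rule fg_injective_extend[OF I[rule_format] NZ N(1) incl _ Suc.prems(2)]) auto
    note gc = module_homD(1)[OF g(1)]
    obtain f' where f': "f' \<in> module_hom B (?NZ (Suc p)) (I (Suc j))"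
      "\<And>x. x \<in> carrier (N p) \<Longrightarrow> f' (\<delta> p x) = d j (g x)"
    proof (rule factor_through_image[OF lN lN lI \<delta> module_hom_comp[OF g(1) d]])
      fix x assume "x \<in> carrier (N p)" "\<delta> p x = \<zero>\<^bsub>N (Suc p)\<^esub>"
      then show "d j (g x) = \<zero>\<^bsub>I (Suc j)\<^esub>" using g(2)[of x] Suc.prems(3) by simp
    qed (use Zim[of p] in simp)
    have "\<forall>y\<in>?Z (Suc p). d (Suc j) (f' y) = \<zero>\<^bsub>I (Suc (Suc j))\<^esub>"
    proof
      fix y assume "y \<in> ?Z (Suc p)"
      then obtain x where x: "x \<in> carrier (N p)" "y = \<delta> p x" unfolding Zim by blast
      have "d j (g x) \<in> d j ` carrier (I j)" using gc x by blast
      then show "d (Suc j) (f' y) = \<zero>\<^bsub>I (Suc (Suc j))\<^esub>" using f'(2) x d0 by simp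
    qed
    from Suc.IH[OF _ f'(1) this] Suc.prems(1)
    obtain h' where h': "h' \<in> module_hom B (N (Suc p)) (I (Suc j))"
      "\<And>y. y \<in> carrier (N (Suc p)) \<Longrightarrow> d (Suc j) (h' y) = \<zero>\<^bsub>I (Suc (Suc j))\<^esub>"
      "\<And>y. y \<in> ?Z (Suc p) \<Longrightarrow> h' y = f' y" by auto
    \<comment> \<open>The values of \<open>h'\<close> lie in the kernel of \<open>d (Suc j)\<close>,
      which is the image of \<open>d j\<close>; since \<open>N (Suc p)\<close> is projective,
      \<open>h'\<close> lifts back to \<open>I j\<close>.\<close>
    obtain h'' where h'': "h'' \<in> module_hom B (N (Suc p)) (I j)"
      "\<And>y. y \<in> carrier (N (Suc p)) \<Longrightarrow> d j (h'' y) = h' y"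
    proof (rule summand_lift[OF N(2) lI lI h'(1) d])
      fix y assume "y \<in> carrier (N (Suc p))"
      then show "h' y \<in> d j ` carrier (I j)"
        unfolding d0[rule_format] using h'(2) module_homD(1)[OF h'(1)] by blast
    qed blast
    interpret H: module_homs B "N (Suc p)" "I j" h'' by (intro module_homsI lI lN h'')
    \<comment> \<open>Subtracting the lift brings all values into the kernel of \<open>d j\<close>
      and changes nothing on \<open>?Z p\<close>, where \<open>\<delta> p\<close> vanishes.\<close>
    let ?h = "\<lambda>x. g x \<ominus>\<^bsub>I j\<^esub> h'' (\<delta> p x)"
    show ?case
    proof (intro bexI[of _ ?h] conjI ballI)
      show "?h \<in> module_hom B (N p) (I j)"
        by (intro module_hom_minus lN lI g module_hom_comp[OF \<delta> h''(1)])
      fix x assume x: "x \<in> carrier (N p)"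
      have dx: "\<delta> p x \<in> ?Z (Suc p)" unfolding Zim using x by blast
      have "d j (?h x) = d j (g x) \<ominus>\<^bsub>I (Suc j)\<^esub> h' (\<delta> p x)"
        using x gc dx h''(2) by (simp add: D.hom_minus H.closed)
      also have "\<dots> = \<zero>\<^bsub>I (Suc j)\<^esub>"
        using h'(3)[OF dx] f'(2)[OF x] gc x by (simp add: D.N.M.minus_self D.closed)
      finally show "d j (?h x) = \<zero>\<^bsub>I (Suc j)\<^esub>" .
    next
      fix x assume x: "x \<in> ?Z p"
      then have "h'' (\<delta> p x) = \<zero>\<^bsub>I j\<^esub>" using H.hom_zero by simp
      moreover have "g x = f x" "g x \<in> carrier (I j)" using g(2)[of x] gc[of x] x by auto
      ultimately show "?h x = f x" by (simp add: D.M.M.minus_eq)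
    qed
  qed
  interpret D0: module_homs B "I 0" "I (Suc 0)" "d 0" by (intro module_homsI lI d)
  obtain f' where f': "f' \<in> module_hom B (?NZ (Suc (Suc k))) M"
    "\<And>x. x \<in> carrier (N (Suc k)) \<Longrightarrow> f' (\<delta> (Suc k) x) = f x"
  proof (rule factor_through_image[OF lN lN M \<delta> f])
    fix x assume x: "x \<in> carrier (N (Suc k))" "\<delta> (Suc k) x = \<zero>\<^bsub>N (Suc (Suc k))\<^esub>"
    then have "x \<in> \<delta> k ` carrier (N k)" using ex by blast
    then obtain y where "y \<in> carrier (N k)" "x = \<delta> k y" by blast
    then show "f x = \<zero>\<^bsub>M\<^esub>" using f0 by simp
  qed (use Zim[of "Suc k"] in simp)
  have ef': "\<forall>x\<in>?Z (Suc (Suc k)). d 0 (e (f' x)) = \<zero>\<^bsub>I (Suc 0)\<^esub>"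
  proof
    fix x assume "x \<in> ?Z (Suc (Suc k))"
    then have "f' x \<in> carrier M" using module_homD(1)[OF f'(1), of x] by simp
    then have "e (f' x) \<in> e ` carrier M" by blast
    then show "d 0 (e (f' x)) = \<zero>\<^bsub>I (Suc 0)\<^esub>" unfolding e0 by simp
  qed
  obtain h where h: "h \<in> module_hom B (N (Suc (Suc k))) (I 0)"
    "\<And>x. x \<in> carrier (N (Suc (Suc k))) \<Longrightarrow> d 0 (h x) = \<zero>\<^bsub>I (Suc 0)\<^esub>"
    "\<And>x. x \<in> ?Z (Suc (Suc k)) \<Longrightarrow> h x = e (f' x)"
    using claim[OF _ module_hom_comp[OF f'(1) e] ef', of "Suc l"] by auto
  \<comment> \<open>The kernel of \<open>d 0\<close> is the copy of \<open>M\<close> in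
    \<open>I 0\<close>, so the extension already takes its values in \<open>M\<close>.\<close>
  obtain g where g: "g \<in> module_hom B (N (Suc (Suc k))) M"
    "\<And>x. x \<in> carrier (N (Suc (Suc k))) \<Longrightarrow> e (g x) = h x"
  proof (rule summand_lift[OF N(2) M lI h(1) e])
    fix x assume "x \<in> carrier (N (Suc (Suc k)))"
    then show "h x \<in> e ` carrier M" unfolding e0 using h(2) module_homD(1)[OF h(1)] by simp
  qed blast
  show ?thesis
  proof (rule that[OF g(1)])
    fix y assume y: "y \<in> carrier (N (Suc k))"
    have dy: "\<delta> (Suc k) y \<in> ?Z (Suc (Suc k))" unfolding Zim using y by blast
    have "e (g (\<delta> (Suc k) y)) = e (f y)" using g(2)[of "\<delta> (Suc k) y"] h(3)[OF dy] f'(2)[OF y] dy by simp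
    then show "f y = g (\<delta> (Suc k) y)"
      using einj y dy module_homD(1)[OF g(1)] module_homD(1)[OF f] by (simp add: inj_on_eq_iff)
  qed
qed

text \<open>
  Finite injective dimension of \<open>B\<^sub>B\<close> enters only through the following property: the dual of a
  sequence of finitely generated free right modules that is exact in positive degrees is again exact
  in positive degrees.
\<close>

lemma right_inj_dim_row_exact:
  fixes J :: "nat \<Rightarrow> 'i set"
  assumes "ring B" and noeth: "left_noetherian (op_ring B)" and dim: "right_inj_dim B < \<infinity>"
    and fin: "\<And>k. finite (J k)" and D: "\<And>k s t. D k s t \<in> carrier B"
    and ce: "\<And>k. col_exact B J D k"
  shows "row_exact B J D k"
proof -
  interpret ring B by fact
  interpret op: ring "op_ring B" by (rule ring_op_ring[OF assms(1)])
  obtain l I d e where res: "injective_resolution_upto (op_ring B) (regular_module (op_ring B)) l I d e"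
  proof -
    have "{l. \<exists>I d e. injective_resolution_upto (op_ring B) (regular_module (op_ring B)) l I d e} \<noteq> {}"
      using dim unfolding right_inj_dim_def inj_dim_def by (metis (no_types, lifting) INF_empty top_enat_def less_irrefl)
    then show ?thesis using that by blast
  qed
  let ?N = "\<lambda>p. free (op_ring B) (J p)"
  let ?c = "\<lambda>p. vmul (op_ring B) (J p) (J (Suc p)) (mat_transpose (D p))"
  let ?d = "\<lambda>k. vmul B (J (Suc k)) (J k) (D k)"
  have tD: "mat_transpose (D p) s t \<in> carrier (op_ring B)" for p s t using D by (simp add: mat_transpose_def)
  have ch: "?c p \<in> module_hom (op_ring B) (?N p) (?N (Suc p))" for p
    by (rule op.vmul_hom[of "mat_transpose (D p)", OF tD])
  have ex: "?c (Suc p) y = \<zero>\<^bsub>?N (Suc (Suc p))\<^esub> \<longleftrightarrow> y \<in> ?c p ` carrier (?N p)"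
    if "y \<in> carrier (?N (Suc p))" for p y
    using ce[of p] that unfolding col_exact_def exact3_def by simp
  have dot: "dot (op_ring B) I y x = dot B I x y" for I :: "'i set" and x y
    by (simp add: dot_def)
  have adj: "dot B (J k) (?d k x) y = dot B (J (Suc k)) x (?c k y)"
    if "x \<in> vecs B (J (Suc k))" "y \<in> vecs B (J k)" for k x y
    by (rule dot_vmul[OF fin fin that D])
  show ?thesis unfolding row_exact_def exact3_def
  proof (intro ballI iffI)
    fix x assume x: "x \<in> vecs B (J (Suc k))" and x0: "?d k x = (\<lambda>_. \<zero>\<^bsub>B\<^esub>)"
    \<comment> \<open>Pairing with \<open>x\<close> is a linear form on columns; it kills the image
      of \<open>?c k\<close> because \<open>x\<close> is a cycle.\<close>
    have f: "(\<lambda>y. dot B (J (Suc k)) x y) \<in> module_hom (op_ring B) (?N (Suc k)) (regular_module (op_ring B))"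
      using op.dot_hom[of x "J (Suc k)"] x by (simp add: dot)
    have f0: "dot B (J (Suc k)) x (?c k y) = \<zero>\<^bsub>regular_module (op_ring B)\<^esub>" if "y \<in> carrier (?N k)" for y
      using adj[OF x, of y] x0 zero_dot[of y] that by simp
    \<comment> \<open>The form factors through \<open>?c (Suc k)\<close>, and its factor is the
      pairing with some row \<open>w\<close>. By adjunction \<open>w\<close> is the desired preimage
      of \<open>x\<close>.\<close>
    obtain g where g: "g \<in> module_hom (op_ring B) (?N (Suc (Suc k))) (regular_module (op_ring B))"
      "\<And>y. y \<in> carrier (?N (Suc k)) \<Longrightarrow> dot B (J (Suc k)) x y = g (?c (Suc k) y)"
      by (rule inj_res_dual_exact[where N="?N" and \<delta>="?c" and k=k, OF noeth left_module_regular[OF op.ring_axioms] res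
            op.free_fg_mod[OF fin] op.summand_free[OF fin] ch ex f f0]) blast+
    obtain w where w: "w \<in> vecs (op_ring B) (J (Suc (Suc k)))"
      "\<And>y. y \<in> vecs (op_ring B) (J (Suc (Suc k))) \<Longrightarrow> g y = dot (op_ring B) (J (Suc (Suc k))) y w"
      by (rule op.hom_eq_dot[OF fin g(1)]) blast
    have wB: "w \<in> vecs B (J (Suc (Suc k)))" using w(1) by simp
    have dw: "?d (Suc k) w \<in> vecs B (J (Suc k))" by (rule vmul_closed[of w _ "D (Suc k)", OF wB D])
    have "x = ?d (Suc k) w"
    proof (rule op.dot_ext[OF fin])
      show "x \<in> vecs (op_ring B) (J (Suc k))" "?d (Suc k) w \<in> vecs (op_ring B) (J (Suc k))"
        using x dw by simp_all
      fix y assume "y \<in> vecs (op_ring B) (J (Suc k))"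
      then have y: "y \<in> vecs B (J (Suc k))" by simp
      have cy: "?c (Suc k) y \<in> vecs B (J (Suc (Suc k)))"
        by (rule vmul_op_closed[of y _ "D (Suc k)", OF y D])
      show "dot (op_ring B) (J (Suc k)) y x = dot (op_ring B) (J (Suc k)) y (?d (Suc k) w)"
        using g(2)[of y] w(2)[of "?c (Suc k) y"] adj[OF wB y] y cy by (simp add: dot)
    qed
    then show "x \<in> ?d (Suc k) ` vecs B (J (Suc (Suc k)))" using wB by blast
  next
    fix x assume x: "x \<in> vecs B (J (Suc k))" and "x \<in> ?d (Suc k) ` vecs B (J (Suc (Suc k)))"
    then obtain w where w: "w \<in> vecs B (J (Suc (Suc k)))" "x = ?d (Suc k) w" by blast
    show "?d k x = (\<lambda>_. \<zero>\<^bsub>B\<^esub>)"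
    proof (rule op.dot_ext[OF fin])
      show "?d k x \<in> vecs (op_ring B) (J k)" using vmul_closed[of x _ "D k", OF x D] by simp
      show "(\<lambda>_. \<zero>\<^bsub>B\<^esub>) \<in> vecs (op_ring B) (J k)" using zero_vecs by simp
      fix y assume "y \<in> vecs (op_ring B) (J k)"
      then have y: "y \<in> vecs B (J k)" by simp
      have cy: "?c k y \<in> vecs B (J (Suc k))" by (rule vmul_op_closed[of y _ "D k", OF y D])
      have "?c (Suc k) (?c k y) = (\<lambda>_. \<zero>\<^bsub>B\<^esub>)" using ex[of "?c k y" k] cy y by simp
      then show "dot (op_ring B) (J k) y (?d k x) = dot (op_ring B) (J k) y (\<lambda>_. \<zero>\<^bsub>B\<^esub>)"
        using adj[OF x y] adj[OF w(1) cy] w(2) dot_zero[OF w(1)] zero_dot[OF y] by (simp add: dot)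
    qed
  qed
qed

section \<open>Gorenstein-projective modules\<close>

text \<open>The consequence of finite right injective dimension, isolated as a property of the ring.
  The definition has to fix the type of the index sets and takes \<open>nat\<close>; the lemma on
  injective dimension holds for every index type.\<close>

definition half_dual :: "('b, 'k) ring_scheme \<Rightarrow> bool" where
  "half_dual B \<longleftrightarrow> (\<forall>(J :: nat \<Rightarrow> nat set) D.
     (\<forall>k. finite (J k)) \<and> (\<forall>k s t. D k s t \<in> carrier B) \<and> (\<forall>k. col_exact B J D k) \<longrightarrow>
     (\<forall>k. row_exact B J D k))"

text \<open>The left half of a complete resolution is a projective resolution of \<open>G\<close>,
  and the duality clause is the exactness of its dual.\<close>

theorem Gproj_subset_CM:
  assumes noeth: "left_noetherian B"
  shows "Gproj B \<subseteq> CM B"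
proof
  interpret ring B using noeth by (simp add: left_noetherian_def)
  fix G assume G: "G \<in> Gproj B"
  let ?Y = "regular_module B"
  have Y: "left_module B ?Y" by (rule left_module_regular[OF ring_axioms])
  obtain P :: "int \<Rightarrow> 'a umodule" and d f where cpr: "complete_projective_resolution B P d"
    and f: "f \<in> module_hom B G ((P 0)\<lparr>carrier := a_kernel (P 0) (P 1) (d 0)\<rparr>)"
      "bij_betw f (carrier G) (a_kernel (P 0) (P 1) (d 0))"
    and Gfg: "G \<in> fg_mod B"
    using G unfolding Gproj_def module_iso_def by auto
  have lG: "left_module B G" using Gfg by (simp add: fg_mod_def)
  from cpr[unfolded complete_projective_resolution_def]
  have P: "\<forall>k. fg_projective B (P k)" and dh: "\<forall>k. d k \<in> module_hom B (P k) (P (k + 1))"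
    and ex: "\<forall>k. d k ` carrier (P k) = a_kernel (P (k + 1)) (P (k + 2)) (d (k + 1))"
    and dual: "\<forall>k. hom_pre (P (k + 1)) (d (k + 1)) ` carrier (hom_group B (P (k + 2)) ?Y) =
          kernel (hom_group B (P (k + 1)) ?Y) (hom_group B (P k) ?Y) (hom_pre (P k) (d k))"
    by - (elim conjE, assumption)+
  have sP: "summand B (P k)" for k using P fg_projective_summand by blast
  then have lP: "left_module B (P k)" for k by (simp add: summand_def)
  have ex': "d (k + 1) x = \<zero>\<^bsub>P (k + 2)\<^esub> \<longleftrightarrow> x \<in> d k ` carrier (P k)" if "x \<in> carrier (P (k + 1))" for k x
    using ex[rule_format, of k] that unfolding a_kernel_def' by blast
  let ?K = "(P 0)\<lparr>carrier := a_kernel (P 0) (P 1) (d 0)\<rparr>"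
  have K: "a_kernel (P 0) (P 1) (d 0) = d (-1) ` carrier (P (-1))"
    using ex[rule_format, of "-1"] by simp
  let ?g = "inv_into (carrier G) f"
  have g: "?g \<in> module_hom B ?K G" by (rule module_hom_inv_into[OF lG f(1)]) (use f(2) in simp)
  have gb: "bij_betw ?g (carrier ?K) (carrier G)" using bij_betw_inv_into[OF f(2)] by simp
  have d1: "d (-1) \<in> module_hom B (P (-1)) ?K"
    using dh[rule_format, of "-1"] K by (auto simp: module_hom_def)
  have lK: "left_module B ?K"
  proof (rule left_module_sub[OF lP])
    interpret D: module_homs B "P 0" "P 1" "d 0"
      using dh[rule_format, of 0] by (intro module_homsI lP) simp
    show "submodule (a_kernel (P 0) (P 1) (d 0)) B (P 0)"
      using D.kernel_submodule by (simp add: a_kernel_def')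
  qed
  interpret g: module_homs B ?K G ?g by (intro module_homsI lK lG g)
  \<comment> \<open>\<open>G\<close> is isomorphic to the image of \<open>d (-1)\<close>, so the
    resolution begins at \<open>P (-1)\<close> with augmentation given by \<open>d (-1)\<close>, and
    the degrees count downwards from there.\<close>
  define Q where "Q = (\<lambda>k. P (-1 - int k))"
  define \<delta> where "\<delta> = (\<lambda>k. d (-2 - int k))"
  have Q: "Q j = P (-3 - int j + 2)" "Q (Suc j) = P (-3 - int j + 1)" "Q (Suc (Suc j)) = P (-3 - int j)"
    "\<delta> j = d (-3 - int j + 1)" "\<delta> (Suc j) = d (-3 - int j)" for j
    unfolding Q_def \<delta>_def by (rule arg_cong[of _ _ P] arg_cong[of _ _ d]; simp)+
  have Q0: "Q 0 = P (-1)" "Q 1 = P (-2)" "\<delta> 0 = d (-2)" by (simp_all add: Q_def \<delta>_def)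
  have \<delta>h: "\<delta> k \<in> module_hom B (Q (Suc k)) (Q k)" for k
  proof -
    have "-3 - int k + 1 + 1 = -3 - int k + 2" by simp
    then show ?thesis using dh[rule_format, of "-3 - int k + 1"]
      unfolding Q(2)[of k] Q(1)[of k] Q(4)[of k] by (simp only:)
  qed
  let ?e = "\<lambda>x. ?g (d (-1) x)"
  have "proj_res B G Q \<delta> ?e"
    unfolding proj_res_def
  proof (intro conjI allI ballI)
    show "summand B (Q k)" for k unfolding Q_def by (rule sP)
    show "\<delta> k \<in> module_hom B (Q (Suc k)) (Q k)" for k by (rule \<delta>h)
    show "?e \<in> module_hom B (Q 0) G" unfolding Q0 by (rule module_hom_comp[OF d1 g])
    have "?e ` carrier (Q 0) = ?g ` (d (-1) ` carrier (P (-1)))" unfolding Q0 by (simp add: image_image)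
    also have "\<dots> = carrier G" using gb K by (simp add: bij_betw_def)
    finally show "?e ` carrier (Q 0) = carrier G" .
    fix x assume x: "x \<in> carrier (Q 0)"
    then have dx: "d (-1) x \<in> carrier ?K" using module_homD(1)[OF d1] Q0 by simp
    have "?e x = \<zero>\<^bsub>G\<^esub> \<longleftrightarrow> ?g (d (-1) x) = ?g \<zero>\<^bsub>?K\<^esub>" by (simp only: g.hom_zero)
    also have "\<dots> \<longleftrightarrow> d (-1) x = \<zero>\<^bsub>P 0\<^esub>"
      using inj_on_eq_iff[of ?g "carrier ?K" "d (-1) x" "\<zero>\<^bsub>?K\<^esub>"] gb dx g.M.M.zero_closed
      by (simp add: bij_betw_def)
    also have "\<dots> \<longleftrightarrow> x \<in> \<delta> 0 ` carrier (Q 1)"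
      using ex'[of x "-2"] x unfolding Q0 by simp
    finally show "?e x = \<zero>\<^bsub>G\<^esub> \<longleftrightarrow> x \<in> \<delta> 0 ` carrier (Q 1)" .
  next
    fix k x assume x: "x \<in> carrier (Q (Suc k))"
    then show "\<delta> k x = \<zero>\<^bsub>Q k\<^esub> \<longleftrightarrow> x \<in> \<delta> (Suc k) ` carrier (Q (Suc (Suc k)))"
      unfolding Q(2,3)[of k] Q(4,5)[of k] Q(1)[of k] by (rule ex')
  qed (rule lG)
  moreover have "hom_exact B Q \<delta> ?Y j" for j
  proof -
    \<comment> \<open>Term \<open>Suc j\<close> of the resolution is the middle one of the three
      terms of \<open>P\<close> that begin at \<open>?i\<close>.\<close>
    let ?i = "-3 - int j"
    have z: "d (?i + 1) (d ?i x) = \<zero>\<^bsub>P (?i + 2)\<^esub>" if "x \<in> carrier (P ?i)" for x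
      using ex'[of "d ?i x" ?i] module_homD(1)[OF dh[rule_format, of ?i] that] that by blast
    have h2: "d (?i + 1) \<in> module_hom B (P (?i + 1)) (P (?i + 2))"
      using dh[rule_format, of "?i + 1"] by (simp add: algebra_simps)
    show ?thesis
      unfolding hom_exact_def Q(2,3)[of j] Q(4,5)[of j] Q(1)[of j]
      using hom_pre_kernel_image(2)[of B "P ?i" "P (?i + 1)" "P (?i + 2)" ?Y "d ?i" "d (?i + 1)",
          OF lP lP lP Y dh[rule_format, of ?i] h2 z] dual[rule_format, of ?i]
      by blast
  qed
  ultimately show "G \<in> CM B" using CM_iff_hom_exact[OF noeth Gfg] by blast
qed

text \<open>
  The complete resolution of \<open>X\<close> is the dual of the sequence obtained by splicing the dual of a free
  resolution of \<open>X\<close> with a free resolution of its kernel, which is the dual of \<open>X\<close>.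
\<close>

theorem CM_subset_Gproj:
  assumes noeth: "left_noetherian B" and noeth': "left_noetherian (op_ring B)" and hd: "half_dual B"
  shows "CM B \<subseteq> Gproj B"
proof
  interpret ring B using noeth by (simp add: left_noetherian_def)
  interpret op: ring "op_ring B" by (rule ring_op_ring[OF ring_axioms])
  fix X assume XCM: "X \<in> CM B"
  then have X: "X \<in> fg_mod B" by (simp add: CM_def)
  then have lX: "left_module B X" by (simp add: fg_mod_def)
  obtain m :: "nat \<Rightarrow> nat" and D e where res: "mat_res B X (\<lambda>k. {..<m k}) D e"
    by (rule mat_res_exists[OF noeth X])
  have ce: "\<And>k. col_exact B (\<lambda>k. {..<m k}) D k"
    using CM_iff_col_exact[OF noeth X res] XCM by blast
  have D: "D k s t \<in> carrier B" for k s t using res by (simp add: mat_res_def)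
  have eh: "e \<in> module_hom B (free B {..<m 0}) X" and esurj: "e ` vecs B {..<m 0} = carrier X"
    and e0: "\<And>x. x \<in> vecs B {..<m 0} \<Longrightarrow> e x = \<zero>\<^bsub>X\<^esub> \<longleftrightarrow> x \<in> vmul B {..<m 1} {..<m 0} (D 0) ` vecs B {..<m 1}"
    using res by (simp_all add: mat_res_def)
  have tD: "mat_transpose (D p) s t \<in> carrier (op_ring B)" for p s t using D by (simp add: mat_transpose_def)
  let ?F0 = "free (op_ring B) {..<m 0}"
  let ?F1 = "free (op_ring B) {..<m 1}"
  let ?c0 = "vmul (op_ring B) {..<m 0} {..<m 1} (mat_transpose (D 0))"
  interpret C0: module_homs "op_ring B" ?F0 ?F1 ?c0
    by (intro module_homsI op.left_module_free op.vmul_hom[of "mat_transpose (D 0)", OF tD])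
  \<comment> \<open>The kernel of the first dual map is the dual of \<open>X\<close>, realised as
    columns.\<close>
  let ?S = "{y \<in> carrier ?F0. ?c0 y = \<zero>\<^bsub>?F1\<^esub>}"
  let ?X' = "?F0\<lparr>carrier := ?S\<rparr>"
  have "?X' \<in> fg_mod (op_ring B)"
    using left_module_sub[OF op.left_module_free C0.kernel_submodule]
      C0.M.fin_gen_sub_iff[OF C0.kernel_submodule]
      fg_sub_free_noetherian[OF noeth' C0.kernel_submodule]
    by (simp add: fg_mod_def)
  then obtain l :: "nat \<Rightarrow> nat" and L \<epsilon> where resL: "mat_res (op_ring B) ?X' (\<lambda>k. {..<l k}) L \<epsilon>"
    by (rule mat_res_exists[OF noeth'])
  have L: "L k s t \<in> carrier B" for k s t using resL by (simp add: mat_res_def)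
  have \<epsilon>h: "\<epsilon> \<in> module_hom (op_ring B) (free (op_ring B) {..<l 0}) ?X'"
    and \<epsilon>surj: "\<epsilon> ` vecs (op_ring B) {..<l 0} = ?S"
    and \<epsilon>0: "\<And>x. x \<in> vecs B {..<l 0} \<Longrightarrow>
      \<epsilon> x = (\<lambda>_. \<zero>\<^bsub>B\<^esub>) \<longleftrightarrow> x \<in> vmul (op_ring B) {..<l 1} {..<l 0} (L 0) ` vecs B {..<l 1}"
    using resL by (simp_all add: mat_res_def)
  have Lex: "row_exact (op_ring B) (\<lambda>k. {..<l k}) L k" for k using resL by (simp add: mat_res_def)
  have "\<epsilon> \<in> module_hom (op_ring B) (free (op_ring B) {..<l 0}) ?F0"
    using \<epsilon>h by (auto simp: module_hom_def)
  \<comment> \<open>The map at the splice: the augmentation onto the dual of \<open>X\<close>,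
    followed by the inclusion of that dual into columns, written as a matrix.\<close>
  then obtain E where E: "\<And>s t. E s t \<in> carrier (op_ring B)"
    "\<And>x. x \<in> vecs (op_ring B) {..<l 0} \<Longrightarrow> \<epsilon> x = vmul (op_ring B) {..<l 0} {..<m 0} E x"
    by (rule op.hom_free_eq_vmul[OF finite_lessThan]) blast
  \<comment> \<open>Degrees from 0 on carry the dual of the resolution of \<open>X\<close>, and
    degree \<open>-1 - j\<close> carries term \<open>j\<close> of the resolution of its dual. Thus
    \<open>M k\<close> leads from degree \<open>k\<close> to degree \<open>k + 1\<close>, with the
    splice at \<open>-1\<close>.\<close>
  define N :: "int \<Rightarrow> nat set" where "N = (\<lambda>k. if k \<ge> 0 then {..<m (nat k)} else {..<l (nat (-1 - k))})"
  define M :: "int \<Rightarrow> nat \<Rightarrow> nat \<Rightarrow> 'a" where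
    "M = (\<lambda>k. if k \<ge> 0 then mat_transpose (D (nat k)) else if k = -1 then E else L (nat (-2 - k)))"
  have fN: "finite (N k)" for k by (simp add: N_def)
  have Mc: "M k s t \<in> carrier B" for k s t using D L E(1) by (simp add: M_def mat_transpose_def)
  have cols: "exact3 (op_ring B) (N k) (N (k + 1)) (N (k + 2)) (M k) (M (k + 1))" for k
  proof -
    consider (pos) j where "k = int j" | (m1) "k = -1" | (m2) "k = -2" | (neg) j where "k = -3 - int j"
    proof -
      have "k \<ge> 0 \<or> k = -1 \<or> k = -2 \<or> k \<le> -3" by linarith
      moreover have "k = int (nat k)" if "k \<ge> 0" using that by simp
      moreover have "k = -3 - int (nat (-3 - k))" if "k \<le> -3" using that by simp
      ultimately show ?thesis using that by metis
    qed
    then show ?thesis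
    proof cases
      case pos
      have "nat (int j + 1) = Suc j" "nat (int j + 2) = Suc (Suc j)" by simp_all
      then show ?thesis using ce[of j] unfolding pos col_exact_def by (simp add: N_def M_def)
    next
      case m1
      have "exact3 (op_ring B) {..<l 0} {..<m 0} {..<m 1} E (mat_transpose (D 0))"
        unfolding exact3_def
      proof
        fix y assume y: "y \<in> vecs (op_ring B) {..<m 0}"
        have "vmul (op_ring B) {..<l 0} {..<m 0} E ` vecs (op_ring B) {..<l 0} = ?S"
          using E(2) \<epsilon>surj by (metis (no_types, lifting) image_cong)
        then show "?c0 y = (\<lambda>_. \<zero>\<^bsub>op_ring B\<^esub>) \<longleftrightarrow>
           y \<in> vmul (op_ring B) {..<l 0} {..<m 0} E ` vecs (op_ring B) {..<l 0}"
          using y by simp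
      qed
      then show ?thesis unfolding m1 by (simp add: N_def M_def)
    next
      case m2
      have "exact3 (op_ring B) {..<l 1} {..<l 0} {..<m 0} (L 0) E"
        unfolding exact3_def using E(2) \<epsilon>0 by simp
      then show ?thesis unfolding m2 by (simp add: N_def M_def)
    next
      case neg
      have n: "nat (-1 - (-3 - int j)) = Suc (Suc j)" "nat (-1 - (-3 - int j + 1)) = Suc j"
        "nat (-1 - (-3 - int j + 2)) = j" "nat (-2 - (-3 - int j)) = Suc j" "nat (-2 - (-3 - int j + 1)) = j"
        by simp_all
      have a: "\<not> (-3 - int j \<ge> 0)" "\<not> (-3 - int j + 1 \<ge> 0)" "\<not> (-3 - int j + 2 \<ge> 0)"
        "-3 - int j \<noteq> -1" "-3 - int j + 1 \<noteq> -1" by simp_all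
      show ?thesis using Lex[of j]
        unfolding neg row_exact_def N_def M_def by (simp only: n a if_False)
    qed
  qed
  have tM: "mat_transpose (M k) s t \<in> carrier B" for k s t using Mc by (simp add: mat_transpose_def)
  \<comment> \<open>\<open>half_dual\<close> concerns sequences bounded on one side, so it is
    applied to the truncation of the spliced complex at each \<open>k\<close> separately.\<close>
  have half: "col_exact B (\<lambda>i. N (k + int i)) (\<lambda>i. mat_transpose (M (k + int i))) i" for k i
    using cols[of "k + int i"] unfolding col_exact_def by (simp add: algebra_simps)
  have rows: "exact3 B (N (k + 2)) (N (k + 1)) (N k) (mat_transpose (M (k + 1))) (mat_transpose (M k))" for k
  proof -
    have "row_exact B (\<lambda>i. N (k + int i)) (\<lambda>i. mat_transpose (M (k + int i))) 0"
      using hd[unfolded half_dual_def, rule_format, of "\<lambda>i. N (k + int i)" "\<lambda>i. mat_transpose (M (k + int i))" 0]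
        fN tM half by blast
    then show ?thesis unfolding row_exact_def by simp
  qed
  \<comment> \<open>Dualising reverses the order. The shift by one puts the free module covering
    \<open>X\<close> into degree \<open>-1\<close>, so that \<open>X\<close> becomes the kernel of
    \<open>d 0\<close>.\<close>
  define P where "P = (\<lambda>k. free B (N (- k - 1)))"
  define d where "d = (\<lambda>k. vmul B (N (- k - 1)) (N (- k - 2)) (mat_transpose (M (- k - 2))))"
  have dc: "d k x \<in> vecs B (N (- k - 2))" if "x \<in> vecs B (N (- k - 1))" for k x
    unfolding d_def by (rule vmul_closed[of x _ "mat_transpose (M (- k - 2))", OF that tM])
  have dh: "d k \<in> module_hom B (P k) (P (k + 1))" for k
  proof -
    have "- (k + 1) - 1 = - k - 2" by simp
    then show ?thesis
      using vmul_hom[of "mat_transpose (M (- k - 2))" "N (- k - 1)" "N (- k - 2)", OF tM]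
      unfolding d_def P_def by (simp only:)
  qed
  have dex: "d (k + 1) x = (\<lambda>_. \<zero>\<^bsub>B\<^esub>) \<longleftrightarrow> x \<in> d k ` vecs B (N (- k - 1))" if "x \<in> vecs B (N (- k - 2))" for k x
  proof -
    have n: "- (k + 1) - 2 = - k - 3" "- (k + 1) - 1 = - k - 2" "- k - 3 + 1 = - k - 2" "- k - 3 + 2 = - k - 1"
      by simp_all
    show ?thesis
      using rows[of "- k - 3"] that unfolding exact3_def d_def n by blast
  qed
  have "complete_projective_resolution B P d"
    unfolding complete_projective_resolution_def
  proof (intro conjI allI)
    fix k
    show "fg_projective B (P k)" unfolding P_def by (rule free_fg_projective[OF fN])
    show "d k \<in> module_hom B (P k) (P (k + 1))" by (rule dh)
    have n: "- (k + 1) - 1 = - k - 2" "- (k + 2) - 1 = - k - 3" by simp_all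
    show "d k ` carrier (P k) = a_kernel (P (k + 1)) (P (k + 2)) (d (k + 1))"
      unfolding a_kernel_def' P_def n free_simps using dex[of _ k] dc[of _ k] by blast
    let ?Y = "regular_module B"
    have Y: "left_module B ?Y" by (rule left_module_regular[OF ring_axioms])
    have lP: "left_module B (P k)" for k unfolding P_def by (rule left_module_free)
    have z: "d (k + 1) (d k x) = \<zero>\<^bsub>P (k + 2)\<^esub>" if "x \<in> carrier (P k)" for x
      using dex[of "d k x" k] dc[of x k] that by (simp add: P_def)
    have h2: "d (k + 1) \<in> module_hom B (P (k + 1)) (P (k + 2))"
      using dh[of "k + 1"] by (simp add: algebra_simps)
    note ki = hom_pre_kernel_image[of B "P k" "P (k + 1)" "P (k + 2)" ?Y "d k" "d (k + 1)", OF lP lP lP Y dh[of k] h2 z]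
    \<comment> \<open>Dualising the new complex returns the column complex. The duality clause is
      therefore the exactness of the columns established above, read in the truncation at
      \<open>?a\<close>.\<close>
    let ?a = "- k - 3"
    have n2: "?a + int 0 = - k - 3" "?a + int (Suc 0) = - k - 2" "?a + int (Suc (Suc 0)) = - k - 1" by simp_all
    have n3: "- (k + 1) - 2 = - k - 3" by simp
    have he: "hom_exact B (\<lambda>i. free B (N (?a + int i)))
        (\<lambda>i. vmul B (N (?a + int (Suc i))) (N (?a + int i)) (mat_transpose (M (?a + int i)))) ?Y 0"
    proof (rule iffD2[OF hom_exact_iff_col_exact[where J="\<lambda>i. N (?a + int i)" and D="\<lambda>i. mat_transpose (M (?a + int i))"]])
      show "finite (N (?a + int i))" for i by (rule fN)
      show "mat_transpose (M (?a + int i)) s t \<in> carrier B" for i s t by (rule tM)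
      show "col_exact B (\<lambda>i. N (?a + int i)) (\<lambda>i. mat_transpose (M (?a + int i))) 0" by (rule half)
      fix x assume x: "x \<in> vecs B (N (?a + int (Suc (Suc 0))))"
      show "vmul B (N (?a + int (Suc 0))) (N (?a + int 0)) (mat_transpose (M (?a + int 0)))
         (vmul B (N (?a + int (Suc (Suc 0)))) (N (?a + int (Suc 0))) (mat_transpose (M (?a + int (Suc 0)))) x) = (\<lambda>_. \<zero>\<^bsub>B\<^esub>)"
        using z[of x] x unfolding n2 d_def P_def n n3 by simp
    qed
    have "\<forall>f\<in>module_hom B (P (k + 1)) ?Y. (\<forall>x\<in>carrier (P k). f (d k x) = \<zero>\<^bsub>?Y\<^esub>) \<longrightarrow>
        (\<exists>g\<in>module_hom B (P (k + 2)) ?Y. \<forall>x\<in>carrier (P (k + 1)). f x = g (d (k + 1) x))"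
      using he unfolding hom_exact_def n2 P_def d_def n n3 .
    with ki show "hom_pre (P (k + 1)) (d (k + 1)) ` carrier (hom_group B (P (k + 2)) ?Y) =
          kernel (hom_group B (P (k + 1)) ?Y) (hom_group B (P k) ?Y) (hom_pre (P k) (d k))" by blast
  qed
  moreover have "module_iso B X ((P 0)\<lparr>carrier := a_kernel (P 0) (P 1) (d 0)\<rparr>)"
  proof -
    have N01: "N 0 = {..<m 0}" "N 1 = {..<m 1}" by (simp_all add: N_def)
    have P1: "P (-1) = free B {..<m 0}" "P (-1 + 1) = P 0" by (simp_all add: P_def N01)
    have d1: "d (-1) \<in> module_hom B (free B {..<m 0}) (P 0)" using dh[of "-1"] unfolding P1 .
    have d2: "d (-2) = vmul B {..<m 1} {..<m 0} (D 0)" by (simp add: d_def N01 M_def)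
    have P0: "P 0 = free B (N (-1))" by (simp add: P_def)
    have d10: "d (-1) x = (\<lambda>_. \<zero>\<^bsub>B\<^esub>) \<longleftrightarrow> e x = \<zero>\<^bsub>X\<^esub>" if "x \<in> vecs B {..<m 0}" for x
      using dex[of x "-2"] that e0[OF that] by (simp add: N01 d2)
    \<comment> \<open>\<open>d (-1)\<close> and \<open>e\<close> have the same kernel, so
      \<open>d (-1)\<close> factors through \<open>e\<close> and identifies \<open>X\<close> with
      the image of \<open>d (-1)\<close>, which is the kernel of \<open>d 0\<close>.\<close>
    obtain f where f: "f \<in> module_hom B (X\<lparr>carrier := e ` carrier (free B {..<m 0})\<rparr>) (P 0)"
      "\<And>x. x \<in> carrier (free B {..<m 0}) \<Longrightarrow> f (e x) = d (-1) x"
      by (rule factor_through_image[OF left_module_free lX _ eh d1])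
        (use d10 in \<open>auto simp: P0 left_module_free\<close>)
    have ker: "a_kernel (P 0) (P 1) (d 0) = d (-1) ` vecs B {..<m 0}"
      using dex[of _ "-1"] dc[of _ "-1"] by (auto simp: a_kernel_def' P_def N01)
    interpret E: module_homs B "free B {..<m 0}" X e by (intro module_homsI left_module_free lX eh)
    have lP0: "left_module B (P 0)" unfolding P0 by (rule left_module_free)
    have fX: "f \<in> module_hom B X (P 0)" using f(1) esurj by (auto simp: module_hom_def)
    interpret F: module_homs B X "P 0" f by (intro module_homsI lP0 lX fX)
    have "f ` carrier X = (\<lambda>x. f (e x)) ` vecs B {..<m 0}" unfolding esurj[symmetric] by (simp add: image_image)
    also have "\<dots> = d (-1) ` vecs B {..<m 0}" using f(2) by (intro image_cong) simp_all
    finally have im: "f ` carrier X = a_kernel (P 0) (P 1) (d 0)" using ker by simp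
    have "inj_on f (carrier X)"
    proof (rule inj_onI)
      fix x y assume xy: "x \<in> carrier X" "y \<in> carrier X" "f x = f y"
      have "x \<ominus>\<^bsub>X\<^esub> y \<in> carrier X" using xy by simp
      then obtain z where z: "z \<in> vecs B {..<m 0}" "x \<ominus>\<^bsub>X\<^esub> y = e z" unfolding esurj[symmetric] by blast
      have "f (x \<ominus>\<^bsub>X\<^esub> y) = \<zero>\<^bsub>P 0\<^esub>" using xy by (simp add: F.hom_minus F.N.M.minus_self F.closed)
      then have "d (-1) z = (\<lambda>_. \<zero>\<^bsub>B\<^esub>)" using f(2)[of z] z by (simp add: P0)
      then have "x \<ominus>\<^bsub>X\<^esub> y = \<zero>\<^bsub>X\<^esub>" using d10[OF z(1)] z(2) by simp
      then show "x = y" using xy by (simp add: E.N.M.minus_eq_zero_iff)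
    qed
    then have "bij_betw f (carrier X) (a_kernel (P 0) (P 1) (d 0))" using im by (simp add: bij_betw_def)
    moreover have "f \<in> module_hom B X ((P 0)\<lparr>carrier := a_kernel (P 0) (P 1) (d 0)\<rparr>)"
      using fX im by (auto simp: module_hom_def)
    ultimately show ?thesis unfolding module_iso_def by (intro bexI[of _ f]) simp_all
  qed
  ultimately show "X \<in> Gproj B" using X unfolding Gproj_def by blast
qed

section \<open>Blocks of triangular complexes\<close>

text \<open>If the index sets split into \<open>U\<close> and \<open>L\<close> and the rows in
  \<open>U\<close> have no entries in columns of \<open>L\<close>, then the vectors on
  \<open>U\<close> form a subcomplex, and \<open>restr B L\<close> is the projection onto the
  quotient complex.\<close>

definition restr :: "('b, 'k) ring_scheme \<Rightarrow> 'i set \<Rightarrow> ('i \<Rightarrow> 'b) \<Rightarrow> 'i \<Rightarrow> 'b" where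
  "restr B S x = (\<lambda>s. if s \<in> S then x s else \<zero>\<^bsub>B\<^esub>)"

context ring begin

lemma restr_vecs: "x \<in> vecs R J \<Longrightarrow> restr R S x \<in> vecs R S"
  using vecsD[of x J] by (auto simp: restr_def vecs_def)

lemma restr_zero_iff:
  assumes "x \<in> vecs R (U \<union> L)" "U \<inter> L = {}"
  shows "restr R L x = (\<lambda>_. \<zero>) \<longleftrightarrow> x \<in> vecs R U"
  using assms vecsD[OF assms(1)] by (auto simp: restr_def vecs_def fun_eq_iff)

lemma vmul_sub:
  assumes "finite (U \<union> L)" "U' \<inter> L' = {}" and D: "\<And>s t. D s t \<in> carrier R"
    and D0: "\<And>u v. u \<in> U \<Longrightarrow> v \<in> L' \<Longrightarrow> D u v = \<zero>" and x: "x \<in> vecs R U" and "U \<inter> L = {}"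
  shows "vmul R (U \<union> L) (U' \<union> L') D x = vmul R U U' D x"
proof
  fix t
  have c: "x s \<in> carrier R" for s by (rule vecsD[OF x])
  have *: "(\<Oplus>s\<in>U \<union> L. x s \<otimes> D s t) = (\<Oplus>s\<in>U. x s \<otimes> D s t)"
    using assms vecs_out[OF x] c by (intro finsum_restrict_support) auto
  show "vmul R (U \<union> L) (U' \<union> L') D x t = vmul R U U' D x t"
  proof (cases "t \<in> L'")
    case True
    have "(\<Oplus>s\<in>U. x s \<otimes> D s t) = (\<Oplus>s\<in>U. \<zero>)" using True D0 c by (intro finsum_cong') auto
    then show ?thesis using True * assms(2) by (auto simp: vmul_def finsum_zero)
  qed (simp add: vmul_def *)
qed

lemma vmul_quot:
  assumes fin: "finite (U \<union> L)" and dis: "U \<inter> L = {}" and D: "\<And>s t. D s t \<in> carrier R"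
    and D0: "\<And>u v. u \<in> U \<Longrightarrow> v \<in> L' \<Longrightarrow> D u v = \<zero>" and x: "x \<in> vecs R (U \<union> L)"
  shows "restr R L' (vmul R (U \<union> L) (U' \<union> L') D x) = vmul R L L' D (restr R L x)"
proof
  fix t
  have c: "x s \<in> carrier R" for s by (rule vecsD[OF x])
  show "restr R L' (vmul R (U \<union> L) (U' \<union> L') D x) t = vmul R L L' D (restr R L x) t"
  proof (cases "t \<in> L'")
    case True
    have "(\<Oplus>s\<in>U \<union> L. x s \<otimes> D s t) = (\<Oplus>s\<in>L. x s \<otimes> D s t)"
      using fin D D0[OF _ True] c by (intro finsum_restrict_support) auto
    also have "\<dots> = (\<Oplus>s\<in>L. restr R L x s \<otimes> D s t)"
      using c D by (intro finsum_cong') (auto simp: restr_def)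
    finally show ?thesis using True by (simp add: restr_def vmul_def)
  qed (simp add: restr_def vmul_def)
qed

text \<open>The piece of the long exact sequence centred at the quotient. \<open>H\<close> says that
  the subcomplex injects into the full complex on homology one step further. It is a separate
  hypothesis since it has two sources: exactness of the subcomplex in general, and injectivity of
  \<open>\<phi> i\<close> in the lowest degree.\<close>

lemma exact3_quotient:
  assumes fin: "finite (U2 \<union> L2)" "finite (U1 \<union> L1)"
    and dis: "U2 \<inter> L2 = {}" "U1 \<inter> L1 = {}" "U0 \<inter> L0 = {}"
    and D: "\<And>s t. D s t \<in> carrier R" and E: "\<And>s t. E s t \<in> carrier R"
    and D0: "\<And>u v. u \<in> U2 \<Longrightarrow> v \<in> L1 \<Longrightarrow> D u v = \<zero>" and E0: "\<And>u v. u \<in> U1 \<Longrightarrow> v \<in> L0 \<Longrightarrow> E u v = \<zero>"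
    and full: "exact3 R (U2 \<union> L2) (U1 \<union> L1) (U0 \<union> L0) D E"
    and H: "\<And>y. y \<in> vecs R (U1 \<union> L1) \<Longrightarrow> vmul R (U1 \<union> L1) (U0 \<union> L0) E y \<in> vecs R U0 \<Longrightarrow>
      \<exists>z\<in>vecs R U1. vmul R U1 U0 E z = vmul R (U1 \<union> L1) (U0 \<union> L0) E y"
  shows "exact3 R L2 L1 L0 D E"
  unfolding exact3_def
proof (intro ballI iffI)
  let ?D = "vmul R (U2 \<union> L2) (U1 \<union> L1) D" and ?E = "vmul R (U1 \<union> L1) (U0 \<union> L0) E"
  note full' = full[unfolded exact3_def, rule_format]
  interpret F1: left_module R "free R (U1 \<union> L1)" by (rule left_module_free)
  interpret E: module_homs R "free R (U1 \<union> L1)" "free R (U0 \<union> L0)" ?E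
    by (intro module_homsI left_module_free vmul_hom E)
  {
    fix y assume y: "y \<in> vecs R L1" and y0: "vmul R L1 L0 E y = (\<lambda>_. \<zero>)"
    have yJ: "y \<in> vecs R (U1 \<union> L1)" using vecs_mono[OF y] by auto
    have ry: "restr R L1 y = y" using vecs_out[OF y] by (auto simp: restr_def fun_eq_iff)
    have Ey: "?E y \<in> vecs R (U0 \<union> L0)" by (rule vmul_closed[OF yJ E])
    have "restr R L0 (?E y) = (\<lambda>_. \<zero>)"
      using vmul_quot[where L'=L0 and D=E, OF fin(2) dis(2) E E0 yJ] ry y0 by simp
    then have "?E y \<in> vecs R U0" using restr_zero_iff[OF Ey dis(3)] by simp
    \<comment> \<open>A cycle of the quotient, seen in the full complex, has its boundary in the
      subcomplex; \<open>H\<close> provides a correction from the subcomplex that makes it a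
      cycle.\<close>
    from H[OF yJ this] obtain z where z: "z \<in> vecs R U1" "vmul R U1 U0 E z = ?E y" by blast
    have zJ: "z \<in> vecs R (U1 \<union> L1)" using vecs_mono[OF z(1)] by auto
    have Ez: "?E z = ?E y" using vmul_sub[where L'=L0 and U'=U0 and D=E, OF fin(2) dis(3) E E0 z(1) dis(2)] z(2) by simp
    let ?v = "y \<ominus>\<^bsub>free R (U1 \<union> L1)\<^esub> z"
    have v: "?v \<in> vecs R (U1 \<union> L1)" using F1.M.minus_closed[of y z] yJ zJ by simp
    have "?E ?v = \<zero>\<^bsub>free R (U0 \<union> L0)\<^esub>"
      using E.hom_minus[of y z] E.N.M.minus_self[of "?E y"] yJ zJ Ez Ey
      by (simp del: free_simps(2-))
    then obtain w where w: "w \<in> vecs R (U2 \<union> L2)" "?v = ?D w"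
      using full'[OF v] by auto
    have vs: "?v s = y s \<ominus> z s" for s
    proof -
      have "(\<ominus>\<^bsub>free R (U1 \<union> L1)\<^esub> z) = (\<lambda>s. \<ominus> z s)"
        using zJ vecsD[OF zJ] by (intro F1.M.minus_equality) (auto simp: l_neg vecs_def)
      then show ?thesis by (simp add: F1.M.minus_eq minus_eq)
    qed
    have "y = restr R L1 ?v"
    proof
      fix s show "y s = restr R L1 ?v s"
      proof (cases "s \<in> L1")
        case True
        then have "z s = \<zero>" using vecs_out[OF z(1)] dis(2) by blast
        then show ?thesis using True vecsD[OF y] unfolding restr_def vs by (simp add: minus_eq)
      qed (use vecs_out[OF y, of s] in \<open>simp add: restr_def\<close>)
    qed
    also have "\<dots> = vmul R L2 L1 D (restr R L2 w)"
      unfolding w(2) by (rule vmul_quot[OF fin(1) dis(1) D D0 w(1)])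
    finally show "y \<in> vmul R L2 L1 D ` vecs R L2" using restr_vecs[OF w(1)] by blast
  next
    fix y assume y: "y \<in> vecs R L1" and "y \<in> vmul R L2 L1 D ` vecs R L2"
    then obtain w where w: "w \<in> vecs R L2" "y = vmul R L2 L1 D w" by blast
    have wJ: "w \<in> vecs R (U2 \<union> L2)" using vecs_mono[OF w(1)] by auto
    have rw: "restr R L2 w = w" using vecs_out[OF w(1)] by (auto simp: restr_def fun_eq_iff)
    have Dw: "?D w \<in> vecs R (U1 \<union> L1)" by (rule vmul_closed[OF wJ D])
    have ry: "restr R L1 (?D w) = y"
      using vmul_quot[where L'=L1 and D=D, OF fin(1) dis(1) D D0 wJ] rw w(2) by simp
    have "?E (?D w) = (\<lambda>_. \<zero>)" using full'[OF Dw] wJ by blast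
    then show "vmul R L1 L0 E y = (\<lambda>_. \<zero>)"
      using vmul_quot[where L'=L0 and U'=U0 and D=E, OF fin(2) dis(2) E E0 Dw] ry by (simp add: restr_def)
  }
qed

text \<open>Exactness of the subcomplex one step further supplies the correction.\<close>

lemma exact3_quotient_of_exact:
  assumes fin: "finite (U2 \<union> L2)" "finite (U1 \<union> L1)" "finite (U0 \<union> L0)"
    and dis: "U2 \<inter> L2 = {}" "U1 \<inter> L1 = {}" "U0 \<inter> L0 = {}" "V \<inter> L = {}"
    and D: "\<And>s t. D s t \<in> carrier R" and E: "\<And>s t. E s t \<in> carrier R" and F: "\<And>s t. F s t \<in> carrier R"
    and D0: "\<And>u v. u \<in> U2 \<Longrightarrow> v \<in> L1 \<Longrightarrow> D u v = \<zero>" and E0: "\<And>u v. u \<in> U1 \<Longrightarrow> v \<in> L0 \<Longrightarrow> E u v = \<zero>"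
    and F0: "\<And>u v. u \<in> U0 \<Longrightarrow> v \<in> L \<Longrightarrow> F u v = \<zero>"
    and full: "exact3 R (U2 \<union> L2) (U1 \<union> L1) (U0 \<union> L0) D E"
    and full': "exact3 R (U1 \<union> L1) (U0 \<union> L0) (V \<union> L) E F"
    and sub: "exact3 R U1 U0 V E F"
  shows "exact3 R L2 L1 L0 D E"
proof (rule exact3_quotient[OF fin(1,2) dis(1-3) D E D0 E0 full])
  let ?E = "vmul R (U1 \<union> L1) (U0 \<union> L0) E"
  fix y assume y: "y \<in> vecs R (U1 \<union> L1)" and Ey: "?E y \<in> vecs R U0"
  have "?E y \<in> vecs R (U0 \<union> L0)" by (rule vmul_closed[OF y E])
  then have "vmul R (U0 \<union> L0) (V \<union> L) F (?E y) = (\<lambda>_. \<zero>)"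
    using full' y unfolding exact3_def by blast
  then have "vmul R U0 V F (?E y) = (\<lambda>_. \<zero>)"
    using vmul_sub[where L'=L and U'=V and D=F, OF fin(3) dis(4) F F0 Ey dis(3)] by simp
  then have "?E y \<in> vmul R U1 U0 E ` vecs R U1" using sub Ey unfolding exact3_def by blast
  then show "\<exists>z\<in>vecs R U1. vmul R U1 U0 E z = ?E y" by (elim imageE) (simp, metis)
qed

text \<open>The piece of the long exact sequence centred at the full complex. The vanishing of the
  composite is assumed for the whole, since the two diagonal blocks say nothing about the part of
  the composite from \<open>L\<close> to \<open>U\<close>.\<close>

lemma exact3_extension:
  assumes fin: "finite (U2 \<union> L2)" "finite (U1 \<union> L1)"
    and dis: "U2 \<inter> L2 = {}" "U1 \<inter> L1 = {}" "U0 \<inter> L0 = {}"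
    and D: "\<And>s t. D s t \<in> carrier R" and E: "\<And>s t. E s t \<in> carrier R"
    and D0: "\<And>u v. u \<in> U2 \<Longrightarrow> v \<in> L1 \<Longrightarrow> D u v = \<zero>" and E0: "\<And>u v. u \<in> U1 \<Longrightarrow> v \<in> L0 \<Longrightarrow> E u v = \<zero>"
    and comp: "\<And>x. x \<in> vecs R (U2 \<union> L2) \<Longrightarrow>
      vmul R (U1 \<union> L1) (U0 \<union> L0) E (vmul R (U2 \<union> L2) (U1 \<union> L1) D x) = (\<lambda>_. \<zero>)"
    and sub: "exact3 R U2 U1 U0 D E" and quot: "exact3 R L2 L1 L0 D E"
  shows "exact3 R (U2 \<union> L2) (U1 \<union> L1) (U0 \<union> L0) D E"
  unfolding exact3_def
proof (intro ballI iffI)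
  let ?D = "vmul R (U2 \<union> L2) (U1 \<union> L1) D" and ?E = "vmul R (U1 \<union> L1) (U0 \<union> L0) E"
  interpret F1: left_module R "free R (U1 \<union> L1)" by (rule left_module_free)
  interpret E: module_homs R "free R (U1 \<union> L1)" "free R (U0 \<union> L0)" ?E
    by (intro module_homsI left_module_free vmul_hom E)
  interpret D: module_homs R "free R (U2 \<union> L2)" "free R (U1 \<union> L1)" ?D
    by (intro module_homsI left_module_free vmul_hom D)
  fix y assume y: "y \<in> vecs R (U1 \<union> L1)" and Ey: "?E y = (\<lambda>_. \<zero>)"
  have "vmul R L1 L0 E (restr R L1 y) = (\<lambda>_. \<zero>)"
    using vmul_quot[where L'=L0 and U'=U0 and D=E, OF fin(2) dis(2) E E0 y] Ey by (simp add: restr_def)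
  then obtain w where w: "w \<in> vecs R L2" "restr R L1 y = vmul R L2 L1 D w"
    using quot restr_vecs[OF y] unfolding exact3_def by blast
  have wJ: "w \<in> vecs R (U2 \<union> L2)" using vecs_mono[OF w(1)] by auto
  have rw: "restr R L2 w = w" using vecs_out[OF w(1)] by (auto simp: restr_def fun_eq_iff)
  have Dw: "?D w \<in> vecs R (U1 \<union> L1)" by (rule vmul_closed[OF wJ D])
  have rD: "restr R L1 (?D w) = restr R L1 y"
    using vmul_quot[where L'=L1 and U'=U1 and D=D, OF fin(1) dis(1) D D0 wJ] rw w(2) by simp
  \<comment> \<open>Subtracting a boundary with the same projection to the quotient moves the cycle
    into the subcomplex.\<close>
  let ?v = "y \<ominus>\<^bsub>free R (U1 \<union> L1)\<^esub> ?D w"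
  have v: "?v \<in> vecs R (U1 \<union> L1)" using F1.M.minus_closed[of y "?D w"] y Dw by simp
  have vs: "?v s = y s \<ominus> ?D w s" for s
  proof -
    have "(\<ominus>\<^bsub>free R (U1 \<union> L1)\<^esub> ?D w) = (\<lambda>s. \<ominus> ?D w s)"
      using Dw vecsD[OF Dw] by (intro F1.M.minus_equality) (auto simp: l_neg vecs_def)
    then show ?thesis by (simp add: F1.M.minus_eq minus_eq)
  qed
  have "?v s = \<zero>" if "s \<in> L1" for s
    using fun_cong[OF rD, of s] that vecsD[OF y] vecsD[OF Dw] unfolding vs
    by (simp add: restr_def minus_self)
  then have "restr R L1 ?v = (\<lambda>_. \<zero>)" by (auto simp: restr_def)
  then have vU: "?v \<in> vecs R U1" using restr_zero_iff[OF v dis(2)] by simp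
  have "?E ?v = \<zero>\<^bsub>free R (U0 \<union> L0)\<^esub>"
    using E.hom_minus[of y "?D w"] E.N.M.minus_self[of "\<zero>\<^bsub>free R (U0 \<union> L0)\<^esub>"] y Dw Ey comp[OF wJ] zero_vecs[of "U0 \<union> L0"]
    by simp
  then have "vmul R U1 U0 E ?v = (\<lambda>_. \<zero>)"
    using vmul_sub[where L'=L0 and U'=U0 and D=E, OF fin(2) dis(3) E E0 vU dis(2)] by simp
  then obtain z where z: "z \<in> vecs R U2" "?v = vmul R U2 U1 D z"
    using sub vU unfolding exact3_def by blast
  have zJ: "z \<in> vecs R (U2 \<union> L2)" using vecs_mono[OF z(1)] by auto
  have Dz: "?D z = ?v" using vmul_sub[where L'=L1 and U'=U1 and D=D, OF fin(1) dis(2) D D0 z(1) dis(1)] z(2) by simp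
  have "y = ?D w \<oplus>\<^bsub>free R (U1 \<union> L1)\<^esub> ?v" using F1.M.add_minus_cancel[of y "?D w"] y Dw by (simp del: free_simps(2-))
  also have "\<dots> = ?D (w \<oplus>\<^bsub>free R (U2 \<union> L2)\<^esub> z)"
    using D.hom_add[of w z] wJ zJ Dz by (simp del: free_simps(2-))
  finally show "y \<in> ?D ` vecs R (U2 \<union> L2)"
    using D.M.M.a_closed[of w z] wJ zJ by (metis free_simps(1) imageI)
next
  fix y assume "y \<in> vmul R (U2 \<union> L2) (U1 \<union> L1) D ` vecs R (U2 \<union> L2)"
  then show "vmul R (U1 \<union> L1) (U0 \<union> L0) E y = (\<lambda>_. \<zero>)" using comp by blast
qed

lemma finsum_Times:
  assumes "finite I" "finite J" "\<And>s t. s \<in> I \<Longrightarrow> t \<in> J \<Longrightarrow> f (s, t) \<in> carrier R"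
  shows "(\<Oplus>p\<in>I \<times> J. f p) = (\<Oplus>s\<in>I. \<Oplus>t\<in>J. f (s, t))"
  using assms(1,3)
proof (induction I)
  case empty
  then show ?case by simp
next
  case (insert a I)
  have e: "insert a I \<times> J = (Pair a ` J) \<union> (I \<times> J)" by auto
  have "(\<Oplus>p\<in>insert a I \<times> J. f p) = (\<Oplus>p\<in>Pair a ` J. f p) \<oplus> (\<Oplus>p\<in>I \<times> J. f p)"
    unfolding e using insert assms(2) by (intro finsum_Un_disjoint) auto
  also have "(\<Oplus>p\<in>Pair a ` J. f p) = (\<Oplus>t\<in>J. f (a, t))"
    using insert.prems by (intro finsum_reindex) (auto simp: inj_on_def)
  finally show ?case
    using insert by (subst finsum_insert) (auto intro!: finsum_closed)
qed

end

text \<open>The maps \<open>r i\<close> identify vectors over \<open>B\<close> with families of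
  vectors over \<open>C\<close>, compatibly with the matrices, so exactness splits into coordinates.
  The abstract form covers rows and columns of triangular matrices at once; \<open>\<beta> i\<close>
  is the range left for the other matrix index.\<close>

lemma exact3_coordinates:
  assumes ring: "ring B" "ring C"
    and surj: "\<And>S z. (\<And>i. i \<in> Q \<Longrightarrow> z i \<in> vecs C (S \<times> \<beta> i)) \<Longrightarrow> \<exists>x\<in>vecs B S. \<forall>i\<in>Q. r i x = z i"
    and inj: "\<And>S x y. x \<in> vecs B S \<Longrightarrow> y \<in> vecs B S \<Longrightarrow> (\<And>i. i \<in> Q \<Longrightarrow> r i x = r i y) \<Longrightarrow> x = y"
    and mem: "\<And>S i x. x \<in> vecs B S \<Longrightarrow> i \<in> Q \<Longrightarrow> r i x \<in> vecs C (S \<times> \<beta> i)"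
    and zero: "\<And>i. r i (\<lambda>_. \<zero>\<^bsub>B\<^esub>) = (\<lambda>_. \<zero>\<^bsub>C\<^esub>)"
    and c: "\<And>s t. D s t \<in> carrier B" "\<And>s t. E s t \<in> carrier B"
    and D: "\<And>x i. x \<in> vecs B I \<Longrightarrow> i \<in> Q \<Longrightarrow> r i (vmul B I J D x) = vmul C (I \<times> \<beta> i) (J \<times> \<beta> i) D' (r i x)"
    and E: "\<And>x i. x \<in> vecs B J \<Longrightarrow> i \<in> Q \<Longrightarrow> r i (vmul B J K E x) = vmul C (J \<times> \<beta> i) (K \<times> \<beta> i) E' (r i x)"
  shows "exact3 B I J K D E \<longleftrightarrow> (\<forall>i\<in>Q. exact3 C (I \<times> \<beta> i) (J \<times> \<beta> i) (K \<times> \<beta> i) D' E')"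
proof
  interpret B: ring B by fact
  interpret C: ring C by fact
  note zv = B.zero_vecs C.zero_vecs
  have vE: "vmul B J K E y = (\<lambda>_. \<zero>\<^bsub>B\<^esub>) \<longleftrightarrow>
      (\<forall>i\<in>Q. vmul C (J \<times> \<beta> i) (K \<times> \<beta> i) E' (r i y) = (\<lambda>_. \<zero>\<^bsub>C\<^esub>))" if y: "y \<in> vecs B J" for y
  proof -
    have "vmul B J K E y = (\<lambda>_. \<zero>\<^bsub>B\<^esub>) \<longleftrightarrow> (\<forall>i\<in>Q. r i (vmul B J K E y) = r i (\<lambda>_. \<zero>\<^bsub>B\<^esub>))"
      using inj[OF B.vmul_closed[OF y c(2)] zv(1)] by auto
    then show ?thesis using E[OF y] zero by simp
  qed
  {
    assume ex: "exact3 B I J K D E"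
    show "\<forall>i\<in>Q. exact3 C (I \<times> \<beta> i) (J \<times> \<beta> i) (K \<times> \<beta> i) D' E'"
      unfolding exact3_def
    proof (intro ballI)
      fix i z assume i: "i \<in> Q" and z: "z \<in> vecs C (J \<times> \<beta> i)"
      \<comment> \<open>One coordinate is tested by filling all others with zero.\<close>
      obtain y where y: "y \<in> vecs B J" "\<And>j. j \<in> Q \<Longrightarrow> r j y = (if j = i then z else (\<lambda>_. \<zero>\<^bsub>C\<^esub>))"
      proof -
        have "\<exists>x\<in>vecs B J. \<forall>j\<in>Q. r j x = (if j = i then z else (\<lambda>_. \<zero>\<^bsub>C\<^esub>))"
          by (rule surj) (use z C.zero_vecs in auto)
        then show ?thesis using that by blast
      qed
      have E0: "vmul C (J \<times> \<beta> j) (K \<times> \<beta> j) E' (\<lambda>_. \<zero>\<^bsub>C\<^esub>) = (\<lambda>_. \<zero>\<^bsub>C\<^esub>)" if "j \<in> Q" for j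
      proof -
        have "vmul B J K E (\<lambda>_. \<zero>\<^bsub>B\<^esub>) = (\<lambda>_. \<zero>\<^bsub>B\<^esub>)"
          using c(2) by (simp add: vmul_def B.finsum_zero fun_eq_iff)
        then show ?thesis using E[OF zv(1) that] zero by simp
      qed
      have "vmul C (J \<times> \<beta> i) (K \<times> \<beta> i) E' z = (\<lambda>_. \<zero>\<^bsub>C\<^esub>) \<longleftrightarrow> vmul B J K E y = (\<lambda>_. \<zero>\<^bsub>B\<^esub>)"
        unfolding vE[OF y(1)] using y(2) i E0 by (metis (no_types, lifting))
      also have "\<dots> \<longleftrightarrow> y \<in> vmul B I J D ` vecs B I" using ex y(1) unfolding exact3_def by blast
      also have "\<dots> \<longleftrightarrow> z \<in> vmul C (I \<times> \<beta> i) (J \<times> \<beta> i) D' ` vecs C (I \<times> \<beta> i)"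
      proof
        assume "y \<in> vmul B I J D ` vecs B I"
        then obtain x where x: "x \<in> vecs B I" "y = vmul B I J D x" by blast
        then show "z \<in> vmul C (I \<times> \<beta> i) (J \<times> \<beta> i) D' ` vecs C (I \<times> \<beta> i)"
          using y(2)[OF i] D[OF x(1) i] mem[OF x(1) i] by auto
      next
        assume "z \<in> vmul C (I \<times> \<beta> i) (J \<times> \<beta> i) D' ` vecs C (I \<times> \<beta> i)"
        then obtain w where w: "w \<in> vecs C (I \<times> \<beta> i)" "z = vmul C (I \<times> \<beta> i) (J \<times> \<beta> i) D' w" by blast
        obtain x where x: "x \<in> vecs B I" "\<And>j. j \<in> Q \<Longrightarrow> r j x = (if j = i then w else (\<lambda>_. \<zero>\<^bsub>C\<^esub>))"
        proof -
          have "\<exists>x\<in>vecs B I. \<forall>j\<in>Q. r j x = (if j = i then w else (\<lambda>_. \<zero>\<^bsub>C\<^esub>))"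
            by (rule surj) (use w(1) C.zero_vecs in auto)
          then show ?thesis using that by blast
        qed
        have D0: "vmul C (I \<times> \<beta> j) (J \<times> \<beta> j) D' (\<lambda>_. \<zero>\<^bsub>C\<^esub>) = (\<lambda>_. \<zero>\<^bsub>C\<^esub>)" if "j \<in> Q" for j
        proof -
          have "vmul B I J D (\<lambda>_. \<zero>\<^bsub>B\<^esub>) = (\<lambda>_. \<zero>\<^bsub>B\<^esub>)"
            using c(1) by (simp add: vmul_def B.finsum_zero fun_eq_iff)
          then show ?thesis using D[OF zv(1) that] zero by simp
        qed
        have "y = vmul B I J D x"
        proof (rule inj[OF y(1) B.vmul_closed[OF x(1) c(1)]])
          fix j assume "j \<in> Q"
          then show "r j y = r j (vmul B I J D x)" using y(2) D[OF x(1)] x(2) w(2) D0 by simp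
        qed
        then show "y \<in> vmul B I J D ` vecs B I" using x(1) by blast
      qed
      finally show "vmul C (J \<times> \<beta> i) (K \<times> \<beta> i) E' z = (\<lambda>_. \<zero>\<^bsub>C\<^esub>) \<longleftrightarrow>
        z \<in> vmul C (I \<times> \<beta> i) (J \<times> \<beta> i) D' ` vecs C (I \<times> \<beta> i)" .
    qed
  }
  {
    assume ex: "\<forall>i\<in>Q. exact3 C (I \<times> \<beta> i) (J \<times> \<beta> i) (K \<times> \<beta> i) D' E'"
    show "exact3 B I J K D E" unfolding exact3_def
    proof
      fix y assume y: "y \<in> vecs B J"
      have "vmul B J K E y = (\<lambda>_. \<zero>\<^bsub>B\<^esub>) \<longleftrightarrow>
          (\<forall>i\<in>Q. r i y \<in> vmul C (I \<times> \<beta> i) (J \<times> \<beta> i) D' ` vecs C (I \<times> \<beta> i))"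
        unfolding vE[OF y] using ex mem[OF y] unfolding exact3_def by blast
      also have "\<dots> \<longleftrightarrow> y \<in> vmul B I J D ` vecs B I"
      proof
        assume "\<forall>i\<in>Q. r i y \<in> vmul C (I \<times> \<beta> i) (J \<times> \<beta> i) D' ` vecs C (I \<times> \<beta> i)"
        then have "\<forall>i\<in>Q. \<exists>w. w \<in> vecs C (I \<times> \<beta> i) \<and> r i y = vmul C (I \<times> \<beta> i) (J \<times> \<beta> i) D' w" by blast
        from bchoice[OF this] obtain w where w: "\<And>i. i \<in> Q \<Longrightarrow> w i \<in> vecs C (I \<times> \<beta> i)"
          "\<And>i. i \<in> Q \<Longrightarrow> r i y = vmul C (I \<times> \<beta> i) (J \<times> \<beta> i) D' (w i)" by blast
        obtain x where x: "x \<in> vecs B I" "\<And>i. i \<in> Q \<Longrightarrow> r i x = w i" using surj[OF w(1)] by blast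
        have "y = vmul B I J D x"
          by (rule inj[OF y B.vmul_closed[OF x(1) c(1)]]) (simp add: D[OF x(1)] w(2) x(2))
        then show "y \<in> vmul B I J D ` vecs B I" using x(1) by blast
      next
        assume "y \<in> vmul B I J D ` vecs B I"
        then obtain x where x: "x \<in> vecs B I" "y = vmul B I J D x" by blast
        then show "\<forall>i\<in>Q. r i y \<in> vmul C (I \<times> \<beta> i) (J \<times> \<beta> i) D' ` vecs C (I \<times> \<beta> i)"
          using D mem[OF x(1)] by auto
      qed
      finally show "vmul B J K E y = (\<lambda>_. \<zero>\<^bsub>B\<^esub>) \<longleftrightarrow> y \<in> vmul B I J D ` vecs B I" .
    qed
  }
qed

section \<open>Triangular matrix rings\<close>

lemma tri_ring_simps [simp]:
  "\<zero>\<^bsub>tri_ring n A\<^esub> = (\<lambda>i j. \<zero>\<^bsub>A\<^esub>)"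
  "a \<oplus>\<^bsub>tri_ring n A\<^esub> b = (\<lambda>i j. a i j \<oplus>\<^bsub>A\<^esub> b i j)"
  "a \<otimes>\<^bsub>tri_ring n A\<^esub> b = (\<lambda>i j. \<Oplus>\<^bsub>A\<^esub>k\<in>{1..n}. a i k \<otimes>\<^bsub>A\<^esub> b k j)"
  "\<one>\<^bsub>tri_ring n A\<^esub> = (\<lambda>i j. if i = j \<and> 1 \<le> i \<and> i \<le> n then \<one>\<^bsub>A\<^esub> else \<zero>\<^bsub>A\<^esub>)"
  by (simp_all add: tri_ring_def)

lemma tri_carrier_iff:
  "a \<in> carrier (tri_ring n A) \<longleftrightarrow>
     (\<forall>i j. a i j \<in> carrier A \<and> (\<not> (1 \<le> i \<and> i \<le> j \<and> j \<le> n) \<longrightarrow> a i j = \<zero>\<^bsub>A\<^esub>))"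
  by (simp add: tri_ring_def)

lemma tri_entry: "a \<in> carrier (tri_ring n A) \<Longrightarrow> a i j \<in> carrier A"
  by (simp add: tri_carrier_iff)

lemma tri_entry_zero: "a \<in> carrier (tri_ring n A) \<Longrightarrow> \<not> (1 \<le> i \<and> i \<le> j \<and> j \<le> n) \<Longrightarrow> a i j = \<zero>\<^bsub>A\<^esub>"
  by (simp add: tri_carrier_iff)

context ring begin

lemma tri_mult_closed:
  assumes a: "a \<in> carrier (tri_ring n R)" and b: "b \<in> carrier (tri_ring n R)"
  shows "a \<otimes>\<^bsub>tri_ring n R\<^esub> b \<in> carrier (tri_ring n R)"
  unfolding tri_carrier_iff tri_ring_simps
proof (intro allI conjI impI)
  note e = tri_entry[OF a] tri_entry[OF b]
  fix i j
  show "(\<Oplus>k\<in>{1..n}. a i k \<otimes> b k j) \<in> carrier R" using e by (intro finsum_closed) auto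
  assume ij: "\<not> (1 \<le> i \<and> i \<le> j \<and> j \<le> n)"
  have "a i k \<otimes> b k j = \<zero>" for k
  proof (cases "1 \<le> i \<and> i \<le> k \<and> k \<le> n")
    case True
    then have "b k j = \<zero>" using ij by (intro tri_entry_zero[OF b]) auto
    then show ?thesis using e by simp
  next
    case False
    then have "a i k = \<zero>" by (intro tri_entry_zero[OF a])
    then show ?thesis using e by simp
  qed
  then show "(\<Oplus>k\<in>{1..n}. a i k \<otimes> b k j) = \<zero>" by (simp add: finsum_zero)
qed

lemma tri_one_mult:
  assumes a: "a \<in> carrier (tri_ring n R)"
  shows "\<one>\<^bsub>tri_ring n R\<^esub> \<otimes>\<^bsub>tri_ring n R\<^esub> a = a" "a \<otimes>\<^bsub>tri_ring n R\<^esub> \<one>\<^bsub>tri_ring n R\<^esub> = a"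
proof -
  note e = tri_entry[OF a]
  show "\<one>\<^bsub>tri_ring n R\<^esub> \<otimes>\<^bsub>tri_ring n R\<^esub> a = a"
  proof (intro ext)
    fix i j
    have "(\<Oplus>k\<in>{1..n}. (if i = k \<and> 1 \<le> i \<and> i \<le> n then \<one> else \<zero>) \<otimes> a k j) =
       (\<Oplus>k\<in>{1..n}. if k = i then a k j else \<zero>)"
      using e by (intro finsum_cong') auto
    also have "\<dots> = a i j" using e tri_entry_zero[OF a, of i j] by (subst finsum_delta) auto
    finally show "(\<one>\<^bsub>tri_ring n R\<^esub> \<otimes>\<^bsub>tri_ring n R\<^esub> a) i j = a i j" by simp
  qed
  show "a \<otimes>\<^bsub>tri_ring n R\<^esub> \<one>\<^bsub>tri_ring n R\<^esub> = a"
  proof (intro ext)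
    fix i j
    have "(\<Oplus>k\<in>{1..n}. a i k \<otimes> (if k = j \<and> 1 \<le> k \<and> k \<le> n then \<one> else \<zero>)) =
       (\<Oplus>k\<in>{1..n}. if k = j then a i k else \<zero>)"
      using e by (intro finsum_cong') auto
    also have "\<dots> = a i j" using e tri_entry_zero[OF a, of i j] by (subst finsum_delta) auto
    finally show "(a \<otimes>\<^bsub>tri_ring n R\<^esub> \<one>\<^bsub>tri_ring n R\<^esub>) i j = a i j" by simp
  qed
qed

lemma tri_mult_assoc:
  assumes a: "a \<in> carrier (tri_ring n R)" and b: "b \<in> carrier (tri_ring n R)" and c: "c \<in> carrier (tri_ring n R)"
  shows "a \<otimes>\<^bsub>tri_ring n R\<^esub> b \<otimes>\<^bsub>tri_ring n R\<^esub> c = a \<otimes>\<^bsub>tri_ring n R\<^esub> (b \<otimes>\<^bsub>tri_ring n R\<^esub> c)"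
proof (intro ext)
  note e = tri_entry[OF a] tri_entry[OF b] tri_entry[OF c]
  fix i j
  have "(\<Oplus>k\<in>{1..n}. (\<Oplus>l\<in>{1..n}. a i l \<otimes> b l k) \<otimes> c k j) =
      (\<Oplus>k\<in>{1..n}. \<Oplus>l\<in>{1..n}. a i l \<otimes> b l k \<otimes> c k j)"
    using e by (intro finsum_cong') (auto intro!: finsum_ldistr finsum_closed)
  also have "\<dots> = (\<Oplus>l\<in>{1..n}. \<Oplus>k\<in>{1..n}. a i l \<otimes> b l k \<otimes> c k j)"
    using e by (intro finsum_swap) auto
  also have "\<dots> = (\<Oplus>l\<in>{1..n}. a i l \<otimes> (\<Oplus>k\<in>{1..n}. b l k \<otimes> c k j))"
  proof (rule finsum_cong')
    fix l assume "l \<in> {1..n}"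
    have "a i l \<otimes> (\<Oplus>k\<in>{1..n}. b l k \<otimes> c k j) = (\<Oplus>k\<in>{1..n}. a i l \<otimes> (b l k \<otimes> c k j))"
      using e by (intro finsum_rdistr) auto
    then show "(\<Oplus>k\<in>{1..n}. a i l \<otimes> b l k \<otimes> c k j) = a i l \<otimes> (\<Oplus>k\<in>{1..n}. b l k \<otimes> c k j)"
      using e by (simp add: m_assoc)
  qed (use e in \<open>auto intro!: finsum_closed\<close>)
  finally show "(a \<otimes>\<^bsub>tri_ring n R\<^esub> b \<otimes>\<^bsub>tri_ring n R\<^esub> c) i j = (a \<otimes>\<^bsub>tri_ring n R\<^esub> (b \<otimes>\<^bsub>tri_ring n R\<^esub> c)) i j"
    by simp
qed

lemma ring_tri_ring: "ring (tri_ring n R)"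
proof (rule ringI)
  show "abelian_group (tri_ring n R)"
  proof (rule abelian_groupI)
    fix a assume a: "a \<in> carrier (tri_ring n R)"
    then show "\<exists>b\<in>carrier (tri_ring n R). b \<oplus>\<^bsub>tri_ring n R\<^esub> a = \<zero>\<^bsub>tri_ring n R\<^esub>"
      by (intro bexI[of _ "\<lambda>i j. \<ominus> a i j"]) (auto simp: tri_carrier_iff l_neg)
  qed (auto simp: tri_carrier_iff a_ac)
  show "Group.monoid (tri_ring n R)"
  proof (rule monoidI)
    show "\<one>\<^bsub>tri_ring n R\<^esub> \<in> carrier (tri_ring n R)" by (simp add: tri_carrier_iff)
  qed (blast intro: tri_mult_closed, blast intro: tri_mult_assoc, (rule tri_one_mult, assumption)+)
  fix a b c assume a: "a \<in> carrier (tri_ring n R)" and b: "b \<in> carrier (tri_ring n R)" and c: "c \<in> carrier (tri_ring n R)"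
  note e = tri_entry[OF a] tri_entry[OF b] tri_entry[OF c]
  show "(a \<oplus>\<^bsub>tri_ring n R\<^esub> b) \<otimes>\<^bsub>tri_ring n R\<^esub> c = a \<otimes>\<^bsub>tri_ring n R\<^esub> c \<oplus>\<^bsub>tri_ring n R\<^esub> b \<otimes>\<^bsub>tri_ring n R\<^esub> c"
    using e by (auto simp: fun_eq_iff l_distr Pi_iff intro!: finsum_addf)
  show "c \<otimes>\<^bsub>tri_ring n R\<^esub> (a \<oplus>\<^bsub>tri_ring n R\<^esub> b) = c \<otimes>\<^bsub>tri_ring n R\<^esub> a \<oplus>\<^bsub>tri_ring n R\<^esub> c \<otimes>\<^bsub>tri_ring n R\<^esub> b"
    using e by (auto simp: fun_eq_iff r_distr Pi_iff intro!: finsum_addf)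
qed

lemma finsum_tri:
  assumes "f \<in> S \<rightarrow> carrier (tri_ring n R)"
  shows "finsum (tri_ring n R) f S i j = (\<Oplus>s\<in>S. f s i j)"
proof -
  interpret T: ring "tri_ring n R" by (rule ring_tri_ring)
  show ?thesis
    by (rule finsum_additive_map[where h="\<lambda>a. a i j"])
      (use assms in \<open>auto simp: T.abelian_monoid_axioms abelian_monoid_axioms tri_entry\<close>)
qed

end

text \<open>
  For \<open>C = A\<close> and \<open>C = op_ring A\<close> the scalar action is left, respectively right, multiplication by
  scalar matrices; this yields both chain conditions for \<open>T\<^sub>n(A)\<close>.
\<close>

definition tri_entries_module ::
  "nat \<Rightarrow> ('c, 'k) ring_scheme \<Rightarrow> ('c, nat \<Rightarrow> nat \<Rightarrow> 'c) module" where
  "tri_entries_module n C =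
     \<lparr>carrier = carrier (tri_ring n C), mult = undefined, one = undefined,
      zero = zero (tri_ring n C), add = add (tri_ring n C), smult = (\<lambda>c a i j. c \<otimes>\<^bsub>C\<^esub> a i j)\<rparr>"

text \<open>Listing the entries at the positions \<open>i \<le> j\<close> presents the module as the
  image of a finite free one.\<close>

lemma tri_entries_module_fg:
  assumes "ring C"
  shows "left_module C (tri_entries_module n C)" "fin_gen C (tri_entries_module n C)"
proof -
  interpret ring C by fact
  let ?M = "tri_entries_module n C"
  have s: "carrier ?M = carrier (tri_ring n C)" "\<zero>\<^bsub>?M\<^esub> = (\<lambda>i j. \<zero>\<^bsub>C\<^esub>)"
    "\<And>a b. a \<oplus>\<^bsub>?M\<^esub> b = (\<lambda>i j. a i j \<oplus>\<^bsub>C\<^esub> b i j)" "\<And>c a. c \<odot>\<^bsub>?M\<^esub> a = (\<lambda>i j. c \<otimes>\<^bsub>C\<^esub> a i j)"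
    by (simp_all add: tri_entries_module_def)
  show lM: "left_module C ?M"
  proof (rule left_moduleI)
    fix a assume "a \<in> carrier ?M"
    then show "\<exists>b\<in>carrier ?M. b \<oplus>\<^bsub>?M\<^esub> a = \<zero>\<^bsub>?M\<^esub>"
      by (intro bexI[of _ "\<lambda>i j. \<ominus>\<^bsub>C\<^esub> a i j"]) (auto simp: s tri_carrier_iff l_neg)
  qed (auto simp: s tri_carrier_iff ring_axioms a_ac l_distr r_distr m_assoc)
  let ?I = "{p \<in> {1..n} \<times> {1..n}. fst p \<le> snd p}"
  let ?h = "\<lambda>x i j. x (i, j)"
  have fI: "finite ?I" by simp
  have h: "?h \<in> module_hom C (free C ?I) ?M"
    by (rule module_homI) (auto simp: s tri_carrier_iff vecsD, auto simp: vecs_def)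
  have "?h ` carrier (free C ?I) = carrier ?M"
  proof
    show "?h ` carrier (free C ?I) \<subseteq> carrier ?M" using module_homD(1)[OF h] by blast
    show "carrier ?M \<subseteq> ?h ` carrier (free C ?I)"
    proof
      fix a assume a: "a \<in> carrier ?M"
      then have a: "a \<in> carrier (tri_ring n C)" by (simp add: s)
      have "a (fst p) (snd p) = \<zero>\<^bsub>C\<^esub>" if "p \<notin> ?I" for p
        using that by (intro tri_entry_zero[OF a]) (cases p; auto)
      then have "(\<lambda>p. a (fst p) (snd p)) \<in> carrier (free C ?I)"
        unfolding free_simps vecs_def using tri_entry[OF a] by blast
      then show "a \<in> ?h ` carrier (free C ?I)" by (rule rev_image_eqI) simp
    qed
  qed
  then show "fin_gen C ?M"
    using module_homs.fg_mod_image[OF module_homsI[OF left_module_free lM h]] free_fg_mod[OF fI]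
    by (simp add: fg_mod_def)
qed

lemma left_noetherian_tri_ring:
  assumes "left_noetherian A" shows "left_noetherian (tri_ring n A)"
proof -
  interpret ring A using assms by (simp add: left_noetherian_def)
  show ?thesis
  proof (rule left_noetherian_finite_extension[OF assms ring_tri_ring tri_entries_module_fg[OF ring_axioms, of n]])
    fix c a assume c: "c \<in> carrier A" and a: "a \<in> carrier (tri_ring n A)"
    \<comment> \<open>The scalar matrix of \<open>c\<close>, cut off outside \<open>{1..n}\<close>
      to stay in the carrier.\<close>
    let ?b = "\<lambda>i j. if i = j \<and> 1 \<le> i \<and> i \<le> n then c else \<zero>\<^bsub>A\<^esub>"
    show "\<exists>b\<in>carrier (tri_ring n A). c \<odot>\<^bsub>tri_entries_module n A\<^esub> a = b \<otimes>\<^bsub>tri_ring n A\<^esub> a"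
    proof
      show "?b \<in> carrier (tri_ring n A)" using c by (simp add: tri_carrier_iff)
      show "c \<odot>\<^bsub>tri_entries_module n A\<^esub> a = ?b \<otimes>\<^bsub>tri_ring n A\<^esub> a"
      proof (intro ext)
        fix i j
        have "(\<Oplus>\<^bsub>A\<^esub>k\<in>{1..n}. ?b i k \<otimes>\<^bsub>A\<^esub> a k j) = (\<Oplus>\<^bsub>A\<^esub>k\<in>{1..n}. if k = i then c \<otimes>\<^bsub>A\<^esub> a k j else \<zero>\<^bsub>A\<^esub>)"
          using c tri_entry[OF a] by (intro finsum_cong') auto
        also have "\<dots> = c \<otimes>\<^bsub>A\<^esub> a i j"
          using c tri_entry[OF a] tri_entry_zero[OF a, of i j] by (subst finsum_delta) auto
        finally show "(c \<odot>\<^bsub>tri_entries_module n A\<^esub> a) i j = (?b \<otimes>\<^bsub>tri_ring n A\<^esub> a) i j"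
          by (simp add: tri_entries_module_def)
      qed
    qed
  qed (simp_all add: tri_entries_module_def)
qed

lemma left_noetherian_op_tri_ring:
  assumes "ring A" "left_noetherian (op_ring A)" shows "left_noetherian (op_ring (tri_ring n A))"
proof -
  interpret ring A by fact
  interpret op: ring "op_ring A" by (rule ring_op_ring[OF ring_axioms])
  have cT: "carrier (tri_ring n (op_ring A)) = carrier (tri_ring n A)"
    by (auto simp: tri_carrier_iff)
  show ?thesis
  proof (rule left_noetherian_finite_extension[OF assms(2) ring_op_ring[OF ring_tri_ring] tri_entries_module_fg[OF op.ring_axioms, of n]])
    fix c a assume "c \<in> carrier (op_ring A)" and "a \<in> carrier (op_ring (tri_ring n A))"
    then have c: "c \<in> carrier A" and a: "a \<in> carrier (tri_ring n A)" by simp_all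
    let ?b = "\<lambda>i j. if i = j \<and> 1 \<le> i \<and> i \<le> n then c else \<zero>\<^bsub>A\<^esub>"
    show "\<exists>b\<in>carrier (op_ring (tri_ring n A)). c \<odot>\<^bsub>tri_entries_module n (op_ring A)\<^esub> a = b \<otimes>\<^bsub>op_ring (tri_ring n A)\<^esub> a"
    proof
      show "?b \<in> carrier (op_ring (tri_ring n A))" using c by (simp add: tri_carrier_iff)
      show "c \<odot>\<^bsub>tri_entries_module n (op_ring A)\<^esub> a = ?b \<otimes>\<^bsub>op_ring (tri_ring n A)\<^esub> a"
      proof (intro ext)
        fix i j
        have "(\<Oplus>\<^bsub>A\<^esub>k\<in>{1..n}. a i k \<otimes>\<^bsub>A\<^esub> ?b k j) = (\<Oplus>\<^bsub>A\<^esub>k\<in>{1..n}. if k = j then a i k \<otimes>\<^bsub>A\<^esub> c else \<zero>\<^bsub>A\<^esub>)"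
          using c tri_entry[OF a] by (intro finsum_cong') auto
        also have "\<dots> = a i j \<otimes>\<^bsub>A\<^esub> c"
          using c tri_entry[OF a] tri_entry_zero[OF a, of i j] by (subst finsum_delta) auto
        finally show "(c \<odot>\<^bsub>tri_entries_module n (op_ring A)\<^esub> a) i j = (?b \<otimes>\<^bsub>op_ring (tri_ring n A)\<^esub> a) i j"
          by (simp add: tri_entries_module_def)
      qed
    qed
  qed (simp_all add: tri_entries_module_def cT tri_ring_def op_ring_def)
qed

text \<open>
  A row vector over the matrix ring is the family of its rows \<open>i\<close>, a row vector over \<open>A\<close> supported
  on the columns \<open>j \<ge> i\<close>; a column vector is the family of its columns \<open>j\<close>, supported on the rows
  \<open>i \<le> j\<close>.  In both cases matrices act through the same matrix \<open>unfold_mat\<close> over \<open>A\<close>.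
\<close>

definition unfold_mat :: "('i \<Rightarrow> 'j \<Rightarrow> nat \<Rightarrow> nat \<Rightarrow> 'a) \<Rightarrow> 'i \<times> nat \<Rightarrow> 'j \<times> nat \<Rightarrow> 'a" where
  "unfold_mat D = (\<lambda>p q. D (fst p) (fst q) (snd p) (snd q))"

definition tri_row :: "nat \<Rightarrow> ('i \<Rightarrow> nat \<Rightarrow> nat \<Rightarrow> 'a) \<Rightarrow> 'i \<times> nat \<Rightarrow> 'a" where
  "tri_row i x = (\<lambda>p. x (fst p) i (snd p))"

definition tri_col :: "nat \<Rightarrow> ('i \<Rightarrow> nat \<Rightarrow> nat \<Rightarrow> 'a) \<Rightarrow> 'i \<times> nat \<Rightarrow> 'a" where
  "tri_col j x = (\<lambda>p. x (fst p) (snd p) j)"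

definition tri_of_rows :: "('c, 'k) ring_scheme \<Rightarrow> nat \<Rightarrow> (nat \<Rightarrow> 'i \<times> nat \<Rightarrow> 'c) \<Rightarrow> 'i \<Rightarrow> nat \<Rightarrow> nat \<Rightarrow> 'c" where
  "tri_of_rows A n z = (\<lambda>s i j. if i \<in> {1..n} then z i (s, j) else \<zero>\<^bsub>A\<^esub>)"

context ring begin

lemma tri_vecs_iff:
  "x \<in> vecs (tri_ring n R) S \<longleftrightarrow>
     (\<forall>s i j. x s i j \<in> carrier R \<and> (\<not> (s \<in> S \<and> 1 \<le> i \<and> i \<le> j \<and> j \<le> n) \<longrightarrow> x s i j = \<zero>))"
proof
  assume x: "x \<in> vecs (tri_ring n R) S"
  show "\<forall>s i j. x s i j \<in> carrier R \<and> (\<not> (s \<in> S \<and> 1 \<le> i \<and> i \<le> j \<and> j \<le> n) \<longrightarrow> x s i j = \<zero>)"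
  proof (intro allI)
    fix s i j
    show "x s i j \<in> carrier R \<and> (\<not> (s \<in> S \<and> 1 \<le> i \<and> i \<le> j \<and> j \<le> n) \<longrightarrow> x s i j = \<zero>)"
    proof (cases "s \<in> S")
      case True
      then have "x s \<in> carrier (tri_ring n R)" using x by (simp add: vecs_def)
      then show ?thesis using True by (auto simp: tri_carrier_iff)
    qed (use x in \<open>simp add: vecs_def\<close>)
  qed
next
  assume "\<forall>s i j. x s i j \<in> carrier R \<and> (\<not> (s \<in> S \<and> 1 \<le> i \<and> i \<le> j \<and> j \<le> n) \<longrightarrow> x s i j = \<zero>)"
  then show "x \<in> vecs (tri_ring n R) S" by (simp add: vecs_def tri_carrier_iff fun_eq_iff)
qed

lemma tri_row_vecs: "x \<in> vecs (tri_ring n R) S \<Longrightarrow> tri_row i x \<in> vecs R (S \<times> {i..n})"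
  unfolding tri_vecs_iff by (auto simp: tri_row_def vecs_def)

lemma tri_col_vecs: "x \<in> vecs (tri_ring n R) S \<Longrightarrow> tri_col j x \<in> vecs R (S \<times> {1..j})"
  unfolding tri_vecs_iff by (auto simp: tri_col_def vecs_def)

lemma tri_of_rows_vecs:
  assumes "\<And>i. i \<in> {1..n} \<Longrightarrow> z i \<in> vecs R (S \<times> {i..n})"
  shows "tri_of_rows R n z \<in> vecs (tri_ring n R) S" "i \<in> {1..n} \<Longrightarrow> tri_row i (tri_of_rows R n z) = z i"
  using assms vecsD[OF assms] unfolding tri_vecs_iff tri_of_rows_def
  by (auto simp: vecs_def tri_row_def fun_eq_iff)

lemma tri_row_inj:
  assumes "x \<in> vecs (tri_ring n R) S" "y \<in> vecs (tri_ring n R) S"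
    and "\<And>i. i \<in> {1..n} \<Longrightarrow> tri_row i x = tri_row i y"
  shows "x = y"
proof (intro ext)
  fix s i j
  show "x s i j = y s i j"
  proof (cases "i \<in> {1..n}")
    case True
    from fun_cong[OF assms(3)[OF this], of "(s, j)"] show ?thesis by (simp add: tri_row_def)
  next
    case False
    then have "x s i j = \<zero>" "y s i j = \<zero>"
      using assms(1,2) unfolding tri_vecs_iff by auto
    then show ?thesis by simp
  qed
qed

text \<open>Row \<open>i\<close> of a product depends only on row \<open>i\<close> of the left
  factor. Triangularity preserves its support \<open>{i..n}\<close>, so the remaining columns are
  dropped from the index sets.\<close>

lemma tri_row_vmul:
  fixes I :: "'i set" and J :: "'j set"
  assumes I: "finite I" and D: "\<And>s t. D s t \<in> carrier (tri_ring n R)" and x: "x \<in> vecs (tri_ring n R) I"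
    and i: "i \<in> {1..n}"
  shows "tri_row i (vmul (tri_ring n R) I J D x) =
     vmul R (I \<times> {i..n}) (J \<times> {i..n}) (unfold_mat D) (tri_row i x)"
proof
  interpret T: ring "tri_ring n R" by (rule ring_tri_ring)
  note e = tri_entry[OF T.vecsD[OF x]] tri_entry[OF D]
  have x0: "x s i j = \<zero>" if "\<not> (i \<le> j \<and> j \<le> n)" for s j using x that unfolding tri_vecs_iff by blast
  fix p :: "'j \<times> nat"
  obtain t k where p: "p = (t, k)" by (cases p)
  show "tri_row i (vmul (tri_ring n R) I J D x) p =
     vmul R (I \<times> {i..n}) (J \<times> {i..n}) (unfold_mat D) (tri_row i x) p"
  proof (cases "t \<in> J")
    case True
    have "tri_row i (vmul (tri_ring n R) I J D x) p = (\<Oplus>s\<in>I. \<Oplus>j\<in>{1..n}. x s i j \<otimes> D s t j k)"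
      using True D T.vecsD[OF x] T.m_closed[OF T.vecsD[OF x] D]
      by (simp add: tri_row_def vmul_def p finsum_tri Pi_iff del: tri_ring_simps(3)) simp
    also have "\<dots> = (\<Oplus>s\<in>I. \<Oplus>j\<in>{i..n}. x s i j \<otimes> D s t j k)"
      using e x0 i by (intro finsum_cong' finsum_restrict_support) (auto intro!: finsum_closed)
    also have "\<dots> = (\<Oplus>q\<in>I \<times> {i..n}. tri_row i x q \<otimes> unfold_mat D q p)"
      using e I by (subst finsum_Times) (auto simp: tri_row_def unfold_mat_def p)
    finally have eq: "tri_row i (vmul (tri_ring n R) I J D x) p =
        (\<Oplus>q\<in>I \<times> {i..n}. tri_row i x q \<otimes> unfold_mat D q p)" .
    show ?thesis
    proof (cases "k \<in> {i..n}")
      case False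
      have "vmul (tri_ring n R) I J D x \<in> vecs (tri_ring n R) J" by (rule T.vmul_closed[OF x D])
      then have "vmul (tri_ring n R) I J D x t i k = \<zero>" using False unfolding tri_vecs_iff by auto
      then show ?thesis using False by (auto simp: tri_row_def vmul_def[of R] p)
    qed (use True eq in \<open>simp add: vmul_def p\<close>)
  qed (simp add: tri_row_def vmul_def p)
qed

text \<open>Over the opposite ring the matrix multiplies from the left, so column \<open>j\<close>
  of the product depends only on column \<open>j\<close> of the vector, which is supported on the
  rows up to \<open>j\<close>.\<close>

lemma tri_col_vmul:
  fixes I :: "'i set" and J :: "'j set"
  assumes I: "finite I" and D: "\<And>s t. D s t \<in> carrier (tri_ring n R)" and y: "y \<in> vecs (tri_ring n R) I"
    and j: "j \<in> {1..n}"
  shows "tri_col j (vmul (op_ring (tri_ring n R)) I J D y) =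
     vmul (op_ring R) (I \<times> {1..j}) (J \<times> {1..j}) (mat_transpose (unfold_mat (mat_transpose D))) (tri_col j y)"
proof
  interpret T: ring "tri_ring n R" by (rule ring_tri_ring)
  interpret op: ring "op_ring (tri_ring n R)" by (rule ring_op_ring[OF ring_tri_ring])
  note e = tri_entry[OF T.vecsD[OF y]] tri_entry[OF D]
  have y0: "y s k j = \<zero>" if "\<not> (1 \<le> k \<and> k \<le> j)" for s k using y that unfolding tri_vecs_iff by blast
  fix p :: "'j \<times> nat"
  obtain t k where p: "p = (t, k)" by (cases p)
  show "tri_col j (vmul (op_ring (tri_ring n R)) I J D y) p =
     vmul (op_ring R) (I \<times> {1..j}) (J \<times> {1..j}) (mat_transpose (unfold_mat (mat_transpose D))) (tri_col j y) p"
  proof (cases "t \<in> J")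
    case True
    have "tri_col j (vmul (op_ring (tri_ring n R)) I J D y) p = (\<Oplus>s\<in>I. \<Oplus>l\<in>{1..n}. D s t k l \<otimes> y s l j)"
      using True D T.vecsD[OF y] T.m_closed[OF D T.vecsD[OF y]]
      by (simp add: tri_col_def vmul_def p finsum_tri Pi_iff del: tri_ring_simps(3)) simp
    also have "\<dots> = (\<Oplus>s\<in>I. \<Oplus>l\<in>{1..j}. D s t k l \<otimes> y s l j)"
      using e y0 j by (intro finsum_cong' finsum_restrict_support) (auto intro!: finsum_closed)
    also have "\<dots> = (\<Oplus>q\<in>I \<times> {1..j}. unfold_mat (mat_transpose D) p q \<otimes> tri_col j y q)"
      using e I by (subst finsum_Times) (auto simp: tri_col_def unfold_mat_def mat_transpose_def p)
    finally have eq: "tri_col j (vmul (op_ring (tri_ring n R)) I J D y) p =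
        (\<Oplus>q\<in>I \<times> {1..j}. unfold_mat (mat_transpose D) p q \<otimes> tri_col j y q)" .
    show ?thesis
    proof (cases "k \<in> {1..j}")
      case False
      have "vmul (op_ring (tri_ring n R)) I J D y \<in> vecs (op_ring (tri_ring n R)) J"
        by (rule op.vmul_closed) (use y D in simp_all)
      then have "vmul (op_ring (tri_ring n R)) I J D y \<in> vecs (tri_ring n R) J" by simp
      then have "vmul (op_ring (tri_ring n R)) I J D y t k j = \<zero>" using False unfolding tri_vecs_iff by auto
      then show ?thesis using False by (auto simp: tri_col_def vmul_def[of "op_ring R"] p)
    qed (use True eq in \<open>simp add: vmul_def p mat_transpose_def\<close>)
  qed (simp add: tri_col_def vmul_def p)
qed

lemma tri_exact3_rows:
  fixes I J K :: "'i set"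
  assumes fin: "finite I" "finite J" and D: "\<And>s t. D s t \<in> carrier (tri_ring n R)" "\<And>s t. E s t \<in> carrier (tri_ring n R)"
  shows "exact3 (tri_ring n R) I J K D E \<longleftrightarrow>
    (\<forall>i\<in>{1..n}. exact3 R (I \<times> {i..n}) (J \<times> {i..n}) (K \<times> {i..n}) (unfold_mat D) (unfold_mat E))"
proof (rule exact3_coordinates[where r=tri_row])
  fix S z assume "\<And>i. i \<in> {1..n} \<Longrightarrow> z i \<in> vecs R (S \<times> {i..n})"
  from tri_of_rows_vecs[OF this] show "\<exists>x\<in>vecs (tri_ring n R) S. \<forall>i\<in>{1..n}. tri_row i x = z i" by blast
qed (use fin D in \<open>auto simp: ring_tri_ring ring_axioms tri_row_vecs tri_row_vmul intro: tri_row_inj\<close>,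
     auto simp: tri_row_def)

lemma tri_exact3_cols:
  fixes I J K :: "'i set"
  assumes fin: "finite I" "finite J" and D: "\<And>s t. D s t \<in> carrier (tri_ring n R)" "\<And>s t. E s t \<in> carrier (tri_ring n R)"
  shows "exact3 (op_ring (tri_ring n R)) I J K (mat_transpose D) (mat_transpose E) \<longleftrightarrow>
    (\<forall>j\<in>{1..n}. exact3 (op_ring R) (I \<times> {1..j}) (J \<times> {1..j}) (K \<times> {1..j})
       (mat_transpose (unfold_mat D)) (mat_transpose (unfold_mat E)))"
proof (rule exact3_coordinates[where r=tri_col])
  have tD: "mat_transpose D s t \<in> carrier (tri_ring n R)" "mat_transpose E s t \<in> carrier (tri_ring n R)" for s t
    using D by (simp_all add: mat_transpose_def)
  then show "mat_transpose D s t \<in> carrier (op_ring (tri_ring n R))" "mat_transpose E s t \<in> carrier (op_ring (tri_ring n R))" for s t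
    by simp_all
  fix S z assume z: "\<And>i. i \<in> {1..n} \<Longrightarrow> z i \<in> vecs (op_ring R) (S \<times> {1..i})"
  have zc: "i \<in> {1..n} \<Longrightarrow> z i p \<in> carrier R" for i p using vecsD[of "z i"] z[of i] by simp
  show "\<exists>x\<in>vecs (op_ring (tri_ring n R)) S. \<forall>i\<in>{1..n}. tri_col i x = z i"
  proof (intro bexI ballI)
    let ?x = "\<lambda>s i j. if j \<in> {1..n} then z j (s, i) else \<zero>"
    show "?x \<in> vecs (op_ring (tri_ring n R)) S"
      using z zc unfolding vecs_op_ring tri_vecs_iff by (auto simp: vecs_def)
    fix i assume "i \<in> {1..n}"
    then show "tri_col i ?x = z i" by (simp add: tri_col_def)
  qed
next
  fix S x y assume xy: "x \<in> vecs (op_ring (tri_ring n R)) S" "y \<in> vecs (op_ring (tri_ring n R)) S"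
    and eq: "\<And>i. i \<in> {1..n} \<Longrightarrow> tri_col i x = tri_col i y"
  show "x = y"
  proof (intro ext)
    fix s i j
    show "x s i j = y s i j"
    proof (cases "j \<in> {1..n}")
      case True
      from fun_cong[OF eq[OF this], of "(s, i)"] show ?thesis by (simp add: tri_col_def)
    next
      case False
      then have "x s i j = \<zero>" "y s i j = \<zero>"
        using xy unfolding vecs_op_ring tri_vecs_iff by auto
      then show ?thesis by simp
    qed
  qed
next
  fix x i assume x: "x \<in> vecs (op_ring (tri_ring n R)) I" and i: "i \<in> {1..n}"
  show "tri_col i (vmul (op_ring (tri_ring n R)) I J (mat_transpose D) x) =
    vmul (op_ring R) (I \<times> {1..i}) (J \<times> {1..i}) (mat_transpose (unfold_mat D)) (tri_col i x)"
    using tri_col_vmul[where D="mat_transpose D", OF fin(1) _ _ i] x D by (simp add: mat_transpose_def)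
next
  fix x i assume x: "x \<in> vecs (op_ring (tri_ring n R)) J" and i: "i \<in> {1..n}"
  show "tri_col i (vmul (op_ring (tri_ring n R)) J K (mat_transpose E) x) =
    vmul (op_ring R) (J \<times> {1..i}) (K \<times> {1..i}) (mat_transpose (unfold_mat E)) (tri_col i x)"
    using tri_col_vmul[where D="mat_transpose E", OF fin(2) _ _ i] x D by (simp add: mat_transpose_def)
qed (auto simp: ring_tri_ring ring_op_ring ring_axioms tri_col_vecs[unfolded One_nat_def], auto simp: tri_col_def)

end

section \<open>Quotients and extensions of column blocks\<close>

context ring begin

text \<open>After transposition the initial block \<open>{1..i - 1}\<close> is a subcomplex of
  \<open>{1..q}\<close> with quotient \<open>{i..q}\<close>. The subcomplex is used one degree
  higher, so exactness in positive degrees is enough.\<close>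

lemma col_exact_quotient_block:
  fixes J :: "nat \<Rightarrow> 'i set" and D :: "nat \<Rightarrow> 'i \<Rightarrow> 'i \<Rightarrow> nat \<Rightarrow> nat \<Rightarrow> 'a"
  assumes fin: "\<And>k. finite (J k)" and D: "\<And>k s t. D k s t \<in> carrier (tri_ring n R)"
    and init: "\<And>q k. 1 \<le> q \<Longrightarrow> q \<le> n \<Longrightarrow> col_exact R (\<lambda>k. J k \<times> {1..q}) (\<lambda>k. unfold_mat (D k)) k"
    and iq: "1 \<le> i" "i \<le> q" "q \<le> n"
  shows "col_exact R (\<lambda>k. J k \<times> {i..q}) (\<lambda>k. unfold_mat (D k)) k"
\<comment> \<open>For \<open>i = 1\<close> the subcomplex would be the empty block, which is outside
  the range of \<open>init\<close>.\<close>
proof (cases "i = 1")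
  case True
  then show ?thesis using init[of q k] iq by simp
next
  case False
  interpret op: ring "op_ring R" by (rule ring_op_ring[OF ring_axioms])
  let ?U = "\<lambda>k. J k \<times> {1..i - 1}" and ?L = "\<lambda>k. J k \<times> {i..q}"
  have UL: "?U k \<union> ?L k = J k \<times> {1..q}" for k using False iq by auto
  have dis: "?U k \<inter> ?L k = {}" for k by auto
  have fUL: "finite (?U k \<union> ?L k)" for k using fin by simp
  have c: "mat_transpose (unfold_mat (D k)) s t \<in> carrier (op_ring R)" for k s t
    using tri_entry[OF D] by (simp add: mat_transpose_def unfold_mat_def)
  have z: "mat_transpose (unfold_mat (D k)) u v = \<zero>\<^bsub>op_ring R\<^esub>" if "u \<in> ?U l" "v \<in> ?L l'" for k l l' u v
  proof -
    have "\<not> snd v \<le> snd u" using that by auto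
    then show ?thesis
      using tri_entry_zero[OF D, of "snd v" "snd u" k "fst v" "fst u"]
      by (simp add: mat_transpose_def unfold_mat_def)
  qed
  have full: "exact3 (op_ring R) (?U k \<union> ?L k) (?U (Suc k) \<union> ?L (Suc k)) (?U (Suc (Suc k)) \<union> ?L (Suc (Suc k)))
      (mat_transpose (unfold_mat (D k))) (mat_transpose (unfold_mat (D (Suc k))))" for k
    using init[of q k] iq unfolding UL col_exact_def by simp
  have sub: "exact3 (op_ring R) (?U k) (?U (Suc k)) (?U (Suc (Suc k)))
      (mat_transpose (unfold_mat (D k))) (mat_transpose (unfold_mat (D (Suc k))))" for k
    using init[of "i - 1" k] False iq unfolding col_exact_def by simp
  show ?thesis unfolding col_exact_def
    by (rule op.exact3_quotient_of_exact[OF fUL fUL fUL dis dis dis dis c c c z z z full full sub])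
qed

text \<open>The block \<open>{Suc q}\<close> is the quotient of \<open>{1..Suc q}\<close> by the
  initial block \<open>{1..q}\<close>. On columns the composite vanishes because it is adjoint to
  the composite on rows, which is the subject of \<open>comp\<close>.\<close>

lemma col_exact_extension_block:
  fixes J :: "nat \<Rightarrow> 'i set" and D :: "nat \<Rightarrow> 'i \<Rightarrow> 'i \<Rightarrow> nat \<Rightarrow> nat \<Rightarrow> 'a"
  assumes fin: "\<And>k. finite (J k)" and D: "\<And>k s t. D k s t \<in> carrier (tri_ring n R)"
    and sub: "\<And>k. col_exact R (\<lambda>k. J k \<times> {1..q}) (\<lambda>k. unfold_mat (D k)) k"
    and quot: "\<And>k. col_exact R (\<lambda>k. J k \<times> {Suc q}) (\<lambda>k. unfold_mat (D k)) k"
    and comp: "\<And>k x. x \<in> vecs R (J (Suc (Suc k)) \<times> {1..Suc q}) \<Longrightarrow>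
       vmul R (J (Suc k) \<times> {1..Suc q}) (J k \<times> {1..Suc q}) (unfold_mat (D k))
         (vmul R (J (Suc (Suc k)) \<times> {1..Suc q}) (J (Suc k) \<times> {1..Suc q}) (unfold_mat (D (Suc k))) x) = (\<lambda>_. \<zero>)"
  shows "col_exact R (\<lambda>k. J k \<times> {1..Suc q}) (\<lambda>k. unfold_mat (D k)) k"
proof -
  interpret op: ring "op_ring R" by (rule ring_op_ring[OF ring_axioms])
  let ?U = "\<lambda>k. J k \<times> {1..q}" and ?L = "\<lambda>k. J k \<times> {Suc q}"
  have UL: "?U k \<union> ?L k = J k \<times> {1..Suc q}" for k by auto
  have dis: "?U k \<inter> ?L k = {}" for k by auto
  have fUL: "finite (?U k \<union> ?L k)" and fJ: "finite (J k \<times> {1..Suc q})" for k using fin by simp_all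
  have c': "unfold_mat (D k) s t \<in> carrier R" for k s t
    using tri_entry[OF D] by (simp add: unfold_mat_def)
  then have c: "mat_transpose (unfold_mat (D k)) s t \<in> carrier (op_ring R)" for k s t
    by (simp add: mat_transpose_def)
  have z: "mat_transpose (unfold_mat (D k)) u v = \<zero>\<^bsub>op_ring R\<^esub>" if "u \<in> ?U l" "v \<in> ?L l'" for k l l' u v
  proof -
    have "\<not> snd v \<le> snd u" using that by auto
    then show ?thesis
      using tri_entry_zero[OF D, of "snd v" "snd u" k "fst v" "fst u"]
      by (simp add: mat_transpose_def unfold_mat_def)
  qed
  have cz: "vmul (op_ring R) (?U (Suc k) \<union> ?L (Suc k)) (?U (Suc (Suc k)) \<union> ?L (Suc (Suc k))) (mat_transpose (unfold_mat (D (Suc k))))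
     (vmul (op_ring R) (?U k \<union> ?L k) (?U (Suc k) \<union> ?L (Suc k)) (mat_transpose (unfold_mat (D k))) y) = (\<lambda>_. \<zero>\<^bsub>op_ring R\<^esub>)"
    if "y \<in> vecs (op_ring R) (?U k \<union> ?L k)" for y
  proof -
    have y: "y \<in> vecs R (J k \<times> {1..Suc q})" using that unfolding UL vecs_op_ring .
    show ?thesis unfolding UL op_ring_simps by (rule op_comp_zero[OF fJ fJ fJ c' c' comp y])
  qed
  have "exact3 (op_ring R) (?U k \<union> ?L k) (?U (Suc k) \<union> ?L (Suc k)) (?U (Suc (Suc k)) \<union> ?L (Suc (Suc k)))
      (mat_transpose (unfold_mat (D k))) (mat_transpose (unfold_mat (D (Suc k))))"
    by (rule op.exact3_extension[OF fUL fUL dis dis dis c c z z cz])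
      (use sub[of k] quot[of k] in \<open>simp_all add: col_exact_def\<close>)
  then show ?thesis unfolding UL col_exact_def .
qed

end

text \<open>Exact columns over the matrix ring mean exact initial blocks over \<open>A\<close>.
  Their quotients include the blocks \<open>{i..n}\<close>; duality over \<open>A\<close> makes the
  rows of these exact, and they are the rows over the matrix ring. Unfolding turns indices into
  pairs, hence the index type in \<open>dual\<close>.\<close>

lemma half_dual_tri_ring:
  fixes A :: "('a, 'k) ring_scheme"
  assumes A: "ring A"
    and dual: "\<And>(J :: nat \<Rightarrow> (nat \<times> nat) set) D k. (\<And>k. finite (J k)) \<Longrightarrow>
      (\<And>k s t. D k s t \<in> carrier A) \<Longrightarrow> (\<And>k. col_exact A J D k) \<Longrightarrow> row_exact A J D k"
  shows "half_dual (tri_ring n A)"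
  unfolding half_dual_def
proof (intro allI impI, elim conjE)
  interpret ring A by fact
  fix J :: "nat \<Rightarrow> nat set" and D k
  assume fin: "\<forall>k. finite (J k)" and D: "\<forall>k s t. D k s t \<in> carrier (tri_ring n A)"
    and ce: "\<forall>k. col_exact (tri_ring n A) J D k"
  note fin = fin[rule_format] and D = D[rule_format]
  have init: "col_exact A (\<lambda>k. J k \<times> {1..q}) (\<lambda>k. unfold_mat (D k)) k" if "1 \<le> q" "q \<le> n" for q k
    using ce[rule_format, of k] that
    unfolding col_exact_def tri_exact3_cols[of "J k" "J (Suc k)" "D k" n "D (Suc k)", OF fin fin D D] by simp
  have "row_exact A (\<lambda>k. J k \<times> {i..n}) (\<lambda>k. unfold_mat (D k)) k" if "i \<in> {1..n}" for i
  proof (rule dual)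
    show "finite (J k \<times> {i..n})" for k using fin by simp
    show "unfold_mat (D k) s t \<in> carrier A" for k s t using tri_entry[OF D] by (simp add: unfold_mat_def)
    show "col_exact A (\<lambda>k. J k \<times> {i..n}) (\<lambda>k. unfold_mat (D k)) k" for k
      by (rule col_exact_quotient_block[OF fin D init]) (use that in auto)
  qed
  then show "row_exact (tri_ring n A) J D k"
    unfolding row_exact_def
      tri_exact3_rows[of "J (Suc (Suc k))" "J (Suc k)" "D (Suc k)" n "D k", OF fin fin D D] by blast
qed

section \<open>Cokernels by coset representatives\<close>

context left_module begin

text \<open>Cosets are compared through differences, which keeps the chosen elements out of the
  later arguments.\<close>

lemma coset_rep_props:
  assumes H: "submodule H R M" and y: "y \<in> carrier M"
  shows "coset_rep M H y \<in> carrier M" "coset_rep M H y \<ominus>\<^bsub>M\<^esub> y \<in> H"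
    and "y' \<in> carrier M \<Longrightarrow> coset_rep M H y = coset_rep M H y' \<longleftrightarrow> y \<ominus>\<^bsub>M\<^esub> y' \<in> H"
proof -
  note sd = submoduleD[OF H]
  have Hc: "h \<in> carrier M" if "h \<in> H" for h using that sd(1) by auto
  have cos: "z \<in> H +>\<^bsub>M\<^esub> y \<longleftrightarrow> z \<in> carrier M \<and> z \<ominus>\<^bsub>M\<^esub> y \<in> H" if y: "y \<in> carrier M" for z y
  proof
    assume "z \<in> H +>\<^bsub>M\<^esub> y"
    then obtain h where h: "h \<in> H" "z = h \<oplus>\<^bsub>M\<^esub> y" by (auto simp: a_r_coset_def')
    then have "z \<ominus>\<^bsub>M\<^esub> y = h" using Hc[OF h(1)] y by (simp add: M.minus_eq M.a_assoc M.r_neg)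
    then show "z \<in> carrier M \<and> z \<ominus>\<^bsub>M\<^esub> y \<in> H" using h Hc y by simp
  next
    assume z: "z \<in> carrier M \<and> z \<ominus>\<^bsub>M\<^esub> y \<in> H"
    then have "z = (z \<ominus>\<^bsub>M\<^esub> y) \<oplus>\<^bsub>M\<^esub> y" using y by (simp add: M.minus_add_cancel)
    then show "z \<in> H +>\<^bsub>M\<^esub> y" using z by (auto simp: a_r_coset_def')
  qed
  have "y \<in> H +>\<^bsub>M\<^esub> y" using cos[OF y] y sd(2) by (simp add: M.minus_self)
  then have rep: "coset_rep M H y \<in> H +>\<^bsub>M\<^esub> y" unfolding coset_rep_def by (rule someI)
  then show rc: "coset_rep M H y \<in> carrier M" "coset_rep M H y \<ominus>\<^bsub>M\<^esub> y \<in> H" using cos[OF y] by auto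
  assume y': "y' \<in> carrier M"
  have trans: "a \<ominus>\<^bsub>M\<^esub> c \<in> H" if "a \<ominus>\<^bsub>M\<^esub> b \<in> H" "b \<ominus>\<^bsub>M\<^esub> c \<in> H" "a \<in> carrier M" "b \<in> carrier M" "c \<in> carrier M" for a b c
  proof -
    have "(a \<ominus>\<^bsub>M\<^esub> b) \<oplus>\<^bsub>M\<^esub> (b \<ominus>\<^bsub>M\<^esub> c) = a \<ominus>\<^bsub>M\<^esub> c"
      using that(3-) by (simp add: M.minus_eq M.a_assoc M.r_neg2 M.r_neg1)
    then show ?thesis using sd(3)[OF that(1,2)] by simp
  qed
  have symm: "b \<ominus>\<^bsub>M\<^esub> a \<in> H" if "a \<ominus>\<^bsub>M\<^esub> b \<in> H" "a \<in> carrier M" "b \<in> carrier M" for a b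
  proof -
    have "\<ominus>\<^bsub>M\<^esub> (a \<ominus>\<^bsub>M\<^esub> b) = b \<ominus>\<^bsub>M\<^esub> a" using that(2,3) by (simp add: M.minus_eq M.minus_add M.a_comm)
    then show ?thesis using sd(5)[OF that(1)] by simp
  qed
  show "coset_rep M H y = coset_rep M H y' \<longleftrightarrow> y \<ominus>\<^bsub>M\<^esub> y' \<in> H"
  proof
    assume eq: "coset_rep M H y = coset_rep M H y'"
    have "y' \<in> H +>\<^bsub>M\<^esub> y'" using cos[OF y'] y' sd(2) by (simp add: M.minus_self)
    then have "coset_rep M H y' \<in> H +>\<^bsub>M\<^esub> y'" unfolding coset_rep_def by (rule someI)
    then have "coset_rep M H y \<ominus>\<^bsub>M\<^esub> y' \<in> H" using cos[OF y'] eq by simp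
    then show "y \<ominus>\<^bsub>M\<^esub> y' \<in> H" using trans[OF symm[OF rc(2,1) y]] rc y y' by blast
  next
    assume d: "y \<ominus>\<^bsub>M\<^esub> y' \<in> H"
    have "H +>\<^bsub>M\<^esub> y = H +>\<^bsub>M\<^esub> y'"
    proof (intro equalityI subsetI)
      fix z assume "z \<in> H +>\<^bsub>M\<^esub> y"
      then show "z \<in> H +>\<^bsub>M\<^esub> y'" using trans[of z y y', OF _ d _ y y'] by (simp add: cos y y')
    next
      fix z assume "z \<in> H +>\<^bsub>M\<^esub> y'"
      then show "z \<in> H +>\<^bsub>M\<^esub> y" using trans[of z y' y, OF _ symm[OF d y y'] _ y' y] by (simp add: cos y y')
    qed
    then show "coset_rep M H y = coset_rep M H y'" by (simp add: coset_rep_def)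
  qed
qed

text \<open>The operations of \<open>coker\<close> pass to the representative of the result. The
  module laws reduce to the fact that replacing arguments by their representatives stays within the
  coset, which is the content of \<open>add\<close> and \<open>sm\<close>.\<close>

lemma coker_module:
  assumes L: "left_module R L" and f: "f \<in> module_hom R L M"
  shows "left_module R (coker L M f)"
    and "coset_rep M (f ` carrier L) \<in> module_hom R M (coker L M f)"
    and "coset_rep M (f ` carrier L) ` carrier M = carrier (coker L M f)"
    and "y \<in> carrier M \<Longrightarrow> coset_rep M (f ` carrier L) y = \<zero>\<^bsub>coker L M f\<^esub> \<longleftrightarrow> y \<in> f ` carrier L"
proof -
  interpret f: module_homs R L M f by (intro module_homsI L left_module_axioms f)
  let ?H = "f ` carrier L" and ?C = "coker L M f"
  let ?r = "coset_rep M ?H"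
  have H: "submodule ?H R M" by (rule f.image_submodule[OF f.M.submodule_carrier])
  note sd = submoduleD[OF H]
  note rp = coset_rep_props[OF H]
  have s: "carrier ?C = ?r ` carrier M" "\<zero>\<^bsub>?C\<^esub> = ?r \<zero>\<^bsub>M\<^esub>"
    "\<And>x y. x \<oplus>\<^bsub>?C\<^esub> y = ?r (x \<oplus>\<^bsub>M\<^esub> y)" "\<And>a x. a \<odot>\<^bsub>?C\<^esub> x = ?r (a \<odot>\<^bsub>M\<^esub> x)"
    by (simp_all add: coker_def Let_def)
  have add: "?r (?r x \<oplus>\<^bsub>M\<^esub> ?r y) = ?r (x \<oplus>\<^bsub>M\<^esub> y)" if "x \<in> carrier M" "y \<in> carrier M" for x y
  proof -
    have "(?r x \<oplus>\<^bsub>M\<^esub> ?r y) \<ominus>\<^bsub>M\<^esub> (x \<oplus>\<^bsub>M\<^esub> y) = (?r x \<ominus>\<^bsub>M\<^esub> x) \<oplus>\<^bsub>M\<^esub> (?r y \<ominus>\<^bsub>M\<^esub> y)"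
      using that rp(1) by (simp add: M.minus_eq M.minus_add M.a_ac)
    also have "\<dots> \<in> ?H" by (rule sd(3)[OF rp(2)[OF that(1)] rp(2)[OF that(2)]])
    finally show ?thesis using rp(1,3) that by simp
  qed
  have sm: "?r (a \<odot>\<^bsub>M\<^esub> ?r x) = ?r (a \<odot>\<^bsub>M\<^esub> x)" if "a \<in> carrier R" "x \<in> carrier M" for a x
  proof -
    have "a \<odot>\<^bsub>M\<^esub> ?r x \<ominus>\<^bsub>M\<^esub> a \<odot>\<^bsub>M\<^esub> x = a \<odot>\<^bsub>M\<^esub> (?r x \<ominus>\<^bsub>M\<^esub> x)"
      using that rp(1) by (simp add: M.minus_eq smult_r_distr smult_r_minus)
    also have "\<dots> \<in> ?H" by (rule sd(4)[OF that(1) rp(2)[OF that(2)]])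
    finally show ?thesis using rp(1,3) that smult_closed by simp
  qed
  show lC: "left_module R ?C"
  proof (rule left_moduleI)
    fix u assume "u \<in> carrier ?C"
    then obtain x where x: "x \<in> carrier M" "u = ?r x" by (auto simp: s)
    then show "\<exists>v\<in>carrier ?C. v \<oplus>\<^bsub>?C\<^esub> u = \<zero>\<^bsub>?C\<^esub>"
      by (intro bexI[of _ "?r (\<ominus>\<^bsub>M\<^esub> x)"]) (auto simp: s add M.l_neg)
  next
    fix u v w assume "u \<in> carrier ?C" "v \<in> carrier ?C" "w \<in> carrier ?C"
    then obtain x y z where xyz: "x \<in> carrier M" "y \<in> carrier M" "z \<in> carrier M" "u = ?r x" "v = ?r y" "w = ?r z"
      by (auto simp: s)
    then show "u \<oplus>\<^bsub>?C\<^esub> v \<oplus>\<^bsub>?C\<^esub> w = u \<oplus>\<^bsub>?C\<^esub> (v \<oplus>\<^bsub>?C\<^esub> w)" by (simp add: s add M.a_assoc)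
  next
    fix u v assume "u \<in> carrier ?C" "v \<in> carrier ?C"
    then obtain x y where xy: "x \<in> carrier M" "y \<in> carrier M" "u = ?r x" "v = ?r y" by (auto simp: s)
    then show "u \<oplus>\<^bsub>?C\<^esub> v = v \<oplus>\<^bsub>?C\<^esub> u" "u \<oplus>\<^bsub>?C\<^esub> v \<in> carrier ?C" by (auto simp: s add M.a_comm)
    {
      fix a assume "a \<in> carrier R"
      then show "a \<odot>\<^bsub>?C\<^esub> (u \<oplus>\<^bsub>?C\<^esub> v) = a \<odot>\<^bsub>?C\<^esub> u \<oplus>\<^bsub>?C\<^esub> a \<odot>\<^bsub>?C\<^esub> v"
        using xy by (simp add: s add sm smult_closed smult_r_distr)
    }
  next
    fix a b u assume ab: "a \<in> carrier R" "b \<in> carrier R" "u \<in> carrier ?C"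
    then obtain x where x: "x \<in> carrier M" "u = ?r x" by (auto simp: s)
    then show "(a \<oplus> b) \<odot>\<^bsub>?C\<^esub> u = a \<odot>\<^bsub>?C\<^esub> u \<oplus>\<^bsub>?C\<^esub> b \<odot>\<^bsub>?C\<^esub> u"
      "(a \<otimes> b) \<odot>\<^bsub>?C\<^esub> u = a \<odot>\<^bsub>?C\<^esub> (b \<odot>\<^bsub>?C\<^esub> u)"
      using ab by (simp_all add: s add sm smult_closed smult_l_distr smult_assoc1)
  next
    fix u assume "u \<in> carrier ?C"
    then obtain x where x: "x \<in> carrier M" "u = ?r x" by (auto simp: s)
    then show "\<zero>\<^bsub>?C\<^esub> \<oplus>\<^bsub>?C\<^esub> u = u" "\<one> \<odot>\<^bsub>?C\<^esub> u = u"
      by (simp_all add: s add sm smult_one)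
  next
    fix a u assume "a \<in> carrier R" "u \<in> carrier ?C"
    then show "a \<odot>\<^bsub>?C\<^esub> u \<in> carrier ?C" using smult_closed by (auto simp: s sm)
  qed (auto simp: s R.ring_axioms)
  show "?r \<in> module_hom R M ?C" by (rule module_homI) (auto simp: s add sm)
  show "?r ` carrier M = carrier ?C" by (simp add: s)
  show "?r y = \<zero>\<^bsub>?C\<^esub> \<longleftrightarrow> y \<in> ?H" if "y \<in> carrier M"
  proof -
    have "y \<ominus>\<^bsub>M\<^esub> \<zero>\<^bsub>M\<^esub> = y" using M.minus_add_cancel[of y "\<zero>\<^bsub>M\<^esub>"] that by simp
    then show ?thesis using rp(3)[OF that M.zero_closed] by (simp add: s)
  qed
qed

end

section \<open>Representations as modules over the triangular matrix ring\<close>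

lemma path_map_self [simp]: "path_map \<phi> i i = id"
  by (simp add: path_map_def)

lemma path_map_Suc: assumes "i \<le> j" shows "path_map \<phi> i (Suc j) x = path_map \<phi> i j (\<phi> j x)"
proof -
  have f: "foldr (\<circ>) fs g = foldr (\<circ>) fs id \<circ> g" for fs :: "('a \<Rightarrow> 'a) list" and g
    by (induction fs) auto
  have "path_map \<phi> i (Suc j) = foldr (\<circ>) (map \<phi> [i..<j]) (\<phi> j)"
    using assms by (simp add: path_map_def)
  then show ?thesis by (subst (asm) f) (simp add: path_map_def)
qed

lemma path_map_trans:
  assumes "i \<le> j" "j \<le> k" shows "path_map \<phi> i j (path_map \<phi> j k x) = path_map \<phi> i k x"
  using assms(2)
proof (induction k arbitrary: x rule: dec_induct)
  case base
  then show ?case by simp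
next
  case (step k)
  then show ?case using assms(1) by (simp add: path_map_Suc)
qed

lemma tri_module_simps:
  "carrier (tri_module n (X, \<phi>)) = (\<Pi>\<^sub>E i\<in>{1..n}. carrier (X i))"
  "\<zero>\<^bsub>tri_module n (X, \<phi>)\<^esub> = (\<lambda>i\<in>{1..n}. \<zero>\<^bsub>X i\<^esub>)"
  "x \<oplus>\<^bsub>tri_module n (X, \<phi>)\<^esub> y = (\<lambda>i\<in>{1..n}. x i \<oplus>\<^bsub>X i\<^esub> y i)"
  "a \<odot>\<^bsub>tri_module n (X, \<phi>)\<^esub> x = (\<lambda>i\<in>{1..n}. (a i i \<odot>\<^bsub>X i\<^esub> x i) \<oplus>\<^bsub>X i\<^esub>
        (\<Oplus>\<^bsub>X i\<^esub>j\<in>{i<..n}. a i j \<odot>\<^bsub>X i\<^esub> path_map \<phi> i j (x j)))"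
  by simp_all

declare tri_module.simps [simp del]

text \<open>The elementary matrix with entry \<open>a\<close> in position \<open>(i, j)\<close>.
  Through these matrices the components and the structure maps are recovered from the
  module.\<close>

definition mat_unit :: "('a, 'k) ring_scheme \<Rightarrow> 'a \<Rightarrow> nat \<Rightarrow> nat \<Rightarrow> nat \<Rightarrow> nat \<Rightarrow> 'a" where
  "mat_unit A a i j = (\<lambda>p q. if p = i \<and> q = j then a else \<zero>\<^bsub>A\<^esub>)"

locale mor_object = ring A for A :: "('a, 'k) ring_scheme" (structure) +
  fixes n :: nat and X :: "nat \<Rightarrow> ('a, 'm) module" and \<phi> :: "nat \<Rightarrow> 'm \<Rightarrow> 'm"
  assumes X: "i \<in> {1..n} \<Longrightarrow> X i \<in> fg_mod A"
    and \<phi>: "1 \<le> i \<Longrightarrow> i < n \<Longrightarrow> \<phi> i \<in> module_hom A (X (Suc i)) (X i)"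
begin

abbreviation "T \<equiv> tri_ring n A"
abbreviation "M \<equiv> tri_module n (X, \<phi>)"

lemma lX: "i \<in> {1..n} \<Longrightarrow> left_module A (X i)"
  using X by (simp add: fg_mod_def)

lemma X_laws:
  assumes "i \<in> {1..n}"
  shows "u \<in> carrier (X i) \<Longrightarrow> v \<in> carrier (X i) \<Longrightarrow> u \<oplus>\<^bsub>X i\<^esub> v \<in> carrier (X i)"
    and "\<zero>\<^bsub>X i\<^esub> \<in> carrier (X i)"
    and "u \<in> carrier (X i) \<Longrightarrow> v \<in> carrier (X i) \<Longrightarrow> w \<in> carrier (X i) \<Longrightarrow>
      u \<oplus>\<^bsub>X i\<^esub> v \<oplus>\<^bsub>X i\<^esub> w = u \<oplus>\<^bsub>X i\<^esub> (v \<oplus>\<^bsub>X i\<^esub> w)"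
    and "u \<in> carrier (X i) \<Longrightarrow> v \<in> carrier (X i) \<Longrightarrow> u \<oplus>\<^bsub>X i\<^esub> v = v \<oplus>\<^bsub>X i\<^esub> u"
    and "u \<in> carrier (X i) \<Longrightarrow> \<zero>\<^bsub>X i\<^esub> \<oplus>\<^bsub>X i\<^esub> u = u"
    and "u \<in> carrier (X i) \<Longrightarrow> \<ominus>\<^bsub>X i\<^esub> u \<in> carrier (X i)"
    and "u \<in> carrier (X i) \<Longrightarrow> \<ominus>\<^bsub>X i\<^esub> u \<oplus>\<^bsub>X i\<^esub> u = \<zero>\<^bsub>X i\<^esub>"
proof -
  interpret Xi: left_module A "X i" by (rule lX[OF assms])
  show "u \<in> carrier (X i) \<Longrightarrow> v \<in> carrier (X i) \<Longrightarrow> u \<oplus>\<^bsub>X i\<^esub> v \<in> carrier (X i)"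
    "\<zero>\<^bsub>X i\<^esub> \<in> carrier (X i)"
    "u \<in> carrier (X i) \<Longrightarrow> v \<in> carrier (X i) \<Longrightarrow> w \<in> carrier (X i) \<Longrightarrow>
      u \<oplus>\<^bsub>X i\<^esub> v \<oplus>\<^bsub>X i\<^esub> w = u \<oplus>\<^bsub>X i\<^esub> (v \<oplus>\<^bsub>X i\<^esub> w)"
    "u \<in> carrier (X i) \<Longrightarrow> v \<in> carrier (X i) \<Longrightarrow> u \<oplus>\<^bsub>X i\<^esub> v = v \<oplus>\<^bsub>X i\<^esub> u"
    "u \<in> carrier (X i) \<Longrightarrow> \<zero>\<^bsub>X i\<^esub> \<oplus>\<^bsub>X i\<^esub> u = u"
    "u \<in> carrier (X i) \<Longrightarrow> \<ominus>\<^bsub>X i\<^esub> u \<in> carrier (X i)"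
    "u \<in> carrier (X i) \<Longrightarrow> \<ominus>\<^bsub>X i\<^esub> u \<oplus>\<^bsub>X i\<^esub> u = \<zero>\<^bsub>X i\<^esub>"
    by (auto simp: Xi.M.a_ac Xi.M.r_neg)
qed

lemma path_hom:
  assumes "1 \<le> i" "i \<le> j" "j \<le> n" shows "path_map \<phi> i j \<in> module_hom A (X j) (X i)"
  using assms(2,3)
proof (induction j rule: dec_induct)
  case base
  show ?case by (rule module_homI) auto
next
  case (step j)
  have "(\<lambda>x. path_map \<phi> i j (\<phi> j x)) \<in> module_hom A (X (Suc j)) (X i)"
    using step assms(1) by (intro module_hom_comp[OF \<phi>]) auto
  moreover have "path_map \<phi> i (Suc j) = (\<lambda>x. path_map \<phi> i j (\<phi> j x))"
    using step by (simp add: path_map_Suc fun_eq_iff)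
  ultimately show ?case by simp
qed

lemma path_homs:
  assumes "1 \<le> i" "i \<le> j" "j \<le> n" shows "module_homs A (X j) (X i) (path_map \<phi> i j)"
  by (rule module_homsI[OF lX lX path_hom]) (use assms in auto)

lemma path_closed: "1 \<le> i \<Longrightarrow> i \<le> j \<Longrightarrow> j \<le> n \<Longrightarrow> y \<in> carrier (X j) \<Longrightarrow> path_map \<phi> i j y \<in> carrier (X i)"
  by (rule module_homs.closed[OF path_homs])

lemma M_comp: "x \<in> carrier M \<Longrightarrow> i \<in> {1..n} \<Longrightarrow> x i \<in> carrier (X i)"
  by (auto simp: tri_module_simps)

lemma M_ext:
  assumes "x \<in> carrier M" "y \<in> carrier M" "\<And>i. i \<in> {1..n} \<Longrightarrow> x i = y i" shows "x = y"
  using assms unfolding tri_module_simps by (rule PiE_ext)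

text \<open>Since \<open>path_map \<phi> i i\<close> is the identity, the diagonal term joins the
  other summands, and all sums then run over \<open>{i..n}\<close>.\<close>

lemma M_smult:
  assumes a: "a \<in> carrier T" and x: "x \<in> carrier M" and i: "i \<in> {1..n}"
  shows "(a \<odot>\<^bsub>M\<^esub> x) i = (\<Oplus>\<^bsub>X i\<^esub>j\<in>{i..n}. a i j \<odot>\<^bsub>X i\<^esub> path_map \<phi> i j (x j))"
proof -
  interpret Xi: left_module A "X i" by (rule lX[OF i])
  have e: "{i..n} = insert i {i<..n}" using i by auto
  have "(\<Oplus>\<^bsub>X i\<^esub>j\<in>{i..n}. a i j \<odot>\<^bsub>X i\<^esub> path_map \<phi> i j (x j)) =
      a i i \<odot>\<^bsub>X i\<^esub> path_map \<phi> i i (x i) \<oplus>\<^bsub>X i\<^esub> (\<Oplus>\<^bsub>X i\<^esub>j\<in>{i<..n}. a i j \<odot>\<^bsub>X i\<^esub> path_map \<phi> i j (x j))"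
    unfolding e
    by (rule Xi.M.finsum_insert)
      (use i M_comp[OF x] tri_entry[OF a] in \<open>auto intro!: Xi.smult_closed path_closed\<close>)
  then show ?thesis using i by (simp add: tri_module_simps)
qed

lemma M_term_closed:
  assumes a: "a \<in> carrier T" and x: "x \<in> carrier M" and i: "1 \<le> i" "i \<le> j" "j \<le> n"
  shows "a i j \<odot>\<^bsub>X i\<^esub> path_map \<phi> i j (x j) \<in> carrier (X i)"
proof -
  interpret Xi: left_module A "X i" using i by (intro lX) simp
  show ?thesis using i M_comp[OF x, of j] tri_entry[OF a] by (auto intro!: Xi.smult_closed path_closed)
qed

lemma M_smult_closed:
  assumes a: "a \<in> carrier T" and x: "x \<in> carrier M" shows "a \<odot>\<^bsub>M\<^esub> x \<in> carrier M"
proof -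
  have "(a \<odot>\<^bsub>M\<^esub> x) i \<in> carrier (X i)" if i: "i \<in> {1..n}" for i
  proof -
    interpret Xi: left_module A "X i" by (rule lX[OF i])
    show ?thesis
      unfolding M_smult[OF a x i]
      using i M_term_closed[OF a x] by (intro Xi.M.finsum_closed) auto
  qed
  moreover have "(a \<odot>\<^bsub>M\<^esub> x) \<in> extensional {1..n}" by (simp add: tri_module_simps)
  ultimately show ?thesis by (auto simp: tri_module_simps(1) PiE_iff)
qed

lemma left_module_M: "left_module T M"
proof (rule left_moduleI)
  show "ring T" by (rule ring_tri_ring)
  show add: "x \<oplus>\<^bsub>M\<^esub> y \<in> carrier M" if "x \<in> carrier M" "y \<in> carrier M" for x y
    using X_laws(1)[OF _ M_comp[OF that(1)] M_comp[OF that(2)]] by (simp add: tri_module_simps)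
  show zero: "\<zero>\<^bsub>M\<^esub> \<in> carrier M" using X_laws(2) by (simp add: tri_module_simps)
  show "x \<oplus>\<^bsub>M\<^esub> y \<oplus>\<^bsub>M\<^esub> z = x \<oplus>\<^bsub>M\<^esub> (y \<oplus>\<^bsub>M\<^esub> z)"
    if "x \<in> carrier M" "y \<in> carrier M" "z \<in> carrier M" for x y z
    using X_laws(3)[OF _ M_comp[OF that(1)] M_comp[OF that(2)] M_comp[OF that(3)]]
    unfolding tri_module_simps by (intro restrict_ext) simp
  show "x \<oplus>\<^bsub>M\<^esub> y = y \<oplus>\<^bsub>M\<^esub> x" if "x \<in> carrier M" "y \<in> carrier M" for x y
    using X_laws(4)[OF _ M_comp[OF that(1)] M_comp[OF that(2)]]
    unfolding tri_module_simps by (intro restrict_ext) simp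
  show "\<zero>\<^bsub>M\<^esub> \<oplus>\<^bsub>M\<^esub> x = x" if x: "x \<in> carrier M" for x
    by (rule M_ext[OF add[OF zero x] x])
      (use X_laws(5)[OF _ M_comp[OF x]] in \<open>simp add: tri_module_simps\<close>)
  show "\<exists>y\<in>carrier M. y \<oplus>\<^bsub>M\<^esub> x = \<zero>\<^bsub>M\<^esub>" if x: "x \<in> carrier M" for x
  proof
    show "(\<lambda>i\<in>{1..n}. \<ominus>\<^bsub>X i\<^esub> x i) \<in> carrier M"
      using X_laws(6)[OF _ M_comp[OF x]] by (simp add: tri_module_simps)
    show "(\<lambda>i\<in>{1..n}. \<ominus>\<^bsub>X i\<^esub> x i) \<oplus>\<^bsub>M\<^esub> x = \<zero>\<^bsub>M\<^esub>"
      using X_laws(7)[OF _ M_comp[OF x]] unfolding tri_module_simps by (intro restrict_ext) simp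
  qed
  show "\<one>\<^bsub>T\<^esub> \<odot>\<^bsub>M\<^esub> x = x" if x: "x \<in> carrier M" for x
  proof (rule M_ext)
    have oT: "\<one>\<^bsub>T\<^esub> \<in> carrier T" using ring.ring_simprules(6)[OF ring_tri_ring] .
    show "\<one>\<^bsub>T\<^esub> \<odot>\<^bsub>M\<^esub> x \<in> carrier M" by (rule M_smult_closed[OF oT x])
    fix i assume i: "i \<in> {1..n}"
    interpret Xi: left_module A "X i" by (rule lX[OF i])
    have "(\<one>\<^bsub>T\<^esub> \<odot>\<^bsub>M\<^esub> x) i = (\<Oplus>\<^bsub>X i\<^esub>j\<in>{i..n}. if j = i then x j else \<zero>\<^bsub>X i\<^esub>)"
      unfolding M_smult[OF oT x i] using i M_comp[OF x]
      by (intro Xi.M.finsum_cong') (auto simp: Xi.smult_one intro!: Xi.smult_l_null path_closed)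
    also have "\<dots> = x i" using i M_comp[OF x] by (subst Xi.M.finsum_delta) auto
    finally show "(\<one>\<^bsub>T\<^esub> \<odot>\<^bsub>M\<^esub> x) i = x i" .
  qed (rule x)
  fix a x assume a: "a \<in> carrier T" and x: "x \<in> carrier M"
  note xc = M_comp[OF x]
  show "a \<odot>\<^bsub>M\<^esub> x \<in> carrier M" by (rule M_smult_closed[OF a x])
  {
    fix b assume b: "b \<in> carrier T"
    show "(a \<oplus>\<^bsub>T\<^esub> b) \<odot>\<^bsub>M\<^esub> x = a \<odot>\<^bsub>M\<^esub> x \<oplus>\<^bsub>M\<^esub> b \<odot>\<^bsub>M\<^esub> x"
    proof (rule M_ext)
      have ab: "a \<oplus>\<^bsub>T\<^esub> b \<in> carrier T" using ring.ring_simprules(1)[OF ring_tri_ring a b] .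
      show "(a \<oplus>\<^bsub>T\<^esub> b) \<odot>\<^bsub>M\<^esub> x \<in> carrier M" by (rule M_smult_closed[OF ab x])
      show "a \<odot>\<^bsub>M\<^esub> x \<oplus>\<^bsub>M\<^esub> b \<odot>\<^bsub>M\<^esub> x \<in> carrier M" by (intro add M_smult_closed a b x)
      fix i assume i: "i \<in> {1..n}"
      interpret Xi: left_module A "X i" by (rule lX[OF i])
      have "((a \<oplus>\<^bsub>T\<^esub> b) \<odot>\<^bsub>M\<^esub> x) i = (\<Oplus>\<^bsub>X i\<^esub>j\<in>{i..n}. a i j \<odot>\<^bsub>X i\<^esub> path_map \<phi> i j (x j) \<oplus>\<^bsub>X i\<^esub> b i j \<odot>\<^bsub>X i\<^esub> path_map \<phi> i j (x j))"
        unfolding M_smult[OF ab x i]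
        using i xc tri_entry[OF a] tri_entry[OF b]
        by (intro Xi.M.finsum_cong') (auto simp: Xi.smult_l_distr path_closed intro!: Xi.M.a_closed Xi.smult_closed path_closed)
      also have "\<dots> = (a \<odot>\<^bsub>M\<^esub> x) i \<oplus>\<^bsub>X i\<^esub> (b \<odot>\<^bsub>M\<^esub> x) i"
        unfolding M_smult[OF a x i] M_smult[OF b x i]
        using i M_term_closed[OF a x] M_term_closed[OF b x] by (intro Xi.M.finsum_addf) auto
      finally show "((a \<oplus>\<^bsub>T\<^esub> b) \<odot>\<^bsub>M\<^esub> x) i = (a \<odot>\<^bsub>M\<^esub> x \<oplus>\<^bsub>M\<^esub> b \<odot>\<^bsub>M\<^esub> x) i"
        using i by (simp add: tri_module_simps(3))
    qed
    show "(a \<otimes>\<^bsub>T\<^esub> b) \<odot>\<^bsub>M\<^esub> x = a \<odot>\<^bsub>M\<^esub> (b \<odot>\<^bsub>M\<^esub> x)"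
    proof (rule M_ext)
      have ab: "a \<otimes>\<^bsub>T\<^esub> b \<in> carrier T" by (rule tri_mult_closed[OF a b])
      show "(a \<otimes>\<^bsub>T\<^esub> b) \<odot>\<^bsub>M\<^esub> x \<in> carrier M" by (rule M_smult_closed[OF ab x])
      have bx: "b \<odot>\<^bsub>M\<^esub> x \<in> carrier M" by (rule M_smult_closed[OF b x])
      show "a \<odot>\<^bsub>M\<^esub> (b \<odot>\<^bsub>M\<^esub> x) \<in> carrier M" by (intro M_smult_closed a b x)
      fix i assume i: "i \<in> {1..n}"
      interpret Xi: left_module A "X i" by (rule lX[OF i])
      \<comment> \<open>Both sides are double sums of these terms, in different orders. On the
        right, triangularity of \<open>b\<close> confines \<open>k\<close> to \<open>{j..n}\<close>,
        and the path from \<open>k\<close> to \<open>j\<close> followed by the path from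
        \<open>j\<close> to \<open>i\<close> is the path from \<open>k\<close> to
        \<open>i\<close>.\<close>
      let ?g = "\<lambda>j k. a i j \<odot>\<^bsub>X i\<^esub> (b j k \<odot>\<^bsub>X i\<^esub> path_map \<phi> i k (x k))"
      note ea = tri_entry[OF a] and eb = tri_entry[OF b]
      have pc: "path_map \<phi> i k (x k) \<in> carrier (X i)" if "k \<in> {i..n}" for k
        using that i xc by (intro path_closed) auto
      have gc: "?g j k \<in> carrier (X i)" if "k \<in> {i..n}" for j k
        using pc[OF that] ea eb by (intro Xi.smult_closed)
      have "((a \<otimes>\<^bsub>T\<^esub> b) \<odot>\<^bsub>M\<^esub> x) i = (\<Oplus>\<^bsub>X i\<^esub>k\<in>{i..n}. \<Oplus>\<^bsub>X i\<^esub>j\<in>{i..n}. ?g j k)"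
        unfolding M_smult[OF ab x i]
      proof (rule Xi.M.finsum_cong')
        fix k assume k: "k \<in> {i..n}"
        have "(a \<otimes>\<^bsub>T\<^esub> b) i k = (\<Oplus>j\<in>{i..n}. a i j \<otimes> b j k)"
          unfolding tri_ring_simps
          using i ea eb tri_entry_zero[OF a, of i] by (intro finsum_restrict_support) auto
        then have "(a \<otimes>\<^bsub>T\<^esub> b) i k \<odot>\<^bsub>X i\<^esub> path_map \<phi> i k (x k) =
            (\<Oplus>\<^bsub>X i\<^esub>j\<in>{i..n}. (a i j \<otimes> b j k) \<odot>\<^bsub>X i\<^esub> path_map \<phi> i k (x k))"
          using pc[OF k] ea eb by (simp add: Xi.finsum_smult Pi_iff)
        also have "\<dots> = (\<Oplus>\<^bsub>X i\<^esub>j\<in>{i..n}. ?g j k)"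
          using pc[OF k] ea eb gc[OF k] by (intro Xi.M.finsum_cong') (auto simp: Xi.smult_assoc1)
        finally show "(a \<otimes>\<^bsub>T\<^esub> b) i k \<odot>\<^bsub>X i\<^esub> path_map \<phi> i k (x k) = (\<Oplus>\<^bsub>X i\<^esub>j\<in>{i..n}. ?g j k)" .
      qed (use gc in \<open>auto intro!: Xi.M.finsum_closed\<close>)
      also have "\<dots> = (\<Oplus>\<^bsub>X i\<^esub>j\<in>{i..n}. \<Oplus>\<^bsub>X i\<^esub>k\<in>{i..n}. ?g j k)"
        using gc by (intro Xi.M.finsum_swap) auto
      also have "\<dots> = (a \<odot>\<^bsub>M\<^esub> (b \<odot>\<^bsub>M\<^esub> x)) i"
        unfolding M_smult[OF a bx i]
      proof (rule Xi.M.finsum_cong')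
        fix j assume j: "j \<in> {i..n}"
        then have jn: "j \<in> {1..n}" using i by auto
        interpret Xj: left_module A "X j" by (rule lX[OF jn])
        interpret P: module_homs A "X j" "X i" "path_map \<phi> i j" using i j by (intro path_homs) auto
        have pj: "path_map \<phi> j k (x k) \<in> carrier (X j)" if "k \<in> {j..n}" for k
          using that jn xc by (intro path_closed) auto
        have "(\<Oplus>\<^bsub>X i\<^esub>k\<in>{i..n}. ?g j k) = (\<Oplus>\<^bsub>X i\<^esub>k\<in>{j..n}. ?g j k)"
        proof (rule Xi.M.finsum_restrict_support)
          fix k assume k: "k \<in> {i..n}" "k \<notin> {j..n}"
          then have "b j k = \<zero>" by (intro tri_entry_zero[OF b]) auto
          then show "?g j k = \<zero>\<^bsub>X i\<^esub>" using pc[OF k(1)] ea by (simp add: Xi.smult_l_null Xi.smult_r_null)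
        qed (use j gc in auto)
        also have "\<dots> = a i j \<odot>\<^bsub>X i\<^esub> (\<Oplus>\<^bsub>X i\<^esub>k\<in>{j..n}. b j k \<odot>\<^bsub>X i\<^esub> path_map \<phi> i k (x k))"
          using j ea eb pc by (intro Xi.smult_finsum[symmetric]) (auto intro!: Xi.smult_closed)
        also have "(\<Oplus>\<^bsub>X i\<^esub>k\<in>{j..n}. b j k \<odot>\<^bsub>X i\<^esub> path_map \<phi> i k (x k)) =
            (\<Oplus>\<^bsub>X i\<^esub>k\<in>{j..n}. path_map \<phi> i j (b j k \<odot>\<^bsub>X j\<^esub> path_map \<phi> j k (x k)))"
        proof (rule Xi.M.finsum_cong')
          fix k assume k: "k \<in> {j..n}"
          have "path_map \<phi> i j (b j k \<odot>\<^bsub>X j\<^esub> path_map \<phi> j k (x k)) = b j k \<odot>\<^bsub>X i\<^esub> path_map \<phi> i j (path_map \<phi> j k (x k))"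
            by (rule P.hom_smult[OF eb pj[OF k]])
          then show "b j k \<odot>\<^bsub>X i\<^esub> path_map \<phi> i k (x k) = path_map \<phi> i j (b j k \<odot>\<^bsub>X j\<^esub> path_map \<phi> j k (x k))"
            using j k by (simp add: path_map_trans)
        qed (use pj eb in \<open>auto intro!: P.closed Xj.smult_closed\<close>)
        also have "\<dots> = path_map \<phi> i j ((b \<odot>\<^bsub>M\<^esub> x) j)"
          unfolding M_smult[OF b x jn]
          using pj eb by (intro P.hom_finsum[symmetric]) (auto intro!: Xj.smult_closed)
        finally show "(\<Oplus>\<^bsub>X i\<^esub>k\<in>{i..n}. ?g j k) = a i j \<odot>\<^bsub>X i\<^esub> path_map \<phi> i j ((b \<odot>\<^bsub>M\<^esub> x) j)" .
      qed (use i M_term_closed[OF a bx] in auto)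
      finally show "((a \<otimes>\<^bsub>T\<^esub> b) \<odot>\<^bsub>M\<^esub> x) i = (a \<odot>\<^bsub>M\<^esub> (b \<odot>\<^bsub>M\<^esub> x)) i" .
    qed
  next
    fix y assume y: "y \<in> carrier M"
    note yc = M_comp[OF y]
    show "a \<odot>\<^bsub>M\<^esub> (x \<oplus>\<^bsub>M\<^esub> y) = a \<odot>\<^bsub>M\<^esub> x \<oplus>\<^bsub>M\<^esub> a \<odot>\<^bsub>M\<^esub> y"
    proof (rule M_ext)
      have xy: "x \<oplus>\<^bsub>M\<^esub> y \<in> carrier M" by (rule add[OF x y])
      show "a \<odot>\<^bsub>M\<^esub> (x \<oplus>\<^bsub>M\<^esub> y) \<in> carrier M" by (rule M_smult_closed[OF a xy])
      show "a \<odot>\<^bsub>M\<^esub> x \<oplus>\<^bsub>M\<^esub> a \<odot>\<^bsub>M\<^esub> y \<in> carrier M" by (intro add M_smult_closed a x y)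
      fix i assume i: "i \<in> {1..n}"
      interpret Xi: left_module A "X i" by (rule lX[OF i])
      have "(a \<odot>\<^bsub>M\<^esub> (x \<oplus>\<^bsub>M\<^esub> y)) i = (\<Oplus>\<^bsub>X i\<^esub>j\<in>{i..n}. a i j \<odot>\<^bsub>X i\<^esub> path_map \<phi> i j (x j) \<oplus>\<^bsub>X i\<^esub> a i j \<odot>\<^bsub>X i\<^esub> path_map \<phi> i j (y j))"
        unfolding M_smult[OF a xy i]
      proof (rule Xi.M.finsum_cong')
        fix j assume j: "j \<in> {i..n}"
        then have jn: "j \<in> {1..n}" using i by auto
        interpret P: module_homs A "X j" "X i" "path_map \<phi> i j" using i j by (intro path_homs) auto
        show "a i j \<odot>\<^bsub>X i\<^esub> path_map \<phi> i j ((x \<oplus>\<^bsub>M\<^esub> y) j) =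
            a i j \<odot>\<^bsub>X i\<^esub> path_map \<phi> i j (x j) \<oplus>\<^bsub>X i\<^esub> a i j \<odot>\<^bsub>X i\<^esub> path_map \<phi> i j (y j)"
          using jn xc[OF jn] yc[OF jn] tri_entry[OF a]
          by (simp add: tri_module_simps(3) P.hom_add Xi.smult_r_distr P.closed)
      qed (use i M_term_closed[OF a x] M_term_closed[OF a y] in \<open>auto intro!: Xi.M.a_closed\<close>)
      also have "\<dots> = (a \<odot>\<^bsub>M\<^esub> x) i \<oplus>\<^bsub>X i\<^esub> (a \<odot>\<^bsub>M\<^esub> y) i"
        unfolding M_smult[OF a x i] M_smult[OF a y i]
        using i M_term_closed[OF a x] M_term_closed[OF a y] by (intro Xi.M.finsum_addf) auto
      finally show "(a \<odot>\<^bsub>M\<^esub> (x \<oplus>\<^bsub>M\<^esub> y)) i = (a \<odot>\<^bsub>M\<^esub> x \<oplus>\<^bsub>M\<^esub> a \<odot>\<^bsub>M\<^esub> y) i"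
        using i by (simp add: tri_module_simps(3))
    qed
  }
qed

lemma mat_unit_closed: "a \<in> carrier A \<Longrightarrow> 1 \<le> i \<Longrightarrow> i \<le> j \<Longrightarrow> j \<le> n \<Longrightarrow> mat_unit A a i j \<in> carrier T"
  by (auto simp: mat_unit_def tri_carrier_iff)

text \<open>With \<open>a\<close> the identity, the case \<open>i = j\<close> projects onto a
  component and the case \<open>j = Suc i\<close> is the structure map \<open>\<phi> i\<close>; in
  this way the object can be read off from its module.\<close>

lemma mat_unit_smult:
  assumes a: "a \<in> carrier A" and ij: "1 \<le> i" "i \<le> j" "j \<le> n" and x: "x \<in> carrier M" and p: "p \<in> {1..n}"
  shows "(mat_unit A a i j \<odot>\<^bsub>M\<^esub> x) p = (if p = i then a \<odot>\<^bsub>X i\<^esub> path_map \<phi> i j (x j) else \<zero>\<^bsub>X p\<^esub>)"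
proof -
  interpret Xp: left_module A "X p" by (rule lX[OF p])
  note xc = M_comp[OF x]
  have c: "p = i \<Longrightarrow> a \<odot>\<^bsub>X p\<^esub> path_map \<phi> p j (x j) \<in> carrier (X p)"
    using a ij xc[of j] by (intro Xp.smult_closed path_closed) auto
  have "(mat_unit A a i j \<odot>\<^bsub>M\<^esub> x) p =
      (\<Oplus>\<^bsub>X p\<^esub>q\<in>{p..n}. if q = j then (if p = i then a \<odot>\<^bsub>X p\<^esub> path_map \<phi> p q (x q) else \<zero>\<^bsub>X p\<^esub>) else \<zero>\<^bsub>X p\<^esub>)"
    unfolding M_smult[OF mat_unit_closed[OF a ij] x p]
    using p a xc c by (intro Xp.M.finsum_cong') (auto simp: mat_unit_def Xp.smult_l_null path_closed intro!: Xp.smult_closed)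
  also have "\<dots> = (if j \<in> {p..n} then (if p = i then a \<odot>\<^bsub>X p\<^esub> path_map \<phi> p j (x j) else \<zero>\<^bsub>X p\<^esub>) else \<zero>\<^bsub>X p\<^esub>)"
    using c by (intro Xp.M.finsum_delta) auto
  finally show ?thesis using ij by auto
qed

text \<open>The inclusion of a component into the direct sum; it is \<open>A\<close>-linear when
  \<open>A\<close> acts on the sum through the matrices \<open>mat_unit A a i i\<close>.\<close>

definition single :: "nat \<Rightarrow> 'm \<Rightarrow> nat \<Rightarrow> 'm" where
  "single i y = (\<lambda>j\<in>{1..n}. if j = i then y else \<zero>\<^bsub>X j\<^esub>)"

lemma single_closed:
  assumes "y \<in> carrier (X i)" shows "single i y \<in> carrier M"
proof -
  have "\<zero>\<^bsub>X j\<^esub> \<in> carrier (X j)" if "j \<in> {1..n}" for j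
  proof -
    interpret left_module A "X j" by (rule lX[OF that])
    show ?thesis by simp
  qed
  then show ?thesis using assms by (auto simp: single_def tri_module_simps)
qed

lemma mat_unit_smult_eq_single:
  assumes "a \<in> carrier A" "1 \<le> i" "i \<le> j" "j \<le> n" "x \<in> carrier M"
  shows "mat_unit A a i j \<odot>\<^bsub>M\<^esub> x = single i (a \<odot>\<^bsub>X i\<^esub> path_map \<phi> i j (x j))"
proof (rule M_ext)
  interpret Xi: left_module A "X i" using assms by (intro lX) simp
  show "mat_unit A a i j \<odot>\<^bsub>M\<^esub> x \<in> carrier M"
    by (rule M_smult_closed[OF mat_unit_closed[OF assms(1-4)] assms(5)])
  show "single i (a \<odot>\<^bsub>X i\<^esub> path_map \<phi> i j (x j)) \<in> carrier M"
    using assms M_comp[OF assms(5)] by (intro single_closed Xi.smult_closed path_closed) auto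
  fix p assume "p \<in> {1..n}"
  then show "(mat_unit A a i j \<odot>\<^bsub>M\<^esub> x) p = single i (a \<odot>\<^bsub>X i\<^esub> path_map \<phi> i j (x j)) p"
    using mat_unit_smult[OF assms] by (simp add: single_def)
qed

lemma single_hom:
  assumes i: "i \<in> {1..n}"
  shows "y \<in> carrier (X i) \<Longrightarrow> y' \<in> carrier (X i) \<Longrightarrow> single i (y \<oplus>\<^bsub>X i\<^esub> y') = single i y \<oplus>\<^bsub>M\<^esub> single i y'"
    and "a \<in> carrier A \<Longrightarrow> y \<in> carrier (X i) \<Longrightarrow> single i (a \<odot>\<^bsub>X i\<^esub> y) = mat_unit A a i i \<odot>\<^bsub>M\<^esub> single i y"
    and "single i \<zero>\<^bsub>X i\<^esub> = \<zero>\<^bsub>M\<^esub>"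
proof -
  have z: "\<zero>\<^bsub>X j\<^esub> \<oplus>\<^bsub>X j\<^esub> \<zero>\<^bsub>X j\<^esub> = \<zero>\<^bsub>X j\<^esub>" if "j \<in> {1..n}" for j
  proof -
    interpret left_module A "X j" by (rule lX[OF that])
    show ?thesis by simp
  qed
  show "single i (y \<oplus>\<^bsub>X i\<^esub> y') = single i y \<oplus>\<^bsub>M\<^esub> single i y'"
    unfolding tri_module_simps single_def by (rule restrict_ext) (use z in simp)
  show "single i \<zero>\<^bsub>X i\<^esub> = \<zero>\<^bsub>M\<^esub>" by (auto simp: tri_module_simps single_def)
  assume "a \<in> carrier A" "y \<in> carrier (X i)"
  then show "single i (a \<odot>\<^bsub>X i\<^esub> y) = mat_unit A a i i \<odot>\<^bsub>M\<^esub> single i y"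
    using i mat_unit_smult_eq_single[of a i i "single i y"] single_closed[of y i]
    by (simp add: single_def)
qed

text \<open>Generators of the components, put in their positions, generate the sum: a
  \<open>T\<close>-submodule meets each component in an \<open>A\<close>-submodule.\<close>

lemma fin_gen_M: "fin_gen T M"
proof -
  interpret M: left_module T M by (rule left_module_M)
  have "\<exists>S. \<forall>i\<in>{1..n}. finite (S i) \<and> S i \<subseteq> carrier (X i) \<and>
      (\<forall>N. submodule N A (X i) \<and> S i \<subseteq> N \<longrightarrow> carrier (X i) \<subseteq> N)"
  proof (rule bchoice, rule ballI)
    fix i assume "i \<in> {1..n}"
    then have "fg_sub A (X i) (carrier (X i))"
      using X by (simp add: fg_mod_def fin_gen_iff_fg_sub)
    then show "\<exists>S. finite S \<and> S \<subseteq> carrier (X i) \<and>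
      (\<forall>N. submodule N A (X i) \<and> S \<subseteq> N \<longrightarrow> carrier (X i) \<subseteq> N)" unfolding fg_sub_def .
  qed
  then obtain S where S0: "\<forall>i\<in>{1..n}. finite (S i) \<and> S i \<subseteq> carrier (X i) \<and>
      (\<forall>N. submodule N A (X i) \<and> S i \<subseteq> N \<longrightarrow> carrier (X i) \<subseteq> N)" ..
  have S: "\<And>i. i \<in> {1..n} \<Longrightarrow> finite (S i)" "\<And>i. i \<in> {1..n} \<Longrightarrow> S i \<subseteq> carrier (X i)"
    "\<And>i N. i \<in> {1..n} \<Longrightarrow> submodule N A (X i) \<Longrightarrow> S i \<subseteq> N \<Longrightarrow> carrier (X i) \<subseteq> N"
    using S0 by blast+
  let ?S = "\<Union>i\<in>{1..n}. single i ` S i"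
  show ?thesis unfolding fin_gen_iff_fg_sub fg_sub_def
  proof (intro exI[of _ ?S] conjI allI impI)
    show "finite ?S" using S(1) by blast
    show "?S \<subseteq> carrier M" using S(2) single_closed by blast
    fix N assume N: "submodule N T M \<and> ?S \<subseteq> N"
    note nd = submoduleD[OF conjunct1[OF N]]
    have sN: "single i y \<in> N" if i: "i \<in> {1..n}" and y: "y \<in> carrier (X i)" for i y
    proof -
      interpret Xi: left_module A "X i" by (rule lX[OF i])
      have "submodule {y \<in> carrier (X i). single i y \<in> N} A (X i)"
      proof (rule Xi.submoduleI)
        show "\<zero>\<^bsub>X i\<^esub> \<in> {y \<in> carrier (X i). single i y \<in> N}" using nd(2) single_hom(3)[OF i] by simp
        fix u v assume "u \<in> {y \<in> carrier (X i). single i y \<in> N}" "v \<in> {y \<in> carrier (X i). single i y \<in> N}"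
        then show "u \<oplus>\<^bsub>X i\<^esub> v \<in> {y \<in> carrier (X i). single i y \<in> N}"
          using nd(3) single_hom(1)[OF i] by simp
      next
        fix a u assume "a \<in> carrier A" "u \<in> {y \<in> carrier (X i). single i y \<in> N}"
        then show "a \<odot>\<^bsub>X i\<^esub> u \<in> {y \<in> carrier (X i). single i y \<in> N}"
          using nd(4) single_hom(2)[OF i] mat_unit_closed[of a i i] i Xi.smult_closed by simp
      qed auto
      then have "carrier (X i) \<subseteq> {y \<in> carrier (X i). single i y \<in> N}"
        by (rule S(3)[OF i]) (use N i S(2)[OF i] in blast)
      then show ?thesis using y by blast
    qed
    show "carrier M \<subseteq> N"
    proof
      fix x assume x: "x \<in> carrier M"
      note xc = M_comp[OF x]
      \<comment> \<open>Truncations of \<open>x\<close> to its first \<open>m\<close> components,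
        used to rebuild \<open>x\<close> one component at a time.\<close>
      let ?t = "\<lambda>m. (\<lambda>i\<in>{1..n}. if i \<le> m then x i else \<zero>\<^bsub>X i\<^esub>)"
      have z: "\<zero>\<^bsub>X j\<^esub> \<in> carrier (X j)" "u \<in> carrier (X j) \<Longrightarrow> \<zero>\<^bsub>X j\<^esub> \<oplus>\<^bsub>X j\<^esub> u = u"
        "u \<in> carrier (X j) \<Longrightarrow> u \<oplus>\<^bsub>X j\<^esub> \<zero>\<^bsub>X j\<^esub> = u" if "j \<in> {1..n}" for j u
      proof -
        interpret left_module A "X j" by (rule lX[OF that])
        show "\<zero>\<^bsub>X j\<^esub> \<in> carrier (X j)" "u \<in> carrier (X j) \<Longrightarrow> \<zero>\<^bsub>X j\<^esub> \<oplus>\<^bsub>X j\<^esub> u = u"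
          "u \<in> carrier (X j) \<Longrightarrow> u \<oplus>\<^bsub>X j\<^esub> \<zero>\<^bsub>X j\<^esub> = u" by simp_all
      qed
      have "m \<le> n \<Longrightarrow> ?t m \<in> N" for m
      proof (induction m)
        case 0
        have "?t 0 = \<zero>\<^bsub>M\<^esub>" by (auto simp: tri_module_simps)
        then show ?case using nd(2) by simp
      next
        case (Suc m)
        have z0: "\<zero>\<^bsub>X (Suc m)\<^esub> \<oplus>\<^bsub>X (Suc m)\<^esub> x (Suc m) = x (Suc m)"
          using Suc.prems xc by (intro z(2)) auto
        have "?t (Suc m) = ?t m \<oplus>\<^bsub>M\<^esub> single (Suc m) (x (Suc m))"
          unfolding tri_module_simps single_def
          by (rule restrict_ext) (use z z0 xc in \<open>auto simp: le_Suc_eq\<close>)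
        moreover have "?t m \<in> N" by (rule Suc.IH) (use Suc.prems in simp)
        moreover have "single (Suc m) (x (Suc m)) \<in> N" using Suc.prems xc by (intro sN) auto
        ultimately show ?case using nd(3) by simp
      qed
      from this[of n] have "?t n \<in> N" by simp
      moreover have "?t n = x"
      proof -
        have "?t n = (\<lambda>i\<in>{1..n}. x i)" by (rule restrict_ext) simp
        then show ?thesis using x by (auto simp: tri_module_simps(1) PiE_iff extensional_restrict)
      qed
      ultimately show "x \<in> N" by simp
    qed
  qed
qed

lemma M_fg_mod: "M \<in> fg_mod T"
  using left_module_M fin_gen_M by (simp add: fg_mod_def)

end

section \<open>The monomorphism category\<close>

text \<open>A vector over the matrix ring concentrated in row \<open>i\<close>; this embeds the row
  complexes over \<open>A\<close> into the complex over the matrix ring.\<close>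

definition row_vec :: "('a, 'k) ring_scheme \<Rightarrow> nat \<Rightarrow> ('i \<times> nat \<Rightarrow> 'a) \<Rightarrow> 'i \<Rightarrow> nat \<Rightarrow> nat \<Rightarrow> 'a" where
  "row_vec A i x = (\<lambda>s p q. if p = i then x (s, q) else \<zero>\<^bsub>A\<^esub>)"

context ring begin

lemma row_vec_vecs: "i \<in> {1..n} \<Longrightarrow> x \<in> vecs R (S \<times> {i..n}) \<Longrightarrow> row_vec R i x \<in> vecs (tri_ring n R) S"
  unfolding tri_vecs_iff using vecsD[of x] vecs_out[of x "S \<times> {i..n}"] by (auto simp: row_vec_def)

lemma tri_row_row_vec: "tri_row p (row_vec R i x) = (if p = i then x else (\<lambda>_. \<zero>))"
  by (auto simp: tri_row_def row_vec_def)

lemma mat_unit_smult_free: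
  assumes a: "a \<in> carrier R" and ij: "1 \<le> i" "i \<le> j" "j \<le> n" and v: "v \<in> vecs (tri_ring n R) S"
  shows "mat_unit R a i j \<odot>\<^bsub>free (tri_ring n R) S\<^esub> v = row_vec R i (\<lambda>p. a \<otimes> v (fst p) j (snd p))"
proof (intro ext)
  fix s p q
  have e: "v s p q \<in> carrier R" for p q using v unfolding tri_vecs_iff by blast
  have "(\<Oplus>k\<in>{1..n}. mat_unit R a i j p k \<otimes> v s k q) =
      (\<Oplus>k\<in>{1..n}. if k = j then (if p = i then a \<otimes> v s k q else \<zero>) else \<zero>)"
    using a e by (intro finsum_cong') (auto simp: mat_unit_def)
  also have "\<dots> = (if p = i then a \<otimes> v s j q else \<zero>)"
    using ij a e by (subst finsum_delta) auto
  finally show "(mat_unit R a i j \<odot>\<^bsub>free (tri_ring n R) S\<^esub> v) s p q = row_vec R i (\<lambda>p. a \<otimes> v (fst p) j (snd p)) s p q"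
    by (simp add: row_vec_def)
qed

lemma row_vec_tri_row:
  assumes i: "i \<in> {1..n}" and v: "v \<in> vecs (tri_ring n R) S"
  shows "mat_unit R \<one> i i \<odot>\<^bsub>free (tri_ring n R) S\<^esub> v = row_vec R i (tri_row i v)"
proof -
  have "v s p q \<in> carrier R" for s p q using v unfolding tri_vecs_iff by blast
  then have "(\<lambda>p. \<one> \<otimes> v (fst p) i (snd p)) = tri_row i v" by (auto simp: tri_row_def)
  then show ?thesis using mat_unit_smult_free[OF one_closed _ order_refl _ v, of i] i by simp
qed

lemma mat_unit_smult_row_vec:
  assumes a: "a \<in> carrier R" and ij: "1 \<le> i" "i \<le> j" "j \<le> n" and x: "x \<in> vecs R (S \<times> {j..n})"
  shows "mat_unit R a i j \<odot>\<^bsub>free (tri_ring n R) S\<^esub> row_vec R j x = row_vec R i (\<lambda>p. a \<otimes> x p)"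
  using mat_unit_smult_free[OF a ij row_vec_vecs[OF _ x]] ij by (simp add: row_vec_def)

lemma vmul_row_vec:
  fixes I J :: "'i set"
  assumes I: "finite I" and D: "\<And>s t. D s t \<in> carrier (tri_ring n R)" and i: "i \<in> {1..n}"
    and x: "x \<in> vecs R (I \<times> {i..n})"
  shows "vmul (tri_ring n R) I J D (row_vec R i x) =
    row_vec R i (vmul R (I \<times> {i..n}) (J \<times> {i..n}) (unfold_mat D) x)"
proof (rule tri_row_inj)
  interpret T: ring "tri_ring n R" by (rule ring_tri_ring)
  have Dc: "unfold_mat D s t \<in> carrier R" for s t using tri_entry[OF D] by (simp add: unfold_mat_def)
  note xv = row_vec_vecs[OF i x]
  show "vmul (tri_ring n R) I J D (row_vec R i x) \<in> vecs (tri_ring n R) J" by (rule T.vmul_closed[OF xv D])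
  show "row_vec R i (vmul R (I \<times> {i..n}) (J \<times> {i..n}) (unfold_mat D) x) \<in> vecs (tri_ring n R) J"
    by (rule row_vec_vecs[OF i vmul_closed[OF x Dc]])
  fix p assume p: "p \<in> {1..n}"
  have "vmul R (I \<times> {p..n}) (J \<times> {p..n}) (unfold_mat D) (\<lambda>_. \<zero>) = (\<lambda>_. \<zero>)"
    using Dc by (simp add: vmul_def finsum_zero fun_eq_iff)
  then show "tri_row p (vmul (tri_ring n R) I J D (row_vec R i x)) =
     tri_row p (row_vec R i (vmul R (I \<times> {i..n}) (J \<times> {i..n}) (unfold_mat D) x))"
    unfolding tri_row_vmul[where D=D, OF I D xv p] tri_row_row_vec by simp
qed

lemma free_minus:
  assumes "x \<in> vecs R S" "y \<in> vecs R S"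
  shows "x \<ominus>\<^bsub>free R S\<^esub> y = (\<lambda>s. x s \<ominus> y s)"
proof -
  interpret F: left_module R "free R S" by (rule left_module_free)
  have "(\<ominus>\<^bsub>free R S\<^esub> y) = (\<lambda>s. \<ominus> y s)"
    using assms vecsD[OF assms(2)] by (intro F.M.minus_equality) (auto simp: l_neg vecs_def)
  then show ?thesis by (simp add: F.M.minus_eq minus_eq)
qed

end

section \<open>Resolutions of the components and of the cokernels\<close>

locale mor_resolution = mor_object A n X \<phi>
  for A :: "('a, 'k) ring_scheme" (structure) and n and X :: "nat \<Rightarrow> ('a, 'm) module" and \<phi> +
  fixes J :: "nat \<Rightarrow> 'i set" and D e
  assumes res: "mat_res (tri_ring n A) (tri_module n (X, \<phi>)) J D e"
begin

abbreviation "D' \<equiv> \<lambda>k. unfold_mat (D k)"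

text \<open>The augmentation of the resolution of \<open>X i\<close> that is cut out of the
  resolution of \<open>M\<close>.\<close>

definition aug :: "nat \<Rightarrow> ('i \<times> nat \<Rightarrow> 'a) \<Rightarrow> 'm" where
  "aug i x = e (row_vec A i x) i"

lemma fin: "finite (J k)" and D: "D k s t \<in> carrier T"
  and e_hom: "e \<in> module_hom T (free T (J 0)) M"
  and e_surj: "e ` vecs T (J 0) = carrier M"
  and e_zero: "x \<in> vecs T (J 0) \<Longrightarrow> e x = \<zero>\<^bsub>M\<^esub> \<longleftrightarrow> x \<in> vmul T (J 1) (J 0) (D 0) ` vecs T (J 1)"
  and rows: "row_exact T J D k"
  using res by (simp_all add: mat_res_def)

lemma D': "D' k s t \<in> carrier A"
  using tri_entry[OF D] by (simp add: unfold_mat_def)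

lemma D'_zero: "snd v < snd u \<Longrightarrow> D' k u v = \<zero>"
  using tri_entry_zero[OF D, of "snd u" "snd v" k "fst u" "fst v"] by (simp add: unfold_mat_def)

sublocale e: module_homs T "free T (J 0)" M e
  by (intro module_homsI ring.left_module_free[OF ring_tri_ring] left_module_M e_hom)

text \<open>A vector in row \<open>i\<close> is fixed by the idempotent
  \<open>mat_unit A \<one> i i\<close>. Its image is fixed as well, and hence lies in component
  \<open>i\<close>.\<close>

lemma e_row_vec:
  assumes i: "i \<in> {1..n}" and x: "x \<in> vecs A (J 0 \<times> {i..n})"
  shows "e (row_vec A i x) = single i (aug i x)" "aug i x \<in> carrier (X i)"
proof -
  interpret Xi: left_module A "X i" by (rule lX[OF i])
  have xv: "row_vec A i x \<in> vecs T (J 0)" by (rule row_vec_vecs[OF i x])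
  then have ec: "e (row_vec A i x) \<in> carrier M" using e.closed by simp
  then show c: "aug i x \<in> carrier (X i)" using M_comp[OF _ i] by (simp add: aug_def)
  have u: "mat_unit A \<one> i i \<in> carrier T" using i by (intro mat_unit_closed) auto
  have "mat_unit A \<one> i i \<odot>\<^bsub>free T (J 0)\<^esub> row_vec A i x = row_vec A i x"
    using row_vec_tri_row[OF i xv] by (simp add: tri_row_row_vec)
  then have "e (row_vec A i x) = mat_unit A \<one> i i \<odot>\<^bsub>M\<^esub> e (row_vec A i x)"
    using e.hom_smult[OF u] xv by (metis free_simps(1))
  also have "\<dots> = single i (aug i x)"
    using mat_unit_smult_eq_single[OF one_closed _ order_refl _ ec, of i] i c
    by (simp add: Xi.smult_one aug_def)
  finally show "e (row_vec A i x) = single i (aug i x)" .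
qed

lemma single_zero_iff: "i \<in> {1..n} \<Longrightarrow> single i y = \<zero>\<^bsub>M\<^esub> \<longleftrightarrow> y = \<zero>\<^bsub>X i\<^esub>"
proof
  assume i: "i \<in> {1..n}" and "single i y = \<zero>\<^bsub>M\<^esub>"
  then have "single i y i = \<zero>\<^bsub>M\<^esub> i" by simp
  then show "y = \<zero>\<^bsub>X i\<^esub>" using i by (simp add: single_def tri_module_simps(2))
qed (simp add: single_hom(3))

lemma aug_hom:
  assumes i: "i \<in> {1..n}" shows "aug i \<in> module_hom A (free A (J 0 \<times> {i..n})) (X i)"
proof (rule module_homI)
  fix x assume "x \<in> carrier (free A (J 0 \<times> {i..n}))"
  then have x: "x \<in> vecs A (J 0 \<times> {i..n})" by simp
  note xv = row_vec_vecs[OF i x]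
  show "aug i x \<in> carrier (X i)" by (rule e_row_vec(2)[OF i x])
  {
    fix y assume "y \<in> carrier (free A (J 0 \<times> {i..n}))"
    then have y: "y \<in> vecs A (J 0 \<times> {i..n})" by simp
    have "row_vec A i (x \<oplus>\<^bsub>free A (J 0 \<times> {i..n})\<^esub> y) = row_vec A i x \<oplus>\<^bsub>free T (J 0)\<^esub> row_vec A i y"
      by (auto simp: row_vec_def fun_eq_iff)
    then show "aug i (x \<oplus>\<^bsub>free A (J 0 \<times> {i..n})\<^esub> y) = aug i x \<oplus>\<^bsub>X i\<^esub> aug i y"
      using e.hom_add[of "row_vec A i x" "row_vec A i y"] xv row_vec_vecs[OF i y] i
      by (simp add: aug_def tri_module_simps(3) del: free_simps(2-))
  }
  fix a assume a: "a \<in> carrier A"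
  have u: "mat_unit A a i i \<in> carrier T" using i a by (intro mat_unit_closed) auto
  have ec: "e (row_vec A i x) \<in> carrier M" using e.closed xv by simp
  have "row_vec A i (a \<odot>\<^bsub>free A (J 0 \<times> {i..n})\<^esub> x) = mat_unit A a i i \<odot>\<^bsub>free T (J 0)\<^esub> row_vec A i x"
    using mat_unit_smult_row_vec[OF a _ order_refl _ x] i by simp
  then show "aug i (a \<odot>\<^bsub>free A (J 0 \<times> {i..n})\<^esub> x) = a \<odot>\<^bsub>X i\<^esub> aug i x"
    using e.hom_smult[OF u, of "row_vec A i x"] xv mat_unit_smult[OF a _ order_refl _ ec i, of i] i
    by (simp add: aug_def del: free_simps(2-))
qed

text \<open>Moving a row from position \<open>Suc i\<close> to position \<open>i\<close> is
  multiplication by a matrix unit, and this unit acts on \<open>M\<close> as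
  \<open>\<phi> i\<close>. So the inclusion of the block \<open>{Suc i..n}\<close> into the block
  \<open>{i..n}\<close> is a chain map over \<open>\<phi> i\<close>.\<close>

lemma aug_natural:
  assumes i: "i \<in> {1..<n}" and x: "x \<in> vecs A (J 0 \<times> {Suc i..n})"
  shows "aug i x = \<phi> i (aug (Suc i) x)"
proof -
  have i': "i \<in> {1..n}" "Suc i \<in> {1..n}" using i by auto
  interpret Xi: left_module A "X i" by (rule lX[OF i'(1)])
  note xv = row_vec_vecs[OF i'(2) x]
  have ec: "e (row_vec A (Suc i) x) \<in> carrier M" using e.closed xv by simp
  have u: "mat_unit A \<one> i (Suc i) \<in> carrier T" using i by (intro mat_unit_closed) auto
  have "(\<lambda>p. \<one> \<otimes> x p) = x" using vecsD[OF x] by auto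
  then have "row_vec A i x = mat_unit A \<one> i (Suc i) \<odot>\<^bsub>free T (J 0)\<^esub> row_vec A (Suc i) x"
    using mat_unit_smult_row_vec[OF one_closed _ _ _ x, of i] i by simp
  then have "aug i x = (mat_unit A \<one> i (Suc i) \<odot>\<^bsub>M\<^esub> e (row_vec A (Suc i) x)) i"
    using e.hom_smult[OF u, of "row_vec A (Suc i) x"] xv by (simp add: aug_def del: free_simps(2-))
  also have "\<dots> = \<one> \<odot>\<^bsub>X i\<^esub> path_map \<phi> i (Suc i) (aug (Suc i) x)"
    using mat_unit_smult[OF one_closed _ _ _ ec i'(1), of i "Suc i"] i by (simp add: aug_def)
  also have "\<dots> = \<phi> i (aug (Suc i) x)"
    using module_homD(1)[OF \<phi> e_row_vec(2)[OF i'(2) x]] i by (simp add: path_map_Suc Xi.smult_one)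
  finally show ?thesis .
qed

lemma aug_zero_iff:
  assumes i: "i \<in> {1..n}" and x: "x \<in> vecs A (J 0 \<times> {i..n})"
  shows "aug i x = \<zero>\<^bsub>X i\<^esub> \<longleftrightarrow>
    x \<in> vmul A (J 1 \<times> {i..n}) (J 0 \<times> {i..n}) (D' 0) ` vecs A (J 1 \<times> {i..n})"
proof -
  note xv = row_vec_vecs[OF i x]
  have "aug i x = \<zero>\<^bsub>X i\<^esub> \<longleftrightarrow> e (row_vec A i x) = \<zero>\<^bsub>M\<^esub>"
    using e_row_vec[OF i x] single_zero_iff[OF i] by simp
  also have "\<dots> \<longleftrightarrow> row_vec A i x \<in> vmul T (J 1) (J 0) (D 0) ` vecs T (J 1)" by (rule e_zero[OF xv])
  also have "\<dots> \<longleftrightarrow> x \<in> vmul A (J 1 \<times> {i..n}) (J 0 \<times> {i..n}) (D' 0) ` vecs A (J 1 \<times> {i..n})"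
  proof
    assume "row_vec A i x \<in> vmul T (J 1) (J 0) (D 0) ` vecs T (J 1)"
    then obtain w where w: "w \<in> vecs T (J 1)" "row_vec A i x = vmul T (J 1) (J 0) (D 0) w" by blast
    have "x = tri_row i (row_vec A i x)" by (simp add: tri_row_row_vec)
    also have "\<dots> = vmul A (J 1 \<times> {i..n}) (J 0 \<times> {i..n}) (D' 0) (tri_row i w)"
      unfolding w(2) by (rule tri_row_vmul[OF fin D w(1) i])
    finally show "x \<in> vmul A (J 1 \<times> {i..n}) (J 0 \<times> {i..n}) (D' 0) ` vecs A (J 1 \<times> {i..n})"
      using tri_row_vecs[OF w(1)] by blast
  next
    assume "x \<in> vmul A (J 1 \<times> {i..n}) (J 0 \<times> {i..n}) (D' 0) ` vecs A (J 1 \<times> {i..n})"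
    then obtain w where w: "w \<in> vecs A (J 1 \<times> {i..n})"
      "x = vmul A (J 1 \<times> {i..n}) (J 0 \<times> {i..n}) (D' 0) w" by blast
    have "row_vec A i x = vmul T (J 1) (J 0) (D 0) (row_vec A i w)"
      using vmul_row_vec[where D="D 0" and J="J 0", OF fin D i w(1)] w(2) by simp
    then show "row_vec A i x \<in> vmul T (J 1) (J 0) (D 0) ` vecs T (J 1)"
      using row_vec_vecs[OF i w(1)] by blast
  qed
  finally show ?thesis .
qed

lemma aug_surj:
  assumes i: "i \<in> {1..n}" shows "aug i ` vecs A (J 0 \<times> {i..n}) = carrier (X i)"
proof
  show "aug i ` vecs A (J 0 \<times> {i..n}) \<subseteq> carrier (X i)" using e_row_vec(2)[OF i] by blast
  show "carrier (X i) \<subseteq> aug i ` vecs A (J 0 \<times> {i..n})"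
  proof
    interpret Xi: left_module A "X i" by (rule lX[OF i])
    fix y assume y: "y \<in> carrier (X i)"
    have "single i y \<in> e ` vecs T (J 0)" unfolding e_surj by (rule single_closed[OF y])
    \<comment> \<open>Row \<open>i\<close> of any preimage of \<open>single i y\<close> is sent to
      \<open>y\<close>, since the idempotent for \<open>i\<close> fixes
      \<open>single i y\<close>.\<close>
    then obtain v where v: "v \<in> vecs T (J 0)" "single i y = e v" by blast
    have u: "mat_unit A \<one> i i \<in> carrier T" using i by (intro mat_unit_closed) auto
    have "aug i (tri_row i v) = (mat_unit A \<one> i i \<odot>\<^bsub>M\<^esub> e v) i"
      using e.hom_smult[OF u, of v] v(1) row_vec_tri_row[OF i v(1)] by (simp add: aug_def del: free_simps(2-))
    also have "\<dots> = y"
      using mat_unit_smult[OF one_closed _ order_refl _ single_closed[OF y] i, of i] i y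
      by (simp add: v(2)[symmetric] single_def Xi.smult_one)
    finally show "y \<in> aug i ` vecs A (J 0 \<times> {i..n})" using tri_row_vecs[OF v(1)] by blast
  qed
qed

lemma rows_block:
  assumes "i \<in> {1..n}" shows "row_exact A (\<lambda>k. J k \<times> {i..n}) D' k"
  using rows[of k] assms
  unfolding row_exact_def tri_exact3_rows[of "J (Suc (Suc k))" "J (Suc k)" "D (Suc k)" n "D k", OF fin fin D D]
  by blast

text \<open>Taking row \<open>i\<close> amounts to applying the idempotent
  \<open>mat_unit A \<one> i i\<close>, which preserves exactness and turns \<open>M\<close> into
  \<open>X i\<close>.\<close>

lemma X_res:
  assumes i: "i \<in> {1..n}" shows "mat_res A (X i) (\<lambda>k. J k \<times> {i..n}) D' (aug i)"
  unfolding mat_res_def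
  using fin D' aug_hom[OF i] aug_surj[OF i] aug_zero_iff[OF i] rows_block[OF i]
  by (intro conjI allI ballI) simp_all

text \<open>The blocks \<open>{Suc i..n}\<close>, \<open>{i..n}\<close> and \<open>{i}\<close> form
  a short exact sequence of complexes over the sequence from \<open>X (Suc i)\<close> through
  \<open>X i\<close> to the cokernel. Its long exact sequence makes the block \<open>{i}\<close>
  exact in positive degrees; injectivity of \<open>\<phi> i\<close> enters in degree 1.\<close>

lemma coker_res:
  assumes i: "i \<in> {1..<n}" and inj: "inj_on (\<phi> i) (carrier (X (Suc i)))"
  shows "mat_res A (coker (X (Suc i)) (X i) (\<phi> i)) (\<lambda>k. J k \<times> {i}) D'
    (\<lambda>x. coset_rep (X i) (\<phi> i ` carrier (X (Suc i))) (aug i x))"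
proof -
  have i': "i \<in> {1..n}" "Suc i \<in> {1..n}" using i by auto
  let ?U = "\<lambda>k. J k \<times> {Suc i..n}" and ?L = "\<lambda>k. J k \<times> {i}"
  let ?C = "coker (X (Suc i)) (X i) (\<phi> i)" and ?r = "coset_rep (X i) (\<phi> i ` carrier (X (Suc i)))"
  have UL: "?U k \<union> ?L k = J k \<times> {i..n}" for k using i by auto
  have dis: "?U k \<inter> ?L k = {}" for k by auto
  have fUL: "finite (?U k \<union> ?L k)" for k using fin by simp
  have z: "D' k u v = \<zero>" if "u \<in> ?U l" "v \<in> ?L l'" for k l l' u v using that by (intro D'_zero) auto
  interpret Xi: left_module A "X i" by (rule lX[OF i'(1)])
  have ph: "\<phi> i \<in> module_hom A (X (Suc i)) (X i)" using i by (intro \<phi>) auto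
  interpret P: module_homs A "X (Suc i)" "X i" "\<phi> i" by (intro module_homsI lX i' ph)
  note ck = Xi.coker_module[OF lX[OF i'(2)] ph]
  interpret a: module_homs A "free A (?U 0 \<union> ?L 0)" "X i" "aug i"
    unfolding UL by (intro module_homsI left_module_free lX i' aug_hom)
  have vL: "x \<in> vecs A (?U k \<union> ?L k)" if "x \<in> vecs A (?L k)" for x k by (rule vecs_mono[OF that]) auto
  have vU: "x \<in> vecs A (?U k \<union> ?L k)" if "x \<in> vecs A (?U k)" for x k by (rule vecs_mono[OF that]) auto
  have rL: "restr A (?L k) x = x" if "x \<in> vecs A (?L k)" for x k
    using vecs_out[OF that] by (auto simp: restr_def)
  note a0 = aug_zero_iff[OF i'(1), folded UL]
  have full: "exact3 A (?U (Suc (Suc k)) \<union> ?L (Suc (Suc k))) (?U (Suc k) \<union> ?L (Suc k)) (?U k \<union> ?L k) (D' (Suc k)) (D' k)" for k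
    using rows_block[OF i'(1), of k] unfolding UL row_exact_def .
  have sub: "exact3 A (?U (Suc (Suc k))) (?U (Suc k)) (?U k) (D' (Suc k)) (D' k)" for k
    using rows_block[OF i'(2), of k] unfolding row_exact_def .
  have imU: "\<phi> i ` carrier (X (Suc i)) = aug i ` vecs A (?U 0)"
    unfolding aug_surj[OF i'(2), symmetric] image_image by (intro image_cong refl aug_natural[OF i, symmetric])
  have re: "row_exact A ?L D' k" for k
  \<comment> \<open>For degree 1 the homology of the subcomplex one step further is
    \<open>X (Suc i)\<close>, which maps injectively to \<open>X i\<close>; for higher degrees the
    subcomplex is exact there.\<close>
  proof (cases k)
    case 0
    have "exact3 A (?L (Suc (Suc 0))) (?L (Suc 0)) (?L 0) (D' (Suc 0)) (D' 0)"
    proof (rule exact3_quotient[OF fUL fUL dis dis dis D' D' z z full])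
      let ?E = "vmul A (?U (Suc 0) \<union> ?L (Suc 0)) (?U 0 \<union> ?L 0) (D' 0)"
      fix y assume y: "y \<in> vecs A (?U (Suc 0) \<union> ?L (Suc 0))" and Ey: "?E y \<in> vecs A (?U 0)"
      have "aug i (?E y) = \<zero>\<^bsub>X i\<^esub>" using a0[OF vU[OF Ey]] y by simp
      then have "\<phi> i (aug (Suc i) (?E y)) = \<phi> i \<zero>\<^bsub>X (Suc i)\<^esub>"
        using aug_natural[OF i Ey] P.hom_zero by simp
      then have "aug (Suc i) (?E y) = \<zero>\<^bsub>X (Suc i)\<^esub>"
        using inj e_row_vec(2)[OF i'(2) Ey] P.M.M.zero_closed by (simp add: inj_on_eq_iff)
      then have "?E y \<in> vmul A (?U 1) (?U 0) (D' 0) ` vecs A (?U 1)" using aug_zero_iff[OF i'(2) Ey] by blast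
      then show "\<exists>z\<in>vecs A (?U (Suc 0)). vmul A (?U (Suc 0)) (?U 0) (D' 0) z = ?E y"
        by (elim imageE) (simp, metis)
    qed
    then show ?thesis by (simp add: row_exact_def 0)
  next
    case (Suc l)
    show ?thesis unfolding row_exact_def Suc
      by (rule exact3_quotient_of_exact[OF fUL fUL fUL dis dis dis dis D' D' D' z z z full full sub])
  qed
  have hom: "(\<lambda>x. ?r (aug i x)) \<in> module_hom A (free A (?L 0)) ?C"
  proof -
    have "(\<lambda>x. ?r (aug i x)) \<in> module_hom A (free A (?U 0 \<union> ?L 0)) ?C"
      by (rule module_hom_comp[OF a.h ck(2)])
    then show ?thesis using vL by (auto simp: module_hom_def)
  qed
  \<comment> \<open>Up to the image of \<open>\<phi> i\<close>, only the part of a vector on the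
    block \<open>{i}\<close> matters for its augmentation.\<close>
  have split: "\<exists>u. u \<in> vecs A (?U 0) \<and> aug i v = aug i (restr A (?L 0) v) \<oplus>\<^bsub>X i\<^esub> aug i u"
    if v: "v \<in> vecs A (?U 0 \<union> ?L 0)" for v
  proof (intro exI conjI)
    let ?v = "restr A (?L 0) v" and ?u = "restr A (?U 0) v"
    show u: "?u \<in> vecs A (?U 0)" by (rule restr_vecs[OF v])
    have "?v \<oplus>\<^bsub>free A (?U 0 \<union> ?L 0)\<^esub> ?u = v"
      using vecsD[OF v] vecs_out[OF v] by (auto simp: restr_def fun_eq_iff)
    then show "aug i v = aug i ?v \<oplus>\<^bsub>X i\<^esub> aug i ?u"
      using a.hom_add[of ?v ?u] vL[OF restr_vecs[OF v]] vU[OF u] by (simp del: free_simps(2-))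
  qed
  have H: "submodule (\<phi> i ` carrier (X (Suc i))) A (X i)" by (rule P.image_submodule[OF P.M.submodule_carrier])
  note sd = submoduleD[OF H]
  have surj: "(\<lambda>x. ?r (aug i x)) ` vecs A (?L 0) = carrier ?C"
  proof
    show "(\<lambda>x. ?r (aug i x)) ` vecs A (?L 0) \<subseteq> carrier ?C" using module_homD(1)[OF hom] by auto
    show "carrier ?C \<subseteq> (\<lambda>x. ?r (aug i x)) ` vecs A (?L 0)"
    proof
      fix c assume "c \<in> carrier ?C"
      then obtain y where y: "y \<in> carrier (X i)" "c = ?r y" unfolding ck(3)[symmetric] by blast
      then obtain v where v: "v \<in> vecs A (?U 0 \<union> ?L 0)" "y = aug i v"
        unfolding aug_surj[OF i'(1), folded UL, symmetric] by blast
      obtain u where u: "u \<in> vecs A (?U 0)" "y = aug i (restr A (?L 0) v) \<oplus>\<^bsub>X i\<^esub> aug i u"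
        using split[OF v(1)] v(2) by blast
      have cl: "aug i (restr A (?L 0) v) \<in> carrier (X i)" "aug i u \<in> carrier (X i)"
        using a.closed vL[OF restr_vecs[OF v(1)]] vU[OF u(1)] by simp_all
      have "y \<ominus>\<^bsub>X i\<^esub> aug i (restr A (?L 0) v) = aug i u"
        using u(2) cl y(1) by (simp add: Xi.M.eq_add_iff_minus_eq[symmetric])
      also have "\<dots> \<in> \<phi> i ` carrier (X (Suc i))" unfolding imU using u(1) by blast
      finally have "c = ?r (aug i (restr A (?L 0) v))"
        using Xi.coset_rep_props(3)[OF H y(1) cl(1)] y(2) by simp
      then show "c \<in> (\<lambda>x. ?r (aug i x)) ` vecs A (?L 0)" using restr_vecs[OF v(1)] by blast
    qed
  qed
  \<comment> \<open>\<open>x\<close> dies in the cokernel if and only if it differs from a vector of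
    the subcomplex by a boundary of the block \<open>{i..n}\<close>; projecting that boundary to
    \<open>{i}\<close> presents \<open>x\<close> as a boundary there.\<close>
  have ker: "?r (aug i x) = \<zero>\<^bsub>?C\<^esub> \<longleftrightarrow> x \<in> vmul A (?L 1) (?L 0) (D' 0) ` vecs A (?L 1)"
    if x: "x \<in> vecs A (?L 0)" for x
  proof -
    have xc: "aug i x \<in> carrier (X i)" using a.closed vL[OF x] by simp
    have "?r (aug i x) = \<zero>\<^bsub>?C\<^esub> \<longleftrightarrow> aug i x \<in> aug i ` vecs A (?U 0)"
      using ck(4)[OF xc] unfolding imU .
    also have "\<dots> \<longleftrightarrow> x \<in> vmul A (?L 1) (?L 0) (D' 0) ` vecs A (?L 1)"
    proof
      assume "aug i x \<in> aug i ` vecs A (?U 0)"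
      then obtain u where u: "u \<in> vecs A (?U 0)" "aug i x = aug i u" by blast
      let ?d = "x \<ominus>\<^bsub>free A (?U 0 \<union> ?L 0)\<^esub> u"
      have dv: "?d \<in> vecs A (?U 0 \<union> ?L 0)" using a.M.M.minus_closed[of x u] vL[OF x] vU[OF u(1)] by simp
      have "aug i ?d = \<zero>\<^bsub>X i\<^esub>"
        using a.hom_minus[of x u] vL[OF x] vU[OF u(1)] u(2) xc by (simp add: Xi.M.minus_self del: free_simps(2-))
      then obtain w where w: "w \<in> vecs A (?U 1 \<union> ?L 1)" "?d = vmul A (?U 1 \<union> ?L 1) (?U 0 \<union> ?L 0) (D' 0) w"
        using a0[OF dv] by blast
      have "x = restr A (?L 0) ?d"
        unfolding free_minus[OF vL[OF x] vU[OF u(1)]]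
      proof
        fix s
        show "x s = restr A (?L 0) (\<lambda>s. x s \<ominus> u s) s"
        proof (cases "s \<in> ?L 0")
          case True
          then have "u s = \<zero>" using vecs_out[OF u(1)] dis[of 0] by blast
          then show ?thesis using True vecsD[OF x] unfolding restr_def by (simp add: minus_eq)
        qed (use vecs_out[OF x, of s] in \<open>simp add: restr_def\<close>)
      qed
      also have "\<dots> = vmul A (?L 1) (?L 0) (D' 0) (restr A (?L 1) w)"
        unfolding w(2) by (rule vmul_quot[OF fUL dis D' z w(1)])
      finally show "x \<in> vmul A (?L 1) (?L 0) (D' 0) ` vecs A (?L 1)" using restr_vecs[OF w(1)] by blast
    next
      assume "x \<in> vmul A (?L 1) (?L 0) (D' 0) ` vecs A (?L 1)"
      then obtain w where w: "w \<in> vecs A (?L 1)" "x = vmul A (?L 1) (?L 0) (D' 0) w" by blast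
      let ?v = "vmul A (?U 1 \<union> ?L 1) (?U 0 \<union> ?L 0) (D' 0) w"
      have v: "?v \<in> vecs A (?U 0 \<union> ?L 0)" by (rule vmul_closed[OF vL[OF w(1)] D'])
      have "restr A (?L 0) ?v = x"
        using vmul_quot[where L'="?L 0" and U'="?U 0" and D="D' 0", OF fUL dis D' z vL[OF w(1)]] rL[OF w(1)] w(2) by simp
      then obtain u where u: "u \<in> vecs A (?U 0)" "aug i ?v = aug i x \<oplus>\<^bsub>X i\<^esub> aug i u"
        using split[OF v] by auto
      have uc: "aug i u \<in> carrier (X i)" using a.closed vU[OF u(1)] by simp
      have "aug i ?v = \<zero>\<^bsub>X i\<^esub>" using a0[OF v] vL[OF w(1)] by blast
      then have "aug i x = \<ominus>\<^bsub>X i\<^esub> aug i u" using u(2) xc uc by (metis Xi.M.minus_equality)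
      moreover have "aug i u \<in> \<phi> i ` carrier (X (Suc i))" unfolding imU using u(1) by blast
      ultimately show "aug i x \<in> aug i ` vecs A (?U 0)" using sd(5) unfolding imU by simp
    qed
    finally show ?thesis .
  qed
  show ?thesis
    unfolding mat_res_def using fin D' hom surj ker re by (intro conjI allI ballI) simp_all
qed

lemma coker_fg:
  assumes i: "i \<in> {1..<n}" shows "coker (X (Suc i)) (X i) (\<phi> i) \<in> fg_mod A"
proof -
  have i': "i \<in> {1..n}" "Suc i \<in> {1..n}" using i by auto
  interpret Xi: left_module A "X i" by (rule lX[OF i'(1)])
  have ph: "\<phi> i \<in> module_hom A (X (Suc i)) (X i)" using i by (intro \<phi>) auto
  note ck = Xi.coker_module[OF lX[OF i'(2)] ph]
  show ?thesis
    using module_homs.fg_mod_image[OF module_homsI[OF Xi.left_module_axioms ck(1,2)]] ck(1,3) X[OF i'(1)]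
    by (simp add: fg_mod_def)
qed

text \<open>All conditions become exactness of column blocks: \<open>M\<close> stands for the blocks
  \<open>{1..q}\<close>, \<open>X i\<close> for \<open>{i..n}\<close>, the cokernel of
  \<open>\<phi> i\<close> for \<open>{i}\<close>. One direction passes to quotient blocks, the other
  assembles \<open>{1..q}\<close> from single blocks.\<close>

theorem CM_iff:
  assumes noeth: "left_noetherian A"
    and inj: "\<And>i. i \<in> {1..<n} \<Longrightarrow> inj_on (\<phi> i) (carrier (X (Suc i)))"
  shows "M \<in> CM T \<longleftrightarrow> (\<forall>i\<in>{1..n}. X i \<in> CM A) \<and> (\<forall>i\<in>{1..<n}. coker (X (Suc i)) (X i) (\<phi> i) \<in> CM A)"
proof -
  let ?E = "\<lambda>b. \<forall>k. col_exact A (\<lambda>k. J k \<times> b) D' k"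
  have M: "M \<in> CM T \<longleftrightarrow> (\<forall>q\<in>{1..n}. ?E {1..q})"
  proof -
    have "col_exact T J D k \<longleftrightarrow> (\<forall>q\<in>{1..n}. col_exact A (\<lambda>k. J k \<times> {1..q}) D' k)" for k
      unfolding col_exact_def
      by (rule tri_exact3_cols[of "J k" "J (Suc k)" "D k" n "D (Suc k)", OF fin fin D D])
    then show ?thesis
      unfolding CM_iff_col_exact[OF left_noetherian_tri_ring[OF noeth] M_fg_mod res] by blast
  qed
  have Xi: "X i \<in> CM A \<longleftrightarrow> ?E {i..n}" if "i \<in> {1..n}" for i
    by (rule CM_iff_col_exact[OF noeth X[OF that] X_res[OF that]])
  have Ci: "coker (X (Suc i)) (X i) (\<phi> i) \<in> CM A \<longleftrightarrow> ?E {i}" if "i \<in> {1..<n}" for i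
    by (rule CM_iff_col_exact[OF noeth coker_fg[OF that] coker_res[OF that inj[OF that]]])
  show ?thesis
  proof
    assume "M \<in> CM T"
    then have init: "col_exact A (\<lambda>k. J k \<times> {1..q}) D' k" if "1 \<le> q" "q \<le> n" for q k
      unfolding M using that by simp
    have blk: "?E {i..q}" if "1 \<le> i" "i \<le> q" "q \<le> n" for i q
      using col_exact_quotient_block[OF fin D init that] by blast
    have "?E {i}" if "i \<in> {1..<n}" for i using blk[of i i] that by simp
    then show "(\<forall>i\<in>{1..n}. X i \<in> CM A) \<and> (\<forall>i\<in>{1..<n}. coker (X (Suc i)) (X i) (\<phi> i) \<in> CM A)"
      using blk[of _ n] Xi Ci by simp
  next
    assume h: "(\<forall>i\<in>{1..n}. X i \<in> CM A) \<and> (\<forall>i\<in>{1..<n}. coker (X (Suc i)) (X i) (\<phi> i) \<in> CM A)"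
    \<comment> \<open>The last single block \<open>{n}\<close> belongs to no cokernel; it is
      supplied by \<open>X n\<close>.\<close>
    have single: "?E {q}" if q: "q \<in> {1..n}" for q
    proof (cases "q = n")
      case True
      then show ?thesis using h Xi[OF q] q by simp
    next
      case False
      then show ?thesis using h Ci[of q] q by auto
    qed
    have "?E {1..q}" if "1 \<le> q" "q \<le> n" for q
      using that
    proof (induction q rule: dec_induct)
      case base
      then show ?case using single[of 1] by simp
    next
      case (step q)
      \<comment> \<open>On rows the block \<open>{1..Suc q}\<close> is a quotient of the full block
        \<open>{1..n}\<close>, from which it inherits that composites vanish.\<close>
      have comp: "vmul A (J (Suc k) \<times> {1..Suc q}) (J k \<times> {1..Suc q}) (D' k)
         (vmul A (J (Suc (Suc k)) \<times> {1..Suc q}) (J (Suc k) \<times> {1..Suc q}) (D' (Suc k)) x) = (\<lambda>_. \<zero>)"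
        if x: "x \<in> vecs A (J (Suc (Suc k)) \<times> {1..Suc q})" for k x
      proof -
        let ?U = "\<lambda>k. J k \<times> {Suc (Suc q)..n}" and ?L = "\<lambda>k. J k \<times> {1..Suc q}"
        have UL: "?U k \<union> ?L k = J k \<times> {1..n}" for k using step by auto
        have dis: "?U k \<inter> ?L k = {}" for k by auto
        have fUL: "finite (?U k \<union> ?L k)" for k using fin by simp
        have z: "D' k u v = \<zero>" if "u \<in> ?U l" "v \<in> ?L l'" for k l l' u v using that by (intro D'_zero) auto
        have xJ: "x \<in> vecs A (?U (Suc (Suc k)) \<union> ?L (Suc (Suc k)))" by (rule vecs_mono[OF x]) auto
        have rx: "restr A (?L (Suc (Suc k))) x = x" using vecs_out[OF x] by (auto simp: restr_def)
        let ?y = "vmul A (?U (Suc (Suc k)) \<union> ?L (Suc (Suc k))) (?U (Suc k) \<union> ?L (Suc k)) (D' (Suc k)) x"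
        have y: "?y \<in> vecs A (?U (Suc k) \<union> ?L (Suc k))" by (rule vmul_closed[OF xJ D'])
        have "row_exact A (\<lambda>k. J k \<times> {1..n}) D' k" using step by (intro rows_block) auto
        then have y0: "vmul A (?U (Suc k) \<union> ?L (Suc k)) (?U k \<union> ?L k) (D' k) ?y = (\<lambda>_. \<zero>)"
          using y xJ unfolding row_exact_def exact3_def UL by blast
        have "vmul A (?L (Suc (Suc k))) (?L (Suc k)) (D' (Suc k)) x = restr A (?L (Suc k)) ?y"
          using vmul_quot[where L'="?L (Suc k)" and U'="?U (Suc k)" and D="D' (Suc k)",
              OF fUL dis D' z[of _ "Suc (Suc k)" _ "Suc k"] xJ] rx by simp
        then have "vmul A (?L (Suc k)) (?L k) (D' k) (vmul A (?L (Suc (Suc k))) (?L (Suc k)) (D' (Suc k)) x) =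
            vmul A (?L (Suc k)) (?L k) (D' k) (restr A (?L (Suc k)) ?y)" by (rule arg_cong)
        also have "\<dots> = restr A (?L k) (vmul A (?U (Suc k) \<union> ?L (Suc k)) (?U k \<union> ?L k) (D' k) ?y)"
          by (rule vmul_quot[OF fUL dis D' z y, symmetric])
        also have "\<dots> = (\<lambda>_. \<zero>)" unfolding y0 by (simp add: restr_def)
        finally show ?thesis .
      qed
      have sub: "\<And>k. col_exact A (\<lambda>k. J k \<times> {1..q}) D' k" using step by simp
      have quot: "\<And>k. col_exact A (\<lambda>k. J k \<times> {Suc q}) D' k" using single[of "Suc q"] step by simp
      show ?case using col_exact_extension_block[OF fin D sub quot comp] by blast
    qed
    then show "M \<in> CM T" unfolding M Ball_def atLeastAtMost_iff by blast
  qed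
qed

end

section \<open>Injectivity of the structure maps\<close>

context mor_object begin

text \<open>\<open>M\<close> embeds into a free \<open>T\<close>-module, where the matrix unit at
  \<open>(i, Suc i)\<close> copies row \<open>Suc i\<close> into row \<open>i\<close>; a vector
  killed by it has zero row \<open>Suc i\<close>. On \<open>M\<close> the same matrix unit acts as
  \<open>\<phi> i\<close>, so an element of the kernel of \<open>\<phi> i\<close> embeds as a vector
  that is both killed and concentrated in row \<open>Suc i\<close>.\<close>

lemma CM_mono:
  assumes noeth: "left_noetherian A" and noeth': "left_noetherian (op_ring A)"
    and hd: "half_dual T" and CM: "M \<in> CM T" and i: "i \<in> {1..<n}"
  shows "inj_on (\<phi> i) (carrier (X (Suc i)))"
proof -
  interpret T: ring T by (rule ring_tri_ring)
  interpret M: left_module T M by (rule left_module_M)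
  have "M \<in> Gproj T"
    using CM_subset_Gproj[OF left_noetherian_tri_ring[OF noeth] left_noetherian_op_tri_ring[OF ring_axioms noeth'] hd] CM
    by blast
  then obtain P d f where cpr: "complete_projective_resolution T P d"
    and f: "f \<in> module_hom T M ((P 0)\<lparr>carrier := a_kernel (P 0) (P 1) (d 0)\<rparr>)"
      "bij_betw f (carrier M) (a_kernel (P 0) (P 1) (d 0))"
    unfolding Gproj_def module_iso_def by auto
  have "fg_projective T (P 0)" using cpr unfolding complete_projective_resolution_def by blast
  then have "summand T (P 0)" by (rule fg_projective_summand)
  \<comment> \<open>The kernel of \<open>d 0\<close> sits in a projective module, and the latter in
    a free one.\<close>
  then obtain m :: nat and \<iota> \<pi> where ip: "\<iota> \<in> module_hom T (P 0) (free T {..<m})"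
    "\<And>x. x \<in> carrier (P 0) \<Longrightarrow> \<pi> (\<iota> x) = x" unfolding summand_def by blast
  have kc: "a_kernel (P 0) (P 1) (d 0) \<subseteq> carrier (P 0)" by (auto simp: a_kernel_def')
  have f': "f \<in> module_hom T M (P 0)" using f(1) kc by (auto simp: module_hom_def)
  define \<theta> where "\<theta> = (\<lambda>x. \<iota> (f x))"
  have th: "\<theta> \<in> module_hom T M (free T {..<m})" unfolding \<theta>_def by (rule module_hom_comp[OF f' ip(1)])
  have tinj: "x = y" if "x \<in> carrier M" "y \<in> carrier M" "\<theta> x = \<theta> y" for x y
    using that ip(2) module_homD(1)[OF f'] f(2) unfolding \<theta>_def bij_betw_def inj_on_def by metis
  interpret \<theta>: module_homs T M "free T {..<m}" \<theta>
    by (intro module_homsI left_module_M T.left_module_free th)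
  have i': "i \<in> {1..n}" "Suc i \<in> {1..n}" using i by auto
  interpret Xi: left_module A "X i" by (rule lX[OF i'(1)])
  have ph: "\<phi> i \<in> module_hom A (X (Suc i)) (X i)" using i by (intro \<phi>) auto
  interpret P: module_homs A "X (Suc i)" "X i" "\<phi> i" by (intro module_homsI lX i' ph)
  have ker: "y = \<zero>\<^bsub>X (Suc i)\<^esub>" if y: "y \<in> carrier (X (Suc i))" and y0: "\<phi> i y = \<zero>\<^bsub>X i\<^esub>" for y
  proof -
    let ?z = "single (Suc i) y"
    have z: "?z \<in> carrier M" by (rule single_closed[OF y])
    have tz: "\<theta> ?z \<in> vecs T {..<m}" using \<theta>.closed[OF z] by simp
    have zi: "?z (Suc i) = y" using i'(2) by (simp add: single_def)
    have u: "mat_unit A \<one> i (Suc i) \<in> carrier T" "mat_unit A \<one> (Suc i) (Suc i) \<in> carrier T"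
      using i by (intro mat_unit_closed; auto)+
    have "mat_unit A \<one> i (Suc i) \<odot>\<^bsub>M\<^esub> ?z = \<zero>\<^bsub>M\<^esub>"
      using mat_unit_smult_eq_single[OF one_closed _ _ _ z, of i "Suc i"] i zi y0 single_hom(3)[OF i'(1)]
      by (simp add: path_map_Suc Xi.smult_r_null)
    then have "row_vec A i (\<lambda>p. \<one> \<otimes> \<theta> ?z (fst p) (Suc i) (snd p)) = (\<lambda>_. \<zero>\<^bsub>T\<^esub>)"
      using mat_unit_smult_free[OF one_closed _ _ _ tz, of i "Suc i"] i \<theta>.hom_smult[OF u(1) z] \<theta>.hom_zero by simp
    \<comment> \<open>The products with the two matrix units have the same entries, placed in row
      \<open>i\<close> and in row \<open>Suc i\<close>; if one product vanishes, so does the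
      other.\<close>
    then have "\<one> \<otimes> \<theta> ?z s (Suc i) q = \<zero>" for s q
      by (auto simp: row_vec_def fun_eq_iff split: if_splits)
    then have "row_vec A (Suc i) (\<lambda>p. \<one> \<otimes> \<theta> ?z (fst p) (Suc i) (snd p)) = (\<lambda>_. \<zero>\<^bsub>T\<^esub>)"
      by (simp add: row_vec_def fun_eq_iff)
    then have "\<theta> (mat_unit A \<one> (Suc i) (Suc i) \<odot>\<^bsub>M\<^esub> ?z) = \<zero>\<^bsub>free T {..<m}\<^esub>"
      using mat_unit_smult_free[OF one_closed _ _ _ tz, of "Suc i" "Suc i"] i \<theta>.hom_smult[OF u(2) z] by simp
    moreover have "mat_unit A \<one> (Suc i) (Suc i) \<odot>\<^bsub>M\<^esub> ?z = ?z"
      using mat_unit_smult_eq_single[OF one_closed _ _ _ z, of "Suc i" "Suc i"] i zi y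
      by (simp add: P.M.smult_one)
    ultimately have "?z = \<zero>\<^bsub>M\<^esub>" using tinj[OF z M.M.zero_closed] \<theta>.hom_zero by simp
    then have "?z (Suc i) = \<zero>\<^bsub>M\<^esub> (Suc i)" by simp
    then show ?thesis using zi i'(2) by (simp add: tri_module_simps(2))
  qed
  show ?thesis
  proof (rule inj_onI)
    fix x y assume xy: "x \<in> carrier (X (Suc i))" "y \<in> carrier (X (Suc i))" "\<phi> i x = \<phi> i y"
    have "x \<ominus>\<^bsub>X (Suc i)\<^esub> y = \<zero>\<^bsub>X (Suc i)\<^esub>"
      using xy by (intro ker) (simp_all add: P.hom_minus Xi.M.minus_self P.closed)
    then show "x = y" using xy by (simp add: P.M.M.minus_eq_zero_iff)
  qed
qed

end

section \<open>Equality of the two subcategories\<close>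

theorem in_Mor_CM:
  assumes noeth: "left_noetherian A" and noeth': "left_noetherian (op_ring A)" and hd: "half_dual (tri_ring n A)"
  shows "in_Mor n A (CM (tri_ring n A)) = mono_cat n A (CM A)"
proof -
  interpret ring A using noeth by (simp add: left_noetherian_def)
  have "Z \<in> in_Mor n A (CM (tri_ring n A)) \<longleftrightarrow> Z \<in> mono_cat n A (CM A)" if ZM: "Z \<in> Mor n A" for Z
  proof -
    obtain X \<phi> where Z: "Z = (X, \<phi>)" by (cases Z)
    interpret mor_object A n X \<phi>
      using ZM unfolding Z Mor_def by unfold_locales auto
    obtain m :: "nat \<Rightarrow> nat" and D e where res: "mat_res T M (\<lambda>k. {..<m k}) D e"
      by (rule mat_res_exists[OF left_noetherian_tri_ring[OF noeth] M_fg_mod])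
    interpret mor_resolution A n X \<phi> "\<lambda>k. {..<m k}" D e by unfold_locales (rule res)
    \<comment> \<open>From left to right injectivity comes from \<open>CM_mono\<close>; from right
      to left it is part of the condition. In both cases the block criterion then applies.\<close>
    have "M \<in> CM T \<longleftrightarrow> (\<forall>i\<in>{1..n}. X i \<in> CM A) \<and> (\<forall>i\<in>{1..<n}. inj_on (\<phi> i) (carrier (X (i + 1)))) \<and>
       (\<forall>i\<in>{1..<n}. coker (X (i + 1)) (X i) (\<phi> i) \<in> CM A)"
      using CM_iff[OF noeth] CM_mono[OF noeth noeth' hd] by (metis Suc_eq_plus1)
    then show ?thesis using ZM unfolding Z in_Mor_def mono_cat_def by simp
  qed
  moreover have "in_Mor n A (CM (tri_ring n A)) \<subseteq> Mor n A" "mono_cat n A (CM A) \<subseteq> Mor n A"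
    by (auto simp: in_Mor_def mono_cat_def)
  ultimately show ?thesis by blast
qed

theorem corollary4p1:
  fixes R :: "'r ring" and A :: "('r, 'a) module" and n :: nat
  assumes "artin_algebra R A" and "n \<ge> 2"
  shows "(right_inj_dim A < \<infinity> \<longrightarrow>
            (in_Mor n A (CM (tri_ring n A)) :: ('a, 'm) mor_obj set) = mono_cat n A (CM A)) \<and>
         (gorenstein A \<longrightarrow>
            (in_Mor n A (Gproj (tri_ring n A)) :: ('a, 'm) mor_obj set) = mono_cat n A (Gproj A))"
proof (intro conjI impI)
  note noeth = artin_algebra_left_noetherian[OF assms(1)]
  interpret ring A using noeth(1) by (simp add: left_noetherian_def)
  \<comment> \<open>Finite right injective dimension gives duality over \<open>A\<close> for every
    index type, in particular for pairs, and this passes to the matrix ring.\<close>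
  have hT: "half_dual (tri_ring n A)" if "right_inj_dim A < \<infinity>"
    by (rule half_dual_tri_ring[OF ring_axioms right_inj_dim_row_exact[OF ring_axioms noeth(2) that]])
  show CM: "(in_Mor n A (CM (tri_ring n A)) :: ('a, 'm) mor_obj set) = mono_cat n A (CM A)"
    if "right_inj_dim A < \<infinity>"
    by (rule in_Mor_CM[OF noeth hT[OF that]])
  assume "gorenstein A"
  then have dim: "right_inj_dim A < \<infinity>" by (simp add: gorenstein_def)
  have hA: "half_dual A"
    unfolding half_dual_def using right_inj_dim_row_exact[OF ring_axioms noeth(2) dim] by blast
  note noethT = left_noetherian_tri_ring[OF noeth(1), of n] left_noetherian_op_tri_ring[OF ring_axioms noeth(2), of n]
  \<comment> \<open>Over both rings duality identifies the Gorenstein-projective modules with the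
    class \<open>CM\<close>, so the second equality is a rewriting of the first.\<close>
  have "(Gproj A :: ('a, 'm) module set) = CM A"
    using Gproj_subset_CM[OF noeth(1)] CM_subset_Gproj[OF noeth hA] by blast
  moreover have "(Gproj (tri_ring n A) :: (nat \<Rightarrow> nat \<Rightarrow> 'a, nat \<Rightarrow> 'm) module set) = CM (tri_ring n A)"
    using Gproj_subset_CM[OF noethT(1)] CM_subset_Gproj[OF noethT hT[OF dim]] by blast
  ultimately show "(in_Mor n A (Gproj (tri_ring n A)) :: ('a, 'm) mor_obj set) = mono_cat n A (Gproj A)"
    using CM[OF dim] by simp
qed

end
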